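(* Let $E,A\in\mathbb{R}^{n\times n}$ with $\mathrm{rank}(E)=m<n$, let $B,D\in\mathbb{R}^{n\times r}$, let $x_0\in\mathbb{R}^n$ and $T>0$. The singular stochastic differential equation $$E\,dx(t)=[Ax(t)+Bu(t)]\,dt+Du(t)\,dW(t),\qquad Ex(0)=x_0,$$ has a unique solution $x(\cdot)\in L^2_{\mathcal{F}_t}(0,T;\mathbb{R}^n)$ for any $u(\cdot)\in L^2_{\mathcal{F}_t}(0,T;\mathbb{R}^r)$ if and only if there exist invertible matrices $M,N\in\mathbb{R}^{n\times n}$ such that $$MEN=\mathrm{diag}(I_h,G),\quad MAN=\mathrm{diag}(A_1,I_{n-h}),\quad MB=\begin{pmatrix} B_1 \\ B_2 \end{pmatrix},\quad MD=\begin{pmatrix} D_1 \\ \mathbf{0}_{(n-h)\times r} \end{pmatrix},$$ where $A_1\in\mathbb{R}^{h\times h}$ is any matrix, $B_1,D_1\in\mathbb{R}^{h\times r}$, $G=\mathrm{diag}(G_1,\dots,G_l)\in\mathbb{R}^{(n-h)\times(n-h)}$ is a nilpotent matrix in which each $G_k\in\mathbb{R}^{m_k\times m_k}$ has entries $1$ on the first superdiagonal and $0$ elsewhere, $\sum_{k=1}^l m_k=n-h$, and $B_2=(B_{21}^{\mathrm T},\dots,B_{2l}^{\mathrm T})^{\mathrm T}\in\mathbb{R}^{(n-h)\times r}$ with $$B_{2k}=\begin{pmatrix} b_{k1} \\ 0 \\ \vdots \\ 0 \end{pmatrix}\in\mathbb{R}^{m_k\times r},\quad b_{k1}\in\mathbb{R}^{1\times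 r},\quad 1\le k\le l,$$ and moreover the initial value satisfies $$\begin{pmatrix}\mathbf{0}_{(n-h)\times h}&I_{n-h}\end{pmatrix}Mx_0=\mathbf{0}_{(n-h)\times1}.$$
   Context: $(\Omega,\mathcal{F},\{\mathcal{F}_t\}_{t\ge0},\mathbb{P})$ is a complete filtered probability space carrying a one-dimensional standard Brownian motion $W$; $\{\mathcal{F}_t\}$ is the natural filtration of $W$ augmented by all $\mathbb{P}$-null sets. $L^2_{\mathcal{F}_t}(0,T;\mathbb{R}^k)$ is the space of $\mathcal{F}_t$-adapted $\mathbb{R}^k$-valued processes $x(\cdot)$ with $\mathbb{E}\int_0^T|x(t)|^2dt<\infty$. $I_k$ is the $k\times k$ identity matrix and $\mathbf{0}$ denotes zero matrices of the indicated size. All coefficient matrices are constant. The equation is understood in integrated It\^o form, $Ex(t)=x_0+\int_0^t[Ax(s)+Bu(s)]ds+\int_0^tDu(s)dW(s)$; solutions need not be continuous (some components are only determined for a.e. $t$), so uniqueness is up to $dt\otimes d\mathbb{P}$-null sets. *)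

theory Defs
  imports
    "HOL-Probability.Probability"
    "Jordan_Normal_Form.DL_Rank"
    "Jordan_Normal_Form.Jordan_Normal_Form"
begin

text \<open>Matrices and vectors are those of \<open>Jordan_Normal_Form\<close>, whose dimensions are natural
  numbers, so that block decompositions can be written down directly.\<close>

subsection \<open>Brownian motion and its augmented filtration\<close>

definition brownian_motion :: "'w measure \<Rightarrow> (real \<Rightarrow> 'w \<Rightarrow> real) \<Rightarrow> bool" where
  "brownian_motion P W \<longleftrightarrow>
     (\<forall>t\<ge>0. W t \<in> borel_measurable P) \<and>
     (AE \<omega> in P. W 0 \<omega> = 0) \<and>
     (AE \<omega> in P. continuous_on {0..} (\<lambda>t. W t \<omega>)) \<and>
     (\<forall>s t. 0 \<le> s \<and> s < t \<longrightarrow>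
        distributed P lborel (\<lambda>\<omega>. W t \<omega> - W s \<omega>) (normal_density 0 (sqrt (t - s)))) \<and>
     (\<forall>(k::nat) \<tau>. 0 \<le> \<tau> 0 \<and> (\<forall>i<k. \<tau> i < \<tau> (Suc i)) \<longrightarrow>
        prob_space.indep_vars P (\<lambda>_. borel) (\<lambda>i \<omega>. W (\<tau> (Suc i)) \<omega> - W (\<tau> i) \<omega>) {..<k})"

definition aug_filtration :: "'w measure \<Rightarrow> (real \<Rightarrow> 'w \<Rightarrow> real) \<Rightarrow> real \<Rightarrow> 'w measure" where
  "aug_filtration P W t =
     sigma (space P)
       ({W s -` S \<inter> space P | s S. 0 \<le> s \<and> s \<le> t \<and> S \<in> sets borel} \<union> null_sets P)"

subsection \<open>Square integrable adapted processes\<close>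

text \<open>Joint measurability, implicit in \<open>E \<integral>\<^sub>0\<^sup>T |x(t)|\<^sup>2 dt\<close>, is made part of
  adaptedness. Only times in \<open>[0,T]\<close> matter.\<close>

definition adapted_process ::
  "'w measure \<Rightarrow> (real \<Rightarrow> 'w \<Rightarrow> real) \<Rightarrow> real \<Rightarrow> (real \<Rightarrow> 'w \<Rightarrow> real) \<Rightarrow> bool" where
  "adapted_process P W T f \<longleftrightarrow>
     (\<lambda>(t, \<omega>). f t \<omega>) \<in> borel_measurable (restrict_space borel {0..T} \<Otimes>\<^sub>M P) \<and>
     (\<forall>t\<in>{0..T}. f t \<in> borel_measurable (aug_filtration P W t))"

definition L2_adapted ::
  "'w measure \<Rightarrow> (real \<Rightarrow> 'w \<Rightarrow> real) \<Rightarrow> real \<Rightarrow> nat \<Rightarrow> (real \<Rightarrow> 'w \<Rightarrow> real Matrix.vec) set" where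
  "L2_adapted P W T k = {x.
     (\<forall>t\<in>{0..T}. \<forall>\<omega>\<in>space P. x t \<omega> \<in> carrier_vec k) \<and>
     (\<forall>i<k. adapted_process P W T (\<lambda>t \<omega>. vec_index (x t \<omega>) i)) \<and>
     (\<integral>\<^sup>+\<omega>. (\<integral>\<^sup>+t\<in>{0..T}. ennreal (\<Sum>i<k. (vec_index (x t \<omega>) i)\<^sup>2) \<partial>lborel) \<partial>P) < \<infinity>}"

subsection \<open>The Ito integral\<close>

text \<open>A simple integrand on \<open>[0,t]\<close> is given by the number \<open>N\<close> of steps, partition points
  \<open>\<tau> 0, \<dots>, \<tau> N\<close> and bounded step values \<open>\<xi> i\<close>, known at time \<open>\<tau> i\<close>,
  on the intervals from \<open>\<tau> i\<close> (excluded) to \<open>\<tau> (Suc i)\<close>.\<close>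

definition simple_integrand ::
  "'w measure \<Rightarrow> (real \<Rightarrow> 'w \<Rightarrow> real) \<Rightarrow> real \<Rightarrow> nat \<Rightarrow> (nat \<Rightarrow> real) \<Rightarrow> (nat \<Rightarrow> 'w \<Rightarrow> real) \<Rightarrow> bool"
where
  "simple_integrand P W t N \<tau> \<xi> \<longleftrightarrow>
     0 \<le> \<tau> 0 \<and> (\<forall>i<N. \<tau> i < \<tau> (Suc i)) \<and> \<tau> N \<le> t \<and>
     (\<forall>i<N. \<xi> i \<in> borel_measurable (aug_filtration P W (\<tau> i)) \<and>
            (\<exists>C. \<forall>\<omega>\<in>space P. \<bar>\<xi> i \<omega>\<bar> \<le> C))"

definition simple_process :: "nat \<Rightarrow> (nat \<Rightarrow> real) \<Rightarrow> (nat \<Rightarrow> 'w \<Rightarrow> real) \<Rightarrow> real \<Rightarrow> 'w \<Rightarrow> real" where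
  "simple_process N \<tau> \<xi> s \<omega> = (\<Sum>i<N. \<xi> i \<omega> * indicator {\<tau> i<..\<tau> (Suc i)} s)"

definition simple_ito ::
  "(real \<Rightarrow> 'w \<Rightarrow> real) \<Rightarrow> nat \<Rightarrow> (nat \<Rightarrow> real) \<Rightarrow> (nat \<Rightarrow> 'w \<Rightarrow> real) \<Rightarrow> 'w \<Rightarrow> real" where
  "simple_ito W N \<tau> \<xi> \<omega> = (\<Sum>i<N. \<xi> i \<omega> * (W (\<tau> (Suc i)) \<omega> - W (\<tau> i) \<omega>))"

text \<open>\<open>J\<close> is (a version of) \<open>\<integral>\<^sub>0\<^sup>t f(s) dW(s)\<close>: the \<open>L\<^sup>2(P)\<close>-limit of the integrals of simple
  integrands approximating \<open>f\<close> in \<open>L\<^sup>2(dt \<otimes> dP)\<close>.\<close>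

definition has_ito_integral ::
  "'w measure \<Rightarrow> (real \<Rightarrow> 'w \<Rightarrow> real) \<Rightarrow> real \<Rightarrow> (real \<Rightarrow> 'w \<Rightarrow> real) \<Rightarrow> ('w \<Rightarrow> real) \<Rightarrow> bool" where
  "has_ito_integral P W t f J \<longleftrightarrow>
     adapted_process P W t f \<and> J \<in> borel_measurable P \<and>
     (\<exists>N \<tau> \<xi>. (\<forall>k::nat. simple_integrand P W t (N k) (\<tau> k) (\<xi> k)) \<and>
        (\<lambda>k. \<integral>\<^sup>+\<omega>. (\<integral>\<^sup>+s\<in>{0..t}.
            ennreal ((f s \<omega> - simple_process (N k) (\<tau> k) (\<xi> k) s \<omega>)\<^sup>2) \<partial>lborel) \<partial>P)
          \<longlonglongrightarrow> 0 \<and>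
        (\<lambda>k. \<integral>\<^sup>+\<omega>. ennreal ((J \<omega> - simple_ito W (N k) (\<tau> k) (\<xi> k) \<omega>)\<^sup>2) \<partial>P) \<longlonglongrightarrow> 0)"

subsection \<open>The singular equation\<close>

text \<open>\<open>E dx = (A x + B u) dt + D u dW\<close>, \<open>E x(0) = x0\<close> in integrated form, which for each
  \<open>t \<in> [0,T]\<close> holds almost surely; integrals of vectors are taken componentwise.\<close>

definition is_solution ::
  "'w measure \<Rightarrow> (real \<Rightarrow> 'w \<Rightarrow> real) \<Rightarrow> real \<Rightarrow> nat \<Rightarrow> real Matrix.mat \<Rightarrow> real Matrix.mat \<Rightarrow>
   real Matrix.mat \<Rightarrow> real Matrix.mat \<Rightarrow> real Matrix.vec \<Rightarrow>
   (real \<Rightarrow> 'w \<Rightarrow> real Matrix.vec) \<Rightarrow> (real \<Rightarrow> 'w \<Rightarrow> real Matrix.vec) \<Rightarrow> bool" where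
  "is_solution P W T n E A B D x0 u x \<longleftrightarrow>
     x \<in> L2_adapted P W T n \<and>
     (\<forall>t\<in>{0..T}. \<exists>J.
        (\<forall>i<n. has_ito_integral P W t (\<lambda>s \<omega>. vec_index (D *\<^sub>v u s \<omega>) i) (J i)) \<and>
        (AE \<omega> in P. E *\<^sub>v x t \<omega> =
           x0 + Matrix.vec n (\<lambda>i. LINT s:{0..t}|lborel. vec_index (A *\<^sub>v x s \<omega> + B *\<^sub>v u s \<omega>) i)
              + Matrix.vec n (\<lambda>i. J i \<omega>)))"

definition uniquely_solvable ::
  "'w measure \<Rightarrow> (real \<Rightarrow> 'w \<Rightarrow> real) \<Rightarrow> real \<Rightarrow> nat \<Rightarrow> real Matrix.mat \<Rightarrow> real Matrix.mat \<Rightarrow>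
   real Matrix.mat \<Rightarrow> real Matrix.mat \<Rightarrow> real Matrix.vec \<Rightarrow>
   (real \<Rightarrow> 'w \<Rightarrow> real Matrix.vec) \<Rightarrow> bool" where
  "uniquely_solvable P W T n E A B D x0 u \<longleftrightarrow>
     (\<exists>x. is_solution P W T n E A B D x0 u x) \<and>
     (\<forall>x y. is_solution P W T n E A B D x0 u x \<and> is_solution P W T n E A B D x0 u y \<longrightarrow>
        (AE (t, \<omega>) in restrict_space lborel {0..T} \<Otimes>\<^sub>M P. x t \<omega> = y t \<omega>))"

subsection \<open>Block matrices\<close>

definition append_cols :: "real Matrix.mat \<Rightarrow> real Matrix.mat \<Rightarrow> real Matrix.mat" where
  "append_cols X Y =
     four_block_mat X Y (0\<^sub>m 0 (dim_col X)) (0\<^sub>m 0 (dim_col Y))"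

text \<open>Vertical concatenation of a list of matrices with \<open>c\<close> columns each.\<close>

definition stack_rows :: "nat \<Rightarrow> real Matrix.mat list \<Rightarrow> real Matrix.mat" where
  "stack_rows c Xs = foldr append_rows Xs (0\<^sub>m 0 c)"

definition shift_block :: "nat \<Rightarrow> real Matrix.mat" where
  "shift_block k = Matrix.mat k k (\<lambda>(i, j). if j = Suc i then 1 else 0)"

end

theory Submission
  imports Defs "Jordan_Normal_Form.Jordan_Normal_Form_Existence"
begin

text \<open>
  The equation with data \<open>(E, A)\<close> has a polynomial homogeneous solution with zero initial value when the pencil
  \<open>c E - A\<close> is singular, so uniqueness forces regularity, and a regular pencil has a Weierstrass form
  \<open>(diag(I, G), diag(A\<^sub>1, I))\<close> with \<open>G\<close> nilpotent. In these coordinates the upper block is an ordinary linear stochastic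
  equation, solved explicitly by a Volterra kernel, with uniqueness by Gronwall's inequality. The lower block reads
  \<open>G y(t) = c + \<integral>\<^sub>0\<^sup>t (y + B\<^sub>2 u) ds + D\<^sub>2 \<integral>\<^sub>0\<^sup>t u dW\<close>. If \<open>G B\<^sub>2 = 0\<close>, \<open>D\<^sub>2 = 0\<close> and \<open>c = 0\<close>, then \<open>y = - B\<^sub>2 u\<close> is its
  only solution. Conversely, these three conditions are obtained from the inputs \<open>u = v \<cdot> indicator {T/2<..} t\<close>:
  going up the rows of the strictly upper triangular \<open>G\<close>, a jump, a Brownian increment and an absolutely continuous
  process would have to cancel, which is impossible unless each of them vanishes. Finally \<open>G B\<^sub>2 = 0\<close> says that
  only the first row of each block of \<open>B\<^sub>2\<close> is nonzero.
\<close>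

no_notation vec_nth (infixl "$" 90)

section \<open>Brownian increments and the augmented filtration\<close>

text \<open>The equation is known for each time only outside a null set that may depend on that
  time, and some components are determined merely for almost every time. Path arguments such as
  Gronwall's inequality become available after almost all times and almost all outcomes have been
  exchanged by Fubini's theorem. This requires every process involved to be jointly measurable,
  including the Ito integral as a function of its upper limit, which is why that integral is built
  from one fast sequence of simple integrands for all times.

  The test inputs are useful because they are deterministic: their Ito integral is an explicit
  increment of \<open>W\<close>, and comparing orders of magnitude on short intervals replaces a
  decomposition theorem for semimartingales. Constant vectors \<open>v\<close> suffice because the
  conditions on the coefficients are linear in \<open>v\<close>.

  Only the nilpotent block is put into Jordan form. Its single eigenvalue 0 is real, so the real
  field suffices, while \<open>A1\<close> may have complex eigenvalues and stays as it is.\<close>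

locale wiener = prob_space P + complete_measure P for P :: "'w measure" +
  fixes W :: "real \<Rightarrow> 'w \<Rightarrow> real"
  assumes BM: "brownian_motion P W"
begin

abbreviation "F \<equiv> aug_filtration P W"

lemma W_measurable [measurable]: "0 \<le> t \<Longrightarrow> W t \<in> borel_measurable P"
  using BM by (auto simp: brownian_motion_def)

lemma W_zero: "AE \<omega> in P. W 0 \<omega> = 0"
  using BM by (auto simp: brownian_motion_def)

lemma W_incr_distributed:
  "0 \<le> s \<Longrightarrow> s < t \<Longrightarrow> distributed P lborel (\<lambda>\<omega>. W t \<omega> - W s \<omega>) (normal_density 0 (sqrt (t - s)))"
  using BM by (auto simp: brownian_motion_def)

lemma W_incr_indep:
  "0 \<le> \<tau> (0::nat) \<Longrightarrow> (\<And>i. i < k \<Longrightarrow> \<tau> i < \<tau> (Suc i)) \<Longrightarrow>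
     indep_vars (\<lambda>_. borel) (\<lambda>i \<omega>. W (\<tau> (Suc i)) \<omega> - W (\<tau> i) \<omega>) {..<k}"
  using BM unfolding brownian_motion_def by blast

section \<open>The augmented sigma-algebras\<close>

lemma F_generator_subset:
  "{W s -` S \<inter> space P | s S. 0 \<le> s \<and> s \<le> t \<and> S \<in> sets borel} \<union> null_sets P \<subseteq> sets P"
  by (auto intro: measurable_sets[OF W_measurable])

lemma space_F [simp]: "space (F t) = space P"
  unfolding aug_filtration_def
  by (rule space_measure_of) (use F_generator_subset sets.space_closed in blast)

lemma sets_F: "sets (F t) = sigma_sets (space P)
    ({W s -` S \<inter> space P | s S. 0 \<le> s \<and> s \<le> t \<and> S \<in> sets borel} \<union> null_sets P)"
  unfolding aug_filtration_def
  by (rule sets_measure_of) (use F_generator_subset sets.space_closed in blast)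

lemma sets_F_subset: "sets (F t) \<subseteq> sets P"
  unfolding sets_F by (rule sets.sigma_sets_subset[OF F_generator_subset])

lemma sets_F_mono: "s \<le> t \<Longrightarrow> sets (F s) \<subseteq> sets (F t)"
  unfolding sets_F by (rule sigma_sets_mono') fastforce

lemma measurable_F_P: "f \<in> borel_measurable (F t) \<Longrightarrow> f \<in> borel_measurable P"
  using sets_F_subset[of t] by (auto simp: measurable_def)

lemma measurable_F_mono: "s \<le> t \<Longrightarrow> f \<in> borel_measurable (F s) \<Longrightarrow> f \<in> borel_measurable (F t)"
  using sets_F_mono[of s t] by (auto simp: measurable_def)

lemma null_sets_in_F: "N \<in> null_sets P \<Longrightarrow> N \<in> sets (F t)"
  unfolding sets_F by (rule sigma_sets.Basic) auto

lemma W_measurable_F: "0 \<le> s \<Longrightarrow> s \<le> t \<Longrightarrow> W s \<in> borel_measurable (F t)"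
proof (rule measurableI)
  fix S :: "real set" assume "0 \<le> s" "s \<le> t" "S \<in> sets borel"
  then show "W s -` S \<inter> space (F t) \<in> sets (F t)"
    unfolding sets_F space_F by (intro sigma_sets.Basic) auto
qed auto

lemma AE_imp_null:
  assumes "AE \<omega> in P. Q \<omega>"
  shows "{\<omega>\<in>space P. \<not> Q \<omega>} \<in> null_sets P"
proof -
  from AE_E[OF assms] obtain N where N: "{\<omega>\<in>space P. \<not> Q \<omega>} \<subseteq> N" "emeasure P N = 0" "N \<in> sets P" by blast
  then have "N \<in> null_sets P" by auto
  from complete2[OF N(1) this] show ?thesis .
qed

text \<open>Augmentation by all null sets is what makes this work: by completeness of
  \<open>P\<close> the exceptional set and each of its subsets are null sets, hence events of
  \<open>F t\<close>. Versions of adapted variables thus remain adapted.\<close>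

lemma measurable_F_AE_eq:
  assumes f: "f \<in> borel_measurable (F t)" and ae: "AE \<omega> in P. f \<omega> = g \<omega>"
  shows "(g::'w \<Rightarrow> real) \<in> borel_measurable (F t)"
proof (rule measurableI)
  fix S :: "real set" assume S: "S \<in> sets borel"
  let ?N = "{\<omega>\<in>space P. f \<omega> \<noteq> g \<omega>}"
  have N: "?N \<in> null_sets P" by (rule AE_imp_null[OF ae])
  have N2: "g -` S \<inter> ?N \<in> null_sets P" by (rule complete2[OF _ N]) auto
  have "g -` S \<inter> space (F t) = (f -` S \<inter> space (F t) - ?N) \<union> (g -` S \<inter> ?N)" by auto
  moreover have "f -` S \<inter> space (F t) \<in> sets (F t)" using measurable_sets[OF f S] .
  ultimately show "g -` S \<inter> space (F t) \<in> sets (F t)"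
    using null_sets_in_F[OF N, of t] null_sets_in_F[OF N2, of t] by auto
qed auto

text \<open>Up to a null set, the values of \<open>W\<close> at finitely many times up to \<open>c\<close> are partial sums of
  increments over a partition of \<open>[0,c]\<close>.\<close>

lemma finite_dim_indep:
  assumes I: "finite I" "I \<subseteq> {0..c}" and c: "0 \<le> c" "c < d"
    and S: "S \<in> sets (PiM I (\<lambda>_. borel))" and B: "B \<in> sets borel"
  shows "prob ({\<omega>\<in>space P. (\<lambda>i\<in>I. W i \<omega>) \<in> S} \<inter> ((\<lambda>\<omega>. W d \<omega> - W c \<omega>) -` B \<inter> space P)) =
    prob {\<omega>\<in>space P. (\<lambda>i\<in>I. W i \<omega>) \<in> S} * prob ((\<lambda>\<omega>. W d \<omega> - W c \<omega>) -` B \<inter> space P)"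
proof -
  let ?A = "insert 0 (insert c I)"
  define L where "L = sorted_list_of_set ?A"
  define k where "k = length L - 1"
  have fin: "finite ?A" using I by simp
  have setL: "set L = ?A" and sorted: "sorted_wrt (<) L"
    unfolding L_def by (rule set_sorted_list_of_set[OF fin], rule strict_sorted_list_of_set)
  have Lne: "L \<noteq> []" using setL by auto
  then have lenL: "length L = Suc k" by (simp add: k_def)
  have mem: "L ! i \<in> {0..c}" if "i \<le> k" for i
    using nth_mem[of i L] that lenL setL I c by auto
  have mono: "L ! i \<le> L ! j" if "i \<le> j" "j \<le> k" for i j
    using sorted_wrt_nth_less[OF sorted, of i j] that lenL by (cases "i = j") auto
  obtain i0 where i0: "i0 \<le> k" "L ! i0 = 0"
    using setL lenL by (metis in_set_conv_nth insertI1 less_Suc_eq_le)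
  have L0: "L ! 0 = 0" using mono[of 0 i0] i0 mem[of 0] by auto
  obtain ik where ik: "ik \<le> k" "L ! ik = c"
    using setL lenL by (metis in_set_conv_nth insertCI less_Suc_eq_le)
  have Lk: "L ! k = c" using mono[of ik k] ik mem[of k] by auto
  \<comment> \<open>\<open>L\<close> runs from 0 to \<open>c\<close>; appending \<open>d\<close>
    makes the increment of index \<open>k\<close> the one after \<open>c\<close>, so that splitting
    the indices into \<open>{..<k}\<close> and \<open>{k}\<close> separates the past from the
    future.\<close>
  define \<tau> where "\<tau> i = (if i \<le> k then L ! i else d)" for i
  define \<Delta> where "\<Delta> i \<omega> = W (\<tau> (Suc i)) \<omega> - W (\<tau> i) \<omega>" for i \<omega>
  have ind: "indep_vars (\<lambda>_. borel) \<Delta> {..<Suc k}"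
    unfolding \<Delta>_def
  proof (rule W_incr_indep)
    show "\<tau> i < \<tau> (Suc i)" if "i < Suc k" for i
      using that c Lk sorted_wrt_nth_less[OF sorted, of i "Suc i"] lenL
      by (cases "i = k") (auto simp: \<tau>_def)
  qed (use L0 in \<open>simp add: \<tau>_def\<close>)
  have "\<forall>i\<in>I. \<exists>p\<le>k. L ! p = i"
    using setL lenL by (metis in_set_conv_nth insertCI less_Suc_eq_le)
  then obtain p where p: "\<And>i. i \<in> I \<Longrightarrow> p i \<le> k" "\<And>i. i \<in> I \<Longrightarrow> L ! (p i) = i" by metis
  \<comment> \<open>The sum of the first \<open>p i\<close> increments telescopes to
    \<open>W i - W 0\<close>; since \<open>W 0\<close> vanishes only almost surely, this
    reconstruction of the values of \<open>W\<close> holds up to a null set.\<close>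
  define f where "f x = (\<lambda>i\<in>I. \<Sum>l<p i. (x l :: real))" for x
  have f: "f \<in> measurable (PiM {..<k} (\<lambda>_. borel)) (PiM I (\<lambda>_. borel))"
    unfolding f_def
  proof (intro measurable_restrict borel_measurable_sum)
    fix i l assume "i \<in> I" "l \<in> {..<p i}"
    then have "l \<in> {..<k}" using p(1)[of i] by auto
    then show "(\<lambda>x. x l) \<in> borel_measurable (PiM {..<k} (\<lambda>_. borel))"
      by (rule measurable_component_singleton)
  qed
  have iv: "indep_var (PiM {..<k} (\<lambda>_. borel)) (\<lambda>\<omega>. \<lambda>i\<in>{..<k}. \<Delta> i \<omega>) (PiM {k} (\<lambda>_. borel)) (\<lambda>\<omega>. \<lambda>i\<in>{k}. \<Delta> i \<omega>)"
    by (rule indep_var_restrict[OF ind]) auto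
  define Y where "Y \<omega> = f (\<lambda>i\<in>{..<k}. \<Delta> i \<omega>)" for \<omega>
  have Y: "Y \<in> measurable P (PiM I (\<lambda>_. borel))"
    unfolding Y_def[abs_def] by (rule measurable_compose[OF indep_var_rv1[OF iv] f])
  have W: "(\<lambda>\<omega>. \<lambda>i\<in>I. W i \<omega>) \<in> measurable P (PiM I (\<lambda>_. borel))"
    by (rule measurable_restrict) (use I in auto)
  have ae: "AE \<omega> in P. Y \<omega> = (\<lambda>i\<in>I. W i \<omega>)"
    using W_zero
  proof eventually_elim
    case (elim \<omega>)
    have "(\<Sum>l<p i. \<Delta> l \<omega>) = W i \<omega>" if "i \<in> I" for i
      using sum_lessThan_telescope[of "\<lambda>l. W (\<tau> l) \<omega>" "p i"] p[OF that] L0 elim by (simp add: \<Delta>_def \<tau>_def)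
    moreover have "(\<Sum>l<p i. (\<lambda>i\<in>{..<k}. \<Delta> i \<omega>) l) = (\<Sum>l<p i. \<Delta> l \<omega>)" if "i \<in> I" for i
      by (rule sum.cong) (use p(1)[OF that] in auto)
    ultimately show ?case by (auto simp: Y_def f_def intro!: restrict_ext)
  qed
  let ?B = "(\<lambda>\<omega>. W d \<omega> - W c \<omega>) -` B \<inter> space P"
  have dB: "?B \<in> sets P" by (rule measurable_sets[OF _ B]) (use c in \<open>auto intro!: borel_measurable_diff W_measurable\<close>)
  have SW: "{\<omega>\<in>space P. (\<lambda>i\<in>I. W i \<omega>) \<in> S} \<in> sets P"
    using measurable_sets[OF W S] by (simp add: vimage_def Int_def conj_commute)
  have SY: "Y -` S \<inter> space P \<in> sets P" by (rule measurable_sets[OF Y S])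
  have mk: "(\<lambda>x. x k) \<in> borel_measurable (PiM {k} (\<lambda>_. borel :: real measure))"
    by (rule measurable_component_singleton) simp
  have "prob ((\<lambda>\<omega>. (\<lambda>i\<in>{..<k}. \<Delta> i \<omega>, \<lambda>i\<in>{k}. \<Delta> i \<omega>)) -`
        ((f -` S \<inter> space (PiM {..<k} (\<lambda>_. borel))) \<times> ((\<lambda>x. x k) -` B \<inter> space (PiM {k} (\<lambda>_. borel)))) \<inter> space P) =
      prob ((\<lambda>\<omega>. \<lambda>i\<in>{..<k}. \<Delta> i \<omega>) -` (f -` S \<inter> space (PiM {..<k} (\<lambda>_. borel))) \<inter> space P) *
      prob ((\<lambda>\<omega>. \<lambda>i\<in>{k}. \<Delta> i \<omega>) -` ((\<lambda>x. x k) -` B \<inter> space (PiM {k} (\<lambda>_. borel))) \<inter> space P)"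
    by (rule indep_varD[OF iv measurable_sets[OF f S] measurable_sets[OF mk B]])
  also have "(\<lambda>\<omega>. (\<lambda>i\<in>{..<k}. \<Delta> i \<omega>, \<lambda>i\<in>{k}. \<Delta> i \<omega>)) -`
        ((f -` S \<inter> space (PiM {..<k} (\<lambda>_. borel))) \<times> ((\<lambda>x. x k) -` B \<inter> space (PiM {k} (\<lambda>_. borel)))) \<inter> space P =
      (Y -` S \<inter> space P) \<inter> ?B"
    by (auto simp: Y_def \<Delta>_def \<tau>_def Lk space_PiM)
  also have "(\<lambda>\<omega>. \<lambda>i\<in>{..<k}. \<Delta> i \<omega>) -` (f -` S \<inter> space (PiM {..<k} (\<lambda>_. borel))) \<inter> space P = Y -` S \<inter> space P"
    by (auto simp: Y_def space_PiM)
  also have "(\<lambda>\<omega>. \<lambda>i\<in>{k}. \<Delta> i \<omega>) -` ((\<lambda>x. x k) -` B \<inter> space (PiM {k} (\<lambda>_. borel))) \<inter> space P = ?B"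
    by (auto simp: \<Delta>_def \<tau>_def Lk space_PiM)
  finally have "prob ((Y -` S \<inter> space P) \<inter> ?B) = prob (Y -` S \<inter> space P) * prob ?B" .
  moreover have "prob ((Y -` S \<inter> space P) \<inter> ?B) = prob ({\<omega>\<in>space P. (\<lambda>i\<in>I. W i \<omega>) \<in> S} \<inter> ?B)"
    by (rule finite_measure_eq_AE) (use ae SW SY dB in auto)
  moreover have "prob (Y -` S \<inter> space P) = prob {\<omega>\<in>space P. (\<lambda>i\<in>I. W i \<omega>) \<in> S}"
    by (rule finite_measure_eq_AE) (use ae SW SY in auto)
  ultimately show ?thesis by simp
qed

text \<open>Agreement with a finite-dimensional event is required only up to null sets. The family
  then contains the null sets that the filtration adds, and independence, being a statement about
  probabilities, is not affected.\<close>

definition cylinders :: "real \<Rightarrow> 'w set set" where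
  "cylinders c = {A \<in> sets P. \<exists>I S. finite I \<and> I \<subseteq> {0..c} \<and> S \<in> sets (PiM I (\<lambda>_. borel)) \<and>
     (AE \<omega> in P. \<omega> \<in> A \<longleftrightarrow> (\<lambda>i\<in>I. W i \<omega>) \<in> S)}"

lemma Int_stable_cylinders: "Int_stable (cylinders c)"
proof (rule Int_stableI)
  fix A B assume "A \<in> cylinders c" "B \<in> cylinders c"
  then obtain I S J S' where
    A: "A \<in> sets P" "finite I" "I \<subseteq> {0..c}" "S \<in> sets (PiM I (\<lambda>_. borel))"
      "AE \<omega> in P. \<omega> \<in> A \<longleftrightarrow> (\<lambda>i\<in>I. W i \<omega>) \<in> S" and
    B: "B \<in> sets P" "finite J" "J \<subseteq> {0..c}" "S' \<in> sets (PiM J (\<lambda>_. borel))"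
      "AE \<omega> in P. \<omega> \<in> B \<longleftrightarrow> (\<lambda>i\<in>J. W i \<omega>) \<in> S'"
    unfolding cylinders_def by auto
  let ?K = "I \<union> J"
  let ?Q = "((\<lambda>x. restrict x I) -` S \<inter> space (PiM ?K (\<lambda>_. borel))) \<inter>
     ((\<lambda>x. restrict x J) -` S' \<inter> space (PiM ?K (\<lambda>_. borel :: real measure)))"
  have "?Q \<in> sets (PiM ?K (\<lambda>_. borel))"
    by (intro sets.Int measurable_sets[OF measurable_restrict_subset] A B) auto
  moreover have "AE \<omega> in P. \<omega> \<in> A \<inter> B \<longleftrightarrow> (\<lambda>i\<in>?K. W i \<omega>) \<in> ?Q"
    using A(5) B(5)
  proof eventually_elim
    case (elim \<omega>)
    have "restrict (\<lambda>i\<in>?K. W i \<omega>) I = (\<lambda>i\<in>I. W i \<omega>)" "restrict (\<lambda>i\<in>?K. W i \<omega>) J = (\<lambda>i\<in>J. W i \<omega>)"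
      by (auto simp: restrict_def)
    with elim show ?case by (auto simp: space_PiM)
  qed
  ultimately show "A \<inter> B \<in> cylinders c"
    unfolding cylinders_def using A B by (intro CollectI conjI exI[of _ ?K] exI[of _ ?Q]) auto
qed

lemma sets_F_cylinders: "sets (F c) \<subseteq> sigma_sets (space P) (cylinders c)"
  unfolding sets_F
proof (rule sigma_sets_mono')
  have "W s -` S \<inter> space P \<in> cylinders c" if "0 \<le> s" "s \<le> c" "S \<in> sets borel" for s S
  proof -
    have "(\<lambda>x. x s) -` S \<inter> space (PiM {s} (\<lambda>_. borel)) \<in> sets (PiM {s} (\<lambda>_. borel :: real measure))"
      by (intro measurable_sets[OF measurable_component_singleton] that) auto
    then show ?thesis unfolding cylinders_def using that
      by (intro CollectI conjI exI[of _ "{s}"] exI[of _ "(\<lambda>x. x s) -` S \<inter> space (PiM {s} (\<lambda>_. borel))"])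
        (auto simp: space_PiM)
  qed
  \<comment> \<open>A null set is a cylinder over no coordinates at all, with the empty event as its
    base.\<close>
  moreover have "N \<in> cylinders c" if "N \<in> null_sets P" for N
    unfolding cylinders_def using that AE_not_in[OF that]
    by (intro CollectI conjI exI[of _ "{}"] exI[of _ "{}"]) auto
  ultimately show "{W s -` S \<inter> space P |s S. 0 \<le> s \<and> s \<le> c \<and> S \<in> sets borel} \<union> null_sets P \<subseteq> cylinders c"
    by auto
qed

text \<open>Independence of two intersection-stable families passes to the sigma-algebras they
  generate. The cylinders are such a family and generate at least \<open>F c\<close>; the preimages
  under the increment form the other one.\<close>

lemma indep_F_incr:
  assumes c: "0 \<le> c" "c < d" and X: "X \<in> borel_measurable (F c)"
  shows "indep_var borel X borel (\<lambda>\<omega>. W d \<omega> - W c \<omega>)"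
proof -
  let ?D = "{(\<lambda>\<omega>. W d \<omega> - W c \<omega>) -` B \<inter> space P | B. B \<in> sets borel}"
  have Wm: "(\<lambda>\<omega>. W d \<omega> - W c \<omega>) \<in> borel_measurable P"
    by (intro borel_measurable_diff W_measurable) (use c in auto)
  have dB: "?D \<subseteq> sets P" using measurable_sets[OF Wm] by blast
  have "indep_set (cylinders c) ?D"
    unfolding indep_sets2_eq
  proof (intro conjI ballI dB)
    fix A D assume "A \<in> cylinders c" "D \<in> ?D"
    then obtain I S B where A: "A \<in> sets P" "finite I" "I \<subseteq> {0..c}" "S \<in> sets (PiM I (\<lambda>_. borel))"
      "AE \<omega> in P. \<omega> \<in> A \<longleftrightarrow> (\<lambda>i\<in>I. W i \<omega>) \<in> S" and B: "B \<in> sets borel"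
      and D: "D = (\<lambda>\<omega>. W d \<omega> - W c \<omega>) -` B \<inter> space P"
      unfolding cylinders_def by auto
    have W: "(\<lambda>\<omega>. \<lambda>i\<in>I. W i \<omega>) \<in> measurable P (PiM I (\<lambda>_. borel))"
      by (rule measurable_restrict) (use A in auto)
    have SW: "{\<omega>\<in>space P. (\<lambda>i\<in>I. W i \<omega>) \<in> S} \<in> sets P"
      using measurable_sets[OF W A(4)] by (simp add: vimage_def Int_def conj_commute)
    have "D \<in> sets P" using dB \<open>D \<in> ?D\<close> by auto
    then have "prob (A \<inter> D) = prob ({\<omega>\<in>space P. (\<lambda>i\<in>I. W i \<omega>) \<in> S} \<inter> D)"
      by (intro finite_measure_eq_AE) (use A SW in auto)
    moreover have "prob A = prob {\<omega>\<in>space P. (\<lambda>i\<in>I. W i \<omega>) \<in> S}"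
      by (intro finite_measure_eq_AE) (use A SW in auto)
    ultimately show "prob (A \<inter> D) = prob A * prob D"
      using finite_dim_indep[OF A(2,3) c A(4) B] D by simp
  qed (auto simp: cylinders_def)
  moreover have "Int_stable ?D"
  proof (rule Int_stableI, safe)
    fix B C :: "real set" assume "B \<in> sets borel" "C \<in> sets borel"
    then show "\<exists>k. ((\<lambda>\<omega>. W d \<omega> - W c \<omega>) -` B \<inter> space P) \<inter> ((\<lambda>\<omega>. W d \<omega> - W c \<omega>) -` C \<inter> space P) =
       (\<lambda>\<omega>. W d \<omega> - W c \<omega>) -` k \<inter> space P \<and> k \<in> sets borel"
      by (intro exI[of _ "B \<inter> C"]) auto
  qed
  ultimately have ind: "indep_set (sigma_sets (space P) (cylinders c)) (sigma_sets (space P) ?D)"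
    by (intro indep_set_sigma_sets Int_stable_cylinders)
  have "{X -` A \<inter> space P | A. A \<in> sets borel} \<subseteq> sets (F c)"
    using measurable_sets[OF X] by auto
  then have "sigma_sets (space P) {X -` A \<inter> space P | A. A \<in> sets borel} \<subseteq> sets (F c)"
    using sets.sigma_sets_subset[of "{X -` A \<inter> space P | A. A \<in> sets borel}" "F c"] by simp
  then have "sigma_sets (space P) {X -` A \<inter> space P | A. A \<in> sets borel} \<subseteq> sigma_sets (space P) (cylinders c)"
    using sets_F_cylinders by blast
  with ind show ?thesis
    unfolding indep_var_eq indep_sets2_eq
    by (intro conjI measurable_F_P[OF X] Wm) blast+
qed

section \<open>Moments of increments weighted by the past\<close>

lemma W_incr_moments:
  assumes "0 \<le> c" "c < d"
  shows "integrable P (\<lambda>\<omega>. W d \<omega> - W c \<omega>)" "integrable P (\<lambda>\<omega>. (W d \<omega> - W c \<omega>)\<^sup>2)"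
    "expectation (\<lambda>\<omega>. W d \<omega> - W c \<omega>) = 0" "expectation (\<lambda>\<omega>. (W d \<omega> - W c \<omega>)\<^sup>2) = d - c"
proof -
  note D = W_incr_distributed[OF assms]
  have \<sigma>: "0 < sqrt (d - c)" using assms by simp
  show "integrable P (\<lambda>\<omega>. W d \<omega> - W c \<omega>)"
    using distributed_integrable[OF D, of "\<lambda>x. x"] integrable_normal_moment_nz_1[OF \<sigma>, of 0] by simp
  show "integrable P (\<lambda>\<omega>. (W d \<omega> - W c \<omega>)\<^sup>2)"
    using distributed_integrable[OF D, of "\<lambda>x. x\<^sup>2"] integrable_normal_moment[OF \<sigma>, of 0 2] by simp
  show e: "expectation (\<lambda>\<omega>. W d \<omega> - W c \<omega>) = 0" by (rule normal_distributed_expectation[OF \<sigma> D])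
  show "expectation (\<lambda>\<omega>. (W d \<omega> - W c \<omega>)\<^sup>2) = d - c"
    using normal_distributed_variance[OF \<sigma> D] e assms by simp
qed

lemma F_incr_moments:
  assumes c: "0 \<le> c" "c < d" and X: "X \<in> borel_measurable (F c)" "integrable P X"
  shows "integrable P (\<lambda>\<omega>. X \<omega> * (W d \<omega> - W c \<omega>))" "expectation (\<lambda>\<omega>. X \<omega> * (W d \<omega> - W c \<omega>)) = 0"
    "integrable P (\<lambda>\<omega>. X \<omega> * (W d \<omega> - W c \<omega>)\<^sup>2)" "expectation (\<lambda>\<omega>. X \<omega> * (W d \<omega> - W c \<omega>)\<^sup>2) = (d - c) * expectation X"
proof -
  note m = W_incr_moments[OF c]
  note i = indep_F_incr[OF c X(1)]
  have "indep_var borel ((\<lambda>x. x) \<circ> X) borel ((\<lambda>x. x\<^sup>2) \<circ> (\<lambda>\<omega>. W d \<omega> - W c \<omega>))"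
    by (rule indep_var_compose[OF i]) measurable
  then have i2: "indep_var borel X borel (\<lambda>\<omega>. (W d \<omega> - W c \<omega>)\<^sup>2)" by (simp add: comp_def)
  show "integrable P (\<lambda>\<omega>. X \<omega> * (W d \<omega> - W c \<omega>))" by (rule indep_var_integrable[OF i X(2) m(1)])
  show "expectation (\<lambda>\<omega>. X \<omega> * (W d \<omega> - W c \<omega>)) = 0"
    using indep_var_lebesgue_integral[OF i X(2) m(1)] m(3) by simp
  show "integrable P (\<lambda>\<omega>. X \<omega> * (W d \<omega> - W c \<omega>)\<^sup>2)" by (rule indep_var_integrable[OF i2 X(2) m(2)])
  show "expectation (\<lambda>\<omega>. X \<omega> * (W d \<omega> - W c \<omega>)\<^sup>2) = (d - c) * expectation X"
    using indep_var_lebesgue_integral[OF i2 X(2) m(2)] m(4) by simp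
qed

lemma W_incr_integrable:
  assumes "0 \<le> c" "c \<le> d"
  shows "integrable P (\<lambda>\<omega>. W d \<omega> - W c \<omega>)" "integrable P (\<lambda>\<omega>. (W d \<omega> - W c \<omega>)\<^sup>2)"
  using W_incr_moments[of c d] assms by (cases "c = d"; simp)+

lemma F_incr_bochner:
  assumes c: "0 \<le> c" "c \<le> d" and X: "X \<in> borel_measurable (F c)" "integrable P X"
  shows "has_bochner_integral P (\<lambda>\<omega>. X \<omega> * (W d \<omega> - W c \<omega>)) 0"
    "has_bochner_integral P (\<lambda>\<omega>. X \<omega> * (W d \<omega> - W c \<omega>)\<^sup>2) ((d - c) * expectation X)"
  using F_incr_moments[of c d X] assms
  by (cases "c = d"; simp add: has_bochner_integral_iff)+

section \<open>The Ito isometry\<close>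

definition bounded_F :: "real \<Rightarrow> ('w \<Rightarrow> real) \<Rightarrow> bool" where
  "bounded_F a \<xi> \<longleftrightarrow> \<xi> \<in> borel_measurable (F a) \<and> (\<exists>C. \<forall>\<omega>\<in>space P. \<bar>\<xi> \<omega>\<bar> \<le> C)"

lemma bounded_F_mult: "bounded_F a \<xi> \<Longrightarrow> bounded_F a \<eta> \<Longrightarrow> bounded_F a (\<lambda>\<omega>. \<xi> \<omega> * \<eta> \<omega>)"
  unfolding bounded_F_def
proof (elim conjE exE, intro conjI)
  fix C D assume C: "\<forall>\<omega>\<in>space P. \<bar>\<xi> \<omega>\<bar> \<le> C" and D: "\<forall>\<omega>\<in>space P. \<bar>\<eta> \<omega>\<bar> \<le> D"
  have "\<bar>\<xi> \<omega> * \<eta> \<omega>\<bar> \<le> C * D" if "\<omega> \<in> space P" for \<omega>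
    unfolding abs_mult using C D that by (intro mult_mono) (auto intro: order_trans[OF abs_ge_zero])
  then show "\<exists>C. \<forall>\<omega>\<in>space P. \<bar>\<xi> \<omega> * \<eta> \<omega>\<bar> \<le> C" by blast
qed auto

lemma bounded_F_mono: "a \<le> b \<Longrightarrow> bounded_F a \<xi> \<Longrightarrow> bounded_F b \<xi>"
  by (auto simp: bounded_F_def intro: measurable_F_mono)

lemma bounded_F_cmult: "bounded_F a \<xi> \<Longrightarrow> bounded_F a (\<lambda>\<omega>. c * \<xi> \<omega>)"
  by (rule bounded_F_mult) (auto simp: bounded_F_def)

lemma integrable_bounded_F_mult:
  assumes "bounded_F a \<xi>" "integrable P X" shows "integrable P (\<lambda>\<omega>. \<xi> \<omega> * X \<omega>)"
proof -
  from assms obtain C where C: "\<forall>\<omega>\<in>space P. \<bar>\<xi> \<omega>\<bar> \<le> C" and m: "\<xi> \<in> borel_measurable P"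
    by (auto simp: bounded_F_def intro: measurable_F_P)
  show ?thesis
  proof (rule Bochner_Integration.integrable_bound)
    show "integrable P (\<lambda>\<omega>. C * X \<omega>)" using assms by simp
    show "(\<lambda>\<omega>. \<xi> \<omega> * X \<omega>) \<in> borel_measurable P" using m assms by simp
    show "AE \<omega> in P. norm (\<xi> \<omega> * X \<omega>) \<le> norm (C * X \<omega>)"
      using C by (intro AE_I2) (auto simp: abs_mult intro!: mult_right_mono elim!: order_trans dest!: bspec)
  qed
qed

text \<open>Whatever is known at the later left end point \<open>c\<close> is independent of each
  increment after \<open>c\<close>. Disjoint steps are therefore uncorrelated, and for overlapping
  ones only the squared increment over the overlap contributes.\<close>

lemma incr_covariance_le:
  assumes \<xi>: "bounded_F a \<xi>" and \<eta>: "bounded_F c \<eta>" and abcd: "0 \<le> a" "a \<le> b" "c \<le> d" "a \<le> c"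
  shows "has_bochner_integral P (\<lambda>\<omega>. (\<xi> \<omega> * (W b \<omega> - W a \<omega>)) * (\<eta> \<omega> * (W d \<omega> - W c \<omega>)))
    (expectation (\<lambda>\<omega>. \<xi> \<omega> * \<eta> \<omega>) * measure lborel ({a<..b} \<inter> {c<..d}))"
proof -
  define \<zeta> where "\<zeta> \<omega> = \<xi> \<omega> * \<eta> \<omega>" for \<omega>
  have \<zeta>: "bounded_F c \<zeta>"
    unfolding \<zeta>_def[abs_def] by (intro bounded_F_mult bounded_F_mono[OF abcd(4) \<xi>] \<eta>)
  have meas: "(\<lambda>\<omega>. \<zeta> \<omega> * (W y \<omega> - W x \<omega>)) \<in> borel_measurable (F z)"
    if "0 \<le> x" "x \<le> y" "y \<le> z" "c \<le> z" for x y z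
    using bounded_F_mono[OF that(4) \<zeta>] that unfolding bounded_F_def
    by (intro borel_measurable_times borel_measurable_diff W_measurable_F) auto
  have int: "integrable P (\<lambda>\<omega>. \<zeta> \<omega> * (W y \<omega> - W x \<omega>))" if "0 \<le> x" "x \<le> y" for x y
    by (rule integrable_bounded_F_mult[OF \<zeta> W_incr_integrable(1)[OF that]])
  show ?thesis
  proof (cases "b \<le> c")
    case True
    have "has_bochner_integral P (\<lambda>\<omega>. (\<zeta> \<omega> * (W b \<omega> - W a \<omega>)) * (W d \<omega> - W c \<omega>)) 0"
      by (rule F_incr_bochner(1)) (use abcd True in \<open>auto intro!: meas int\<close>)
    moreover have "measure lborel ({a<..b} \<inter> {c<..d}) = 0" using True by simp
    ultimately show ?thesis by (simp only: mult_zero_right) (simp add: \<zeta>_def mult_ac)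
  next
    case False
    define m where "m = min b d"
    define M where "M = max b d"
    have m: "c \<le> m" "m \<le> M" "0 \<le> c" using False abcd by (auto simp: m_def M_def)
    have 1: "has_bochner_integral P (\<lambda>\<omega>. (\<zeta> \<omega> * (W c \<omega> - W a \<omega>)) * (W d \<omega> - W c \<omega>)) 0"
      by (rule F_incr_bochner(1)) (use abcd m in \<open>auto intro!: meas int\<close>)
    have "integrable P (\<lambda>\<omega>. \<zeta> \<omega> * 1)" by (rule integrable_bounded_F_mult[OF \<zeta>]) simp
    then have 2: "has_bochner_integral P (\<lambda>\<omega>. \<zeta> \<omega> * (W m \<omega> - W c \<omega>)\<^sup>2) ((m - c) * expectation \<zeta>)"
      by (intro F_incr_bochner(2)) (use m \<zeta> in \<open>auto simp: bounded_F_def\<close>)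
    have 3: "has_bochner_integral P (\<lambda>\<omega>. (\<zeta> \<omega> * (W m \<omega> - W c \<omega>)) * (W M \<omega> - W m \<omega>)) 0"
      by (rule F_incr_bochner(1)) (use m in \<open>auto intro!: meas int\<close>)
    have "{a<..b} \<inter> {c<..d} = {c<..m}" using abcd False by (auto simp: m_def)
    then have "measure lborel ({a<..b} \<inter> {c<..d}) = m - c" using m by simp
    \<comment> \<open>The product of the two increments splits into the part before \<open>c\<close>
      times the later increment, the square over the overlap from \<open>c\<close> to
      \<open>m\<close>, and the overlap times the increment from \<open>m\<close> to
      \<open>M\<close>. Only the middle term survives the expectation.\<close>
    moreover have "(\<lambda>\<omega>. (\<zeta> \<omega> * (W c \<omega> - W a \<omega>)) * (W d \<omega> - W c \<omega>) + \<zeta> \<omega> * (W m \<omega> - W c \<omega>)\<^sup>2 +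
        (\<zeta> \<omega> * (W m \<omega> - W c \<omega>)) * (W M \<omega> - W m \<omega>)) =
        (\<lambda>\<omega>. (\<xi> \<omega> * (W b \<omega> - W a \<omega>)) * (\<eta> \<omega> * (W d \<omega> - W c \<omega>)))"
      unfolding m_def M_def by (cases "b \<le> d") (auto simp: \<zeta>_def min_def max_def power2_eq_square algebra_simps)
    ultimately show ?thesis
      using has_bochner_integral_add[OF has_bochner_integral_add[OF 1 2] 3]
      by (simp add: \<zeta>_def[abs_def] mult_ac)
  qed
qed

text \<open>The pairs \<open>(\<phi>, X)\<close> of an elementary integrand and its Ito integral, closed under sums without a
  common refinement of partitions.\<close>

inductive elem :: "(real \<Rightarrow> 'w \<Rightarrow> real) \<Rightarrow> ('w \<Rightarrow> real) \<Rightarrow> bool" where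
  zero: "elem (\<lambda>s \<omega>. 0) (\<lambda>\<omega>. 0)"
| step: "elem \<phi> X \<Longrightarrow> 0 \<le> a \<Longrightarrow> a \<le> b \<Longrightarrow> bounded_F a \<xi> \<Longrightarrow>
    elem (\<lambda>s \<omega>. \<phi> s \<omega> + \<xi> \<omega> * indicator {a<..b} s) (\<lambda>\<omega>. X \<omega> + \<xi> \<omega> * (W b \<omega> - W a \<omega>))"

text \<open>The isometry in polarised form. Being bilinear in the two pairs, it passes from single
  steps to sums, which the identity between squared norms alone would not do.\<close>

definition isom :: "(real \<Rightarrow> 'w \<Rightarrow> real) \<Rightarrow> ('w \<Rightarrow> real) \<Rightarrow> (real \<Rightarrow> 'w \<Rightarrow> real) \<Rightarrow> ('w \<Rightarrow> real) \<Rightarrow> bool" where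
  "isom \<phi> X \<psi> Y \<longleftrightarrow> (\<forall>\<omega>\<in>space P. integrable lborel (\<lambda>s. \<phi> s \<omega> * \<psi> s \<omega>)) \<and>
     integrable P (\<lambda>\<omega>. \<integral>s. \<phi> s \<omega> * \<psi> s \<omega> \<partial>lborel) \<and>
     has_bochner_integral P (\<lambda>\<omega>. X \<omega> * Y \<omega>) (\<integral>\<omega>. \<integral>s. \<phi> s \<omega> * \<psi> s \<omega> \<partial>lborel \<partial>P)"

lemma isom_sym: "isom \<phi> X \<psi> Y \<Longrightarrow> isom \<psi> Y \<phi> X"
  unfolding isom_def by (simp add: mult.commute)

lemma isom_zero: "isom (\<lambda>s \<omega>. 0) (\<lambda>\<omega>. 0) \<psi> Y"
  by (simp add: isom_def has_bochner_integral_iff)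

lemma isom_add:
  assumes "isom \<phi> X \<psi> Y" "isom \<phi>' X' \<psi> Y"
  shows "isom (\<lambda>s \<omega>. \<phi> s \<omega> + \<phi>' s \<omega>) (\<lambda>\<omega>. X \<omega> + X' \<omega>) \<psi> Y"
proof -
  have "(\<integral>s. (\<phi> s \<omega> + \<phi>' s \<omega>) * \<psi> s \<omega> \<partial>lborel) = (\<integral>s. \<phi> s \<omega> * \<psi> s \<omega> \<partial>lborel) + (\<integral>s. \<phi>' s \<omega> * \<psi> s \<omega> \<partial>lborel)"
    if "\<omega> \<in> space P" for \<omega>
    using assms that by (simp add: isom_def distrib_right)
  then have "integrable P (\<lambda>\<omega>. \<integral>s. (\<phi> s \<omega> + \<phi>' s \<omega>) * \<psi> s \<omega> \<partial>lborel)"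
    and "(\<integral>\<omega>. \<integral>s. (\<phi> s \<omega> + \<phi>' s \<omega>) * \<psi> s \<omega> \<partial>lborel \<partial>P) =
      (\<integral>\<omega>. \<integral>s. \<phi> s \<omega> * \<psi> s \<omega> \<partial>lborel \<partial>P) + (\<integral>\<omega>. \<integral>s. \<phi>' s \<omega> * \<psi> s \<omega> \<partial>lborel \<partial>P)"
    using assms by (simp_all add: isom_def cong: Bochner_Integration.integrable_cong Bochner_Integration.integral_cong)
  moreover have "has_bochner_integral P (\<lambda>\<omega>. X \<omega> * Y \<omega> + X' \<omega> * Y \<omega>)
    ((\<integral>\<omega>. \<integral>s. \<phi> s \<omega> * \<psi> s \<omega> \<partial>lborel \<partial>P) + (\<integral>\<omega>. \<integral>s. \<phi>' s \<omega> * \<psi> s \<omega> \<partial>lborel \<partial>P))"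
    using assms by (auto simp: isom_def intro: has_bochner_integral_add)
  ultimately show ?thesis using assms by (simp add: isom_def distrib_right)
qed

lemma isom_step:
  assumes "bounded_F a \<xi>" "bounded_F c \<eta>" "0 \<le> a" "a \<le> b" "0 \<le> c" "c \<le> d"
  shows "isom (\<lambda>s \<omega>. \<xi> \<omega> * indicator {a<..b} s) (\<lambda>\<omega>. \<xi> \<omega> * (W b \<omega> - W a \<omega>))
    (\<lambda>s \<omega>. \<eta> \<omega> * indicator {c<..d} s) (\<lambda>\<omega>. \<eta> \<omega> * (W d \<omega> - W c \<omega>))"
  using assms
proof (induction a c arbitrary: b d \<xi> \<eta> rule: linorder_wlog)
  case (le a c)
  have eq: "(\<lambda>s. (\<xi> \<omega> * indicator {a<..b} s) * (\<eta> \<omega> * indicator {c<..d} s)) =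
      (\<lambda>s. (\<xi> \<omega> * \<eta> \<omega>) * indicator ({a<..b} \<inter> {c<..d}) s)" for \<omega>
    by (auto simp: fun_eq_iff indicator_def)
  have fin: "emeasure lborel ({a<..b} \<inter> {c<..d}) < \<infinity>"
    by (rule le_less_trans[OF emeasure_mono[of _ "{a<..b}"]]) (use le in auto)
  have "integrable P (\<lambda>\<omega>. \<xi> \<omega> * (\<eta> \<omega> * 1))"
    by (intro integrable_bounded_F_mult[OF le(2)] integrable_bounded_F_mult[OF le(3)]) simp
  then show ?case
    using incr_covariance_le[OF le(2,3,4,5,7) le(1)] fin by (simp add: isom_def eq)
next
  case (sym a c)
  then show ?case by (intro isom_sym[OF sym(1)])
qed

text \<open>Bilinearity reduces the claim to two single steps: the induction on one pair is nested
  inside the induction on the other, and symmetry exchanges their roles.\<close>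

lemma elem_isom: "elem \<phi> X \<Longrightarrow> elem \<psi> Y \<Longrightarrow> isom \<phi> X \<psi> Y"
proof (induction rule: elem.induct)
  case (step \<phi> X a b \<xi>)
  from step.prems have "isom \<psi> Y (\<lambda>s \<omega>. \<xi> \<omega> * indicator {a<..b} s) (\<lambda>\<omega>. \<xi> \<omega> * (W b \<omega> - W a \<omega>))"
    by (induction rule: elem.induct) (use step in \<open>auto intro!: isom_add isom_step isom_zero\<close>)
  then show ?case by (intro isom_add step.IH step.prems) (rule isom_sym)
qed (rule isom_zero)

lemma elem_isometry:
  assumes "elem \<phi> X"
  shows "(\<integral>\<^sup>+\<omega>. ennreal ((X \<omega>)\<^sup>2) \<partial>P) = (\<integral>\<^sup>+\<omega>. \<integral>\<^sup>+s. ennreal ((\<phi> s \<omega>)\<^sup>2) \<partial>lborel \<partial>P)"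
    "(\<integral>\<^sup>+\<omega>. ennreal ((X \<omega>)\<^sup>2) \<partial>P) < \<infinity>"
proof -
  note i = elem_isom[OF assms assms, unfolded isom_def power2_eq_square[symmetric]]
  have "(\<integral>\<^sup>+\<omega>. ennreal ((X \<omega>)\<^sup>2) \<partial>P) = ennreal (\<integral>\<omega>. (X \<omega>)\<^sup>2 \<partial>P)"
    using i by (intro nn_integral_eq_integral) (auto dest: integrable.intros)
  also have "\<dots> = ennreal (\<integral>\<omega>. \<integral>s. (\<phi> s \<omega>)\<^sup>2 \<partial>lborel \<partial>P)"
    using i by (simp add: has_bochner_integral_iff)
  also have "\<dots> = (\<integral>\<^sup>+\<omega>. ennreal (\<integral>s. (\<phi> s \<omega>)\<^sup>2 \<partial>lborel) \<partial>P)"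
    using i by (intro nn_integral_eq_integral[symmetric]) auto
  also have "\<dots> = (\<integral>\<^sup>+\<omega>. \<integral>\<^sup>+s. ennreal ((\<phi> s \<omega>)\<^sup>2) \<partial>lborel \<partial>P)"
    using i by (intro nn_integral_cong nn_integral_eq_integral[symmetric]) auto
  finally show "(\<integral>\<^sup>+\<omega>. ennreal ((X \<omega>)\<^sup>2) \<partial>P) = (\<integral>\<^sup>+\<omega>. \<integral>\<^sup>+s. ennreal ((\<phi> s \<omega>)\<^sup>2) \<partial>lborel \<partial>P)" .
  show "(\<integral>\<^sup>+\<omega>. ennreal ((X \<omega>)\<^sup>2) \<partial>P) < \<infinity>"
    using i by (subst nn_integral_eq_integral) (auto dest: integrable.intros)
qed

lemma elem_measurable:
  assumes "elem \<phi> X"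
  shows "X \<in> borel_measurable P" "(\<lambda>(s, \<omega>). \<phi> s \<omega>) \<in> borel_measurable (borel \<Otimes>\<^sub>M P)"
  using assms
proof (induction rule: elem.induct)
  case (step \<phi> X a b \<xi>)
  have [measurable]: "\<xi> \<in> borel_measurable P"
    using step by (auto simp: bounded_F_def intro: measurable_F_P)
  {
    case 1
    show ?case using step by (intro borel_measurable_add borel_measurable_times borel_measurable_diff W_measurable) auto
  next
    case 2
    note [measurable] = step(6)
    show ?case by measurable
  }
qed auto

section \<open>Linear combinations of elementary integrals, and simple integrands among them\<close>

lemma elem_add: "elem \<psi> Y \<Longrightarrow> elem \<phi> X \<Longrightarrow> elem (\<lambda>s \<omega>. \<phi> s \<omega> + \<psi> s \<omega>) (\<lambda>\<omega>. X \<omega> + Y \<omega>)"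
proof (induction rule: elem.induct)
  case (step \<psi> Y a b \<xi>)
  then have "elem (\<lambda>s \<omega>. (\<phi> s \<omega> + \<psi> s \<omega>) + \<xi> \<omega> * indicator {a<..b} s) (\<lambda>\<omega>. (X \<omega> + Y \<omega>) + \<xi> \<omega> * (W b \<omega> - W a \<omega>))"
    by (intro elem.step) auto
  then show ?case by (simp add: add.assoc)
qed simp

lemma elem_cmult: "elem \<phi> X \<Longrightarrow> elem (\<lambda>s \<omega>. c * \<phi> s \<omega>) (\<lambda>\<omega>. c * X \<omega>)"
proof (induction rule: elem.induct)
  case zero
  then show ?case by (simp add: elem.zero)
next
  case (step \<phi> X a b \<xi>)
  then have "elem (\<lambda>s \<omega>. c * \<phi> s \<omega> + (c * \<xi> \<omega>) * indicator {a<..b} s) (\<lambda>\<omega>. c * X \<omega> + (c * \<xi> \<omega>) * (W b \<omega> - W a \<omega>))"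
    by (intro elem.step bounded_F_cmult)
  then show ?case by (simp add: algebra_simps)
qed

lemma elem_sum:
  "finite K \<Longrightarrow> (\<And>j. j \<in> K \<Longrightarrow> elem (\<phi> j) (X j)) \<Longrightarrow> elem (\<lambda>s \<omega>. \<Sum>j\<in>K. c j * \<phi> j s \<omega>) (\<lambda>\<omega>. \<Sum>j\<in>K. c j * X j \<omega>)"
proof (induction rule: finite_induct)
  case (insert j K)
  then have "elem (\<lambda>s \<omega>. (\<Sum>j\<in>K. c j * \<phi> j s \<omega>) + c j * \<phi> j s \<omega>) (\<lambda>\<omega>. (\<Sum>j\<in>K. c j * X j \<omega>) + c j * X j \<omega>)"
    by (intro elem_add elem_cmult) auto
  then show ?case using insert by (simp add: add.commute)
qed (simp add: elem.zero)

lemma simple_integrand_le: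
  assumes "simple_integrand P W t N \<tau> \<xi>" "i \<le> j" "j \<le> N"
  shows "0 \<le> \<tau> i" "\<tau> i \<le> \<tau> j" "\<tau> j \<le> t"
proof -
  have m: "\<tau> i \<le> \<tau> j" if "i \<le> j" "j \<le> N" for i j
    using that
  proof (induction rule: dec_induct)
    case (step n)
    then show ?case using assms(1) unfolding simple_integrand_def by (meson Suc_le_eq less_imp_le order_trans)
  qed simp
  show "\<tau> i \<le> \<tau> j" using m assms by blast
  show "0 \<le> \<tau> i" using m[of 0 i] assms by (auto simp: simple_integrand_def)
  show "\<tau> j \<le> t" using m[of j N] assms by (auto simp: simple_integrand_def)
qed

lemma simple_elem:
  assumes "simple_integrand P W t N \<tau> \<xi>"
  shows "elem (simple_process N \<tau> \<xi>) (simple_ito W N \<tau> \<xi>)"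
proof -
  have "elem (simple_process k \<tau> \<xi>) (simple_ito W k \<tau> \<xi>)" if "k \<le> N" for k
    using that
  proof (induction k)
    case (Suc k)
    then have "elem (\<lambda>s \<omega>. simple_process k \<tau> \<xi> s \<omega> + \<xi> k \<omega> * indicator {\<tau> k<..\<tau> (Suc k)} s)
       (\<lambda>\<omega>. simple_ito W k \<tau> \<xi> \<omega> + \<xi> k \<omega> * (W (\<tau> (Suc k)) \<omega> - W (\<tau> k) \<omega>))"
      using simple_integrand_le[OF assms, of k "Suc k"] assms
      by (intro elem.step) (auto simp: bounded_F_def simple_integrand_def)
    then show ?case unfolding simple_process_def[abs_def] simple_ito_def[abs_def] sum.lessThan_Suc .
  qed (simp add: simple_process_def[abs_def] simple_ito_def[abs_def] elem.zero)
  then show ?thesis by simp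
qed

lemma simple_process_outside:
  assumes "simple_integrand P W t N \<tau> \<xi>" "s \<notin> {0..t}"
  shows "simple_process N \<tau> \<xi> s \<omega> = 0"
  unfolding simple_process_def
proof (rule sum.neutral, intro ballI)
  fix i assume "i \<in> {..<N}"
  then show "\<xi> i \<omega> * indicator {\<tau> i<..\<tau> (Suc i)} s = 0"
    using simple_integrand_le[OF assms(1), of i "Suc i"] assms(2) by (auto simp: indicator_def)
qed

end

section \<open>Mean-square inequalities\<close>

lemma set_nn_integral_sq_eq:
  fixes t :: real
  shows "(\<integral>\<^sup>+s\<in>{0..t}. ennreal ((f s)\<^sup>2) \<partial>lborel) = (\<integral>\<^sup>+s. ennreal ((indicator {0..t} s * f s)\<^sup>2) \<partial>lborel)"
  by (rule nn_integral_cong) (auto simp: indicator_def)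

lemma sum_square_le:
  fixes a :: "'i \<Rightarrow> real"
  shows "finite K \<Longrightarrow> (\<Sum>j\<in>K. a j)\<^sup>2 \<le> card K * (\<Sum>j\<in>K. (a j)\<^sup>2)"
  using sum_squared_le_sum_of_squares[of a K] by (simp add: mult.commute)

lemma nn_integral_sum_square_le:
  fixes a :: "'i \<Rightarrow> 'b \<Rightarrow> real" and c :: "'i \<Rightarrow> real"
  assumes K: "finite K" and [measurable]: "\<And>j. j \<in> K \<Longrightarrow> a j \<in> borel_measurable M"
  shows "(\<integral>\<^sup>+x. ennreal ((\<Sum>j\<in>K. c j * a j x)\<^sup>2) \<partial>M) \<le>
    (\<Sum>j\<in>K. ennreal (card K * (c j)\<^sup>2) * (\<integral>\<^sup>+x. ennreal ((a j x)\<^sup>2) \<partial>M))"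
proof -
  have "(\<integral>\<^sup>+x. ennreal ((\<Sum>j\<in>K. c j * a j x)\<^sup>2) \<partial>M) \<le>
    (\<integral>\<^sup>+x. (\<Sum>j\<in>K. ennreal (card K * (c j)\<^sup>2) * ennreal ((a j x)\<^sup>2)) \<partial>M)"
  proof (rule nn_integral_mono)
    fix x
    have "(\<Sum>j\<in>K. ennreal (card K * (c j)\<^sup>2) * ennreal ((a j x)\<^sup>2)) = ennreal (card K * (\<Sum>j\<in>K. (c j * a j x)\<^sup>2))"
      by (simp add: ennreal_mult[symmetric] sum_distrib_left power_mult_distrib mult.assoc)
    then show "ennreal ((\<Sum>j\<in>K. c j * a j x)\<^sup>2) \<le> (\<Sum>j\<in>K. ennreal (card K * (c j)\<^sup>2) * ennreal ((a j x)\<^sup>2))"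
      using sum_square_le[OF K, of "\<lambda>j. c j * a j x"] by (simp add: ennreal_leI)
  qed
  also have "\<dots> = (\<Sum>j\<in>K. ennreal (card K * (c j)\<^sup>2) * (\<integral>\<^sup>+x. ennreal ((a j x)\<^sup>2) \<partial>M))"
    by (subst nn_integral_sum) (auto intro!: sum.cong nn_integral_cmult)
  finally show ?thesis .
qed

lemma nn_integral_sq_triangle:
  assumes [measurable]: "f \<in> borel_measurable M" "g \<in> borel_measurable M"
  shows "(\<integral>\<^sup>+x. ennreal ((f x + g x :: real)\<^sup>2) \<partial>M) \<le> 2 * (\<integral>\<^sup>+x. ennreal ((f x)\<^sup>2) \<partial>M) + 2 * (\<integral>\<^sup>+x. ennreal ((g x)\<^sup>2) \<partial>M)"
proof -
  have "(\<integral>\<^sup>+x. ennreal ((f x + g x)\<^sup>2) \<partial>M) \<le> (\<integral>\<^sup>+x. 2 * ennreal ((f x)\<^sup>2) + 2 * ennreal ((g x)\<^sup>2) \<partial>M)"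
  proof (rule nn_integral_mono)
    fix x
    have "(f x + g x)\<^sup>2 \<le> 2 * (f x)\<^sup>2 + 2 * (g x)\<^sup>2"
      using zero_le_power2[of "f x - g x"] by (simp add: power2_eq_square algebra_simps)
    then have "ennreal ((f x + g x)\<^sup>2) \<le> ennreal (2 * (f x)\<^sup>2 + 2 * (g x)\<^sup>2)" by (rule ennreal_leI)
    also have "\<dots> = 2 * ennreal ((f x)\<^sup>2) + 2 * ennreal ((g x)\<^sup>2)" by (simp add: ennreal_mult)
    finally show "ennreal ((f x + g x)\<^sup>2) \<le> 2 * ennreal ((f x)\<^sup>2) + 2 * ennreal ((g x)\<^sup>2)" .
  qed
  also have "\<dots> = 2 * (\<integral>\<^sup>+x. ennreal ((f x)\<^sup>2) \<partial>M) + 2 * (\<integral>\<^sup>+x. ennreal ((g x)\<^sup>2) \<partial>M)"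
    by (simp add: nn_integral_add nn_integral_cmult)
  finally show ?thesis .
qed

section \<open>Vanishing combinations and uniqueness of Ito integrals\<close>

context wiener begin

text \<open>Extension by zero trades the time domain \<open>{0..t}\<close> for the whole line, where
  Fubini's theorem for \<open>lborel\<close> and translations in time are available.\<close>

lemma measurable_zero_extension:
  fixes t :: real
  assumes "(\<lambda>(s, \<omega>). f s \<omega>) \<in> borel_measurable (restrict_space borel {0..t} \<Otimes>\<^sub>M P)"
  shows "(\<lambda>(s, \<omega>). indicator {0..t} s * (f s \<omega> :: real)) \<in> borel_measurable (borel \<Otimes>\<^sub>M P)"
proof -
  let ?A = "{0..t} \<times> space P"
  have 1: "fst \<in> measurable (restrict_space (borel \<Otimes>\<^sub>M P) ?A) (restrict_space borel {0..t})"
    by (rule measurable_restrict_space2)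
      (auto simp: space_restrict_space intro: measurable_restrict_space1)
  have 2: "snd \<in> measurable (restrict_space (borel \<Otimes>\<^sub>M P) ?A) P"
    by (rule measurable_restrict_space1) simp
  have "(\<lambda>x. case_prod f x) \<in> borel_measurable (restrict_space (borel \<Otimes>\<^sub>M P) ?A)"
    using measurable_compose[OF measurable_Pair[OF 1 2] assms] by simp
  moreover have "?A \<inter> space (borel \<Otimes>\<^sub>M P) = ?A" by (auto simp: space_pair_measure)
  ultimately have "(\<lambda>x. indicator ?A x *\<^sub>R case_prod f x) \<in> borel_measurable (borel \<Otimes>\<^sub>M P)"
    by (subst (asm) borel_measurable_restrict_space_iff) (auto intro!: pair_measureI)
  then show ?thesis
    by (rule measurable_cong[THEN iffD1, rotated]) (auto simp: space_pair_measure indicator_def)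
qed

lemma measurable_nn2 [measurable]:
  assumes [measurable]: "(\<lambda>(s, \<omega>). g s \<omega>) \<in> borel_measurable (borel \<Otimes>\<^sub>M P)"
  shows "(\<lambda>\<omega>. \<integral>\<^sup>+s. ennreal ((g s \<omega>)\<^sup>2 :: real) \<partial>lborel) \<in> borel_measurable P"
  by measurable

lemma nn2_triangle:
  assumes f: "(\<lambda>(s, \<omega>). f s \<omega>) \<in> borel_measurable (borel \<Otimes>\<^sub>M P)"
    and g: "(\<lambda>(s, \<omega>). g s \<omega>) \<in> borel_measurable (borel \<Otimes>\<^sub>M P)"
  shows "(\<integral>\<^sup>+\<omega>. \<integral>\<^sup>+s. ennreal ((f s \<omega> + g s \<omega> :: real)\<^sup>2) \<partial>lborel \<partial>P) \<le>
    2 * (\<integral>\<^sup>+\<omega>. \<integral>\<^sup>+s. ennreal ((f s \<omega>)\<^sup>2) \<partial>lborel \<partial>P) + 2 * (\<integral>\<^sup>+\<omega>. \<integral>\<^sup>+s. ennreal ((g s \<omega>)\<^sup>2) \<partial>lborel \<partial>P)"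
proof -
  have sec: "(\<lambda>s. h s \<omega>) \<in> borel_measurable lborel"
    if "(\<lambda>(s, \<omega>). h s \<omega>) \<in> borel_measurable (borel \<Otimes>\<^sub>M P)" "\<omega> \<in> space P" for h and \<omega>
    using measurable_compose[OF measurable_Pair2'[OF that(2)] that(1)] by simp
  have "(\<integral>\<^sup>+\<omega>. \<integral>\<^sup>+s. ennreal ((f s \<omega> + g s \<omega> :: real)\<^sup>2) \<partial>lborel \<partial>P) \<le>
     (\<integral>\<^sup>+\<omega>. 2 * (\<integral>\<^sup>+s. ennreal ((f s \<omega>)\<^sup>2) \<partial>lborel) + 2 * (\<integral>\<^sup>+s. ennreal ((g s \<omega>)\<^sup>2) \<partial>lborel) \<partial>P)"
    by (intro nn_integral_mono nn_integral_sq_triangle sec[OF f] sec[OF g])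
  also have "\<dots> = 2 * (\<integral>\<^sup>+\<omega>. \<integral>\<^sup>+s. ennreal ((f s \<omega>)\<^sup>2) \<partial>lborel \<partial>P) + 2 * (\<integral>\<^sup>+\<omega>. \<integral>\<^sup>+s. ennreal ((g s \<omega>)\<^sup>2) \<partial>lborel \<partial>P)"
    using measurable_nn2[OF f] measurable_nn2[OF g] by (simp add: nn_integral_add nn_integral_cmult)
  finally show ?thesis .
qed

text \<open>Linearity and uniqueness at once, without integrating a sum: if the integrands cancel,
  the same combination of their approximants is small in mean square, and the isometry carries this
  over to the combination of the simple integrals and so to the limits.\<close>

lemma ito_integral_comb_zero:
  assumes K: "finite K" and J: "\<And>j. j \<in> K \<Longrightarrow> has_ito_integral P W t (f j) (J j)"
    and z: "\<And>s \<omega>. s \<in> {0..t} \<Longrightarrow> \<omega> \<in> space P \<Longrightarrow> (\<Sum>j\<in>K. c j * f j s \<omega>) = 0"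
  shows "AE \<omega> in P. (\<Sum>j\<in>K. c j * J j \<omega>) = 0"
proof -
  have "\<forall>j\<in>K. \<exists>N \<tau> \<xi>. (\<forall>k::nat. simple_integrand P W t (N k) (\<tau> k) (\<xi> k)) \<and>
        (\<lambda>k. \<integral>\<^sup>+\<omega>. (\<integral>\<^sup>+s\<in>{0..t}.
            ennreal ((f j s \<omega> - simple_process (N k) (\<tau> k) (\<xi> k) s \<omega>)\<^sup>2) \<partial>lborel) \<partial>P) \<longlonglongrightarrow> 0 \<and>
        (\<lambda>k. \<integral>\<^sup>+\<omega>. ennreal ((J j \<omega> - simple_ito W (N k) (\<tau> k) (\<xi> k) \<omega>)\<^sup>2) \<partial>P) \<longlonglongrightarrow> 0"
    using J unfolding has_ito_integral_def by blast
  from bchoice[OF this] obtain N where "\<forall>j\<in>K. \<exists>\<tau> \<xi>. (\<forall>k::nat. simple_integrand P W t (N j k) (\<tau> k) (\<xi> k)) \<and>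
        (\<lambda>k. \<integral>\<^sup>+\<omega>. (\<integral>\<^sup>+s\<in>{0..t}.
            ennreal ((f j s \<omega> - simple_process (N j k) (\<tau> k) (\<xi> k) s \<omega>)\<^sup>2) \<partial>lborel) \<partial>P) \<longlonglongrightarrow> 0 \<and>
        (\<lambda>k. \<integral>\<^sup>+\<omega>. ennreal ((J j \<omega> - simple_ito W (N j k) (\<tau> k) (\<xi> k) \<omega>)\<^sup>2) \<partial>P) \<longlonglongrightarrow> 0" ..
  from bchoice[OF this] obtain \<tau> where "\<forall>j\<in>K. \<exists>\<xi>. (\<forall>k::nat. simple_integrand P W t (N j k) (\<tau> j k) (\<xi> k)) \<and>
        (\<lambda>k. \<integral>\<^sup>+\<omega>. (\<integral>\<^sup>+s\<in>{0..t}.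
            ennreal ((f j s \<omega> - simple_process (N j k) (\<tau> j k) (\<xi> k) s \<omega>)\<^sup>2) \<partial>lborel) \<partial>P) \<longlonglongrightarrow> 0 \<and>
        (\<lambda>k. \<integral>\<^sup>+\<omega>. ennreal ((J j \<omega> - simple_ito W (N j k) (\<tau> j k) (\<xi> k) \<omega>)\<^sup>2) \<partial>P) \<longlonglongrightarrow> 0" ..
  from bchoice[OF this] obtain \<xi> where A: "\<And>j k. j \<in> K \<Longrightarrow> simple_integrand P W t (N j k) (\<tau> j k) (\<xi> j k)"
    "\<And>j. j \<in> K \<Longrightarrow> (\<lambda>k. \<integral>\<^sup>+\<omega>. (\<integral>\<^sup>+s\<in>{0..t}.
            ennreal ((f j s \<omega> - simple_process (N j k) (\<tau> j k) (\<xi> j k) s \<omega>)\<^sup>2) \<partial>lborel) \<partial>P) \<longlonglongrightarrow> 0"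
    "\<And>j. j \<in> K \<Longrightarrow> (\<lambda>k. \<integral>\<^sup>+\<omega>. ennreal ((J j \<omega> - simple_ito W (N j k) (\<tau> j k) (\<xi> j k) \<omega>)\<^sup>2) \<partial>P) \<longlonglongrightarrow> 0"
    by blast
  define \<phi> where "\<phi> j k = simple_process (N j k) (\<tau> j k) (\<xi> j k)" for j k
  define X where "X j k = simple_ito W (N j k) (\<tau> j k) (\<xi> j k)" for j k
  have el: "elem (\<phi> j k) (X j k)" if "j \<in> K" for j k
    unfolding \<phi>_def X_def by (rule simple_elem[OF A(1)[OF that]])
  define g where "g j k s \<omega> = indicator {0..t} s * (f j s \<omega> - \<phi> j k s \<omega>)" for j k s \<omega>
  have mJ: "J j \<in> borel_measurable P" and mX: "X j k \<in> borel_measurable P" if "j \<in> K" for j k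
    using J[OF that] elem_measurable[OF el[OF that, of k]] by (auto simp: has_ito_integral_def)
  have mg: "(\<lambda>(s, \<omega>). g j k s \<omega>) \<in> borel_measurable (borel \<Otimes>\<^sub>M P)" if "j \<in> K" for j k
  proof -
    have [measurable]: "(\<lambda>(s, \<omega>). indicator {0..t} s * f j s \<omega>) \<in> borel_measurable (borel \<Otimes>\<^sub>M P)"
      by (rule measurable_zero_extension) (use J[OF that] in \<open>auto simp: has_ito_integral_def adapted_process_def\<close>)
    have [measurable]: "(\<lambda>(s, \<omega>). \<phi> j k s \<omega>) \<in> borel_measurable (borel \<Otimes>\<^sub>M P)"
      by (rule elem_measurable[OF el[OF that]])
    show ?thesis unfolding g_def right_diff_distrib by measurable
  qed
  define a where "a j k = (\<integral>\<^sup>+\<omega>. ennreal ((J j \<omega> - X j k \<omega>)\<^sup>2) \<partial>P)" for j k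
  define b where "b j k = (\<integral>\<^sup>+\<omega>. \<integral>\<^sup>+s. ennreal ((g j k s \<omega>)\<^sup>2) \<partial>lborel \<partial>P)" for j k
  have lim: "a j \<longlonglongrightarrow> 0" "b j \<longlonglongrightarrow> 0" if "j \<in> K" for j
    using A(2,3)[OF that] unfolding a_def b_def g_def set_nn_integral_sq_eq \<phi>_def X_def by auto
  define C where "C j = ennreal (card K * (c j)\<^sup>2)" for j
  have le: "(\<integral>\<^sup>+\<omega>. ennreal ((\<Sum>j\<in>K. c j * J j \<omega>)\<^sup>2) \<partial>P) \<le> 2 * (\<Sum>j\<in>K. C j * a j k) + 2 * (\<Sum>j\<in>K. C j * b j k)" for k
  proof -
    have "(\<integral>\<^sup>+\<omega>. ennreal ((\<Sum>j\<in>K. c j * J j \<omega>)\<^sup>2) \<partial>P) =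
        (\<integral>\<^sup>+\<omega>. ennreal (((\<Sum>j\<in>K. c j * (J j \<omega> - X j k \<omega>)) + (\<Sum>j\<in>K. c j * X j k \<omega>))\<^sup>2) \<partial>P)"
      unfolding sum.distrib[symmetric] right_diff_distrib diff_add_cancel ..
    also have "\<dots> \<le> 2 * (\<integral>\<^sup>+\<omega>. ennreal ((\<Sum>j\<in>K. c j * (J j \<omega> - X j k \<omega>))\<^sup>2) \<partial>P) +
        2 * (\<integral>\<^sup>+\<omega>. ennreal ((\<Sum>j\<in>K. c j * X j k \<omega>)\<^sup>2) \<partial>P)"
      by (intro nn_integral_sq_triangle borel_measurable_sum borel_measurable_times borel_measurable_diff
          borel_measurable_const mJ mX)
    finally have 1: "(\<integral>\<^sup>+\<omega>. ennreal ((\<Sum>j\<in>K. c j * J j \<omega>)\<^sup>2) \<partial>P) \<le>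
        2 * (\<integral>\<^sup>+\<omega>. ennreal ((\<Sum>j\<in>K. c j * (J j \<omega> - X j k \<omega>))\<^sup>2) \<partial>P) +
        2 * (\<integral>\<^sup>+\<omega>. ennreal ((\<Sum>j\<in>K. c j * X j k \<omega>)\<^sup>2) \<partial>P)" .
    have 2: "(\<integral>\<^sup>+\<omega>. ennreal ((\<Sum>j\<in>K. c j * (J j \<omega> - X j k \<omega>))\<^sup>2) \<partial>P) \<le> (\<Sum>j\<in>K. C j * a j k)"
      unfolding C_def a_def by (intro nn_integral_sum_square_le[OF K] borel_measurable_diff mJ mX)
    have "(\<integral>\<^sup>+\<omega>. ennreal ((\<Sum>j\<in>K. c j * X j k \<omega>)\<^sup>2) \<partial>P) =
        (\<integral>\<^sup>+\<omega>. \<integral>\<^sup>+s. ennreal ((\<Sum>j\<in>K. c j * \<phi> j k s \<omega>)\<^sup>2) \<partial>lborel \<partial>P)"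
      by (rule elem_isometry[OF elem_sum[OF K el]])
    also have "\<dots> = (\<integral>\<^sup>+\<omega>. \<integral>\<^sup>+s. ennreal ((\<Sum>j\<in>K. c j * g j k s \<omega>)\<^sup>2) \<partial>lborel \<partial>P)"
    proof (intro nn_integral_cong)
      fix \<omega> s assume \<omega>: "\<omega> \<in> space P"
      \<comment> \<open>Inside \<open>{0..t}\<close> the integrands cancel, which leaves minus the
        combination of the approximants; outside, the approximants and the cut-off errors both
        vanish.\<close>
      have "(\<Sum>j\<in>K. c j * g j k s \<omega>) = - (\<Sum>j\<in>K. c j * \<phi> j k s \<omega>)"
      proof (cases "s \<in> {0..t}")
        case True
        then show ?thesis using z[OF True \<omega>] by (simp add: g_def right_diff_distrib sum_subtractf)
      next
        case False
        then show ?thesis using simple_process_outside[OF A(1) False] by (simp add: g_def \<phi>_def)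
      qed
      then show "ennreal ((\<Sum>j\<in>K. c j * \<phi> j k s \<omega>)\<^sup>2) = ennreal ((\<Sum>j\<in>K. c j * g j k s \<omega>)\<^sup>2)" by simp
    qed
    also have "\<dots> \<le> (\<integral>\<^sup>+\<omega>. (\<Sum>j\<in>K. C j * (\<integral>\<^sup>+s. ennreal ((g j k s \<omega>)\<^sup>2) \<partial>lborel)) \<partial>P)"
      unfolding C_def
    proof (intro nn_integral_mono nn_integral_sum_square_le K)
      fix \<omega> j assume "\<omega> \<in> space P" "j \<in> K"
      then show "(\<lambda>s. g j k s \<omega>) \<in> borel_measurable lborel"
        using measurable_compose[OF measurable_Pair2' mg[of j k], of \<omega>] by simp
    qed
    also have "\<dots> = (\<Sum>j\<in>K. C j * b j k)"
      unfolding b_def using measurable_nn2[OF mg]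
      by (subst nn_integral_sum) (auto intro!: sum.cong nn_integral_cmult borel_measurable_times_ennreal)
    finally have 3: "(\<integral>\<^sup>+\<omega>. ennreal ((\<Sum>j\<in>K. c j * X j k \<omega>)\<^sup>2) \<partial>P) \<le> (\<Sum>j\<in>K. C j * b j k)" .
    show ?thesis by (rule order_trans[OF 1 add_mono[OF mult_left_mono[OF 2] mult_left_mono[OF 3]]]) auto
  qed
  have "(\<lambda>k. 2 * (\<Sum>j\<in>K. C j * a j k) + 2 * (\<Sum>j\<in>K. C j * b j k)) \<longlonglongrightarrow> 2 * (\<Sum>j\<in>K. C j * 0) + 2 * (\<Sum>j\<in>K. C j * 0)"
    by (intro tendsto_add ennreal_tendsto_cmult tendsto_sum lim) (auto simp: C_def)
  then have "(\<lambda>k. 2 * (\<Sum>j\<in>K. C j * a j k) + 2 * (\<Sum>j\<in>K. C j * b j k)) \<longlonglongrightarrow> 0"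
    by simp
  then have "(\<integral>\<^sup>+\<omega>. ennreal ((\<Sum>j\<in>K. c j * J j \<omega>)\<^sup>2) \<partial>P) \<le> 0"
    by (rule LIMSEQ_le_const) (use le in blast)
  then have "(\<integral>\<^sup>+\<omega>. ennreal ((\<Sum>j\<in>K. c j * J j \<omega>)\<^sup>2) \<partial>P) = 0"
    by simp
  moreover have "(\<lambda>\<omega>. ennreal ((\<Sum>j\<in>K. c j * J j \<omega>)\<^sup>2)) \<in> borel_measurable P"
    by (intro measurable_compose[OF _ measurable_ennreal] borel_measurable_power borel_measurable_sum
        borel_measurable_times borel_measurable_const mJ)
  ultimately show ?thesis by (simp add: nn_integral_0_iff_AE)
qed

lemma ito_integral_unique:
  assumes "has_ito_integral P W t f J" "has_ito_integral P W t f J'"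
  shows "AE \<omega> in P. J \<omega> = J' \<omega>"
proof -
  \<comment> \<open>The difference of the two versions, written as a combination with weights 1 and
    -1 over one and the same integrand.\<close>
  have "AE \<omega> in P. (\<Sum>j\<in>{True, False}. (if j then 1 else -1) * (if j then J else J') \<omega>) = 0"
    by (rule ito_integral_comb_zero[where f = "\<lambda>_. f" and t = t]) (use assms in auto)
  then show ?thesis by eventually_elim simp
qed

end

section \<open>Approximation by simple integrands\<close>

text \<open>A measurable function is almost everywhere a limit of continuous ones. Clamping these at
  the bound \<open>M\<close> of the limit does not disturb the convergence and provides the
  domination needed later.\<close>

lemma real_clamp_continuous_approx:
  fixes g :: "real \<Rightarrow> real"
  assumes "g \<in> borel_measurable borel" and M: "\<And>x. \<bar>g x\<bar> \<le> M"
  obtains c where "\<And>n::nat. continuous_on UNIV (c n)" "\<And>n x. \<bar>c n x\<bar> \<le> M" "AE x in lborel. (\<lambda>n. c n x) \<longlonglongrightarrow> g x"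
proof -
  have "g \<in> borel_measurable (lebesgue_on UNIV)"
    using assms(1) by (simp add: borel_measurable_restrict_space_iff measurable_completion)
  then have "g measurable_on UNIV"
    by (subst measurable_on_iff_borel_measurable) auto
  then obtain N c where N: "negligible N" and c: "\<And>n::nat. continuous_on UNIV (c n)"
    and lim: "\<And>x. x \<notin> N \<Longrightarrow> (\<lambda>n. c n x) \<longlonglongrightarrow> g x"
    unfolding measurable_on_def by auto
  have "M \<ge> 0" using M[of 0] by linarith
  show thesis
  proof (rule that[of "\<lambda>n x. max (- M) (min M (c n x))"])
    show "continuous_on UNIV (\<lambda>x. max (- M) (min M (c n x)))" for n
      by (intro continuous_intros c)
    show "\<bar>max (- M) (min M (c n x))\<bar> \<le> M" for n x using \<open>M \<ge> 0\<close> by auto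
    have "(\<lambda>n. max (- M) (min M (c n x))) \<longlonglongrightarrow> g x" if "x \<notin> N" for x
    proof -
      have "(\<lambda>n. max (- M) (min M (c n x))) \<longlonglongrightarrow> max (- M) (min M (g x))"
        by (intro tendsto_intros lim that)
      then show ?thesis using M[of x] by (simp add: abs_le_iff max_def min_def split: if_splits)
    qed
    moreover have "AE x in lebesgue. x \<notin> N" using N by (simp add: AE_not_in negligible_iff_null_sets)
    ultimately have "AE x in lebesgue. (\<lambda>n. max (- M) (min M (c n x))) \<longlonglongrightarrow> g x" by auto
    then show "AE x in lborel. (\<lambda>n. max (- M) (min M (c n x))) \<longlonglongrightarrow> g x"
      by (simp add: AE_completion_iff)
  qed
qed

lemma nn_integral_lborel_shift:
  fixes f :: "real \<Rightarrow> ennreal"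
  assumes "f \<in> borel_measurable borel"
  shows "(\<integral>\<^sup>+x. f (x + h) \<partial>lborel) = (\<integral>\<^sup>+x. f x \<partial>lborel)"
  using nn_integral_real_affine[OF assms, of 1 h] by (simp add: add.commute)

text \<open>The shift is transferred to a continuous function, for which pointwise convergence and a
  bound on a compact interval are enough. The replacement error at the shifted argument reduces to
  the unshifted one, since Lebesgue measure is invariant under translation.\<close>

lemma L2_translation_continuous:
  fixes g :: "real \<Rightarrow> real"
  assumes g[measurable]: "g \<in> borel_measurable borel" and M: "\<And>x. \<bar>g x\<bar> \<le> M"
    and supp: "\<And>x. x \<notin> {0..T} \<Longrightarrow> g x = 0" and h: "h \<longlonglongrightarrow> 0"
  shows "(\<lambda>k::nat. \<integral>\<^sup>+r. ennreal ((g r - g (r + h k))\<^sup>2) \<partial>lborel) \<longlonglongrightarrow> 0"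
proof -
  obtain c where c: "\<And>n::nat. continuous_on UNIV (c n)" "\<And>n x. \<bar>c n x\<bar> \<le> M" "AE x in lborel. (\<lambda>n. c n x) \<longlonglongrightarrow> g x"
    using real_clamp_continuous_approx[OF g M] by blast
  have [measurable]: "c n \<in> borel_measurable borel" for n by (rule borel_measurable_continuous_onI[OF c(1)])
  \<comment> \<open>\<open>?B\<close> contains the support and its translates by at most 1;
    \<open>?B'\<close> in turn contains all translates of \<open>?B\<close> by at most 1.\<close>
  let ?B = "{-1..T+1}" and ?B' = "{-2..T+2}"
  have sq: "(x - y)\<^sup>2 \<le> (2 * M)\<^sup>2" if "\<bar>x\<bar> \<le> M" "\<bar>y\<bar> \<le> M" for x y :: real
    using that by (intro power2_le_iff_abs_le[THEN iffD2]) auto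
  define e where "e n = (\<integral>\<^sup>+r. ennreal ((indicator ?B' r * (g r - c n r))\<^sup>2) \<partial>lborel)" for n
  define d where "d n k = (\<integral>\<^sup>+r. ennreal ((indicator ?B r * (c n r - c n (r + h k)))\<^sup>2) \<partial>lborel)" for n k
  have fin: "(\<integral>\<^sup>+r. ennreal ((2 * M)\<^sup>2) * indicator {a..b} r \<partial>lborel) < \<infinity>" for a b :: real
    by (subst nn_integral_cmult_indicator) (auto simp: ennreal_mult_less_top emeasure_lborel_Icc_eq)
  have e: "e \<longlonglongrightarrow> 0"
  proof -
    have "e \<longlonglongrightarrow> (\<integral>\<^sup>+r. 0 \<partial>(lborel :: real measure))"
      unfolding e_def
    proof (rule nn_integral_dominated_convergence[where w = "\<lambda>r. ennreal ((2 * M)\<^sup>2) * indicator ?B' r"])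
      show "AE r in lborel. ennreal ((indicator ?B' r * (g r - c n r))\<^sup>2) \<le> ennreal ((2 * M)\<^sup>2) * indicator ?B' r" for n
        using sq M c(2) by (intro AE_I2) (auto simp: indicator_def intro!: ennreal_leI)
      show "AE r in lborel. (\<lambda>n. ennreal ((indicator ?B' r * (g r - c n r))\<^sup>2)) \<longlonglongrightarrow> 0"
        using c(3)
      proof eventually_elim
        case (elim r)
        have "(\<lambda>n. ennreal ((indicator ?B' r * (g r - c n r))\<^sup>2)) \<longlonglongrightarrow> ennreal ((indicator ?B' r * (g r - g r))\<^sup>2)"
          by (intro tendsto_intros elim)
        then show ?case by simp
      qed
    qed (use fin in auto)
    then show ?thesis by simp
  qed
  have d: "d n \<longlonglongrightarrow> 0" for n
  proof -
    have "d n \<longlonglongrightarrow> (\<integral>\<^sup>+r. 0 \<partial>(lborel :: real measure))"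
      unfolding d_def
    proof (rule nn_integral_dominated_convergence[where w = "\<lambda>r. ennreal ((2 * M)\<^sup>2) * indicator ?B r"])
      show "AE r in lborel. ennreal ((indicator ?B r * (c n r - c n (r + h k)))\<^sup>2) \<le> ennreal ((2 * M)\<^sup>2) * indicator ?B r" for k
        using sq c(2) by (intro AE_I2) (auto simp: indicator_def intro!: ennreal_leI)
      have "(\<lambda>k. ennreal ((indicator ?B r * (c n r - c n (r + h k)))\<^sup>2)) \<longlonglongrightarrow> 0" for r
      proof -
        have "(\<lambda>k. r + h k) \<longlonglongrightarrow> r + 0" by (intro tendsto_intros h)
        then have "(\<lambda>k. c n (r + h k)) \<longlonglongrightarrow> c n r"
          using c(1)[of n] by (intro isCont_tendsto_compose[of _ "c n"]) (auto simp: continuous_on_eq_continuous_at)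
        then have "(\<lambda>k. ennreal ((indicator ?B r * (c n r - c n (r + h k)))\<^sup>2)) \<longlonglongrightarrow> ennreal ((indicator ?B r * (c n r - c n r))\<^sup>2)"
          by (intro tendsto_intros)
        then show ?thesis by simp
      qed
      then show "AE r in lborel. (\<lambda>k. ennreal ((indicator ?B r * (c n r - c n (r + h k)))\<^sup>2)) \<longlonglongrightarrow> 0" by simp
    qed (use fin in auto)
    then show ?thesis by simp
  qed
  define S where "S k = (\<integral>\<^sup>+r. ennreal ((g r - g (r + h k))\<^sup>2) \<partial>lborel)" for k
  have ennreal_combine: "s \<le> 2 * x + 2 * (2 * z + 2 * x)"
    if "s \<le> 2 * u + 2 * v" "v \<le> 2 * y + 2 * w" "u \<le> x" "w \<le> x" "y = z" for s u v w x y z :: ennreal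
  proof -
    have "v \<le> 2 * z + 2 * x" using that by (auto intro!: order_trans[OF that(2)] add_mono mult_left_mono)
    then have "2 * u + 2 * v \<le> 2 * x + 2 * (2 * z + 2 * x)" using that by (intro add_mono mult_left_mono) auto
    then show ?thesis using that(1) by (rule order_trans[rotated])
  qed
  have le: "S k \<le> 2 * e n + 2 * (2 * d n k + 2 * e n)" if "\<bar>h k\<bar> \<le> 1" for n k
  proof -
    define u v w where "u r = indicator ?B r * (g r - c n r)" and "v r = indicator ?B r * (c n r - c n (r + h k))"
      and "w r = indicator ?B r * (c n (r + h k) - g (r + h k))" for r
    have [measurable]: "u \<in> borel_measurable lborel" "v \<in> borel_measurable lborel" "w \<in> borel_measurable lborel"
      unfolding u_def v_def w_def by measurable
    have "g r - g (r + h k) = u r + (v r + w r)" for r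
    proof (cases "r \<in> ?B")
      case False
      then have "r \<notin> {0..T}" "r + h k \<notin> {0..T}" using that by auto
      with False show ?thesis using supp by (simp add: u_def v_def w_def)
    qed (simp add: u_def v_def w_def)
    then have "S k \<le> 2 * (\<integral>\<^sup>+r. ennreal ((u r)\<^sup>2) \<partial>lborel) + 2 * (\<integral>\<^sup>+r. ennreal ((v r + w r)\<^sup>2) \<partial>lborel)"
      unfolding S_def by (simp only:) (rule nn_integral_sq_triangle, measurable)
    moreover have "(\<integral>\<^sup>+r. ennreal ((v r + w r)\<^sup>2) \<partial>lborel) \<le> 2 * (\<integral>\<^sup>+r. ennreal ((v r)\<^sup>2) \<partial>lborel) + 2 * (\<integral>\<^sup>+r. ennreal ((w r)\<^sup>2) \<partial>lborel)"
      by (rule nn_integral_sq_triangle) measurable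
    moreover have "(\<integral>\<^sup>+r. ennreal ((u r)\<^sup>2) \<partial>lborel) \<le> e n"
      unfolding e_def u_def by (rule nn_integral_mono) (auto simp: indicator_def)
    moreover have "(\<integral>\<^sup>+r. ennreal ((w r)\<^sup>2) \<partial>lborel) \<le> e n"
    proof -
      have "(\<integral>\<^sup>+r. ennreal ((w r)\<^sup>2) \<partial>lborel) \<le> (\<integral>\<^sup>+r. ennreal ((indicator ?B' (r + h k) * (g (r + h k) - c n (r + h k)))\<^sup>2) \<partial>lborel)"
        unfolding w_def using that by (intro nn_integral_mono) (auto simp: indicator_def power2_commute)
      also have "\<dots> = e n"
        unfolding e_def by (rule nn_integral_lborel_shift[where f = "\<lambda>r. ennreal ((indicator ?B' r * (g r - c n r))\<^sup>2)"]) measurable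
      finally show ?thesis .
    qed
    moreover have "(\<integral>\<^sup>+r. ennreal ((v r)\<^sup>2) \<partial>lborel) = d n k" by (simp add: d_def v_def)
    ultimately show ?thesis by (intro ennreal_combine)
  qed
  have "S \<longlonglongrightarrow> 0"
  proof (rule tendsto_zero_ennreal)
    fix \<epsilon> :: real assume "0 < \<epsilon>"
    \<comment> \<open>The bound \<open>le\<close> carries total weight ten, so errors below
      \<open>\<epsilon> / 20\<close> leave at most \<open>\<epsilon> / 2\<close>, which is strictly
      smaller than \<open>\<epsilon>\<close>.\<close>
    then have "0 < ennreal (\<epsilon> / 20)" by simp
    then obtain n where n: "e n < ennreal (\<epsilon> / 20)"
      using eventually_happens'[OF _ order_tendstoD(2)[OF e \<open>0 < ennreal (\<epsilon> / 20)\<close>]] by auto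
    have "\<forall>\<^sub>F k in sequentially. \<bar>h k\<bar> \<le> 1"
      using tendstoD[OF h, of 1] by (auto elim!: eventually_mono)
    moreover have "\<forall>\<^sub>F k in sequentially. d n k < ennreal (\<epsilon> / 20)"
      by (rule order_tendstoD(2)[OF d]) fact
    ultimately show "\<forall>\<^sub>F k in sequentially. S k < ennreal \<epsilon>"
    proof eventually_elim
      case (elim k)
      have "S k \<le> 2 * e n + 2 * (2 * d n k + 2 * e n)" by (rule le) fact
      also have "\<dots> \<le> 2 * ennreal (\<epsilon> / 20) + 2 * (2 * ennreal (\<epsilon> / 20) + 2 * ennreal (\<epsilon> / 20))"
        using n elim by (intro add_mono mult_left_mono) auto
      also have "\<dots> = ennreal (\<epsilon> / 2)"
        using \<open>0 < \<epsilon>\<close> by (simp add: ennreal_numeral[symmetric] ennreal_mult[symmetric] ennreal_plus[symmetric] del: ennreal_numeral ennreal_plus)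
      also have "\<dots> < ennreal \<epsilon>" using \<open>0 < \<epsilon>\<close> by (simp add: ennreal_less_iff)
      finally show ?case .
    qed
  qed
  then show ?thesis by (simp add: S_def[abs_def])
qed

lemma interval_partition_ex:
  fixes \<tau> :: "nat \<Rightarrow> real"
  shows "\<tau> 0 < r \<Longrightarrow> r \<le> \<tau> N \<Longrightarrow> \<exists>j<N. \<tau> j < r \<and> r \<le> \<tau> (Suc j)"
proof (induction N)
  case (Suc N)
  then show ?case by (cases "r \<le> \<tau> N") (auto simp: not_le intro: less_SucI)
qed simp

section \<open>Step approximation of bounded adapted processes\<close>

context wiener begin

lemma lborel_P: "pair_sigma_finite (lborel :: real measure) P"
  by unfold_locales

lemma sectionI:
  assumes "(\<lambda>(s, \<omega>). h s \<omega>) \<in> borel_measurable (borel \<Otimes>\<^sub>M P)" "\<omega> \<in> space P"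
  shows "(\<lambda>s. h s \<omega>) \<in> borel_measurable borel"
  using measurable_compose[OF measurable_Pair2'[OF assms(2)] assms(1)] by simp

lemma measurable_process_comp:
  assumes "(\<lambda>(s, \<omega>). h s \<omega>) \<in> borel_measurable (borel \<Otimes>\<^sub>M P)"
    and "a \<in> borel_measurable M" "c \<in> measurable M P"
  shows "(\<lambda>x. h (a x) (c x)) \<in> borel_measurable M"
  using measurable_compose[OF measurable_Pair[OF assms(2,3)] assms(1)] by simp

text \<open>Dominated convergence lifts translation continuity from single paths to the mean: the
  bound \<open>M\<close> and the support in \<open>{0..T}\<close> supply a constant as dominating
  function.\<close>

lemma translation_continuous_process:
  fixes g :: "real \<Rightarrow> 'w \<Rightarrow> real"
  assumes g[measurable]: "(\<lambda>(s, \<omega>). g s \<omega>) \<in> borel_measurable (borel \<Otimes>\<^sub>M P)"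
    and M: "\<And>s \<omega>. \<omega> \<in> space P \<Longrightarrow> \<bar>g s \<omega>\<bar> \<le> M"
    and supp: "\<And>s \<omega>. s \<notin> {0..T} \<Longrightarrow> g s \<omega> = 0"
  shows "((\<lambda>h. \<integral>\<^sup>+\<omega>. \<integral>\<^sup>+r. ennreal ((g r \<omega> - g (r + h) \<omega>)\<^sup>2) \<partial>lborel \<partial>P) \<longlongrightarrow> 0) (at 0)"
  unfolding LIMSEQ_SEQ_conv[symmetric]
proof safe
  fix h :: "nat \<Rightarrow> real" assume h: "h \<longlonglongrightarrow> 0"
  define c where "c = (\<integral>\<^sup>+r. ennreal (M\<^sup>2) * indicator {0..T} r \<partial>lborel)"
  have c: "c < \<infinity>" unfolding c_def
    by (subst nn_integral_cmult_indicator) (auto simp: ennreal_mult_less_top emeasure_lborel_Icc_eq)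
  have "(\<lambda>k. \<integral>\<^sup>+\<omega>. \<integral>\<^sup>+r. ennreal ((g r \<omega> - g (r + h k) \<omega>)\<^sup>2) \<partial>lborel \<partial>P) \<longlonglongrightarrow> (\<integral>\<^sup>+\<omega>. 0 \<partial>P)"
  proof (rule nn_integral_dominated_convergence[where w = "\<lambda>_. 2 * c + 2 * c"])
    show "(\<lambda>\<omega>. \<integral>\<^sup>+r. ennreal ((g r \<omega> - g (r + h k) \<omega>)\<^sup>2) \<partial>lborel) \<in> borel_measurable P" for k by measurable
    show "(\<integral>\<^sup>+\<omega>. 2 * c + 2 * c \<partial>P) < \<infinity>"
      using c by (simp add: emeasure_space_1 ennreal_mult_less_top)
    show "AE \<omega> in P. (\<integral>\<^sup>+r. ennreal ((g r \<omega> - g (r + h k) \<omega>)\<^sup>2) \<partial>lborel) \<le> 2 * c + 2 * c" for k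
    proof (rule AE_I2)
      fix \<omega> assume \<omega>: "\<omega> \<in> space P"
      note [measurable] = sectionI[OF g \<omega>]
      have le: "(\<integral>\<^sup>+r. ennreal ((g r \<omega>)\<^sup>2) \<partial>lborel) \<le> c"
        unfolding c_def using M[OF \<omega>] supp
        by (intro nn_integral_mono) (auto simp: indicator_def abs_le_square_iff[symmetric] intro!: ennreal_leI order_trans[OF _ abs_ge_self])
      have "(\<integral>\<^sup>+r. ennreal ((g r \<omega> + - g (r + h k) \<omega>)\<^sup>2) \<partial>lborel) \<le>
         2 * (\<integral>\<^sup>+r. ennreal ((g r \<omega>)\<^sup>2) \<partial>lborel) + 2 * (\<integral>\<^sup>+r. ennreal ((- g (r + h k) \<omega>)\<^sup>2) \<partial>lborel)"
        by (rule nn_integral_sq_triangle) measurable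
      also have "(\<integral>\<^sup>+r. ennreal ((- g (r + h k) \<omega>)\<^sup>2) \<partial>lborel) = (\<integral>\<^sup>+r. ennreal ((g r \<omega>)\<^sup>2) \<partial>lborel)"
        using nn_integral_lborel_shift[of "\<lambda>r. ennreal ((g r \<omega>)\<^sup>2)" "h k"] by simp
      also have "2 * (\<integral>\<^sup>+r. ennreal ((g r \<omega>)\<^sup>2) \<partial>lborel) + 2 * (\<integral>\<^sup>+r. ennreal ((g r \<omega>)\<^sup>2) \<partial>lborel) \<le> 2 * c + 2 * c"
        by (intro add_mono mult_left_mono le) auto
      finally show "(\<integral>\<^sup>+r. ennreal ((g r \<omega> - g (r + h k) \<omega>)\<^sup>2) \<partial>lborel) \<le> 2 * c + 2 * c" by simp
    qed
    show "AE \<omega> in P. (\<lambda>k. \<integral>\<^sup>+r. ennreal ((g r \<omega> - g (r + h k) \<omega>)\<^sup>2) \<partial>lborel) \<longlonglongrightarrow> 0"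
      by (intro AE_I2 L2_translation_continuous[OF sectionI[OF g] M supp h])
  qed auto
  then show "(\<lambda>k. \<integral>\<^sup>+\<omega>. \<integral>\<^sup>+r. ennreal ((g r \<omega> - g (r + h k) \<omega>)\<^sup>2) \<partial>lborel \<partial>P) \<longlonglongrightarrow> 0" by simp
qed

text \<open>The average over \<open>s \<in> (0,\<delta>)\<close> of the squared error committed by freezing \<open>g\<close> at the grid points
  \<open>s + j \<delta>\<close> is an average over \<open>h \<in> (0,\<delta>]\<close> of squared \<open>L\<^sup>2\<close>-distances from \<open>g\<close> to its translates by \<open>h\<close>.\<close>

lemma grid_average_le:
  fixes g :: "real \<Rightarrow> 'w \<Rightarrow> real"
  assumes g[measurable]: "(\<lambda>(s, \<omega>). g s \<omega>) \<in> borel_measurable (borel \<Otimes>\<^sub>M P)" and \<delta>: "0 < \<delta>"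
    and e: "\<And>h. 0 < h \<Longrightarrow> h \<le> \<delta> \<Longrightarrow> (\<integral>\<^sup>+\<omega>. \<integral>\<^sup>+r. ennreal ((g r \<omega> - g (r + h) \<omega>)\<^sup>2) \<partial>lborel \<partial>P) \<le> e"
  shows "(\<integral>\<^sup>+s. (\<Sum>j<N. \<integral>\<^sup>+\<omega>. \<integral>\<^sup>+h. indicator {0<..\<delta>} h * ennreal ((g (s + real j * \<delta>) \<omega> - g (s + real j * \<delta> + h) \<omega>)\<^sup>2) \<partial>lborel \<partial>P) *
      indicator {0<..<\<delta>} s \<partial>lborel) \<le> e * ennreal \<delta>"
proof -
  interpret L: pair_sigma_finite "lborel :: real measure" P by (rule lborel_P)
  define q where "q r h \<omega> = ennreal ((g r \<omega> - g (r + h) \<omega>)\<^sup>2)" for r h \<omega>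
  note [measurable (raw)] = measurable_process_comp[OF g]
  define A where "A j = {real j * \<delta><..<real j * \<delta> + \<delta>}" for j :: nat
  have [measurable]: "A j \<in> sets borel" for j by (simp add: A_def)
  have 1: "(\<integral>\<^sup>+s. (\<integral>\<^sup>+\<omega>. \<integral>\<^sup>+h. indicator {0<..\<delta>} h * q (s + real j * \<delta>) h \<omega> \<partial>lborel \<partial>P) * indicator {0<..<\<delta>} s \<partial>lborel) =
    (\<integral>\<^sup>+\<omega>. \<integral>\<^sup>+h. indicator {0<..\<delta>} h * (\<integral>\<^sup>+r. indicator (A j) r * q r h \<omega> \<partial>lborel) \<partial>lborel \<partial>P)" for j
  proof -
    have "(\<integral>\<^sup>+s. (\<integral>\<^sup>+\<omega>. \<integral>\<^sup>+h. indicator {0<..\<delta>} h * q (s + real j * \<delta>) h \<omega> \<partial>lborel \<partial>P) * indicator {0<..<\<delta>} s \<partial>lborel) =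
      (\<integral>\<^sup>+s. (\<integral>\<^sup>+\<omega>. (\<integral>\<^sup>+h. indicator {0<..\<delta>} h * q (s + real j * \<delta>) h \<omega> \<partial>lborel) * indicator {0<..<\<delta>} s \<partial>P) \<partial>lborel)"
      unfolding q_def by (intro nn_integral_cong nn_integral_multc[symmetric]) measurable
    also have "\<dots> = (\<integral>\<^sup>+\<omega>. (\<integral>\<^sup>+s. (\<integral>\<^sup>+h. indicator {0<..\<delta>} h * q (s + real j * \<delta>) h \<omega> \<partial>lborel) * indicator {0<..<\<delta>} s \<partial>lborel) \<partial>P)"
      unfolding q_def by (rule L.Fubini'[symmetric]) measurable
    also have "\<dots> = (\<integral>\<^sup>+\<omega>. (\<integral>\<^sup>+s. (\<integral>\<^sup>+h. indicator {0<..\<delta>} h * q (s + real j * \<delta>) h \<omega> * indicator {0<..<\<delta>} s \<partial>lborel) \<partial>lborel) \<partial>P)"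
      unfolding q_def by (intro nn_integral_cong nn_integral_multc[symmetric]) measurable
    also have "\<dots> = (\<integral>\<^sup>+\<omega>. (\<integral>\<^sup>+h. (\<integral>\<^sup>+s. indicator {0<..\<delta>} h * q (s + real j * \<delta>) h \<omega> * indicator {0<..<\<delta>} s \<partial>lborel) \<partial>lborel) \<partial>P)"
      unfolding q_def by (intro nn_integral_cong lborel_pair.Fubini') measurable
    also have "\<dots> = (\<integral>\<^sup>+\<omega>. \<integral>\<^sup>+h. indicator {0<..\<delta>} h * (\<integral>\<^sup>+r. indicator (A j) r * q r h \<omega> \<partial>lborel) \<partial>lborel \<partial>P)"
    proof (intro nn_integral_cong)
      fix \<omega> and h :: real assume [simp]: "\<omega> \<in> space P"
      define p where "p r = indicator (A j) r * q r h \<omega>" for r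
      have p[measurable]: "p \<in> borel_measurable borel" unfolding p_def q_def by measurable
      have "(\<integral>\<^sup>+s. indicator {0<..\<delta>} h * q (s + real j * \<delta>) h \<omega> * indicator {0<..<\<delta>} s \<partial>lborel) =
        (\<integral>\<^sup>+s. indicator {0<..\<delta>} h * p (s + real j * \<delta>) \<partial>lborel)"
        unfolding p_def by (intro nn_integral_cong) (auto simp: A_def indicator_def)
      also have "\<dots> = indicator {0<..\<delta>} h * (\<integral>\<^sup>+s. p (s + real j * \<delta>) \<partial>lborel)"
        by (rule nn_integral_cmult) measurable
      also have "(\<integral>\<^sup>+s. p (s + real j * \<delta>) \<partial>lborel) = (\<integral>\<^sup>+r. p r \<partial>lborel)"
        by (rule nn_integral_lborel_shift[OF p])
      finally show "(\<integral>\<^sup>+s. indicator {0<..\<delta>} h * q (s + real j * \<delta>) h \<omega> * indicator {0<..<\<delta>} s \<partial>lborel) =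
        indicator {0<..\<delta>} h * (\<integral>\<^sup>+r. indicator (A j) r * q r h \<omega> \<partial>lborel)" unfolding p_def .
    qed
    finally show ?thesis .
  qed
  \<comment> \<open>The cells \<open>A j\<close> are disjoint, so summing over the grid costs at
    most one integral over the whole line, however many cells there are.\<close>
  have disj: "(\<Sum>j<N. indicator (A j) r) \<le> (1::ennreal)" for r
  proof -
    have "disjoint_family A"
    proof (unfold disjoint_family_on_def, safe)
      fix i j x assume ij: "i \<noteq> j" "x \<in> A i" "x \<in> A j"
      then have "real i * \<delta> < (real j + 1) * \<delta>" "real j * \<delta> < (real i + 1) * \<delta>"
        by (auto simp: A_def algebra_simps)
      then have "real i < real j + 1" "real j < real i + 1" using \<delta> by simp_all
      then show "x \<in> {}" using ij(1) by linarith
    qed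
    then have "(\<Sum>j<N. indicator (A j) r) = (indicator (\<Union>j<N. A j) r :: ennreal)"
      by (subst indicator_UN_disjoint) (auto simp: disjoint_family_on_def)
    then show ?thesis by (simp add: indicator_def)
  qed
  have "(\<integral>\<^sup>+s. (\<Sum>j<N. \<integral>\<^sup>+\<omega>. \<integral>\<^sup>+h. indicator {0<..\<delta>} h * q (s + real j * \<delta>) h \<omega> \<partial>lborel \<partial>P) * indicator {0<..<\<delta>} s \<partial>lborel) =
    (\<integral>\<^sup>+s. (\<Sum>j<N. (\<integral>\<^sup>+\<omega>. \<integral>\<^sup>+h. indicator {0<..\<delta>} h * q (s + real j * \<delta>) h \<omega> \<partial>lborel \<partial>P) * indicator {0<..<\<delta>} s) \<partial>lborel)"
    by (simp only: sum_distrib_right)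
  also have "\<dots> = (\<Sum>j<N. \<integral>\<^sup>+\<omega>. \<integral>\<^sup>+h. indicator {0<..\<delta>} h * (\<integral>\<^sup>+r. indicator (A j) r * q r h \<omega> \<partial>lborel) \<partial>lborel \<partial>P)"
    unfolding 1[symmetric] unfolding q_def by (rule nn_integral_sum) measurable
  also have "\<dots> = (\<integral>\<^sup>+\<omega>. (\<Sum>j<N. \<integral>\<^sup>+h. indicator {0<..\<delta>} h * (\<integral>\<^sup>+r. indicator (A j) r * q r h \<omega> \<partial>lborel) \<partial>lborel) \<partial>P)"
    unfolding q_def by (rule nn_integral_sum[symmetric]) measurable
  also have "\<dots> = (\<integral>\<^sup>+\<omega>. (\<integral>\<^sup>+h. (\<Sum>j<N. indicator {0<..\<delta>} h * (\<integral>\<^sup>+r. indicator (A j) r * q r h \<omega> \<partial>lborel)) \<partial>lborel) \<partial>P)"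
    unfolding q_def by (intro nn_integral_cong nn_integral_sum[symmetric]) measurable
  also have "\<dots> \<le> (\<integral>\<^sup>+\<omega>. \<integral>\<^sup>+h. indicator {0<..\<delta>} h * (\<integral>\<^sup>+r. q r h \<omega> \<partial>lborel) \<partial>lborel \<partial>P)"
  proof (intro nn_integral_mono)
    fix \<omega> and h :: real assume "\<omega> \<in> space P"
    then have [measurable]: "(\<lambda>r. q r h \<omega>) \<in> borel_measurable borel" unfolding q_def by measurable
    have "(\<Sum>j<N. indicator {0<..\<delta>} h * (\<integral>\<^sup>+r. indicator (A j) r * q r h \<omega> \<partial>lborel)) =
      indicator {0<..\<delta>} h * (\<integral>\<^sup>+r. (\<Sum>j<N. indicator (A j) r) * q r h \<omega> \<partial>lborel)"
      unfolding sum_distrib_left[symmetric] sum_distrib_right by (subst nn_integral_sum) auto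
    also have "\<dots> \<le> indicator {0<..\<delta>} h * (\<integral>\<^sup>+r. 1 * q r h \<omega> \<partial>lborel)"
      by (intro mult_left_mono nn_integral_mono mult_right_mono disj) auto
    finally show "(\<Sum>j<N. indicator {0<..\<delta>} h * (\<integral>\<^sup>+r. indicator (A j) r * q r h \<omega> \<partial>lborel)) \<le>
      indicator {0<..\<delta>} h * (\<integral>\<^sup>+r. q r h \<omega> \<partial>lborel)" by simp
  qed
  also have "\<dots> = (\<integral>\<^sup>+h. \<integral>\<^sup>+\<omega>. indicator {0<..\<delta>} h * (\<integral>\<^sup>+r. q r h \<omega> \<partial>lborel) \<partial>P \<partial>lborel)"
    unfolding q_def by (rule L.Fubini') measurable
  also have "\<dots> = (\<integral>\<^sup>+h. indicator {0<..\<delta>} h * (\<integral>\<^sup>+\<omega>. \<integral>\<^sup>+r. q r h \<omega> \<partial>lborel \<partial>P) \<partial>lborel)"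
    unfolding q_def by (intro nn_integral_cong nn_integral_cmult) measurable
  also have "\<dots> \<le> (\<integral>\<^sup>+h. e * indicator {0<..\<delta>} h \<partial>lborel)"
    using e unfolding q_def by (intro nn_integral_mono) (auto simp: indicator_def)
  also have "\<dots> = e * ennreal \<delta>"
    using \<delta> by (subst nn_integral_cmult_indicator) auto
  finally show ?thesis by (simp only: q_def)
qed

text \<open>Freezing \<open>g\<close> at the left end of each cell keeps the step values adapted,
  but \<open>g\<close> has no continuity and a prescribed grid may consist of bad times. The error
  averaged over the offset \<open>s\<close> is small, so some shifted grid is good.\<close>

lemma bounded_simple_approx:
  fixes g :: "real \<Rightarrow> 'w \<Rightarrow> real"
  assumes g[measurable]: "(\<lambda>(s, \<omega>). g s \<omega>) \<in> borel_measurable (borel \<Otimes>\<^sub>M P)"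
    and M: "\<And>s \<omega>. \<omega> \<in> space P \<Longrightarrow> \<bar>g s \<omega>\<bar> \<le> M"
    and supp: "\<And>s \<omega>. s \<notin> {0..T} \<Longrightarrow> g s \<omega> = 0"
    and ad: "\<And>t. t \<in> {0..T} \<Longrightarrow> g t \<in> borel_measurable (F t)"
    and T: "0 < T" and \<epsilon>: "0 < \<epsilon>"
  shows "\<exists>N \<tau> \<xi>. simple_integrand P W T N \<tau> \<xi> \<and>
    (\<integral>\<^sup>+\<omega>. (\<integral>\<^sup>+s\<in>{0..T}. ennreal ((g s \<omega> - simple_process N \<tau> \<xi> s \<omega>)\<^sup>2) \<partial>lborel) \<partial>P) \<le> ennreal \<epsilon>"
proof -
  note [measurable (raw)] = measurable_process_comp[OF g]
  \<comment> \<open>Two thirds of \<open>\<epsilon>\<close> go to the grid error, bounded by twice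
    its average, and one third to the ends of \<open>{0..T}\<close> that the grid leaves
    uncovered.\<close>
  define e where "e = \<epsilon> / 3"
  have e: "0 < e" using \<epsilon> by (simp add: e_def)
  have "\<forall>\<^sub>F h in at 0. (\<integral>\<^sup>+\<omega>. \<integral>\<^sup>+r. ennreal ((g r \<omega> - g (r + h) \<omega>)\<^sup>2) \<partial>lborel \<partial>P) < ennreal e"
    by (rule order_tendstoD(2)[OF translation_continuous_process[OF g M supp]]) (use e in auto)
  then obtain \<eta> where \<eta>: "0 < \<eta>"
    "\<And>h. 0 < h \<Longrightarrow> h < \<eta> \<Longrightarrow> (\<integral>\<^sup>+\<omega>. \<integral>\<^sup>+r. ennreal ((g r \<omega> - g (r + h) \<omega>)\<^sup>2) \<partial>lborel \<partial>P) < ennreal e"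
    unfolding eventually_at by (auto simp: dist_real_def)
  \<comment> \<open>The first summand forces \<open>\<delta> < \<eta>\<close>, the second forces
    \<open>M\<^sup>2 * \<delta> \<le> e\<close>.\<close>
  obtain N where N: "real N > T / \<eta> + M\<^sup>2 * T / e"
    using reals_Archimedean2 by blast
  \<comment> \<open>The grid has one cell fewer than would fill \<open>{0..T}\<close>, so that it
    still ends before \<open>T\<close> after a shift by \<open>s < \<delta>\<close>.\<close>
  define n where "n = Suc N"
  define \<delta> where "\<delta> = T / n"
  have "0 \<le> T / \<eta>" "0 \<le> M\<^sup>2 * T / e" using T \<eta>(1) e by auto
  then have n: "real n > T / \<eta>" "real n > M\<^sup>2 * T / e" "n > 0"
    using N unfolding n_def of_nat_Suc by linarith+
  have \<delta>: "0 < \<delta>" "\<delta> < \<eta>" "M\<^sup>2 * \<delta> \<le> e" "real n * \<delta> = T"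
    using n T \<eta>(1) e by (auto simp: \<delta>_def field_simps)
  define Q where "Q s = (\<Sum>j<N. \<integral>\<^sup>+\<omega>. \<integral>\<^sup>+h. indicator {0<..\<delta>} h *
    ennreal ((g (s + real j * \<delta>) \<omega> - g (s + real j * \<delta> + h) \<omega>)\<^sup>2) \<partial>lborel \<partial>P)" for s
  have Q: "(\<integral>\<^sup>+s. Q s * indicator {0<..<\<delta>} s \<partial>lborel) \<le> ennreal e * ennreal \<delta>"
    unfolding Q_def by (rule grid_average_le[OF g \<delta>(1)]) (use \<eta>(2) \<delta>(2) in \<open>auto intro: less_imp_le\<close>)
  \<comment> \<open>If every offset had an error above \<open>2 * e\<close>, the integral over all
    offsets would exceed its bound \<open>e * \<delta>\<close>.\<close>
  have "\<exists>s\<in>{0<..<\<delta>}. Q s \<le> ennreal (2 * e)"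
  proof (rule ccontr)
    assume "\<not> ?thesis"
    then have "(\<integral>\<^sup>+s. ennreal (2 * e) * indicator {0<..<\<delta>} s \<partial>lborel) \<le> (\<integral>\<^sup>+s. Q s * indicator {0<..<\<delta>} s \<partial>lborel)"
      by (intro nn_integral_mono) (auto simp: indicator_def not_le less_imp_le)
    then have "ennreal (2 * e) * ennreal \<delta> \<le> ennreal e * ennreal \<delta>"
      using Q \<delta>(1) by (subst (asm) nn_integral_cmult_indicator) auto
    then show False using e \<delta>(1) by (simp add: ennreal_mult[symmetric])
  qed
  then obtain s where s: "0 < s" "s < \<delta>" "Q s \<le> ennreal (2 * e)" by auto
  define \<tau> where "\<tau> j = s + real j * \<delta>" for j
  define \<xi> where "\<xi> j = g (\<tau> j)" for j
  have \<tau>N: "\<tau> N = s + T - \<delta>" using \<delta>(4) by (simp add: \<tau>_def n_def algebra_simps)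
  have \<tau>Suc: "\<tau> (Suc j) = \<tau> j + \<delta>" for j by (simp add: \<tau>_def algebra_simps)
  have \<tau>0: "\<tau> 0 = s" by (simp add: \<tau>_def)
  have \<tau>le: "\<tau> i \<le> \<tau> j" if "i \<le> j" for i j using that \<delta>(1) by (simp add: \<tau>_def)
  have \<tau>T: "0 \<le> \<tau> j" "\<tau> j \<le> T" if "j \<le> N" for j
    using \<tau>le[of 0 j] \<tau>le[OF that] s \<tau>N \<tau>0 by linarith+
  have simple: "simple_integrand P W T N \<tau> \<xi>"
    unfolding simple_integrand_def \<xi>_def
    using \<tau>T s \<delta>(1) \<tau>Suc M by (auto intro!: ad exI[of _ M])
  have \<phi>: "simple_process N \<tau> \<xi> r \<omega> = \<xi> j \<omega>" if "j < N" "\<tau> j < r" "r \<le> \<tau> (Suc j)" for r j \<omega>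
  proof -
    have "\<xi> i \<omega> * indicator {\<tau> i<..\<tau> (Suc i)} r = (if i = j then \<xi> j \<omega> else 0)" for i
    proof (cases i j rule: linorder_cases)
      case less
      then show ?thesis using \<tau>le[of "Suc i" j] that by (auto simp: indicator_def)
    next
      case greater
      then show ?thesis using \<tau>le[of "Suc j" i] that by (auto simp: indicator_def)
    qed (use that in \<open>auto simp: indicator_def\<close>)
    then show ?thesis using that(1) unfolding simple_process_def by (simp add: sum.delta)
  qed
  have \<phi>0: "simple_process N \<tau> \<xi> r \<omega> = 0" if "\<And>j. j < N \<Longrightarrow> \<not> (\<tau> j < r \<and> r \<le> \<tau> (Suc j))" for r \<omega>
    unfolding simple_process_def using that by (intro sum.neutral) (auto simp: indicator_def)
  \<comment> \<open>No step covers \<open>?R\<close>: there the approximant is 0 and the squared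
    error at most \<open>M\<^sup>2\<close>, and the two pieces have total length
    \<open>\<delta>\<close>.\<close>
  let ?R = "{0..s} \<union> {\<tau> N<..T}"
  have pw: "ennreal ((g r \<omega> - simple_process N \<tau> \<xi> r \<omega>)\<^sup>2) * indicator {0..T} r \<le>
      (\<Sum>j<N. indicator {\<tau> j<..\<tau> (Suc j)} r * ennreal ((g (\<tau> j) \<omega> - g r \<omega>)\<^sup>2)) + ennreal (M\<^sup>2) * indicator ?R r"
    if "\<omega> \<in> space P" for r \<omega>
  proof (cases "\<exists>j<N. \<tau> j < r \<and> r \<le> \<tau> (Suc j)")
    case True
    then obtain j where j: "j < N" "\<tau> j < r" "r \<le> \<tau> (Suc j)" by blast
    have "ennreal ((g r \<omega> - simple_process N \<tau> \<xi> r \<omega>)\<^sup>2) * indicator {0..T} r \<le>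
      indicator {\<tau> j<..\<tau> (Suc j)} r * ennreal ((g (\<tau> j) \<omega> - g r \<omega>)\<^sup>2)"
      using j \<phi>[OF j] by (auto simp: indicator_def \<xi>_def power2_commute)
    also have "\<dots> \<le> (\<Sum>j<N. indicator {\<tau> j<..\<tau> (Suc j)} r * ennreal ((g (\<tau> j) \<omega> - g r \<omega>)\<^sup>2))"
      by (rule member_le_sum) (use j in auto)
    finally show ?thesis by (rule order_trans) simp
  next
    case False
    then have 0: "simple_process N \<tau> \<xi> r \<omega> = 0" by (intro \<phi>0) blast
    have "indicator {0..T} r \<le> (indicator ?R r :: ennreal)"
      using False interval_partition_ex[of \<tau> r N, unfolded \<tau>0] by (cases "s < r"; cases "r \<le> \<tau> N") (auto simp: indicator_def not_less)
    moreover have "ennreal ((g r \<omega>)\<^sup>2) \<le> ennreal (M\<^sup>2)"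
      using M[OF that, of r] by (intro ennreal_leI) (simp add: abs_le_square_iff[symmetric] order_trans[OF _ abs_ge_self])
    ultimately have "ennreal ((g r \<omega>)\<^sup>2) * indicator {0..T} r \<le> ennreal (M\<^sup>2) * indicator ?R r"
      by (intro mult_mono) auto
    then show ?thesis unfolding 0 by (simp add: add_increasing)
  qed
  have R: "emeasure lborel ?R \<le> ennreal \<delta>"
  proof -
    have "emeasure lborel ?R \<le> emeasure lborel {0..s} + emeasure lborel {\<tau> N<..T}"
      by (rule emeasure_subadditive) auto
    also have "\<dots> = ennreal s + ennreal (T - \<tau> N)" using s \<tau>T[of N] by simp
    also have "\<dots> = ennreal \<delta>" using s \<tau>N by (subst ennreal_plus[symmetric]) auto
    finally show ?thesis .
  qed
  have shift: "(\<integral>\<^sup>+r. indicator {\<tau> j<..\<tau> (Suc j)} r * ennreal ((g (\<tau> j) \<omega> - g r \<omega>)\<^sup>2) \<partial>lborel) =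
    (\<integral>\<^sup>+h. indicator {0<..\<delta>} h * ennreal ((g (s + real j * \<delta>) \<omega> - g (s + real j * \<delta> + h) \<omega>)\<^sup>2) \<partial>lborel)"
    if [simp]: "\<omega> \<in> space P" for j \<omega>
  proof -
    have "(\<integral>\<^sup>+r. indicator {\<tau> j<..\<tau> (Suc j)} r * ennreal ((g (\<tau> j) \<omega> - g r \<omega>)\<^sup>2) \<partial>lborel) =
      (\<integral>\<^sup>+h. indicator {\<tau> j<..\<tau> (Suc j)} (h + \<tau> j) * ennreal ((g (\<tau> j) \<omega> - g (h + \<tau> j) \<omega>)\<^sup>2) \<partial>lborel)"
      by (rule nn_integral_lborel_shift[symmetric]) measurable
    also have "\<dots> = (\<integral>\<^sup>+h. indicator {0<..\<delta>} h * ennreal ((g (s + real j * \<delta>) \<omega> - g (s + real j * \<delta> + h) \<omega>)\<^sup>2) \<partial>lborel)"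
      unfolding \<tau>Suc by (intro nn_integral_cong) (auto simp: indicator_def \<tau>_def add.commute)
    finally show ?thesis .
  qed
  have "(\<integral>\<^sup>+\<omega>. (\<integral>\<^sup>+s\<in>{0..T}. ennreal ((g s \<omega> - simple_process N \<tau> \<xi> s \<omega>)\<^sup>2) \<partial>lborel) \<partial>P) \<le>
    (\<integral>\<^sup>+\<omega>. (\<Sum>j<N. \<integral>\<^sup>+h. indicator {0<..\<delta>} h *
    ennreal ((g (s + real j * \<delta>) \<omega> - g (s + real j * \<delta> + h) \<omega>)\<^sup>2) \<partial>lborel) + ennreal (M\<^sup>2) * ennreal \<delta> \<partial>P)"
  proof (rule nn_integral_mono)
    fix \<omega> assume \<omega>[simp]: "\<omega> \<in> space P"
    have "(\<integral>\<^sup>+s\<in>{0..T}. ennreal ((g s \<omega> - simple_process N \<tau> \<xi> s \<omega>)\<^sup>2) \<partial>lborel) \<le>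
       (\<integral>\<^sup>+r. (\<Sum>j<N. indicator {\<tau> j<..\<tau> (Suc j)} r * ennreal ((g (\<tau> j) \<omega> - g r \<omega>)\<^sup>2)) + ennreal (M\<^sup>2) * indicator ?R r \<partial>lborel)"
      by (intro nn_integral_mono pw \<omega>)
    also have "\<dots> = (\<integral>\<^sup>+r. (\<Sum>j<N. indicator {\<tau> j<..\<tau> (Suc j)} r * ennreal ((g (\<tau> j) \<omega> - g r \<omega>)\<^sup>2)) \<partial>lborel) +
       (\<integral>\<^sup>+r. ennreal (M\<^sup>2) * indicator ?R r \<partial>lborel)"
      by (rule nn_integral_add) measurable
    also have "(\<integral>\<^sup>+r. (\<Sum>j<N. indicator {\<tau> j<..\<tau> (Suc j)} r * ennreal ((g (\<tau> j) \<omega> - g r \<omega>)\<^sup>2)) \<partial>lborel) =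
       (\<Sum>j<N. \<integral>\<^sup>+r. indicator {\<tau> j<..\<tau> (Suc j)} r * ennreal ((g (\<tau> j) \<omega> - g r \<omega>)\<^sup>2) \<partial>lborel)"
      by (rule nn_integral_sum) measurable
    also have "(\<integral>\<^sup>+r. ennreal (M\<^sup>2) * indicator ?R r \<partial>lborel) = ennreal (M\<^sup>2) * emeasure lborel ?R"
      by (rule nn_integral_cmult_indicator) simp
    finally show "(\<integral>\<^sup>+s\<in>{0..T}. ennreal ((g s \<omega> - simple_process N \<tau> \<xi> s \<omega>)\<^sup>2) \<partial>lborel) \<le>
      (\<Sum>j<N. \<integral>\<^sup>+h. indicator {0<..\<delta>} h *
        ennreal ((g (s + real j * \<delta>) \<omega> - g (s + real j * \<delta> + h) \<omega>)\<^sup>2) \<partial>lborel) + ennreal (M\<^sup>2) * ennreal \<delta>"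
      unfolding shift[OF \<omega>] by (rule order_trans) (intro add_mono mult_left_mono R order_refl, simp)
  qed
  also have "\<dots> = Q s + ennreal (M\<^sup>2) * ennreal \<delta>"
  proof -
    have "(\<integral>\<^sup>+\<omega>. (\<Sum>j<N. \<integral>\<^sup>+h. indicator {0<..\<delta>} h *
        ennreal ((g (s + real j * \<delta>) \<omega> - g (s + real j * \<delta> + h) \<omega>)\<^sup>2) \<partial>lborel) + ennreal (M\<^sup>2) * ennreal \<delta> \<partial>P) =
      (\<integral>\<^sup>+\<omega>. (\<Sum>j<N. \<integral>\<^sup>+h. indicator {0<..\<delta>} h *
        ennreal ((g (s + real j * \<delta>) \<omega> - g (s + real j * \<delta> + h) \<omega>)\<^sup>2) \<partial>lborel) \<partial>P) + (\<integral>\<^sup>+\<omega>. ennreal (M\<^sup>2) * ennreal \<delta> \<partial>P)"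
      by (rule nn_integral_add) measurable
    also have "(\<integral>\<^sup>+\<omega>. (\<Sum>j<N. \<integral>\<^sup>+h. indicator {0<..\<delta>} h *
        ennreal ((g (s + real j * \<delta>) \<omega> - g (s + real j * \<delta> + h) \<omega>)\<^sup>2) \<partial>lborel) \<partial>P) = Q s"
      unfolding Q_def by (rule nn_integral_sum) measurable
    finally show ?thesis by (simp add: emeasure_space_1)
  qed
  also have "\<dots> \<le> ennreal (2 * e) + ennreal e"
    using s(3) \<delta>(1,3) by (intro add_mono) (auto simp: ennreal_mult[symmetric] intro!: ennreal_leI)
  also have "\<dots> = ennreal \<epsilon>" using e by (simp add: e_def ennreal_plus[symmetric] del: ennreal_plus)
  finally show ?thesis using simple by blast
qed

end

text \<open>A geometric rate makes the sum of the squared errors finite in mean and therefore almost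
  surely, so the whole sequence converges and no subsequence has to be chosen.\<close>

lemma fast_L2_convergence_AE:
  fixes X :: "nat \<Rightarrow> 'b \<Rightarrow> real"
  assumes [measurable]: "\<And>k. X k \<in> borel_measurable M" "Y \<in> borel_measurable M"
    and le: "\<And>k. (\<integral>\<^sup>+x. ennreal ((X k x - Y x)\<^sup>2) \<partial>M) \<le> ennreal (C * (1 / 4) ^ k)" and C: "0 \<le> C"
  shows "AE x in M. (\<lambda>k. X k x) \<longlonglongrightarrow> Y x"
proof -
  have "(\<integral>\<^sup>+x. (\<Sum>k. ennreal ((X k x - Y x)\<^sup>2)) \<partial>M) = (\<Sum>k. \<integral>\<^sup>+x. ennreal ((X k x - Y x)\<^sup>2) \<partial>M)"
    by (rule nn_integral_suminf) measurable
  also have "\<dots> \<le> (\<Sum>k. ennreal (C * (1 / 4) ^ k))"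
    by (rule suminf_le) (use le in auto)
  also have "\<dots> < \<infinity>"
    using C by (subst suminf_ennreal2) (auto intro: summable_mult summable_geometric)
  finally have "AE x in M. (\<Sum>k. ennreal ((X k x - Y x)\<^sup>2)) \<noteq> \<infinity>"
    by (intro nn_integral_PInf_AE) auto
  then show ?thesis
  proof eventually_elim
    case (elim x)
    then have "summable (\<lambda>k. (X k x - Y x)\<^sup>2)"
      by (intro summable_suminf_not_top) (auto simp: top.not_eq_extremum)
    then have "(\<lambda>k. (X k x - Y x)\<^sup>2) \<longlonglongrightarrow> 0" by (rule summable_LIMSEQ_zero)
    then have "(\<lambda>k. sqrt ((X k x - Y x)\<^sup>2)) \<longlonglongrightarrow> sqrt 0" by (rule tendsto_real_sqrt)
    then have "(\<lambda>k. X k x - Y x) \<longlonglongrightarrow> 0" by (simp add: tendsto_rabs_zero_iff)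
    then show ?case by (rule LIM_zero_cancel)
  qed
qed

lemma fast_L2_Cauchy_AE:
  fixes X :: "nat \<Rightarrow> 'b \<Rightarrow> real"
  assumes "prob_space M" and [measurable]: "\<And>k. X k \<in> borel_measurable M"
    and le: "\<And>k. (\<integral>\<^sup>+x. ennreal ((X (Suc k) x - X k x)\<^sup>2) \<partial>M) \<le> ennreal (C * (1 / 4) ^ k)" and C: "0 \<le> C"
  shows "AE x in M. convergent (\<lambda>k. X k x)"
proof -
  interpret prob_space M by fact
  have le1: "(\<integral>\<^sup>+x. ennreal \<bar>X (Suc k) x - X k x\<bar> \<partial>M) \<le> ennreal ((C + 1) * (1 / 2) ^ k)" for k
  proof -
    have "(\<integral>\<^sup>+x. ennreal \<bar>X (Suc k) x - X k x\<bar> \<partial>M) \<le> (\<integral>\<^sup>+x. ennreal (2 ^ k) * ennreal ((X (Suc k) x - X k x)\<^sup>2) + ennreal ((1 / 2) ^ k) \<partial>M)"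
    proof (rule nn_integral_mono)
      fix x
      define d where "d = \<bar>X (Suc k) x - X k x\<bar>"
      \<comment> \<open>The inequality \<open>d \<le> c * d\<^sup>2 + 1 / c\<close> turns a second
        moment of order \<open>(1 / 4) ^ k\<close> into a first moment of order
        \<open>(1 / 2) ^ k\<close>; this weight balances the two terms.\<close>
      define c where "c = (2::real) ^ k"
      have c: "c > 0" by (simp add: c_def)
      have "0 \<le> (c * d - 1)\<^sup>2" by simp
      then have "2 * (c * d) \<le> (c * d)\<^sup>2 + 1" by (simp add: power2_diff)
      moreover have "0 \<le> c * d" using c by (simp add: d_def)
      ultimately have "c * d \<le> (c * d)\<^sup>2 + 1" by linarith
      then have "d \<le> c * d\<^sup>2 + 1 / c" using c by (simp add: field_simps power2_eq_square)
      then have "\<bar>X (Suc k) x - X k x\<bar> \<le> 2 ^ k * (X (Suc k) x - X k x)\<^sup>2 + (1 / 2) ^ k"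
        by (simp add: c_def d_def power_one_over)
      then have "ennreal \<bar>X (Suc k) x - X k x\<bar> \<le> ennreal (2 ^ k * (X (Suc k) x - X k x)\<^sup>2 + (1 / 2) ^ k)" by (rule ennreal_leI)
      then show "ennreal \<bar>X (Suc k) x - X k x\<bar> \<le> ennreal (2 ^ k) * ennreal ((X (Suc k) x - X k x)\<^sup>2) + ennreal ((1 / 2) ^ k)"
        by (simp add: ennreal_mult)
    qed
    also have "\<dots> = ennreal (2 ^ k) * (\<integral>\<^sup>+x. ennreal ((X (Suc k) x - X k x)\<^sup>2) \<partial>M) + ennreal ((1 / 2) ^ k)"
      by (simp add: nn_integral_add nn_integral_cmult emeasure_space_1)
    also have "\<dots> \<le> ennreal (2 ^ k) * ennreal (C * (1 / 4) ^ k) + ennreal ((1 / 2) ^ k)"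
      by (intro add_mono mult_left_mono le) auto
    also have "\<dots> = ennreal ((C + 1) * (1 / 2) ^ k)"
    proof -
      have "(2::real) ^ k * (C * (1 / 4) ^ k) = C * (1 / 2) ^ k"
        by (simp add: power_mult_distrib[symmetric])
      then show ?thesis using C by (simp add: ennreal_mult[symmetric] ennreal_plus[symmetric] distrib_right del: ennreal_plus)
    qed
    finally show ?thesis .
  qed
  have "(\<integral>\<^sup>+x. (\<Sum>k. ennreal \<bar>X (Suc k) x - X k x\<bar>) \<partial>M) = (\<Sum>k. \<integral>\<^sup>+x. ennreal \<bar>X (Suc k) x - X k x\<bar> \<partial>M)"
    by (rule nn_integral_suminf) measurable
  also have "\<dots> \<le> (\<Sum>k. ennreal ((C + 1) * (1 / 2) ^ k))"
    by (rule suminf_le) (use le1 in auto)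
  also have "\<dots> < \<infinity>"
    using C by (subst suminf_ennreal2) (auto intro: summable_mult summable_geometric)
  finally have "AE x in M. (\<Sum>k. ennreal \<bar>X (Suc k) x - X k x\<bar>) \<noteq> \<infinity>"
    by (intro nn_integral_PInf_AE) auto
  then show ?thesis
  proof eventually_elim
    case (elim x)
    then have "summable (\<lambda>k. \<bar>X (Suc k) x - X k x\<bar>)"
      by (intro summable_suminf_not_top) (auto simp: top.not_eq_extremum)
    then have "summable (\<lambda>k. X (Suc k) x - X k x)" by (rule summable_rabs_cancel)
    then have "convergent (\<lambda>n. \<Sum>k<n. X (Suc k) x - X k x)" by (simp add: summable_iff_convergent)
    moreover have "(\<lambda>n. \<Sum>k<n. X (Suc k) x - X k x) = (\<lambda>n. X n x - X 0 x)"
      by (rule ext) (rule sum_lessThan_telescope)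
    ultimately have "convergent (\<lambda>n. X n x - X 0 x)" by simp
    then have "convergent (\<lambda>n. (X n x - X 0 x) + X 0 x)" by (intro convergent_add convergent_const)
    then show ?case by simp
  qed
qed

section \<open>Square integrable integrands, and a jointly measurable Brownian motion\<close>

context wiener begin

lemma nn_integral_pair_P:
  fixes f :: "real \<Rightarrow> 'w \<Rightarrow> ennreal"
  assumes "(\<lambda>(s, \<omega>). f s \<omega>) \<in> borel_measurable (borel \<Otimes>\<^sub>M P)"
  shows "(\<integral>\<^sup>+\<omega>. \<integral>\<^sup>+s. f s \<omega> \<partial>lborel \<partial>P) = (\<integral>\<^sup>+x. (case x of (s, \<omega>) \<Rightarrow> f s \<omega>) \<partial>(lborel \<Otimes>\<^sub>M P))"
proof -
  interpret L: pair_sigma_finite "lborel :: real measure" P by (rule lborel_P)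
  show ?thesis using L.nn_integral_snd[of "\<lambda>(s, \<omega>). f s \<omega>"] assms by simp
qed

text \<open>Truncation at a large level \<open>M\<close> is close to \<open>f\<close> by dominated
  convergence, and it is bounded and still adapted, which reduces the claim to the bounded
  case.\<close>

lemma simple_approx:
  assumes f: "adapted_process P W T f" and T: "0 < T" and \<epsilon>: "0 < \<epsilon>"
    and L2: "(\<integral>\<^sup>+\<omega>. (\<integral>\<^sup>+s\<in>{0..T}. ennreal ((f s \<omega>)\<^sup>2) \<partial>lborel) \<partial>P) < \<infinity>"
  shows "\<exists>N \<tau> \<xi>. simple_integrand P W T N \<tau> \<xi> \<and>
    (\<integral>\<^sup>+\<omega>. (\<integral>\<^sup>+s\<in>{0..T}. ennreal ((f s \<omega> - simple_process N \<tau> \<xi> s \<omega>)\<^sup>2) \<partial>lborel) \<partial>P) \<le> ennreal \<epsilon>"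
proof -
  define f0 where "f0 s \<omega> = indicator {0..T} s * f s \<omega>" for s \<omega>
  have f0[measurable]: "(\<lambda>(s, \<omega>). f0 s \<omega>) \<in> borel_measurable (borel \<Otimes>\<^sub>M P)"
    unfolding f0_def by (rule measurable_zero_extension) (use f in \<open>simp add: adapted_process_def\<close>)
  define g where "g M s \<omega> = max (- real M) (min (real M) (f0 s \<omega>))" for M :: nat and s \<omega>
  have g[measurable]: "(\<lambda>(s, \<omega>). g M s \<omega>) \<in> borel_measurable (borel \<Otimes>\<^sub>M P)" for M
    unfolding g_def by measurable
  have dist_eq: "(\<integral>\<^sup>+\<omega>. \<integral>\<^sup>+s. ennreal ((f0 s \<omega> - g M s \<omega>)\<^sup>2) \<partial>lborel \<partial>P) =
    (\<integral>\<^sup>+x. (case x of (s, \<omega>) \<Rightarrow> ennreal ((f0 s \<omega> - g M s \<omega>)\<^sup>2)) \<partial>(lborel \<Otimes>\<^sub>M P))" for M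
    by (rule nn_integral_pair_P) measurable
  have "(\<lambda>M. \<integral>\<^sup>+x. (case x of (s, \<omega>) \<Rightarrow> ennreal ((f0 s \<omega> - g M s \<omega>)\<^sup>2)) \<partial>(lborel \<Otimes>\<^sub>M P)) \<longlonglongrightarrow> (\<integral>\<^sup>+x. 0 \<partial>((lborel :: real measure) \<Otimes>\<^sub>M P))"
  proof (rule nn_integral_dominated_convergence[where w = "\<lambda>(s, \<omega>). ennreal ((f0 s \<omega>)\<^sup>2)"
      and u = "\<lambda>M (s, \<omega>). ennreal ((f0 s \<omega> - g M s \<omega>)\<^sup>2)" and u' = "\<lambda>_. 0"])
    have "(\<integral>\<^sup>+\<omega>. \<integral>\<^sup>+s. ennreal ((f0 s \<omega>)\<^sup>2) \<partial>lborel \<partial>P) < \<infinity>"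
      using L2 unfolding set_nn_integral_sq_eq f0_def .
    then show "(\<integral>\<^sup>+x. (case x of (s, \<omega>) \<Rightarrow> ennreal ((f0 s \<omega>)\<^sup>2)) \<partial>(lborel \<Otimes>\<^sub>M P)) < \<infinity>"
      by (subst (asm) nn_integral_pair_P) measurable
    have "(y - max (- real M) (min (real M) y))\<^sup>2 \<le> y\<^sup>2" for y M
      by (intro abs_le_square_iff[THEN iffD1]) (auto simp: max_def min_def abs_if)
    then show "AE x in lborel \<Otimes>\<^sub>M P. (case x of (s, \<omega>) \<Rightarrow> ennreal ((f0 s \<omega> - g M s \<omega>)\<^sup>2)) \<le> (case x of (s, \<omega>) \<Rightarrow> ennreal ((f0 s \<omega>)\<^sup>2))" for M
      unfolding g_def by (intro AE_I2) (auto intro!: ennreal_leI)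
    have "(\<lambda>M. ennreal ((y - max (- real M) (min (real M) y))\<^sup>2)) \<longlonglongrightarrow> 0" for y :: real
    proof (rule tendsto_eventually)
      obtain M0 :: nat where "\<bar>y\<bar> \<le> real M0" using real_arch_simple by blast
      then show "\<forall>\<^sub>F M in sequentially. ennreal ((y - max (- real M) (min (real M) y))\<^sup>2) = 0"
        by (intro eventually_sequentiallyI[of M0]) (auto simp: max_def min_def abs_if split: if_splits)
    qed
    then show "AE x in lborel \<Otimes>\<^sub>M P. (\<lambda>M. case x of (s, \<omega>) \<Rightarrow> ennreal ((f0 s \<omega> - g M s \<omega>)\<^sup>2)) \<longlonglongrightarrow> 0"
      unfolding g_def by (intro AE_I2) auto
  qed auto
  \<comment> \<open>The triangle inequality for squares doubles each of the two errors, hence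
    \<open>\<epsilon> / 4\<close> for both.\<close>
  then have "\<forall>\<^sub>F M in sequentially. (\<integral>\<^sup>+\<omega>. \<integral>\<^sup>+s. ennreal ((f0 s \<omega> - g M s \<omega>)\<^sup>2) \<partial>lborel \<partial>P) < ennreal (\<epsilon> / 4)"
    unfolding dist_eq using \<epsilon> by (intro order_tendstoD(2)[of _ 0]) auto
  from eventually_happens'[OF sequentially_bot this]
  obtain M where M: "(\<integral>\<^sup>+\<omega>. \<integral>\<^sup>+s. ennreal ((f0 s \<omega> - g M s \<omega>)\<^sup>2) \<partial>lborel \<partial>P) < ennreal (\<epsilon> / 4)" ..
  have "\<exists>N \<tau> \<xi>. simple_integrand P W T N \<tau> \<xi> \<and>
    (\<integral>\<^sup>+\<omega>. (\<integral>\<^sup>+s\<in>{0..T}. ennreal ((g M s \<omega> - simple_process N \<tau> \<xi> s \<omega>)\<^sup>2) \<partial>lborel) \<partial>P) \<le> ennreal (\<epsilon> / 4)"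
  proof (rule bounded_simple_approx[OF g])
    show "g M t \<in> borel_measurable (F t)" if "t \<in> {0..T}" for t
    proof -
      have "f t \<in> borel_measurable (F t)" using f that by (simp add: adapted_process_def)
      then show ?thesis unfolding g_def f0_def by measurable
    qed
    show "\<bar>g M s \<omega>\<bar> \<le> real M" for s \<omega> by (auto simp: g_def)
    show "g M s \<omega> = 0" if "s \<notin> {0..T}" for s \<omega> using that by (simp add: g_def f0_def)
  qed (use T \<epsilon> in auto)
  then obtain N \<tau> \<xi> where S: "simple_integrand P W T N \<tau> \<xi>"
    and le: "(\<integral>\<^sup>+\<omega>. (\<integral>\<^sup>+s\<in>{0..T}. ennreal ((g M s \<omega> - simple_process N \<tau> \<xi> s \<omega>)\<^sup>2) \<partial>lborel) \<partial>P) \<le> ennreal (\<epsilon> / 4)"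
    by blast
  let ?\<phi> = "simple_process N \<tau> \<xi>"
  have \<phi>[measurable]: "(\<lambda>(s, \<omega>). ?\<phi> s \<omega>) \<in> borel_measurable (borel \<Otimes>\<^sub>M P)"
    by (rule elem_measurable[OF simple_elem[OF S]])
  have "(\<integral>\<^sup>+\<omega>. (\<integral>\<^sup>+s\<in>{0..T}. ennreal ((f s \<omega> - ?\<phi> s \<omega>)\<^sup>2) \<partial>lborel) \<partial>P) =
    (\<integral>\<^sup>+\<omega>. \<integral>\<^sup>+s. ennreal (((f0 s \<omega> - g M s \<omega>) + indicator {0..T} s * (g M s \<omega> - ?\<phi> s \<omega>))\<^sup>2) \<partial>lborel \<partial>P)"
    by (intro nn_integral_cong) (auto simp: f0_def g_def indicator_def)
  also have "\<dots> \<le> 2 * (\<integral>\<^sup>+\<omega>. \<integral>\<^sup>+s. ennreal ((f0 s \<omega> - g M s \<omega>)\<^sup>2) \<partial>lborel \<partial>P) +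
     2 * (\<integral>\<^sup>+\<omega>. \<integral>\<^sup>+s. ennreal ((indicator {0..T} s * (g M s \<omega> - ?\<phi> s \<omega>))\<^sup>2) \<partial>lborel \<partial>P)"
    by (rule nn2_triangle) measurable
  also have "\<dots> \<le> 2 * ennreal (\<epsilon> / 4) + 2 * ennreal (\<epsilon> / 4)"
    using M le unfolding set_nn_integral_sq_eq by (intro add_mono mult_left_mono) auto
  also have "\<dots> = ennreal \<epsilon>"
    using \<epsilon> by (simp add: ennreal_numeral[symmetric] ennreal_mult[symmetric] ennreal_plus[symmetric] del: ennreal_numeral ennreal_plus)
  finally show ?thesis using S by blast
qed

text \<open>Redefining \<open>W\<close> on the null set of discontinuous paths makes it jointly measurable.\<close>

definition Wc :: "real \<Rightarrow> 'w \<Rightarrow> real" where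
  "Wc t \<omega> = (if continuous_on {0..} (\<lambda>t. W t \<omega>) then W (max 0 t) \<omega> else 0)"

lemma Wc_eq: "AE \<omega> in P. \<forall>t\<ge>0. Wc t \<omega> = W t \<omega>"
proof -
  have "AE \<omega> in P. continuous_on {0..} (\<lambda>t. W t \<omega>)" using BM by (simp add: brownian_motion_def)
  then show ?thesis by eventually_elim (simp add: Wc_def)
qed

lemma Wc_measurable_F: "0 \<le> s \<Longrightarrow> s \<le> t \<Longrightarrow> Wc s \<in> borel_measurable (F t)"
  by (rule measurable_F_AE_eq[OF W_measurable_F]) (use Wc_eq in auto)

lemma Wc_continuous: "isCont (\<lambda>t. Wc t \<omega>) t"
proof -
  have "continuous_on UNIV (\<lambda>t. Wc t \<omega>)"
    unfolding Wc_def
    by (cases "continuous_on {0..} (\<lambda>t. W t \<omega>)")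
      (auto intro!: continuous_on_compose2[of "{0..}" "\<lambda>t. W t \<omega>"] continuous_intros)
  then show ?thesis by (simp add: continuous_on_eq_continuous_at)
qed

text \<open>Rounding time down to multiples of \<open>1 / Suc k\<close> makes the process depend on
  time through countably many values, which is jointly measurable. Continuity of the paths passes
  this on to the limit.\<close>

lemma Wc_measurable: "(\<lambda>(t, \<omega>). Wc t \<omega>) \<in> borel_measurable (borel \<Otimes>\<^sub>M P)"
proof (rule borel_measurable_LIMSEQ_real)
  define u where "u k t = real_of_int \<lfloor>real (Suc k) * t\<rfloor> / real (Suc k)" for k t
  have m: "Wc a \<in> borel_measurable P" for a
  proof (cases "0 \<le> a")
    case True
    then show ?thesis using measurable_F_P[OF Wc_measurable_F[of a a]] by simp
  next
    case False
    then have "Wc a = Wc 0" by (auto simp: Wc_def fun_eq_iff)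
    then show ?thesis using measurable_F_P[OF Wc_measurable_F[of 0 0]] by simp
  qed
  show "(\<lambda>(t, \<omega>). Wc (u k t) \<omega>) \<in> borel_measurable (borel \<Otimes>\<^sub>M P)" for k
  proof -
    have "(\<lambda>x. Wc (real_of_int (\<lfloor>real (Suc k) * fst x\<rfloor>) / real (Suc k)) (snd x)) \<in> borel_measurable (borel \<Otimes>\<^sub>M P)"
      by (rule measurable_compose_countable[where f = "\<lambda>i x. Wc (real_of_int i / real (Suc k)) (snd x)"])
        (use m in measurable)
    then show ?thesis by (simp add: u_def case_prod_beta')
  qed
  show "(\<lambda>k. case x of (t, \<omega>) \<Rightarrow> Wc (u k t) \<omega>) \<longlonglongrightarrow> (case x of (t, \<omega>) \<Rightarrow> Wc t \<omega>)" for x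
  proof (cases x)
    case (Pair t \<omega>)
    have "(\<lambda>k. u k t) \<longlonglongrightarrow> t"
    proof (rule LIMSEQ_I)
      fix r :: real assume "0 < r"
      then obtain n where n: "inverse (real (Suc n)) < r" using reals_Archimedean by blast
      have "norm (u k t - t) < r" if "n \<le> k" for k
      proof -
        have "\<bar>real_of_int \<lfloor>real (Suc k) * t\<rfloor> - real (Suc k) * t\<bar> \<le> 1" by linarith
        moreover have "u k t - t = (real_of_int \<lfloor>real (Suc k) * t\<rfloor> - real (Suc k) * t) / real (Suc k)"
          by (simp add: u_def diff_divide_distrib del: of_nat_Suc)
        ultimately have "\<bar>u k t - t\<bar> \<le> inverse (real (Suc k))"
          by (simp add: abs_divide divide_right_mono inverse_eq_divide del: of_nat_Suc)
        also have "\<dots> \<le> inverse (real (Suc n))" using that by (simp add: le_imp_inverse_le)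
        finally show ?thesis using n by simp
      qed
      then show "\<exists>no. \<forall>k\<ge>no. norm (u k t - t) < r" by blast
    qed
    then show ?thesis using isCont_tendsto_compose[OF Wc_continuous] Pair by simp
  qed
qed

end

section \<open>Existence of the Ito integral\<close>

text \<open>Cauchy-Schwarz, obtained by integrating the squared deviation of \<open>h\<close> from
  its mean \<open>m / L\<close>. Two cases are treated apart: an infinite right-hand side, where the
  left integral may be a default value, and \<open>a = b\<close>, where the mean would divide by
  0.\<close>

lemma square_set_integral_le:
  fixes h :: "real \<Rightarrow> real"
  assumes [measurable]: "h \<in> borel_measurable borel" and ab: "a \<le> b"
  shows "ennreal ((LINT s:{a..b}|lborel. h s)\<^sup>2) \<le> ennreal (b - a) * (\<integral>\<^sup>+s\<in>{a..b}. ennreal ((h s)\<^sup>2) \<partial>lborel)"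
proof (cases "a < b \<and> (\<integral>\<^sup>+s\<in>{a..b}. ennreal ((h s)\<^sup>2) \<partial>lborel) < \<infinity>")
  case False
  then consider "a = b" | "a < b" "(\<integral>\<^sup>+s\<in>{a..b}. ennreal ((h s)\<^sup>2) \<partial>lborel) = \<top>"
    using ab by (cases "a < b") (auto simp: less_top[symmetric])
  then show ?thesis
  proof cases
    case 1
    have "AE s in lborel. indicator {b} s * h s = 0"
      using AE_lborel_singleton[of b] by eventually_elim auto
    then have "(LINT s:{b..b}|lborel. h s) = 0"
      unfolding set_lebesgue_integral_def by (intro integral_eq_zero_AE) auto
    then show ?thesis using 1 by simp
  qed (simp add: ennreal_mult_top)
next
  case True
  let ?i = "indicator {a..b} :: real \<Rightarrow> real"
  have "integrable lborel (\<lambda>s. ?i s * (h s)\<^sup>2)"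
  proof (rule integrableI_nonneg)
    have "(\<integral>\<^sup>+s. ennreal (?i s * (h s)\<^sup>2) \<partial>lborel) = (\<integral>\<^sup>+s\<in>{a..b}. ennreal ((h s)\<^sup>2) \<partial>lborel)"
      by (intro nn_integral_cong) (auto simp: indicator_def)
    then show "(\<integral>\<^sup>+s. ennreal (?i s * (h s)\<^sup>2) \<partial>lborel) < \<infinity>" using True by simp
  qed auto
  note i2 = this
  have i0: "integrable lborel ?i" by (simp add: less_top[symmetric] emeasure_lborel_Icc_eq)
  have i1: "integrable lborel (\<lambda>s. ?i s * h s)"
  proof (rule Bochner_Integration.integrable_bound)
    show "integrable lborel (\<lambda>s. ?i s + ?i s * (h s)\<^sup>2)" using i0 i2 by (rule Bochner_Integration.integrable_add)
    have "\<bar>x\<bar> \<le> 1 + x\<^sup>2" for x :: real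
      using zero_le_power2[of "\<bar>x\<bar> - 1"] by (simp add: power2_diff)
    then show "AE s in lborel. norm (?i s * h s) \<le> norm (?i s + ?i s * (h s)\<^sup>2)"
      by (intro AE_I2) (auto simp: indicator_def)
  qed auto
  define m where "m = (\<integral>s. ?i s * h s \<partial>lborel)"
  define q where "q = (\<integral>s. ?i s * (h s)\<^sup>2 \<partial>lborel)"
  define L where "L = b - a"
  have L: "0 < L" using True by (simp add: L_def)
  have e: "?i s * (h s - m / L)\<^sup>2 = ?i s * (h s)\<^sup>2 - 2 * (m / L) * (?i s * h s) + (m / L)\<^sup>2 * ?i s" for s
    by (auto simp: indicator_def power2_diff)
  have "0 \<le> (\<integral>s. ?i s * (h s - m / L)\<^sup>2 \<partial>lborel)" by (rule integral_nonneg_AE) auto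
  also have "\<dots> = q - 2 * (m / L) * m + (m / L)\<^sup>2 * L"
    unfolding e using i0 i1 i2 True by (simp add: m_def q_def L_def)
  also have "\<dots> = q - m\<^sup>2 / L" using L by (simp add: power2_eq_square field_simps)
  finally have "m\<^sup>2 \<le> L * q" using L by (simp add: field_simps)
  then have "ennreal (m\<^sup>2) \<le> ennreal (L * q)" by (rule ennreal_leI)
  also have "\<dots> = ennreal L * ennreal q" using L by (simp add: ennreal_mult' less_imp_le)
  also have "ennreal q = (\<integral>\<^sup>+s. ennreal (?i s * (h s)\<^sup>2) \<partial>lborel)"
    unfolding q_def by (rule nn_integral_eq_integral[symmetric]) (use i2 in auto)
  also have "\<dots> = (\<integral>\<^sup>+s\<in>{a..b}. ennreal ((h s)\<^sup>2) \<partial>lborel)"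
    by (intro nn_integral_cong) (auto simp: indicator_def)
  finally show ?thesis by (simp add: m_def L_def set_lebesgue_integral_def)
qed

section \<open>Stopped simple integrands and the integral as a process\<close>

context wiener begin

lemma measurable_restrict_process:
  assumes "(\<lambda>(s, \<omega>). h s \<omega>) \<in> borel_measurable (borel \<Otimes>\<^sub>M P)"
  shows "(\<lambda>(s, \<omega>). h s \<omega>) \<in> borel_measurable (restrict_space borel A \<Otimes>\<^sub>M P)"
proof -
  have "fst \<in> borel_measurable (restrict_space borel A \<Otimes>\<^sub>M P)"
    by (rule measurable_compose[OF measurable_fst measurable_restrict_space1]) simp
  from measurable_process_comp[OF assms this measurable_snd] show ?thesis by (simp add: case_prod_beta')
qed

lemma adapted_process_le:
  assumes f: "adapted_process P W T f" and t: "t \<le> T"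
  shows "adapted_process P W t f"
proof -
  have "fst \<in> measurable (restrict_space borel {0..t} \<Otimes>\<^sub>M P) (restrict_space borel {0..T})"
  proof (rule measurable_restrict_space2)
    show "fst \<in> borel_measurable (restrict_space borel {0..t} \<Otimes>\<^sub>M P)"
      by (rule measurable_compose[OF measurable_fst measurable_restrict_space1]) simp
  qed (use t in \<open>auto simp: space_pair_measure space_restrict_space\<close>)
  then have "(\<lambda>x. case_prod f (fst x, snd x)) \<in> borel_measurable (restrict_space borel {0..t} \<Otimes>\<^sub>M P)"
    using f by (intro measurable_compose[OF measurable_Pair]) (auto simp: adapted_process_def)
  then show ?thesis using f t by (simp add: adapted_process_def case_prod_beta')
qed

text \<open>Capping the partition points at \<open>t\<close> would produce steps of length 0, which
  \<open>simple_integrand\<close> excludes. So \<open>N'\<close> keeps exactly the steps that begin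
  before \<open>t\<close>; the dropped ones contribute nothing up to time \<open>t\<close>.\<close>

lemma simple_integrand_stop:
  assumes S: "simple_integrand P W T N \<tau> \<xi>" and t: "0 \<le> t"
  obtains N' where "simple_integrand P W t N' (\<lambda>i. min (\<tau> i) t) \<xi>"
    "\<And>s \<omega>. s \<le> t \<Longrightarrow> simple_process N' (\<lambda>i. min (\<tau> i) t) \<xi> s \<omega> = simple_process N \<tau> \<xi> s \<omega>"
    "\<And>\<omega>. simple_ito W N' (\<lambda>i. min (\<tau> i) t) \<xi> \<omega> = (\<Sum>i<N. \<xi> i \<omega> * (W (min (\<tau> (Suc i)) t) \<omega> - W (min (\<tau> i) t) \<omega>))"
proof -
  have mono: "\<tau> i \<le> \<tau> j" if "i \<le> j" "j \<le> N" for i j by (rule simple_integrand_le[OF S that])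
  have "\<exists>N'\<le>N. (\<forall>i<N'. \<tau> i < t) \<and> (\<forall>i. N' \<le> i \<longrightarrow> i < N \<longrightarrow> t \<le> \<tau> i)"
  proof (cases "\<exists>i<N. t \<le> \<tau> i")
    case True
    then obtain i where i: "i < N" "t \<le> \<tau> i" by blast
    define k where "k = (LEAST i. t \<le> \<tau> i)"
    have k: "t \<le> \<tau> k" "k \<le> i" unfolding k_def using i by (auto intro: LeastI Least_le)
    have "\<tau> j < t" if "j < k" for j using not_less_Least[of j "\<lambda>i. t \<le> \<tau> i"] that by (simp add: k_def)
    then show ?thesis using k i mono[of k] by (intro exI[of _ k]) (auto intro: order_trans)
  qed (auto intro!: exI[of _ N] simp: not_le)
  then obtain N' where N': "N' \<le> N" "\<And>i. i < N' \<Longrightarrow> \<tau> i < t" "\<And>i. N' \<le> i \<Longrightarrow> i < N \<Longrightarrow> t \<le> \<tau> i" by blast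
  have lt: "\<tau> i < \<tau> (Suc i)" if "i < N" for i using S that by (simp add: simple_integrand_def)
  show thesis
  proof (rule that[of N'])
    show "simple_integrand P W t N' (\<lambda>i. min (\<tau> i) t) \<xi>"
      unfolding simple_integrand_def
    proof (intro conjI allI impI)
      fix i assume i: "i < N'"
      have m: "min (\<tau> i) t = \<tau> i" using N'(2)[OF i] by simp
      show "min (\<tau> i) t < min (\<tau> (Suc i)) t" using lt[of i] N' i by auto
      show "\<xi> i \<in> borel_measurable (F (min (\<tau> i) t))" "\<exists>C. \<forall>\<omega>\<in>space P. \<bar>\<xi> i \<omega>\<bar> \<le> C"
        using S i N'(1) unfolding m by (auto simp: simple_integrand_def)
    qed (use S t in \<open>auto simp: simple_integrand_def\<close>)
    show "simple_process N' (\<lambda>i. min (\<tau> i) t) \<xi> s \<omega> = simple_process N \<tau> \<xi> s \<omega>" if "s \<le> t" for s \<omega>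
      unfolding simple_process_def
    proof (rule sum.mono_neutral_cong_left)
      show "\<forall>i\<in>{..<N} - {..<N'}. \<xi> i \<omega> * indicat_real {\<tau> i<..\<tau> (Suc i)} s = 0"
      proof
        fix i assume "i \<in> {..<N} - {..<N'}"
        then show "\<xi> i \<omega> * indicat_real {\<tau> i<..\<tau> (Suc i)} s = 0"
          using N'(3)[of i] that by (auto simp: indicator_def)
      qed
    qed (use N'(1) that in \<open>auto simp: indicator_def\<close>)
    show "simple_ito W N' (\<lambda>i. min (\<tau> i) t) \<xi> \<omega> = (\<Sum>i<N. \<xi> i \<omega> * (W (min (\<tau> (Suc i)) t) \<omega> - W (min (\<tau> i) t) \<omega>))" for \<omega>
      unfolding simple_ito_def
    proof (rule sum.mono_neutral_left)
      show "\<forall>i\<in>{..<N} - {..<N'}. \<xi> i \<omega> * (W (min (\<tau> (Suc i)) t) \<omega> - W (min (\<tau> i) t) \<omega>) = 0"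
      proof
        fix i assume "i \<in> {..<N} - {..<N'}"
        then have "min (\<tau> i) t = t" "min (\<tau> (Suc i)) t = t"
          using N'(3)[of i] lt[of i] by auto
        then show "\<xi> i \<omega> * (W (min (\<tau> (Suc i)) t) \<omega> - W (min (\<tau> i) t) \<omega>) = 0" by simp
      qed
    qed (use N'(1) in auto)
  qed
qed

definition L2_process :: "real \<Rightarrow> (real \<Rightarrow> 'w \<Rightarrow> real) \<Rightarrow> bool" where
  "L2_process T f \<longleftrightarrow> adapted_process P W T f \<and> (\<integral>\<^sup>+\<omega>. (\<integral>\<^sup>+s\<in>{0..T}. ennreal ((f s \<omega>)\<^sup>2) \<partial>lborel) \<partial>P) < \<infinity>"

lemma L2_process_le:
  assumes f: "L2_process T f" and t: "t \<le> T"
  shows "L2_process t f"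
proof -
  have "(\<integral>\<^sup>+\<omega>. (\<integral>\<^sup>+s\<in>{0..t}. ennreal ((f s \<omega>)\<^sup>2) \<partial>lborel) \<partial>P) \<le> (\<integral>\<^sup>+\<omega>. (\<integral>\<^sup>+s\<in>{0..T}. ennreal ((f s \<omega>)\<^sup>2) \<partial>lborel) \<partial>P)"
    by (intro nn_integral_mono) (use t in \<open>auto simp: indicator_def\<close>)
  also have "\<dots> < \<infinity>" using f by (simp add: L2_process_def)
  finally show ?thesis using f by (simp add: L2_process_def adapted_process_le[OF _ t])
qed

lemma measurable_ext:
  assumes "adapted_process P W T f"
  shows "(\<lambda>(s, \<omega>). indicator {0..T} s * f s \<omega>) \<in> borel_measurable (borel \<Otimes>\<^sub>M P)"
  by (rule measurable_zero_extension) (use assms in \<open>simp add: adapted_process_def\<close>)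

text \<open>The difference of two simple integrands is elementary, so the isometry turns their
  closeness to \<open>f\<close> into closeness of their integrals.\<close>

lemma simple_process_dist_le:
  assumes f: "adapted_process P W T f"
    and S: "simple_integrand P W T N \<tau> \<xi>" "simple_integrand P W T N' \<tau>' \<xi>'"
    and d: "(\<integral>\<^sup>+\<omega>. (\<integral>\<^sup>+s\<in>{0..T}. ennreal ((f s \<omega> - simple_process N \<tau> \<xi> s \<omega>)\<^sup>2) \<partial>lborel) \<partial>P) \<le> d1"
      "(\<integral>\<^sup>+\<omega>. (\<integral>\<^sup>+s\<in>{0..T}. ennreal ((f s \<omega> - simple_process N' \<tau>' \<xi>' s \<omega>)\<^sup>2) \<partial>lborel) \<partial>P) \<le> d2"
  shows "(\<integral>\<^sup>+\<omega>. ennreal ((simple_ito W N \<tau> \<xi> \<omega> - simple_ito W N' \<tau>' \<xi>' \<omega>)\<^sup>2) \<partial>P) \<le> 2 * d1 + 2 * d2"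
proof -
  note [measurable] = measurable_ext[OF f]
  note el = simple_elem[OF S(1)] simple_elem[OF S(2)]
  note [measurable] = elem_measurable(2)[OF el(1)] elem_measurable(2)[OF el(2)]
  let ?p = "simple_process N \<tau> \<xi>" and ?p' = "simple_process N' \<tau>' \<xi>'"
  have "elem (\<lambda>s \<omega>. -1 * ?p' s \<omega> + ?p s \<omega>) (\<lambda>\<omega>. -1 * simple_ito W N' \<tau>' \<xi>' \<omega> + simple_ito W N \<tau> \<xi> \<omega>)"
    by (intro elem_add elem_cmult el)
  from elem_isometry(1)[OF this]
  have "(\<integral>\<^sup>+\<omega>. ennreal ((simple_ito W N \<tau> \<xi> \<omega> - simple_ito W N' \<tau>' \<xi>' \<omega>)\<^sup>2) \<partial>P) =
    (\<integral>\<^sup>+\<omega>. \<integral>\<^sup>+s. ennreal ((?p s \<omega> - ?p' s \<omega>)\<^sup>2) \<partial>lborel \<partial>P)" by simp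
  also have "\<dots> = (\<integral>\<^sup>+\<omega>. \<integral>\<^sup>+s. ennreal ((indicator {0..T} s * (f s \<omega> - ?p' s \<omega>) + - (indicator {0..T} s * (f s \<omega> - ?p s \<omega>)))\<^sup>2) \<partial>lborel \<partial>P)"
    using simple_process_outside[OF S(1)] simple_process_outside[OF S(2)]
    by (intro nn_integral_cong) (auto simp: indicator_def)
  also have "\<dots> \<le> 2 * (\<integral>\<^sup>+\<omega>. \<integral>\<^sup>+s. ennreal ((indicator {0..T} s * (f s \<omega> - ?p' s \<omega>))\<^sup>2) \<partial>lborel \<partial>P) +
     2 * (\<integral>\<^sup>+\<omega>. \<integral>\<^sup>+s. ennreal ((- (indicator {0..T} s * (f s \<omega> - ?p s \<omega>)))\<^sup>2) \<partial>lborel \<partial>P)"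
    by (rule nn2_triangle; unfold right_diff_distrib) measurable
  also have "\<dots> \<le> 2 * d2 + 2 * d1"
    using d unfolding set_nn_integral_sq_eq by (intro add_mono mult_left_mono) auto
  finally show ?thesis by (simp add: add.commute)
qed

text \<open>One sequence of simple integrands on \<open>[0,T]\<close>, stopped at each
  \<open>t\<close>, serves all upper limits, which keeps the limit jointly measurable in time and
  outcome. The rate \<open>(1 / 4) ^ k\<close> yields almost sure convergence at every
  \<open>t\<close>.\<close>

lemma ito_integral_exists:
  assumes f: "L2_process T f" and T: "0 < T"
  obtains I where "L2_process T I" "\<And>t. t \<in> {0..T} \<Longrightarrow> has_ito_integral P W t f (I t)"
proof -
  note fa = f[unfolded L2_process_def, THEN conjunct1] and fL = f[unfolded L2_process_def, THEN conjunct2]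
  have "\<forall>k::nat. \<exists>N \<tau> \<xi>. simple_integrand P W T N \<tau> \<xi> \<and>
    (\<integral>\<^sup>+\<omega>. (\<integral>\<^sup>+s\<in>{0..T}. ennreal ((f s \<omega> - simple_process N \<tau> \<xi> s \<omega>)\<^sup>2) \<partial>lborel) \<partial>P) \<le> ennreal ((1 / 4) ^ k)"
    by (intro allI simple_approx[OF fa T _ fL]) simp
  from choice[OF this] obtain N where "\<forall>k. \<exists>\<tau> \<xi>. simple_integrand P W T (N k) \<tau> \<xi> \<and>
    (\<integral>\<^sup>+\<omega>. (\<integral>\<^sup>+s\<in>{0..T}. ennreal ((f s \<omega> - simple_process (N k) \<tau> \<xi> s \<omega>)\<^sup>2) \<partial>lborel) \<partial>P) \<le> ennreal ((1 / 4) ^ k)" ..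
  from choice[OF this] obtain \<tau> where "\<forall>k. \<exists>\<xi>. simple_integrand P W T (N k) (\<tau> k) \<xi> \<and>
    (\<integral>\<^sup>+\<omega>. (\<integral>\<^sup>+s\<in>{0..T}. ennreal ((f s \<omega> - simple_process (N k) (\<tau> k) \<xi> s \<omega>)\<^sup>2) \<partial>lborel) \<partial>P) \<le> ennreal ((1 / 4) ^ k)" ..
  from choice[OF this] obtain \<xi> where S: "\<And>k. simple_integrand P W T (N k) (\<tau> k) (\<xi> k)"
    and dist: "\<And>k. (\<integral>\<^sup>+\<omega>. (\<integral>\<^sup>+s\<in>{0..T}. ennreal ((f s \<omega> - simple_process (N k) (\<tau> k) (\<xi> k) s \<omega>)\<^sup>2) \<partial>lborel) \<partial>P) \<le> ennreal ((1 / 4) ^ k)"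
    by blast
  define V where "V k t \<omega> = (\<Sum>i<N k. \<xi> k i \<omega> * (W (min (\<tau> k (Suc i)) t) \<omega> - W (min (\<tau> k i) t) \<omega>))" for k t \<omega>
  \<comment> \<open>\<open>V\<close> is the stopped simple integral itself. \<open>Vc\<close> is a
    version of it built from the continuous paths \<open>Wc\<close>, from which it inherits joint
    measurability.\<close>
  define Vc where "Vc k t \<omega> = (\<Sum>i<N k. \<xi> k i \<omega> * (Wc (min (\<tau> k (Suc i)) t) \<omega> - Wc (min (\<tau> k i) t) \<omega>))" for k t \<omega>
  have \<tau>0: "0 \<le> \<tau> k i" if "i \<le> N k" for k i by (rule simple_integrand_le(1)[OF S that]) simp
  have \<xi>F: "\<xi> k i \<in> borel_measurable (F (\<tau> k i))" if "i < N k" for k i using S that by (auto simp: simple_integrand_def)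
  have VVc: "AE \<omega> in P. Vc k t \<omega> = V k t \<omega>" if "0 \<le> t" for k t
    using Wc_eq
  proof eventually_elim
    case (elim \<omega>)
    then show ?case unfolding V_def Vc_def using \<tau>0 that by (intro sum.cong) auto
  qed
  have Vc_F: "Vc k t \<in> borel_measurable (F t)" if "0 \<le> t" for k t
    unfolding Vc_def
  proof (rule borel_measurable_sum)
    fix i assume i: "i \<in> {..<N k}"
    show "(\<lambda>\<omega>. \<xi> k i \<omega> * (Wc (min (\<tau> k (Suc i)) t) \<omega> - Wc (min (\<tau> k i) t) \<omega>)) \<in> borel_measurable (F t)"
    proof (cases "\<tau> k i < t")
      case True
      then show ?thesis
        using i \<tau>0[of i k] \<tau>0[of "Suc i" k] that
        by (intro borel_measurable_times borel_measurable_diff Wc_measurable_F measurable_F_mono[OF _ \<xi>F]) auto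
    next
      case False
      \<comment> \<open>When its step begins after \<open>t\<close>, the value
        \<open>\<xi> k i\<close> need not be known at time \<open>t\<close>; but then the stopped
        increment is 0.\<close>
      then have "min (\<tau> k (Suc i)) t = min (\<tau> k i) t"
        using i simple_integrand_le(2)[OF S, of i "Suc i" k] by auto
      then show ?thesis by simp
    qed
  qed
  have Vc_joint: "(\<lambda>(t, \<omega>). Vc k t \<omega>) \<in> borel_measurable (borel \<Otimes>\<^sub>M P)" for k
  proof -
    have [measurable]: "\<xi> k i \<in> borel_measurable P" if "i \<in> {..<N k}" for i
      using measurable_F_P[OF \<xi>F] that by simp
    note [measurable (raw)] = measurable_process_comp[OF Wc_measurable]
    show ?thesis unfolding Vc_def by measurable
  qed
  \<comment> \<open>Where the sequence diverges, \<open>lim\<close> has some unspecified value.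
    Measurability holds regardless, and divergence has probability 0 at each \<open>t\<close> in
    \<open>{0..T}\<close>.\<close>
  define I where "I t \<omega> = lim (\<lambda>k. Vc k t \<omega>)" for t \<omega>
  have I_F: "I t \<in> borel_measurable (F t)" if "0 \<le> t" for t
    unfolding I_def by (intro borel_measurable_lim_metric Vc_F that)
  have I_joint: "(\<lambda>(t, \<omega>). I t \<omega>) \<in> borel_measurable (borel \<Otimes>\<^sub>M P)"
    unfolding I_def case_prod_beta' using Vc_joint by (intro borel_measurable_lim_metric) (simp add: case_prod_beta')
  have "\<forall>t. \<exists>N'. 0 \<le> t \<longrightarrow> (\<forall>k. simple_integrand P W t (N' k) (\<lambda>i. min (\<tau> k i) t) (\<xi> k) \<and>
      (\<forall>s \<omega>. s \<le> t \<longrightarrow> simple_process (N' k) (\<lambda>i. min (\<tau> k i) t) (\<xi> k) s \<omega> = simple_process (N k) (\<tau> k) (\<xi> k) s \<omega>) \<and>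
      simple_ito W (N' k) (\<lambda>i. min (\<tau> k i) t) (\<xi> k) = V k t)"
  proof
    fix t :: real
    have "\<exists>N'. \<forall>k. simple_integrand P W t (N' k) (\<lambda>i. min (\<tau> k i) t) (\<xi> k) \<and>
      (\<forall>s \<omega>. s \<le> t \<longrightarrow> simple_process (N' k) (\<lambda>i. min (\<tau> k i) t) (\<xi> k) s \<omega> = simple_process (N k) (\<tau> k) (\<xi> k) s \<omega>) \<and>
      simple_ito W (N' k) (\<lambda>i. min (\<tau> k i) t) (\<xi> k) = V k t" if t: "0 \<le> t"
    proof (intro choice allI)
      fix k
      show "\<exists>N'. simple_integrand P W t N' (\<lambda>i. min (\<tau> k i) t) (\<xi> k) \<and>
      (\<forall>s \<omega>. s \<le> t \<longrightarrow> simple_process N' (\<lambda>i. min (\<tau> k i) t) (\<xi> k) s \<omega> = simple_process (N k) (\<tau> k) (\<xi> k) s \<omega>) \<and>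
      simple_ito W N' (\<lambda>i. min (\<tau> k i) t) (\<xi> k) = V k t"
        by (rule simple_integrand_stop[OF S[of k] t]) (auto simp: V_def[abs_def] fun_eq_iff)
    qed
    then show "\<exists>N'. 0 \<le> t \<longrightarrow> (\<forall>k. simple_integrand P W t (N' k) (\<lambda>i. min (\<tau> k i) t) (\<xi> k) \<and>
      (\<forall>s \<omega>. s \<le> t \<longrightarrow> simple_process (N' k) (\<lambda>i. min (\<tau> k i) t) (\<xi> k) s \<omega> = simple_process (N k) (\<tau> k) (\<xi> k) s \<omega>) \<and>
      simple_ito W (N' k) (\<lambda>i. min (\<tau> k i) t) (\<xi> k) = V k t)"
      by blast
  qed
  from choice[OF this] obtain N' where N': "\<And>t k. 0 \<le> t \<Longrightarrow> simple_integrand P W t (N' t k) (\<lambda>i. min (\<tau> k i) t) (\<xi> k)"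
      "\<And>t k s \<omega>. 0 \<le> t \<Longrightarrow> s \<le> t \<Longrightarrow> simple_process (N' t k) (\<lambda>i. min (\<tau> k i) t) (\<xi> k) s \<omega> = simple_process (N k) (\<tau> k) (\<xi> k) s \<omega>"
      "\<And>t k. 0 \<le> t \<Longrightarrow> simple_ito W (N' t k) (\<lambda>i. min (\<tau> k i) t) (\<xi> k) = V k t"
    by blast
  have dist_t: "(\<integral>\<^sup>+\<omega>. (\<integral>\<^sup>+s\<in>{0..t}. ennreal ((f s \<omega> - simple_process (N' t k) (\<lambda>i. min (\<tau> k i) t) (\<xi> k) s \<omega>)\<^sup>2) \<partial>lborel) \<partial>P)
      \<le> ennreal ((1 / 4) ^ k)" if t: "t \<in> {0..T}" for t k
  proof -
    have "(\<integral>\<^sup>+\<omega>. (\<integral>\<^sup>+s\<in>{0..t}. ennreal ((f s \<omega> - simple_process (N' t k) (\<lambda>i. min (\<tau> k i) t) (\<xi> k) s \<omega>)\<^sup>2) \<partial>lborel) \<partial>P) \<le>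
      (\<integral>\<^sup>+\<omega>. (\<integral>\<^sup>+s\<in>{0..T}. ennreal ((f s \<omega> - simple_process (N k) (\<tau> k) (\<xi> k) s \<omega>)\<^sup>2) \<partial>lborel) \<partial>P)"
      using t N'(2)[of t] by (intro nn_integral_mono) (auto simp: indicator_def)
    then show ?thesis using dist[of k] by (rule order_trans)
  qed
  have V_P: "V k t \<in> borel_measurable P" "Vc k t \<in> borel_measurable P" "I t \<in> borel_measurable P" if "0 \<le> t" for k t
    using elem_measurable(1)[OF simple_elem[OF N'(1)[OF that, of k]]] N'(3)[OF that] measurable_F_P[OF Vc_F[OF that]] measurable_F_P[OF I_F[OF that]] by auto
  have Vdist: "(\<integral>\<^sup>+\<omega>. ennreal ((V l t \<omega> - V k t \<omega>)\<^sup>2) \<partial>P) \<le> ennreal (4 * (1 / 4) ^ k)" if t: "t \<in> {0..T}" and kl: "k \<le> l" for k l t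
  proof -
    have t0: "0 \<le> t" "t \<le> T" using t by auto
    have "(\<integral>\<^sup>+\<omega>. ennreal ((V l t \<omega> - V k t \<omega>)\<^sup>2) \<partial>P) \<le> 2 * ennreal ((1 / 4) ^ l) + 2 * ennreal ((1 / 4) ^ k)"
      using simple_process_dist_le[OF adapted_process_le[OF fa t0(2)] N'(1)[OF t0(1)] N'(1)[OF t0(1)] dist_t[OF t, of l] dist_t[OF t, of k]] N'(3)[OF t0(1)]
      by simp
    also have "\<dots> \<le> 2 * ennreal ((1 / 4) ^ k) + 2 * ennreal ((1 / 4) ^ k)"
      using kl by (intro add_mono mult_left_mono ennreal_leI power_decreasing) auto
    also have "\<dots> = ennreal (4 * (1 / 4) ^ k)"
      by (simp add: ennreal_numeral[symmetric] ennreal_mult[symmetric] ennreal_plus[symmetric] del: ennreal_numeral ennreal_plus)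
    finally show ?thesis .
  qed
  have Ilim: "AE \<omega> in P. (\<lambda>k. V k t \<omega>) \<longlonglongrightarrow> I t \<omega>" if t: "t \<in> {0..T}" for t
  proof -
    have t0: "0 \<le> t" using t by auto
    have "AE \<omega> in P. convergent (\<lambda>k. V k t \<omega>)"
      by (rule fast_L2_Cauchy_AE[OF prob_space_axioms V_P(1)[OF t0] Vdist[OF t]]) auto
    moreover have "AE \<omega> in P. \<forall>k. Vc k t \<omega> = V k t \<omega>" using VVc[OF t0] by (simp add: AE_all_countable)
    ultimately show ?thesis
      by eventually_elim (simp add: I_def convergent_LIMSEQ_iff)
  qed
  have Idist: "(\<integral>\<^sup>+\<omega>. ennreal ((I t \<omega> - V k t \<omega>)\<^sup>2) \<partial>P) \<le> ennreal (4 * (1 / 4) ^ k)" if t: "t \<in> {0..T}" for t k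
  proof -
    have t0: "0 \<le> t" using t by auto
    \<comment> \<open>Fatou's lemma follows: almost sure convergence passes the bound on
      \<open>V l t - V k t\<close>, uniform in \<open>l\<close>, to the limit.\<close>
    have "AE \<omega> in P. ennreal ((I t \<omega> - V k t \<omega>)\<^sup>2) = liminf (\<lambda>l. ennreal ((V l t \<omega> - V k t \<omega>)\<^sup>2))"
      using Ilim[OF t]
    proof eventually_elim
      case (elim \<omega>)
      have "(\<lambda>l. ennreal ((V l t \<omega> - V k t \<omega>)\<^sup>2)) \<longlonglongrightarrow> ennreal ((I t \<omega> - V k t \<omega>)\<^sup>2)"
        by (rule tendsto_ennrealI[OF tendsto_power[OF tendsto_diff[OF elim tendsto_const]]])
      from lim_imp_Liminf[OF sequentially_bot this] show ?case ..
    qed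
    have "(\<integral>\<^sup>+\<omega>. ennreal ((I t \<omega> - V k t \<omega>)\<^sup>2) \<partial>P) = (\<integral>\<^sup>+\<omega>. liminf (\<lambda>l. ennreal ((V l t \<omega> - V k t \<omega>)\<^sup>2)) \<partial>P)"
      by (rule nn_integral_cong_AE) fact
    also have "\<dots> \<le> liminf (\<lambda>l. \<integral>\<^sup>+\<omega>. ennreal ((V l t \<omega> - V k t \<omega>)\<^sup>2) \<partial>P)"
      by (rule nn_integral_liminf) (use V_P[OF t0] in measurable)
    also have "\<dots> \<le> limsup (\<lambda>l. \<integral>\<^sup>+\<omega>. ennreal ((V l t \<omega> - V k t \<omega>)\<^sup>2) \<partial>P)"
      by (rule Liminf_le_Limsup) simp
    also have "\<dots> \<le> ennreal (4 * (1 / 4) ^ k)"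
      by (rule Limsup_bounded) (use Vdist[OF t] in \<open>auto intro!: eventually_sequentiallyI[of k]\<close>)
    finally show ?thesis .
  qed
  have tozero: "(\<lambda>k. ennreal (c * (1 / 4) ^ k)) \<longlonglongrightarrow> 0" for c
  proof -
    have "(\<lambda>k. c * (1 / 4) ^ k) \<longlonglongrightarrow> c * 0" by (intro tendsto_intros LIMSEQ_realpow_zero) auto
    then have "(\<lambda>k. ennreal (c * (1 / 4) ^ k)) \<longlonglongrightarrow> ennreal (c * 0)" by (rule tendsto_ennrealI)
    then show ?thesis by simp
  qed
  show thesis
  proof (rule that[of I])
    fix t assume t: "t \<in> {0..T}"
    then have t0: "0 \<le> t" "t \<le> T" by auto
    show "has_ito_integral P W t f (I t)"
      unfolding has_ito_integral_def
    proof (intro conjI exI)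
      show "adapted_process P W t f" by (rule adapted_process_le[OF fa t0(2)])
      show "I t \<in> borel_measurable P" by (rule V_P[OF t0(1)])
      show "\<forall>k. simple_integrand P W t (N' t k) (\<lambda>i. min (\<tau> k i) t) (\<xi> k)" using N'(1)[OF t0(1)] by blast
      show "(\<lambda>k. \<integral>\<^sup>+\<omega>. (\<integral>\<^sup>+s\<in>{0..t}. ennreal ((f s \<omega> - simple_process (N' t k) (\<lambda>i. min (\<tau> k i) t) (\<xi> k) s \<omega>)\<^sup>2) \<partial>lborel) \<partial>P) \<longlonglongrightarrow> 0"
        by (rule tendsto_sandwich[OF _ _ tendsto_const tozero[of 1]]) (use dist_t[OF t] in auto)
      show "(\<lambda>k. \<integral>\<^sup>+\<omega>. ennreal ((I t \<omega> - simple_ito W (N' t k) (\<lambda>i. min (\<tau> k i) t) (\<xi> k) \<omega>)\<^sup>2) \<partial>P) \<longlonglongrightarrow> 0"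
        unfolding N'(3)[OF t0(1)]
        by (rule tendsto_sandwich[OF _ _ tendsto_const tozero[of 4]]) (use Idist[OF t] in auto)
    qed
  next
    \<comment> \<open>Stopping can only decrease the norm of the first approximant, so the isometry
      bounds all \<open>V 0 t\<close> by the same \<open>c\<close>; the distance of
      \<open>I t\<close> from \<open>V 0 t\<close> contributes the 8 below.\<close>
    define c where "c = (\<integral>\<^sup>+\<omega>. \<integral>\<^sup>+s. ennreal ((simple_process (N 0) (\<tau> 0) (\<xi> 0) s \<omega>)\<^sup>2) \<partial>lborel \<partial>P)"
    have c: "c < \<infinity>" using elem_isometry[OF simple_elem[OF S[of 0]]] by (simp add: c_def)
    have bound: "(\<integral>\<^sup>+\<omega>. ennreal ((I t \<omega>)\<^sup>2) \<partial>P) \<le> 8 + 2 * c" if t: "t \<in> {0..T}" for t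
    proof -
      have t0: "0 \<le> t" using t by auto
      have "(\<integral>\<^sup>+\<omega>. ennreal ((V 0 t \<omega>)\<^sup>2) \<partial>P) = (\<integral>\<^sup>+\<omega>. \<integral>\<^sup>+s. ennreal ((simple_process (N' t 0) (\<lambda>i. min (\<tau> 0 i) t) (\<xi> 0) s \<omega>)\<^sup>2) \<partial>lborel \<partial>P)"
        using elem_isometry(1)[OF simple_elem[OF N'(1)[OF t0, of 0]]] N'(3)[OF t0] by simp
      also have "\<dots> \<le> c"
        unfolding c_def
      proof (intro nn_integral_mono)
        fix \<omega> s
        show "ennreal ((simple_process (N' t 0) (\<lambda>i. min (\<tau> 0 i) t) (\<xi> 0) s \<omega>)\<^sup>2) \<le> ennreal ((simple_process (N 0) (\<tau> 0) (\<xi> 0) s \<omega>)\<^sup>2)"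
          using N'(2)[OF t0, of s 0 \<omega>] simple_process_outside[OF N'(1)[OF t0], of s 0 \<omega>] by (cases "s \<le> t") auto
      qed
      finally have V0: "(\<integral>\<^sup>+\<omega>. ennreal ((V 0 t \<omega>)\<^sup>2) \<partial>P) \<le> c" .
      have "(\<integral>\<^sup>+\<omega>. ennreal ((I t \<omega>)\<^sup>2) \<partial>P) = (\<integral>\<^sup>+\<omega>. ennreal (((I t \<omega> - V 0 t \<omega>) + V 0 t \<omega>)\<^sup>2) \<partial>P)" by simp
      also have "\<dots> \<le> 2 * (\<integral>\<^sup>+\<omega>. ennreal ((I t \<omega> - V 0 t \<omega>)\<^sup>2) \<partial>P) + 2 * (\<integral>\<^sup>+\<omega>. ennreal ((V 0 t \<omega>)\<^sup>2) \<partial>P)"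
        by (rule nn_integral_sq_triangle) (use V_P[OF t0] in auto)
      also have "\<dots> \<le> 2 * ennreal (4 * (1 / 4) ^ 0) + 2 * c"
        by (rule add_mono[OF mult_left_mono[OF Idist[OF t]] mult_left_mono[OF V0]]) auto
      also have "2 * ennreal (4 * (1 / 4) ^ 0) = 8" by (simp add: ennreal_numeral[symmetric] ennreal_mult[symmetric] del: ennreal_numeral)
      finally show ?thesis .
    qed
    interpret L: pair_sigma_finite "lborel :: real measure" P by (rule lborel_P)
    note [measurable] = I_joint
    have "(\<integral>\<^sup>+\<omega>. (\<integral>\<^sup>+s\<in>{0..T}. ennreal ((I s \<omega>)\<^sup>2) \<partial>lborel) \<partial>P) = (\<integral>\<^sup>+s. (\<integral>\<^sup>+\<omega>. ennreal ((I s \<omega>)\<^sup>2) * indicator {0..T} s \<partial>P) \<partial>lborel)"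
      by (rule L.Fubini') measurable
    also have "\<dots> \<le> (\<integral>\<^sup>+s. (8 + 2 * c) * indicator {0..T} s \<partial>lborel)"
      using bound by (intro nn_integral_mono) (auto simp: indicator_def)
    also have "\<dots> = (8 + 2 * c) * emeasure lborel {0..T}" by (rule nn_integral_cmult_indicator) simp
    also have "\<dots> < \<infinity>" using c T by (simp add: ennreal_mult_less_top)
    finally show "L2_process T I"
      unfolding L2_process_def adapted_process_def
      by (intro conjI ballI I_F measurable_restrict_process[OF I_joint]) auto
  qed
qed

end

section \<open>Closure properties of square integrable processes\<close>

context wiener begin

lemma nn2_ext:
  "(\<integral>\<^sup>+\<omega>. (\<integral>\<^sup>+s\<in>{0..T}. ennreal ((f s \<omega>)\<^sup>2) \<partial>lborel) \<partial>P) =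
   (\<integral>\<^sup>+\<omega>. \<integral>\<^sup>+s. ennreal ((indicator {0..T} s * f s \<omega>)\<^sup>2) \<partial>lborel \<partial>P)" for T :: real
  unfolding set_nn_integral_sq_eq ..

lemma L2_process_add:
  assumes "L2_process T f" "L2_process T g"
  shows "L2_process T (\<lambda>s \<omega>. f s \<omega> + g s \<omega>)"
proof -
  have "adapted_process P W T (\<lambda>s \<omega>. f s \<omega> + g s \<omega>)"
    using assms unfolding L2_process_def adapted_process_def case_prod_beta'
    by (auto intro!: borel_measurable_add)
  moreover have "(\<integral>\<^sup>+\<omega>. (\<integral>\<^sup>+s\<in>{0..T}. ennreal ((f s \<omega> + g s \<omega>)\<^sup>2) \<partial>lborel) \<partial>P) < \<infinity>"
  proof -
    have "(\<integral>\<^sup>+\<omega>. (\<integral>\<^sup>+s\<in>{0..T}. ennreal ((f s \<omega> + g s \<omega>)\<^sup>2) \<partial>lborel) \<partial>P) \<le>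
      2 * (\<integral>\<^sup>+\<omega>. (\<integral>\<^sup>+s\<in>{0..T}. ennreal ((f s \<omega>)\<^sup>2) \<partial>lborel) \<partial>P) + 2 * (\<integral>\<^sup>+\<omega>. (\<integral>\<^sup>+s\<in>{0..T}. ennreal ((g s \<omega>)\<^sup>2) \<partial>lborel) \<partial>P)"
      unfolding nn2_ext distrib_left
      by (rule nn2_triangle) (use assms in \<open>auto simp: L2_process_def intro!: measurable_ext\<close>)
    also have "\<dots> < \<infinity>" using assms by (simp add: L2_process_def ennreal_mult_less_top)
    finally show ?thesis .
  qed
  ultimately show ?thesis by (simp add: L2_process_def)
qed

lemma L2_process_bounded_mult:
  assumes f: "L2_process T f" and c[measurable]: "c \<in> borel_measurable borel" and C: "\<And>s. s \<in> {0..T} \<Longrightarrow> \<bar>c s\<bar> \<le> C"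
  shows "L2_process T (\<lambda>s \<omega>. c s * f s \<omega>)"
proof -
  have "(\<lambda>x. c (fst x)) \<in> borel_measurable (restrict_space borel {0..T} \<Otimes>\<^sub>M P)"
    by (rule measurable_compose[OF measurable_fst measurable_restrict_space1]) measurable
  then have "adapted_process P W T (\<lambda>s \<omega>. c s * f s \<omega>)"
    using f unfolding L2_process_def adapted_process_def case_prod_beta'
    by (auto intro!: borel_measurable_times)
  moreover have "(\<integral>\<^sup>+\<omega>. (\<integral>\<^sup>+s\<in>{0..T}. ennreal ((c s * f s \<omega>)\<^sup>2) \<partial>lborel) \<partial>P) < \<infinity>"
  proof -
    note m = measurable_ext[OF f[unfolded L2_process_def, THEN conjunct1]]
    have "(\<integral>\<^sup>+\<omega>. (\<integral>\<^sup>+s\<in>{0..T}. ennreal ((c s * f s \<omega>)\<^sup>2) \<partial>lborel) \<partial>P) \<le>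
      (\<integral>\<^sup>+\<omega>. (\<integral>\<^sup>+s. ennreal (C\<^sup>2) * ennreal ((indicator {0..T} s * f s \<omega>)\<^sup>2) \<partial>lborel) \<partial>P)"
    proof (intro nn_integral_mono)
      fix s \<omega>
      show "ennreal ((c s * f s \<omega>)\<^sup>2) * indicator {0..T} s \<le> ennreal (C\<^sup>2) * ennreal ((indicator {0..T} s * f s \<omega>)\<^sup>2)"
      proof (cases "s \<in> {0..T}")
        case True
        have "(c s)\<^sup>2 \<le> C\<^sup>2" using C[OF True] by (intro abs_le_square_iff[THEN iffD1]) auto
        then have "(c s * f s \<omega>)\<^sup>2 \<le> C\<^sup>2 * (f s \<omega>)\<^sup>2" by (simp add: power_mult_distrib mult_right_mono)
        then show ?thesis using True by (simp add: ennreal_mult[symmetric] ennreal_leI)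
      qed simp
    qed
    also have "\<dots> = (\<integral>\<^sup>+\<omega>. ennreal (C\<^sup>2) * (\<integral>\<^sup>+s. ennreal ((indicator {0..T} s * f s \<omega>)\<^sup>2) \<partial>lborel) \<partial>P)"
      using sectionI[OF m] by (intro nn_integral_cong nn_integral_cmult) simp
    also have "\<dots> = ennreal (C\<^sup>2) * (\<integral>\<^sup>+\<omega>. (\<integral>\<^sup>+s. ennreal ((indicator {0..T} s * f s \<omega>)\<^sup>2) \<partial>lborel) \<partial>P)"
      by (rule nn_integral_cmult[OF measurable_nn2[OF m]])
    also have "\<dots> < \<infinity>" using f unfolding L2_process_def nn2_ext by (simp add: ennreal_mult_less_top)
    finally show ?thesis .
  qed
  ultimately show ?thesis by (simp add: L2_process_def)
qed

lemma L2_process_cmult: "L2_process T f \<Longrightarrow> L2_process T (\<lambda>s \<omega>. c * f s \<omega>)"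
  by (rule L2_process_bounded_mult[where C = "\<bar>c\<bar>"]) auto

lemma L2_process_const: "L2_process T (\<lambda>s \<omega>. c)"
proof -
  have "(\<integral>\<^sup>+\<omega>. (\<integral>\<^sup>+s\<in>{0..T}. ennreal (c\<^sup>2) \<partial>lborel) \<partial>P) < \<infinity>"
    by (subst nn_integral_cmult_indicator) (auto simp: emeasure_space_1 ennreal_mult_less_top emeasure_lborel_Icc_eq)
  then show ?thesis by (simp add: L2_process_def adapted_process_def)
qed

lemma L2_process_sum: "finite K \<Longrightarrow> (\<And>j. j \<in> K \<Longrightarrow> L2_process T (f j)) \<Longrightarrow> L2_process T (\<lambda>s \<omega>. \<Sum>j\<in>K. f j s \<omega>)"
  by (induction rule: finite_induct) (auto intro: L2_process_add L2_process_const)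

lemma L2_process_cong:
  assumes "L2_process T f" "\<And>s \<omega>. s \<in> {0..T} \<Longrightarrow> \<omega> \<in> space P \<Longrightarrow> f s \<omega> = g s \<omega>"
  shows "L2_process T g"
proof -
  have "adapted_process P W T f = adapted_process P W T g"
    unfolding adapted_process_def using assms(2)
    by (intro arg_cong2[where f = conj] measurable_cong ball_cong refl)
      (auto simp: space_pair_measure space_restrict_space intro!: measurable_cong)
  moreover have "(\<integral>\<^sup>+\<omega>. (\<integral>\<^sup>+s\<in>{0..T}. ennreal ((f s \<omega>)\<^sup>2) \<partial>lborel) \<partial>P) = (\<integral>\<^sup>+\<omega>. (\<integral>\<^sup>+s\<in>{0..T}. ennreal ((g s \<omega>)\<^sup>2) \<partial>lborel) \<partial>P)"
    by (intro nn_integral_cong) (use assms(2) in \<open>auto simp: indicator_def\<close>)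
  ultimately show ?thesis using assms(1) by (simp add: L2_process_def)
qed

text \<open>Along a path that is not integrable, the time integral in the equation would take a
  default value. Square integrability excludes this almost surely, because
  \<open>\<bar>x\<bar> \<le> 1 + x\<^sup>2\<close> and the time interval is bounded.\<close>

lemma L2_process_paths:
  assumes f: "L2_process T f"
  shows "AE \<omega> in P. set_integrable lborel {0..T} (\<lambda>s. f s \<omega>)"
proof -
  note m = measurable_ext[OF f[unfolded L2_process_def, THEN conjunct1]]
  have "AE \<omega> in P. (\<integral>\<^sup>+s. ennreal ((indicator {0..T} s * f s \<omega>)\<^sup>2) \<partial>lborel) \<noteq> \<infinity>"
    using f unfolding L2_process_def nn2_ext by (intro nn_integral_PInf_AE measurable_nn2[OF m]) auto
  then show ?thesis using AE_space
  proof eventually_elim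
    case (elim \<omega>)
    have [measurable]: "(\<lambda>s. indicator {0..T} s * f s \<omega>) \<in> borel_measurable borel" by (rule sectionI[OF m elim(2)])
    have i2: "integrable lborel (\<lambda>s. (indicator {0..T} s * f s \<omega>)\<^sup>2)"
      by (rule integrableI_nonneg) (use elim(1) in \<open>auto simp: less_top\<close>)
    have i0: "integrable lborel (indicator {0..T} :: real \<Rightarrow> real)" by (simp add: less_top[symmetric] emeasure_lborel_Icc_eq)
    have "integrable lborel (\<lambda>s. indicator {0..T} s * f s \<omega>)"
    proof (rule Bochner_Integration.integrable_bound)
      show "integrable lborel (\<lambda>s. indicator {0..T} s + (indicator {0..T} s * f s \<omega>)\<^sup>2)"
        using i0 i2 by (rule Bochner_Integration.integrable_add)
      have "\<bar>x\<bar> \<le> 1 + x\<^sup>2" for x :: real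
        using zero_le_power2[of "\<bar>x\<bar> - 1"] by (simp add: power2_diff)
      then show "AE s in lborel. norm (indicator {0..T} s * f s \<omega>) \<le> norm (indicator {0..T} s + (indicator {0..T} s * f s \<omega>)\<^sup>2)"
        by (intro AE_I2) (auto simp: indicator_def)
    qed simp
    then show ?case by (simp add: set_integrable_def)
  qed
qed

text \<open>An adapted process need not be progressively measurable, so the measurability of its time integral
  with respect to \<open>F t\<close> is read off from approximating simple integrands.\<close>

lemma time_integral_measurable_F:
  assumes f: "L2_process t f" and t: "0 \<le> t"
  shows "(\<lambda>\<omega>. LINT s:{0..t}|lborel. f s \<omega>) \<in> borel_measurable (F t)"
proof (cases "t = 0")
  case True
  have "(LINT s:{0..0::real}|lborel. f s \<omega>) = 0" for \<omega>
  proof -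
    have "AE s in lborel. indicator {0..0::real} s *\<^sub>R f s \<omega> = 0"
      using AE_lborel_singleton[of 0] by eventually_elim auto
    then show ?thesis unfolding set_lebesgue_integral_def by (rule integral_eq_zero_AE)
  qed
  then show ?thesis using True by simp
next
  case False
  with t have T: "0 < t" by simp
  note fa = f[unfolded L2_process_def, THEN conjunct1] and fL = f[unfolded L2_process_def, THEN conjunct2]
  have "\<forall>k::nat. \<exists>N \<tau> \<xi>. simple_integrand P W t N \<tau> \<xi> \<and>
    (\<integral>\<^sup>+\<omega>. (\<integral>\<^sup>+s\<in>{0..t}. ennreal ((f s \<omega> - simple_process N \<tau> \<xi> s \<omega>)\<^sup>2) \<partial>lborel) \<partial>P) \<le> ennreal ((1 / 4) ^ k)"
    by (intro allI simple_approx[OF fa T _ fL]) simp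
  from choice[OF this] obtain N where "\<forall>k. \<exists>\<tau> \<xi>. simple_integrand P W t (N k) \<tau> \<xi> \<and>
    (\<integral>\<^sup>+\<omega>. (\<integral>\<^sup>+s\<in>{0..t}. ennreal ((f s \<omega> - simple_process (N k) \<tau> \<xi> s \<omega>)\<^sup>2) \<partial>lborel) \<partial>P) \<le> ennreal ((1 / 4) ^ k)" ..
  from choice[OF this] obtain \<tau> where "\<forall>k. \<exists>\<xi>. simple_integrand P W t (N k) (\<tau> k) \<xi> \<and>
    (\<integral>\<^sup>+\<omega>. (\<integral>\<^sup>+s\<in>{0..t}. ennreal ((f s \<omega> - simple_process (N k) (\<tau> k) \<xi> s \<omega>)\<^sup>2) \<partial>lborel) \<partial>P) \<le> ennreal ((1 / 4) ^ k)" ..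
  from choice[OF this] obtain \<xi> where S: "\<And>k. simple_integrand P W t (N k) (\<tau> k) (\<xi> k)"
    and dist: "\<And>k. (\<integral>\<^sup>+\<omega>. (\<integral>\<^sup>+s\<in>{0..t}. ennreal ((f s \<omega> - simple_process (N k) (\<tau> k) (\<xi> k) s \<omega>)\<^sup>2) \<partial>lborel) \<partial>P) \<le> ennreal ((1 / 4) ^ k)"
    by blast
  define \<phi> where "\<phi> k = simple_process (N k) (\<tau> k) (\<xi> k)" for k
  define Y where "Y \<omega> = (LINT s:{0..t}|lborel. f s \<omega>)" for \<omega>
  define X where "X k \<omega> = (LINT s:{0..t}|lborel. \<phi> k s \<omega>)" for k \<omega>
  have \<phi>m: "(\<lambda>(s, \<omega>). \<phi> k s \<omega>) \<in> borel_measurable (borel \<Otimes>\<^sub>M P)" for k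
    unfolding \<phi>_def by (rule elem_measurable(2)[OF simple_elem[OF S]])
  note m = measurable_ext[OF fa]
  have \<xi>m: "\<xi> k i \<in> borel_measurable (F t)" if "i < N k" for k i
  proof (rule measurable_F_mono)
    show "\<tau> k i \<le> t" using simple_integrand_le(3)[OF S, of i i k] that by simp
    show "\<xi> k i \<in> borel_measurable (F (\<tau> k i))" using S[of k] that by (simp add: simple_integrand_def)
  qed
  \<comment> \<open>The time integral of a simple process is a finite sum of step values, all known
    by time \<open>t\<close>, weighted with the step lengths.\<close>
  have Xeq: "X k \<omega> = (\<Sum>i<N k. \<xi> k i \<omega> * (\<tau> k (Suc i) - \<tau> k i))" for k \<omega>
  proof -
    have "indicator {0..t} s *\<^sub>R \<phi> k s \<omega> = simple_process (N k) (\<tau> k) (\<xi> k) s \<omega>" for s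
      unfolding \<phi>_def using simple_process_outside[OF S, of s k \<omega>] by (cases "s \<in> {0..t}") auto
    then have "X k \<omega> = (\<integral>s. (\<Sum>i<N k. \<xi> k i \<omega> * indicator {\<tau> k i<..\<tau> k (Suc i)} s) \<partial>lborel)"
      unfolding X_def set_lebesgue_integral_def simple_process_def by simp
    also have "\<dots> = (\<Sum>i<N k. \<xi> k i \<omega> * (\<tau> k (Suc i) - \<tau> k i))"
    proof (subst Bochner_Integration.integral_sum)
      fix i assume "i \<in> {..<N k}"
      then have le: "\<tau> k i \<le> \<tau> k (Suc i)" using simple_integrand_le(2)[OF S, of i "Suc i" k] by auto
      then show "integrable lborel (\<lambda>s. \<xi> k i \<omega> * indicator {\<tau> k i<..\<tau> k (Suc i)} s)" by simp
    next
      show "(\<Sum>i<N k. \<integral>s. \<xi> k i \<omega> * indicator {\<tau> k i<..\<tau> k (Suc i)} s \<partial>lborel) = (\<Sum>i<N k. \<xi> k i \<omega> * (\<tau> k (Suc i) - \<tau> k i))"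
      proof (rule sum.cong)
        fix i assume "i \<in> {..<N k}"
        then have le: "\<tau> k i \<le> \<tau> k (Suc i)" using simple_integrand_le(2)[OF S, of i "Suc i" k] by auto
        then show "(\<integral>s. \<xi> k i \<omega> * indicator {\<tau> k i<..\<tau> k (Suc i)} s \<partial>lborel) = \<xi> k i \<omega> * (\<tau> k (Suc i) - \<tau> k i)" by simp
      qed simp
    qed
    finally show ?thesis .
  qed
  have XF: "X k \<in> borel_measurable (F t)" for k
    unfolding Xeq[abs_def] by (intro borel_measurable_sum borel_measurable_times \<xi>m borel_measurable_const) auto
  have Yeq: "Y \<omega> = (\<integral>s. indicator {0..t} s * f s \<omega> \<partial>lborel)" for \<omega>
    by (simp add: Y_def set_lebesgue_integral_def)
  have YP: "Y \<in> borel_measurable P"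
    unfolding Yeq[abs_def]
  proof (rule lborel.borel_measurable_lebesgue_integral)
    note [measurable (raw)] = measurable_process_comp[OF m]
    show "(\<lambda>(\<omega>, s). indicator {0..t} s * f s \<omega>) \<in> borel_measurable (P \<Otimes>\<^sub>M lborel)" by measurable
  qed
  have "(\<integral>\<^sup>+\<omega>. ennreal ((X k \<omega> - Y \<omega>)\<^sup>2) \<partial>P) \<le> ennreal (t * (1 / 4) ^ k)" for k
  proof -
    have "(\<integral>\<^sup>+\<omega>. ennreal ((X k \<omega> - Y \<omega>)\<^sup>2) \<partial>P) \<le>
      (\<integral>\<^sup>+\<omega>. ennreal t * (\<integral>\<^sup>+s. ennreal ((indicator {0..t} s * (f s \<omega> - \<phi> k s \<omega>))\<^sup>2) \<partial>lborel) \<partial>P)"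
    proof (rule nn_integral_mono_AE)
      show "AE \<omega> in P. ennreal ((X k \<omega> - Y \<omega>)\<^sup>2) \<le>
         ennreal t * (\<integral>\<^sup>+s. ennreal ((indicator {0..t} s * (f s \<omega> - \<phi> k s \<omega>))\<^sup>2) \<partial>lborel)"
        using L2_process_paths[OF f] AE_space
      proof eventually_elim
        case (elim \<omega>)
        note [measurable] = sectionI[OF m elim(2)] sectionI[OF \<phi>m elim(2)]
        have i: "set_integrable lborel {0..t} (\<lambda>s. \<phi> k s \<omega>)"
          unfolding \<phi>_def simple_process_def set_integrable_def real_scaleR_def sum_distrib_left
        proof (intro Bochner_Integration.integrable_sum)
          fix i
          have "integrable lborel (\<lambda>s. \<xi> k i \<omega> * (indicator {0..t} s * indicator {\<tau> k i<..\<tau> k (Suc i)} s))"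
            by (intro integrable_mult_right integrable_real_mult_indicator) (auto simp: less_top[symmetric] emeasure_lborel_Icc_eq)
          then show "integrable lborel (\<lambda>s. indicator {0..t} s * (\<xi> k i \<omega> * indicator {\<tau> k i<..\<tau> k (Suc i)} s))"
            by (simp add: mult_ac)
        qed
        have "Y \<omega> - X k \<omega> = (LINT s:{0..t}|lborel. f s \<omega> - \<phi> k s \<omega>)"
          unfolding Y_def X_def using elim(1) i by (rule set_integral_diff(2)[symmetric])
        also have "\<dots> = (LINT s:{0..t}|lborel. indicator {0..t} s * (f s \<omega> - \<phi> k s \<omega>))"
          unfolding set_lebesgue_integral_def by (intro Bochner_Integration.integral_cong) (auto simp: indicator_def)
        finally have "ennreal ((Y \<omega> - X k \<omega>)\<^sup>2) \<le> ennreal (t - 0) *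
           (\<integral>\<^sup>+s\<in>{0..t}. ennreal ((indicator {0..t} s * (f s \<omega> - \<phi> k s \<omega>))\<^sup>2) \<partial>lborel)"
          using t by (simp only:) (rule square_set_integral_le, simp_all add: right_diff_distrib)
        also have "(\<integral>\<^sup>+s\<in>{0..t}. ennreal ((indicator {0..t} s * (f s \<omega> - \<phi> k s \<omega>))\<^sup>2) \<partial>lborel) =
           (\<integral>\<^sup>+s. ennreal ((indicator {0..t} s * (f s \<omega> - \<phi> k s \<omega>))\<^sup>2) \<partial>lborel)"
          by (intro nn_integral_cong) (auto simp: indicator_def)
        finally show ?case by (simp add: power2_commute)
      qed
    qed
    also have "\<dots> = ennreal t * (\<integral>\<^sup>+\<omega>. (\<integral>\<^sup>+s. ennreal ((indicator {0..t} s * (f s \<omega> - \<phi> k s \<omega>))\<^sup>2) \<partial>lborel) \<partial>P)"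
    proof (intro nn_integral_cmult measurable_nn2)
      note [measurable] = m \<phi>m
      show "(\<lambda>(s, \<omega>). indicator {0..t} s * (f s \<omega> - \<phi> k s \<omega>)) \<in> borel_measurable (borel \<Otimes>\<^sub>M P)"
        unfolding right_diff_distrib by measurable
    qed
    also have "\<dots> \<le> ennreal t * ennreal ((1 / 4) ^ k)"
      using dist[of k] unfolding nn2_ext \<phi>_def by (rule mult_left_mono) simp
    finally show ?thesis using t by (simp add: ennreal_mult)
  qed
  then have "AE \<omega> in P. (\<lambda>k. X k \<omega>) \<longlonglongrightarrow> Y \<omega>"
    by (intro fast_L2_convergence_AE[OF _ YP _ t] measurable_F_P[OF XF])
  then have "AE \<omega> in P. lim (\<lambda>k. X k \<omega>) = Y \<omega>"
    by eventually_elim (rule limI)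
  \<comment> \<open>The limit agrees with \<open>Y\<close> only almost surely, which suffices
    because the filtration contains all null sets.\<close>
  then have "Y \<in> borel_measurable (F t)"
    by (rule measurable_F_AE_eq[rotated]) (intro borel_measurable_lim_metric XF)
  then show ?thesis by (simp add: Y_def[abs_def])
qed

text \<open>With \<open>k = 1\<close> this covers plain time integrals, with the Volterra kernel the
  explicit solution. Adaptedness at time \<open>t\<close> comes from
  \<open>time_integral_measurable_F\<close>, applied to \<open>k (t - s) * f s \<omega>\<close> with
  \<open>t\<close> frozen.\<close>

lemma L2_process_convolution:
  assumes f: "L2_process T f" and k: "continuous_on UNIV k" and T: "0 < T"
  shows "L2_process T (\<lambda>t \<omega>. LINT s:{0..t}|lborel. k (t - s) * f s \<omega>)"
proof -
  have km[measurable]: "k \<in> borel_measurable borel" by (rule borel_measurable_continuous_onI[OF k])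
  have "compact (k ` {-T..T})" by (intro compact_continuous_image continuous_on_subset[OF k]) auto
  from compact_imp_bounded[OF this] obtain C where "\<forall>x\<in>k ` {-T..T}. norm x \<le> C"
    unfolding bounded_iff ..
  then have C: "\<And>s. s \<in> {-T..T} \<Longrightarrow> \<bar>k s\<bar> \<le> C" by simp
  note m = measurable_ext[OF f[unfolded L2_process_def, THEN conjunct1]]
  have h: "L2_process t (\<lambda>s \<omega>. k (t - s) * f s \<omega>)" if "t \<in> {0..T}" for t
    by (rule L2_process_bounded_mult[OF L2_process_le[OF f]]) (use that in \<open>auto intro!: C\<close>)
  define g where "g t \<omega> = (LINT s:{0..t}|lborel. k (t - s) * f s \<omega>)" for t \<omega>
  \<comment> \<open>The same integral with \<open>f\<close> extended by zero and the range of
    integration moved into an indicator, so that joint measurability can be read off on the whole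
    line.\<close>
  define g0 where "g0 t \<omega> = (\<integral>s. indicator {s. 0 \<le> s \<and> s \<le> t} s * (k (t - s) * (indicator {0..T} s * f s \<omega>)) \<partial>lborel)" for t \<omega>
  have gg0: "g t \<omega> = g0 t \<omega>" if "t \<in> {0..T}" for t \<omega>
    unfolding g_def g0_def set_lebesgue_integral_def using that
    by (intro Bochner_Integration.integral_cong) (auto simp: indicator_def)
  have g0: "(\<lambda>(t, \<omega>). g0 t \<omega>) \<in> borel_measurable (borel \<Otimes>\<^sub>M P)"
  proof -
    note [measurable (raw)] = measurable_process_comp[OF m]
    show ?thesis unfolding g0_def by measurable
  qed
  have "adapted_process P W T g"
    unfolding adapted_process_def
  proof (intro conjI ballI)
    have "(\<lambda>(t, \<omega>). g t \<omega>) \<in> borel_measurable (restrict_space borel {0..T} \<Otimes>\<^sub>M P) \<longleftrightarrow>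
        (\<lambda>(t, \<omega>). g0 t \<omega>) \<in> borel_measurable (restrict_space borel {0..T} \<Otimes>\<^sub>M P)"
      by (rule measurable_cong) (auto simp: space_pair_measure space_restrict_space gg0)
    then show "(\<lambda>(t, \<omega>). g t \<omega>) \<in> borel_measurable (restrict_space borel {0..T} \<Otimes>\<^sub>M P)"
      using measurable_restrict_process[OF g0] by simp
    show "g t \<in> borel_measurable (F t)" if "t \<in> {0..T}" for t
      unfolding g_def using that by (intro time_integral_measurable_F h) auto
  qed
  moreover have "(\<integral>\<^sup>+\<omega>. (\<integral>\<^sup>+t\<in>{0..T}. ennreal ((g t \<omega>)\<^sup>2) \<partial>lborel) \<partial>P) < \<infinity>"
  proof -
    have "(\<integral>\<^sup>+\<omega>. (\<integral>\<^sup>+t\<in>{0..T}. ennreal ((g t \<omega>)\<^sup>2) \<partial>lborel) \<partial>P) \<le>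
      (\<integral>\<^sup>+\<omega>. ennreal (T * T * C\<^sup>2) * (\<integral>\<^sup>+s. ennreal ((indicator {0..T} s * f s \<omega>)\<^sup>2) \<partial>lborel) \<partial>P)"
    proof (rule nn_integral_mono)
      fix \<omega> assume \<omega>: "\<omega> \<in> space P"
      note [measurable] = sectionI[OF m \<omega>]
      define q where "q = (\<integral>\<^sup>+s. ennreal ((indicator {0..T} s * f s \<omega>)\<^sup>2) \<partial>lborel)"
      have "ennreal ((g t \<omega>)\<^sup>2) \<le> ennreal T * (ennreal (C\<^sup>2) * q)" if t: "t \<in> {0..T}" for t
      proof -
        have "g t \<omega> = (LINT s:{0..t}|lborel. k (t - s) * (indicator {0..T} s * f s \<omega>))"
          unfolding g_def set_lebesgue_integral_def using t by (intro Bochner_Integration.integral_cong) (auto simp: indicator_def)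
        then have "ennreal ((g t \<omega>)\<^sup>2) \<le> ennreal (t - 0) * (\<integral>\<^sup>+s\<in>{0..t}. ennreal ((k (t - s) * (indicator {0..T} s * f s \<omega>))\<^sup>2) \<partial>lborel)"
          using t by (simp only:) (rule square_set_integral_le, simp_all)
        also have "\<dots> \<le> ennreal T * (\<integral>\<^sup>+s. ennreal (C\<^sup>2) * ennreal ((indicator {0..T} s * f s \<omega>)\<^sup>2) \<partial>lborel)"
        proof (rule mult_mono[OF _ nn_integral_mono])
          fix s
          show "ennreal ((k (t - s) * (indicator {0..T} s * f s \<omega>))\<^sup>2) * indicator {0..t} s \<le> ennreal (C\<^sup>2) * ennreal ((indicator {0..T} s * f s \<omega>)\<^sup>2)"
          proof (cases "s \<in> {0..t}")
            case True
            have "(k (t - s))\<^sup>2 \<le> C\<^sup>2" using C[of "t - s"] True t by (intro abs_le_square_iff[THEN iffD1]) auto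
            then have "(k (t - s) * (indicator {0..T} s * f s \<omega>))\<^sup>2 \<le> C\<^sup>2 * (indicator {0..T} s * f s \<omega>)\<^sup>2"
              by (simp add: power_mult_distrib mult_right_mono)
            then show ?thesis using True by (simp add: ennreal_mult[symmetric] ennreal_leI)
          qed simp
        qed (use t in \<open>auto intro: ennreal_leI\<close>)
        also have "\<dots> = ennreal T * (ennreal (C\<^sup>2) * q)"
          unfolding q_def by (subst nn_integral_cmult) auto
        finally show ?thesis .
      qed
      then have "(\<integral>\<^sup>+t\<in>{0..T}. ennreal ((g t \<omega>)\<^sup>2) \<partial>lborel) \<le> (\<integral>\<^sup>+t. (ennreal T * (ennreal (C\<^sup>2) * q)) * indicator {0..T} t \<partial>lborel)"
        by (intro nn_integral_mono) (auto simp: indicator_def)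
      also have "\<dots> = (ennreal T * (ennreal (C\<^sup>2) * q)) * ennreal T"
        using T by (subst nn_integral_cmult_indicator) auto
      also have "\<dots> = ennreal (T * T * C\<^sup>2) * q" using T by (simp add: ennreal_mult mult_ac)
      finally show "(\<integral>\<^sup>+t\<in>{0..T}. ennreal ((g t \<omega>)\<^sup>2) \<partial>lborel) \<le> ennreal (T * T * C\<^sup>2) * q" .
    qed
    also have "\<dots> = ennreal (T * T * C\<^sup>2) * (\<integral>\<^sup>+\<omega>. (\<integral>\<^sup>+s. ennreal ((indicator {0..T} s * f s \<omega>)\<^sup>2) \<partial>lborel) \<partial>P)"
      by (rule nn_integral_cmult[OF measurable_nn2[OF m]])
    also have "\<dots> < \<infinity>" using f unfolding L2_process_def nn2_ext by (simp add: ennreal_mult_less_top)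
    finally show ?thesis .
  qed
  ultimately have "L2_process T g" by (simp add: L2_process_def)
  then show ?thesis by (simp add: g_def[abs_def])
qed

end

section \<open>Integral equations satisfied almost everywhere\<close>

text \<open>An open interval has positive measure and cannot be contained in a null set. Identities
  valid for almost every time are evaluated at times found in this way.\<close>

lemma AE_interval_obtain:
  fixes x y T :: real
  assumes "AE t in lborel. t \<in> {0..T} \<longrightarrow> Q t" "0 \<le> x" "x < y" "y \<le> T"
  obtains t where "x < t" "t < y" "Q t"
proof -
  from AE_E[OF assms(1)] obtain N where N: "{t \<in> space lborel. \<not> (t \<in> {0..T} \<longrightarrow> Q t)} \<subseteq> N" "emeasure lborel N = 0" "N \<in> sets lborel" by blast
  have "\<not> {x<..<y} \<subseteq> N"
  proof
    assume "{x<..<y} \<subseteq> N"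
    from emeasure_mono[OF this N(3)] N(2) assms(3) show False by simp
  qed
  then obtain t where t: "t \<in> {x<..<y}" "t \<notin> N" by blast
  then have "t \<in> {0..T}" using assms by auto
  moreover have "t \<in> {0..T} \<longrightarrow> Q t" using N(1) t(2) by auto
  ultimately show thesis using that t(1) by auto
qed

lemma set_integral_continuous:
  fixes g :: "real \<Rightarrow> real"
  assumes "set_integrable lborel {0..T} g"
  shows "continuous_on {0..T} (\<lambda>t. LINT s:{0..t}|lborel. g s :: real)"
proof -
  have "g integrable_on {0..T}" by (rule set_borel_integral_eq_integral(1)[OF assms])
  then have "continuous_on {0..T} (\<lambda>t. integral {0..t} g)" by (rule indefinite_integral_continuous_1)
  moreover have "integral {0..t} g = (LINT s:{0..t}|lborel. g s)" if "t \<in> {0..T}" for t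
    by (rule set_borel_integral_eq_integral(2)[symmetric], rule set_integrable_subset[OF assms]) (use that in auto)
  ultimately show ?thesis by (rule continuous_on_eq)
qed

lemma enn2real_inj: "0 = enn2real a - enn2real b \<Longrightarrow> a < \<infinity> \<Longrightarrow> b < \<infinity> \<Longrightarrow> a = b"
  by (cases a; cases b) auto

text \<open>The primitive is continuous, so it vanishes at every time and not just at almost every
  one. Then the positive and the negative part of \<open>g\<close> give the same mass to every
  half-line, and a finite measure on the line is determined by these masses.\<close>

lemma AE_zero_of_zero_integrals:
  fixes g :: "real \<Rightarrow> real"
  assumes T: "0 < T" and g: "set_integrable lborel {0..T} g"
    and z: "AE t in lborel. t \<in> {0..T} \<longrightarrow> (LINT s:{0..t}|lborel. g s :: real) = 0"
  shows "AE s in lborel. s \<in> {0..T} \<longrightarrow> g s = 0"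
proof -
  define G where "G t = (LINT s:{0..t}|lborel. g s)" for t
  have cont: "continuous_on {0..T} G" unfolding G_def by (rule set_integral_continuous[OF g])
  have G0: "G t = 0" if t: "t \<in> {0..T}" for t
  proof (rule ccontr)
    assume "G t \<noteq> 0"
    then obtain e where e: "e > 0" "\<And>s. s \<in> {0..T} \<Longrightarrow> dist s t < e \<Longrightarrow> dist (G s) (G t) < \<bar>G t\<bar>"
      using cont[unfolded continuous_on_iff, rule_format, OF t, of "\<bar>G t\<bar>"] by auto
    have "max 0 (t - e) < min T (t + e)" using t e(1) T by auto
    from AE_interval_obtain[OF z _ this] obtain s where "max 0 (t - e) < s" "s < min T (t + e)" "G s = 0"
      unfolding G_def by auto
    then have "s \<in> {0..T}" "dist s t < e" using t by (auto simp: dist_real_def)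
    from e(2)[OF this] \<open>G s = 0\<close> show False by (simp add: dist_real_def)
  qed
  define h where "h s = indicator {0..T} s * g s" for s
  have h: "integrable lborel h" using g by (simp add: h_def[abs_def] set_integrable_def)
  then have [measurable]: "h \<in> borel_measurable borel" by auto
  have hI: "(\<integral>s. indicator {x<..} s * h s \<partial>lborel) = 0" for x
  proof -
    have i: "integrable lborel (\<lambda>s. indicator A s * h s)" if "A \<in> sets borel" for A
      using integrable_mult_indicator[OF _ h, of A] that by simp
    have tot: "(\<integral>s. h s \<partial>lborel) = 0" using G0[of T] T by (simp add: G_def set_lebesgue_integral_def h_def)
    have le: "(\<integral>s. indicator {..x} s * h s \<partial>lborel) = 0"
    proof -
      consider "x < 0" | "x \<in> {0..T}" | "T < x" by fastforce
      then show ?thesis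
      proof cases
        case 1
        then have "(\<lambda>s. indicator {..x} s * h s) = (\<lambda>s. 0)" by (auto simp: h_def indicator_def)
        then show ?thesis by simp
      next
        case 2
        have "(\<integral>s. indicator {..x} s * h s \<partial>lborel) = G x"
          unfolding G_def set_lebesgue_integral_def using 2
          by (intro Bochner_Integration.integral_cong) (auto simp: h_def indicator_def)
        then show ?thesis using G0[OF 2] by simp
      next
        case 3
        then have "(\<lambda>s. indicator {..x} s * h s) = h" by (auto simp: h_def indicator_def fun_eq_iff)
        then show ?thesis using tot by simp
      qed
    qed
    have "indicator {x<..} s * h s = h s - indicator {..x} s * h s" for s by (auto simp: indicator_def)
    then show ?thesis using tot le h i[of "{..x}"] by simp
  qed
  have fin: "(\<integral>\<^sup>+s. ennreal (h s) * indicator A s \<partial>lborel) < \<infinity>" "(\<integral>\<^sup>+s. ennreal (- h s) * indicator A s \<partial>lborel) < \<infinity>" for A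
  proof -
    have "(\<integral>\<^sup>+s. ennreal (norm (h s)) \<partial>lborel) < \<infinity>" using h by (simp add: integrable_iff_bounded)
    moreover have "(\<integral>\<^sup>+s. ennreal (h s) * indicator A s \<partial>lborel) \<le> (\<integral>\<^sup>+s. ennreal (norm (h s)) \<partial>lborel)"
      "(\<integral>\<^sup>+s. ennreal (- h s) * indicator A s \<partial>lborel) \<le> (\<integral>\<^sup>+s. ennreal (norm (h s)) \<partial>lborel)"
      by (intro nn_integral_mono; auto simp: indicator_def intro!: ennreal_leI)+
    ultimately show "(\<integral>\<^sup>+s. ennreal (h s) * indicator A s \<partial>lborel) < \<infinity>" "(\<integral>\<^sup>+s. ennreal (- h s) * indicator A s \<partial>lborel) < \<infinity>"
      by (auto intro: le_less_trans)
  qed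
  \<comment> \<open>Since \<open>ennreal\<close> cuts off negative values, the two densities are the
    positive and the negative part of \<open>h\<close>, which agree only where \<open>h\<close> is
    0.\<close>
  have "density lborel (\<lambda>s. ennreal (h s)) = density lborel (\<lambda>s. ennreal (- h s))"
  proof (rule measure_eqI_lessThan)
    fix x :: real
    have i: "integrable lborel (\<lambda>s. indicator {x<..} s * h s)"
      using integrable_mult_indicator[OF _ h, of "{x<..}"] by simp
    have "0 = (\<integral>s. indicator {x<..} s * h s \<partial>lborel)" using hI by simp
    also have "\<dots> = enn2real (\<integral>\<^sup>+s. ennreal (indicator {x<..} s * h s) \<partial>lborel) - enn2real (\<integral>\<^sup>+s. ennreal (- (indicator {x<..} s * h s)) \<partial>lborel)"
      by (rule real_lebesgue_integral_def[OF i])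
    also have "(\<integral>\<^sup>+s. ennreal (indicator {x<..} s * h s) \<partial>lborel) = (\<integral>\<^sup>+s. ennreal (h s) * indicator {x<..} s \<partial>lborel)"
      by (intro nn_integral_cong) (auto simp: indicator_def)
    also have "(\<integral>\<^sup>+s. ennreal (- (indicator {x<..} s * h s)) \<partial>lborel) = (\<integral>\<^sup>+s. ennreal (- h s) * indicator {x<..} s \<partial>lborel)"
      by (intro nn_integral_cong) (auto simp: indicator_def)
    finally have "(\<integral>\<^sup>+s. ennreal (h s) * indicator {x<..} s \<partial>lborel) = (\<integral>\<^sup>+s. ennreal (- h s) * indicator {x<..} s \<partial>lborel)"
      using fin[of "{x<..}"] by (intro enn2real_inj) auto
    then show "emeasure (density lborel (\<lambda>s. ennreal (h s))) {x<..} = emeasure (density lborel (\<lambda>s. ennreal (- h s))) {x<..}"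
      by (simp add: emeasure_density)
    show "emeasure (density lborel (\<lambda>s. ennreal (h s))) {x<..} < \<infinity>" using fin by (simp add: emeasure_density)
  qed auto
  then have "AE s in lborel. ennreal (h s) = ennreal (- h s)"
    by (intro sigma_finite_measure.density_unique[OF lborel.sigma_finite_measure_axioms]) auto
  then show ?thesis
  proof eventually_elim
    case (elim s)
    then have "h s = 0" by (cases "h s \<ge> 0") (auto simp: ennreal_neg ennreal_eq_0_iff not_le)
    then show ?case by (auto simp: h_def)
  qed
qed

text \<open>Gronwall's inequality for a function that is merely integrable and obeys the bound
  almost everywhere. Inserting the bound into itself \<open>k\<close> times produces the factor
  \<open>(C * t) ^ k / fact k\<close>, which tends to 0.\<close>

lemma AE_zero_of_integral_bound:
  fixes \<phi> :: "real \<Rightarrow> real"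
  assumes T: "0 < T" and \<phi>: "set_integrable lborel {0..T} \<phi>" "\<And>s. 0 \<le> \<phi> s" and C: "0 \<le> C"
    and le: "AE t in lborel. t \<in> {0..T} \<longrightarrow> \<phi> t \<le> C * (LINT s:{0..t}|lborel. \<phi> s)"
  shows "AE t in lborel. t \<in> {0..T} \<longrightarrow> \<phi> t = 0"
proof -
  define \<Phi> where "\<Phi> t = (LINT s:{0..t}|lborel. \<phi> s)" for t
  have i: "set_integrable lborel {0..t} \<phi>" if "t \<in> {0..T}" for t
    by (rule set_integrable_subset[OF \<phi>(1)]) (use that in auto)
  define K where "K = \<Phi> T"
  have bound: "\<Phi> t \<le> K * (C * t) ^ k / fact k" if "t \<in> {0..T}" for t k
    using that
  proof (induction k arbitrary: t)
    case 0
    have "\<Phi> t \<le> \<Phi> T" unfolding \<Phi>_def set_lebesgue_integral_def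
      using i[OF 0] i[of T] T 0 \<phi>(2) by (intro integral_mono) (auto simp: set_integrable_def indicator_def)
    then show ?case by (simp add: K_def)
  next
    case (Suc k)
    have ci: "set_integrable lborel {0..t} (\<lambda>s. C * (K * (C * s) ^ k / fact k))"
      by (rule borel_integrable_atLeastAtMost') (intro continuous_intros, simp_all)
    have "\<Phi> t \<le> (LINT s:{0..t}|lborel. C * (K * (C * s) ^ k / fact k))"
      unfolding \<Phi>_def
    proof (rule set_integral_mono_AE[OF i[OF Suc.prems] ci])
      show "AE s\<in>{0..t} in lborel. \<phi> s \<le> C * (K * (C * s) ^ k / fact k)"
        using le
      proof eventually_elim
        case (elim s)
        show ?case
        proof
          assume "s \<in> {0..t}"
          then have s: "s \<in> {0..T}" using Suc.prems by auto
          then have "\<phi> s \<le> C * \<Phi> s" using elim by (simp add: \<Phi>_def)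
          also have "\<dots> \<le> C * (K * (C * s) ^ k / fact k)" by (rule mult_left_mono[OF Suc.IH[OF s] C])
          finally show "\<phi> s \<le> C * (K * (C * s) ^ k / fact k)" .
        qed
      qed
    qed
    also have "\<dots> = integral {0..t} (\<lambda>s. C * (K * (C * s) ^ k / fact k))"
      by (rule set_borel_integral_eq_integral(2)[OF ci])
    also have "\<dots> = K * (C * t) ^ Suc k / fact (Suc k)"
    proof -
      have "((\<lambda>s. C * (K * (C * s) ^ k / fact k)) has_integral (K * (C * t) ^ Suc k / fact (Suc k) - K * (C * 0) ^ Suc k / fact (Suc k))) {0..t}"
      proof (rule fundamental_theorem_of_calculus)
        show "0 \<le> t" using Suc.prems by simp
        fix s assume "s \<in> {0..t}"
        have "((\<lambda>s. K * (C * s) ^ Suc k / fact (Suc k)) has_real_derivative (K * (of_nat (Suc k) * (C * s) ^ k * C) / fact (Suc k))) (at s within {0..t})"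
          by (rule derivative_eq_intros refl | simp)+
        also have "K * (of_nat (Suc k) * (C * s) ^ k * C) / fact (Suc k) = C * (K * (C * s) ^ k / fact k)"
          by (simp add: fact_Suc del: of_nat_Suc)
        finally show "((\<lambda>s. K * (C * s) ^ Suc k / fact (Suc k)) has_vector_derivative C * (K * (C * s) ^ k / fact k)) (at s within {0..t})"
          by (simp add: has_real_derivative_iff_has_vector_derivative)
      qed
      from integral_unique[OF this] show ?thesis by simp
    qed
    finally show ?case .
  qed
  have \<Phi>0: "\<Phi> t \<le> 0" if t: "t \<in> {0..T}" for t
  proof (rule LIMSEQ_le_const)
    have "(\<lambda>k. (C * t) ^ k / fact k) \<longlonglongrightarrow> 0"
      using summable_LIMSEQ_zero[OF summable_exp[of "C * t"]] by (simp add: inverse_eq_divide)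
    then have "(\<lambda>k. K * ((C * t) ^ k / fact k)) \<longlonglongrightarrow> K * 0" by (intro tendsto_intros)
    then show "(\<lambda>k. K * (C * t) ^ k / fact k) \<longlonglongrightarrow> 0" by simp
  qed (use bound[OF t] in auto)
  have "AE t in lborel. t \<in> {0..T} \<longrightarrow> \<phi> t \<le> 0"
    using le
  proof eventually_elim
    case (elim t)
    show ?case
    proof
      assume t: "t \<in> {0..T}"
      then have "\<phi> t \<le> C * \<Phi> t" using elim by (simp add: \<Phi>_def)
      also have "\<dots> \<le> 0" using C \<Phi>0[OF t] by (simp add: mult_nonneg_nonpos)
      finally show "\<phi> t \<le> 0" .
    qed
  qed
  then show ?thesis by eventually_elim (use \<phi>(2) in \<open>auto intro: antisym\<close>)
qed

section \<open>Step integrands, exchange of null sets, and local energy\<close>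

context wiener begin

lemma has_ito_integral_step:
  assumes a: "0 \<le> a" and t: "0 \<le> t"
  shows "has_ito_integral P W t (\<lambda>s \<omega>. c * indicator {a<..} s) (\<lambda>\<omega>. c * (W t \<omega> - W (min t a) \<omega>))"
proof -
  \<comment> \<open>For \<open>t \<le> a\<close> there must be no step at all, because a simple
    integrand needs strictly increasing points; \<open>\<tau> 0 = min a t\<close> keeps the
    partition inside \<open>[0,t]\<close> in that case too.\<close>
  define N where "N = (if a < t then 1 else 0 :: nat)"
  define \<tau> where "\<tau> i = (if i = (0::nat) then min a t else t)" for i
  define \<xi> where "\<xi> = (\<lambda>(i::nat) (\<omega>::'w). c)"
  have S: "simple_integrand P W t N \<tau> \<xi>"
    using a t by (auto simp: simple_integrand_def N_def \<tau>_def \<xi>_def)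
  have p: "simple_process N \<tau> \<xi> s \<omega> = c * indicator {a<..} s" if "s \<in> {0..t}" for s \<omega>
    using that by (auto simp: simple_process_def N_def \<tau>_def \<xi>_def indicator_def)
  have i: "simple_ito W N \<tau> \<xi> \<omega> = c * (W t \<omega> - W (min t a) \<omega>)" for \<omega>
    by (auto simp: simple_ito_def N_def \<tau>_def \<xi>_def min_def)
  have "L2_process t (\<lambda>s \<omega>. (c * indicator {a<..} s) * 1)"
    by (rule L2_process_bounded_mult[OF L2_process_const, where C = "\<bar>c\<bar>"]) (auto simp: indicator_def)
  then have "adapted_process P W t (\<lambda>s \<omega>. c * indicator {a<..} s)"
    by (simp add: L2_process_def)
  moreover have "(\<integral>\<^sup>+\<omega>. (\<integral>\<^sup>+s\<in>{0..t}. ennreal ((c * indicator {a<..} s - simple_process N \<tau> \<xi> s \<omega>)\<^sup>2) \<partial>lborel) \<partial>P) = (\<integral>\<^sup>+\<omega>. (\<integral>\<^sup>+s. 0 \<partial>(lborel::real measure)) \<partial>P)"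
  proof (intro nn_integral_cong)
    fix \<omega> s
    show "ennreal ((c * indicator {a<..} s - simple_process N \<tau> \<xi> s \<omega>)\<^sup>2) * indicator {0..t} s = 0"
      by (cases "s \<in> {0..t}") (simp_all add: p)
  qed
  ultimately show ?thesis
    unfolding has_ito_integral_def using a t S i
    by (intro conjI exI[of _ "\<lambda>_. N"] exI[of _ "\<lambda>_. \<tau>"] exI[of _ "\<lambda>_. \<xi>"]) auto
qed

text \<open>A solution satisfies its equation outside null sets that may differ from time to time.
  The exchange produces a single null set of outcomes outside which the path satisfies it at almost
  every time, as pathwise arguments require.\<close>

lemma AE_swap_process:
  assumes "adapted_process P W T h"
  shows "(AE t in lborel. t \<in> {0..T} \<longrightarrow> (AE \<omega> in P. h t \<omega> = 0)) \<longleftrightarrow>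
    (AE \<omega> in P. AE t in lborel. t \<in> {0..T} \<longrightarrow> h t \<omega> = 0)"
proof -
  interpret L: pair_sigma_finite "lborel :: real measure" P by (rule lborel_P)
  define h0 where "h0 t \<omega> = indicator {0..T} t * h t \<omega>" for t \<omega>
  note [measurable (raw)] = measurable_process_comp[OF measurable_ext[OF assms], folded h0_def]
  have "(AE t in lborel. AE \<omega> in P. h0 t \<omega> = 0) \<longleftrightarrow> (AE \<omega> in P. AE t in lborel. h0 t \<omega> = 0)"
    by (rule L.AE_commute) measurable
  moreover have "(t \<in> {0..T} \<longrightarrow> (AE \<omega> in P. h t \<omega> = 0)) = (AE \<omega> in P. h0 t \<omega> = 0)" for t
    by (cases "t \<in> {0..T}") (auto simp: h0_def)
  moreover have "(t \<in> {0..T} \<longrightarrow> h t \<omega> = 0) = (h0 t \<omega> = 0)" for t \<omega>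
    by (cases "t \<in> {0..T}") (auto simp: h0_def)
  ultimately show ?thesis by simp
qed

definition energy :: "(real \<Rightarrow> 'w \<Rightarrow> real) \<Rightarrow> real \<Rightarrow> real \<Rightarrow> ennreal" where
  "energy g x y = (\<integral>\<^sup>+\<omega>. (\<integral>\<^sup>+s\<in>{x..y}. ennreal ((g s \<omega>)\<^sup>2) \<partial>lborel) \<partial>P)"

text \<open>Dominated convergence on the product space: the intervals shrink to the time
  \<open>a\<close>, and a single time carries no mass.\<close>

lemma energy_tendsto_zero:
  assumes g: "L2_process T g" and xy: "\<And>k. 0 \<le> x k" "\<And>k. y k \<le> T" and lim: "x \<longlonglongrightarrow> a" "y \<longlonglongrightarrow> a"
  shows "(\<lambda>k::nat. energy g (x k) (y k)) \<longlonglongrightarrow> 0"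
proof -
  interpret L: pair_sigma_finite "lborel :: real measure" P by (rule lborel_P)
  define g0 where "g0 t \<omega> = indicator {0..T} t * g t \<omega>" for t \<omega>
  have m: "(\<lambda>(s, \<omega>). g0 s \<omega>) \<in> borel_measurable (borel \<Otimes>\<^sub>M P)"
    unfolding g0_def by (rule measurable_ext) (use g in \<open>simp add: L2_process_def\<close>)
  note [measurable] = m
  have eq: "energy g (x k) (y k) = (\<integral>\<^sup>+z. (case z of (s, \<omega>) \<Rightarrow> ennreal ((g0 s \<omega>)\<^sup>2) * indicator {x k..y k} s) \<partial>(lborel \<Otimes>\<^sub>M P))" for k
  proof -
    have "energy g (x k) (y k) = (\<integral>\<^sup>+\<omega>. (\<integral>\<^sup>+s. ennreal ((g0 s \<omega>)\<^sup>2) * indicator {x k..y k} s \<partial>lborel) \<partial>P)"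
      unfolding energy_def g0_def using xy[of k] by (intro nn_integral_cong) (auto simp: indicator_def)
    also have "\<dots> = (\<integral>\<^sup>+z. (case z of (s, \<omega>) \<Rightarrow> ennreal ((g0 s \<omega>)\<^sup>2) * indicator {x k..y k} s) \<partial>(lborel \<Otimes>\<^sub>M P))"
      by (rule nn_integral_pair_P) measurable
    finally show ?thesis .
  qed
  have "(\<lambda>k. \<integral>\<^sup>+z. (case z of (s, \<omega>) \<Rightarrow> ennreal ((g0 s \<omega>)\<^sup>2) * indicator {x k..y k} s) \<partial>(lborel \<Otimes>\<^sub>M P)) \<longlonglongrightarrow>
      (\<integral>\<^sup>+z. 0 \<partial>((lborel :: real measure) \<Otimes>\<^sub>M P))"
  proof (rule nn_integral_dominated_convergence[where w = "\<lambda>(s, \<omega>). ennreal ((g0 s \<omega>)\<^sup>2)"])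
    have "(\<integral>\<^sup>+\<omega>. \<integral>\<^sup>+s. ennreal ((g0 s \<omega>)\<^sup>2) \<partial>lborel \<partial>P) < \<infinity>"
      using g unfolding L2_process_def nn2_ext g0_def by simp
    then show "(\<integral>\<^sup>+z. (case z of (s, \<omega>) \<Rightarrow> ennreal ((g0 s \<omega>)\<^sup>2)) \<partial>(lborel \<Otimes>\<^sub>M P)) < \<infinity>"
      by (subst (asm) nn_integral_pair_P) measurable
    show "AE z in lborel \<Otimes>\<^sub>M P. (case z of (s, \<omega>) \<Rightarrow> ennreal ((g0 s \<omega>)\<^sup>2) * indicator {x k..y k} s) \<le> (case z of (s, \<omega>) \<Rightarrow> ennreal ((g0 s \<omega>)\<^sup>2))" for k
      by (intro AE_I2) (auto simp: indicator_def)
    have ev: "\<forall>\<^sub>F k in sequentially. s \<notin> {x k..y k}" if "s \<noteq> a" for s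
    proof (cases "s < a")
      case True
      from order_tendstoD(1)[OF lim(1) this] show ?thesis by eventually_elim auto
    next
      case False
      with that have "a < s" by simp
      from order_tendstoD(2)[OF lim(2) this] show ?thesis by eventually_elim auto
    qed
    have "AE z in lborel \<Otimes>\<^sub>M P. fst z \<noteq> a"
    proof (rule L.AE_pair_measure)
      show "{z \<in> space (lborel \<Otimes>\<^sub>M P). fst z \<noteq> a} \<in> sets (lborel \<Otimes>\<^sub>M P)" by measurable
      show "AE s in lborel. AE \<omega> in P. fst (s, \<omega>) \<noteq> a" using AE_lborel_singleton[of a] by eventually_elim simp
    qed
    then show "AE z in lborel \<Otimes>\<^sub>M P. (\<lambda>k. case z of (s, \<omega>) \<Rightarrow> ennreal ((g0 s \<omega>)\<^sup>2) * indicator {x k..y k} s) \<longlonglongrightarrow> 0"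
    proof eventually_elim
      case (elim z)
      show ?case
        by (rule tendsto_eventually, rule eventually_mono[OF ev[OF elim]]) (auto simp: case_prod_beta')
    qed
  qed (auto intro!: borel_measurable_indicator)
  then show ?thesis by (simp add: eq)
qed

text \<open>Cauchy-Schwarz contributes the length of the interval, and the remaining energy tends to
  0 by itself as the interval shrinks. So the second moment of a time integral is of smaller order
  than the length, hence than that of a Brownian increment.\<close>

lemma time_integral_energy:
  assumes g: "L2_process T g" and xy: "0 \<le> x" "x \<le> y" "y \<le> T"
  shows "(\<integral>\<^sup>+\<omega>. ennreal ((LINT s:{x..y}|lborel. g s \<omega>)\<^sup>2) \<partial>P) \<le> ennreal (y - x) * energy g x y"
    "AE \<omega> in P. (LINT s:{0..y}|lborel. g s \<omega>) - (LINT s:{0..x}|lborel. g s \<omega>) = (LINT s:{x..y}|lborel. g s \<omega>)"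
    "(\<lambda>\<omega>. LINT s:{x..y}|lborel. g s \<omega>) \<in> borel_measurable P"
proof -
  define g0 where "g0 t \<omega> = indicator {0..T} t * g t \<omega>" for t \<omega>
  have m: "(\<lambda>(s, \<omega>). g0 s \<omega>) \<in> borel_measurable (borel \<Otimes>\<^sub>M P)"
    unfolding g0_def by (rule measurable_ext) (use g in \<open>simp add: L2_process_def\<close>)
  note [measurable] = m
  have g0: "(LINT s:{x..y}|lborel. g s \<omega>) = (LINT s:{x..y}|lborel. g0 s \<omega>)" for \<omega>
    unfolding set_lebesgue_integral_def g0_def using xy
    by (intro Bochner_Integration.integral_cong) (auto simp: indicator_def)
  have "(\<integral>\<^sup>+\<omega>. ennreal ((LINT s:{x..y}|lborel. g s \<omega>)\<^sup>2) \<partial>P) \<le>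
      (\<integral>\<^sup>+\<omega>. ennreal (y - x) * (\<integral>\<^sup>+s\<in>{x..y}. ennreal ((g0 s \<omega>)\<^sup>2) \<partial>lborel) \<partial>P)"
    unfolding g0 by (intro nn_integral_mono square_set_integral_le sectionI[OF m] xy)
  also have "\<dots> = ennreal (y - x) * (\<integral>\<^sup>+\<omega>. (\<integral>\<^sup>+s\<in>{x..y}. ennreal ((g0 s \<omega>)\<^sup>2) \<partial>lborel) \<partial>P)"
    by (rule nn_integral_cmult) measurable
  also have "(\<integral>\<^sup>+\<omega>. (\<integral>\<^sup>+s\<in>{x..y}. ennreal ((g0 s \<omega>)\<^sup>2) \<partial>lborel) \<partial>P) = energy g x y"
    unfolding energy_def g0_def using xy by (intro nn_integral_cong) (auto simp: indicator_def)
  finally show "(\<integral>\<^sup>+\<omega>. ennreal ((LINT s:{x..y}|lborel. g s \<omega>)\<^sup>2) \<partial>P) \<le> ennreal (y - x) * energy g x y" .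
  show "(\<lambda>\<omega>. LINT s:{x..y}|lborel. g s \<omega>) \<in> borel_measurable P"
    unfolding g0 unfolding set_lebesgue_integral_def
  proof (rule lborel.borel_measurable_lebesgue_integral)
    note [measurable (raw)] = measurable_process_comp[OF m]
    show "(\<lambda>(\<omega>, s). indicator {x..y} s *\<^sub>R g0 s \<omega>) \<in> borel_measurable (P \<Otimes>\<^sub>M lborel)" by measurable
  qed
  show "AE \<omega> in P. (LINT s:{0..y}|lborel. g s \<omega>) - (LINT s:{0..x}|lborel. g s \<omega>) = (LINT s:{x..y}|lborel. g s \<omega>)"
    using L2_process_paths[OF g]
  proof eventually_elim
    case (elim \<omega>)
    have i: "set_integrable lborel A (\<lambda>s. g s \<omega>)" if "A \<subseteq> {0..T}" "A \<in> sets borel" for A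
      by (rule set_integrable_subset[OF elim]) (use that in auto)
    have sub: "{0..x} \<subseteq> {0..T}" "{x<..y} \<subseteq> {0..T}" "{x..y} \<subseteq> {0..T}" using xy by auto
    have "{0..y} = {0..x} \<union> {x<..y}" "{0..x} \<inter> {x<..y} = {}" using xy by auto
    then have 1: "(LINT s:{0..y}|lborel. g s \<omega>) = (LINT s:{0..x}|lborel. g s \<omega>) + (LINT s:{x<..y}|lborel. g s \<omega>)"
      by (simp only:) (rule set_integral_Un, auto intro!: i sub)
    have "(LINT s:{x<..y}|lborel. g s \<omega>) = (LINT s:{x..y}|lborel. g s \<omega>)"
      unfolding set_lebesgue_integral_def
    proof (rule integral_cong_AE)
      show "AE s in lborel. indicat_real {x<..y} s *\<^sub>R g s \<omega> = indicat_real {x..y} s *\<^sub>R g s \<omega>"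
        using AE_lborel_singleton[of x] by eventually_elim (auto simp: indicator_def)
    qed (use i[OF sub(2)] i[OF sub(3)] in \<open>auto simp: set_integrable_def\<close>)
    with 1 show ?case by simp
  qed
qed

lemma nn_integral_W_incr_sq:
  assumes "0 \<le> x" "x \<le> y"
  shows "(\<integral>\<^sup>+\<omega>. ennreal ((d * (W y \<omega> - W x \<omega>))\<^sup>2) \<partial>P) = ennreal (d\<^sup>2 * (y - x))"
proof (cases "x = y")
  case False
  with assms have xy: "0 \<le> x" "x < y" by auto
  have "(\<integral>\<^sup>+\<omega>. ennreal ((d * (W y \<omega> - W x \<omega>))\<^sup>2) \<partial>P) = ennreal (\<integral>\<omega>. (d * (W y \<omega> - W x \<omega>))\<^sup>2 \<partial>P)"
    by (rule nn_integral_eq_integral) (use W_incr_moments(2)[OF xy] in \<open>auto simp: power_mult_distrib\<close>)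
  then show ?thesis using W_incr_moments(4)[OF xy] by (simp add: power_mult_distrib)
qed simp

lemma real_zero_of_ennreal_bound:
  assumes "\<And>k::nat. ennreal (c\<^sup>2) \<le> b k" "b \<longlonglongrightarrow> 0"
  shows "c = (0::real)"
proof -
  have "ennreal (c\<^sup>2) \<le> 0" by (rule LIMSEQ_le_const[OF assms(2)]) (use assms(1) in blast)
  then show ?thesis by simp
qed

text \<open>On an interval of length \<open>\<delta>\<close> around \<open>a\<close> the jump has size \<open>\<bar>\<beta>\<bar>\<close>, the Brownian term has second moment of order
  \<open>d\<^sup>2 \<delta>\<close>, and that of the time integral is \<open>o(\<delta>)\<close>.\<close>

lemma jump_brownian_integral_independent:
  assumes g: "L2_process T g" and a: "0 < a" "a < T"
    and eq: "AE t in lborel. t \<in> {0..T} \<longrightarrow> (AE \<omega> in P. \<beta> * indicator {a<..} t =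
      c + (LINT s:{0..t}|lborel. g s \<omega>) + d * (W t \<omega> - W (min t a) \<omega>))"
  shows "\<beta> = 0" "c = 0" "d = 0" "AE \<omega> in P. AE s in lborel. s \<in> {0..T} \<longrightarrow> g s \<omega> = 0"
proof -
  let ?Q = "\<lambda>t. AE \<omega> in P. \<beta> * indicator {a<..} t = c + (LINT s:{0..t}|lborel. g s \<omega>) + d * (W t \<omega> - W (min t a) \<omega>)"
  define G where "G x y \<omega> = (LINT s:{x..y}|lborel. g s \<omega>)" for x y \<omega>
  have Gm: "G x y \<in> borel_measurable P" and Ge: "(\<integral>\<^sup>+\<omega>. ennreal ((G x y \<omega>)\<^sup>2) \<partial>P) \<le> ennreal (y - x) * energy g x y"
    and Gd: "AE \<omega> in P. G 0 y \<omega> - G 0 x \<omega> = G x y \<omega>" if "0 \<le> x" "x \<le> y" "y \<le> T" for x y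
    using time_integral_energy[OF g that] by (simp_all add: G_def[abs_def])
  \<comment> \<open>Small enough for intervals of this length on either side of \<open>a\<close> to
    stay inside \<open>[0,T]\<close>, and for one that starts at 0 to end no later than
    \<open>a\<close>.\<close>
  define \<delta> where "\<delta> k = min a (T - a) / real (Suc k)" for k
  have \<delta>: "0 < \<delta> k" "\<delta> k \<le> a" "\<delta> k \<le> T - a" for k
    using a frac_le[of "min a (T - a)" "min a (T - a)" 1 "real (Suc k)"] by (auto simp: \<delta>_def)
  have \<delta>0: "\<delta> \<longlonglongrightarrow> 0" unfolding \<delta>_def by (rule lim_const_over_n[THEN LIMSEQ_Suc])
  have conv: "x \<longlonglongrightarrow> z" if "\<And>k. \<bar>x k - z\<bar> \<le> \<delta> k" for x and z :: real
    by (rule LIM_zero_cancel, rule Lim_null_comparison[OF _ \<delta>0]) (use that in simp)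
  show \<beta>: "\<beta> = 0"
  proof -
    \<comment> \<open>Subtracting the equations at a time before and a time after \<open>a\<close>
      isolates the jump. The equation is known only for almost every time, so both times are picked
      from a set of full measure.\<close>
    have "\<exists>s t. a - \<delta> k < s \<and> s < a \<and> a < t \<and> t < a + \<delta> k \<and> ?Q s \<and> ?Q t" for k
    proof -
      obtain s where "a - \<delta> k < s" "s < a" "?Q s" using AE_interval_obtain[OF eq, of "a - \<delta> k" a] \<delta>[of k] a by auto
      moreover obtain t where "a < t" "t < a + \<delta> k" "?Q t" using AE_interval_obtain[OF eq, of a "a + \<delta> k"] \<delta>[of k] a by auto
      ultimately show ?thesis by blast
    qed
    then have "\<forall>k. \<exists>s t. a - \<delta> k < s \<and> s < a \<and> a < t \<and> t < a + \<delta> k \<and> ?Q s \<and> ?Q t" ..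
    from choice[OF this] obtain s where "\<forall>k. \<exists>t. a - \<delta> k < s k \<and> s k < a \<and> a < t \<and> t < a + \<delta> k \<and> ?Q (s k) \<and> ?Q t" ..
    from choice[OF this] obtain t where "\<forall>k. a - \<delta> k < s k \<and> s k < a \<and> a < t k \<and> t k < a + \<delta> k \<and> ?Q (s k) \<and> ?Q (t k)" ..
    then have st: "\<And>k. a - \<delta> k < s k" "\<And>k. s k < a" "\<And>k. a < t k" "\<And>k. t k < a + \<delta> k" "\<And>k. ?Q (s k)" "\<And>k. ?Q (t k)" by blast+
    have rng: "0 \<le> s k" "s k \<le> t k" "t k \<le> T" for k using st(1-4)[of k] \<delta>[of k] by auto
    have "ennreal (\<beta>\<^sup>2) \<le> 2 * (ennreal T * energy g (s k) (t k)) + 2 * ennreal (d\<^sup>2 * \<delta> k)" for k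
    proof -
      have "AE \<omega> in P. \<beta> = G (s k) (t k) \<omega> + d * (W (t k) \<omega> - W a \<omega>)"
        using st(5)[of k] st(6)[of k] Gd[OF rng, of k]
      proof eventually_elim
        case (elim \<omega>)
        have "min (s k) a = s k" "min (t k) a = a" using st(2,3)[of k] by auto
        then show ?case using elim st(2,3)[of k] by (simp add: G_def)
      qed
      then have "(\<integral>\<^sup>+\<omega>. ennreal (\<beta>\<^sup>2) \<partial>P) = (\<integral>\<^sup>+\<omega>. ennreal ((G (s k) (t k) \<omega> + d * (W (t k) \<omega> - W a \<omega>))\<^sup>2) \<partial>P)"
        by (intro nn_integral_cong_AE) (auto elim!: eventually_mono)
      also have "\<dots> \<le> 2 * (\<integral>\<^sup>+\<omega>. ennreal ((G (s k) (t k) \<omega>)\<^sup>2) \<partial>P) + 2 * (\<integral>\<^sup>+\<omega>. ennreal ((d * (W (t k) \<omega> - W a \<omega>))\<^sup>2) \<partial>P)"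
        using a st(3)[of k] rng[of k]
        by (intro nn_integral_sq_triangle Gm borel_measurable_times borel_measurable_diff W_measurable borel_measurable_const) auto
      also have "(\<integral>\<^sup>+\<omega>. ennreal ((d * (W (t k) \<omega> - W a \<omega>))\<^sup>2) \<partial>P) = ennreal (d\<^sup>2 * (t k - a))"
        by (rule nn_integral_W_incr_sq) (use a st(3)[of k] in auto)
      finally have 1: "ennreal (\<beta>\<^sup>2) \<le> 2 * (\<integral>\<^sup>+\<omega>. ennreal ((G (s k) (t k) \<omega>)\<^sup>2) \<partial>P) + 2 * ennreal (d\<^sup>2 * (t k - a))"
        by (simp add: emeasure_space_1)
      have 2: "(\<integral>\<^sup>+\<omega>. ennreal ((G (s k) (t k) \<omega>)\<^sup>2) \<partial>P) \<le> ennreal T * energy g (s k) (t k)"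
        by (rule order_trans[OF Ge[OF rng]], rule mult_right_mono) (use rng[of k] in \<open>auto intro: ennreal_leI\<close>)
      have 3: "ennreal (d\<^sup>2 * (t k - a)) \<le> ennreal (d\<^sup>2 * \<delta> k)"
        using st(4)[of k] by (intro ennreal_leI mult_left_mono) auto
      show ?thesis by (rule order_trans[OF 1 add_mono[OF mult_left_mono[OF 2] mult_left_mono[OF 3]]]) auto
    qed
    moreover have "(\<lambda>k. 2 * (ennreal T * energy g (s k) (t k)) + 2 * ennreal (d\<^sup>2 * \<delta> k)) \<longlonglongrightarrow> 2 * (ennreal T * 0) + 2 * ennreal (d\<^sup>2 * 0)"
    proof (intro tendsto_add ennreal_tendsto_cmult tendsto_ennrealI tendsto_mult \<delta>0 tendsto_const energy_tendsto_zero[OF g])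
      have "\<bar>s k - a\<bar> \<le> \<delta> k" "\<bar>t k - a\<bar> \<le> \<delta> k" for k
        using st(1-4)[of k] by linarith+
      then show "s \<longlonglongrightarrow> a" "t \<longlonglongrightarrow> a" by (auto intro: conv)
    qed (use rng in auto)
    ultimately show ?thesis by (intro real_zero_of_ennreal_bound) auto
  qed
  show c: "c = 0"
  proof -
    \<comment> \<open>Before \<open>a\<close> there is neither a jump nor a Brownian term, so the
      equation near time 0 isolates \<open>c\<close>.\<close>
    have "\<exists>t. 0 < t \<and> t < \<delta> k \<and> ?Q t" for k
    proof -
      obtain t where "0 < t" "t < \<delta> k" "?Q t" using AE_interval_obtain[OF eq, of 0 "\<delta> k"] \<delta>[of k] a by auto
      then show ?thesis by blast
    qed
    then have "\<forall>k. \<exists>t. 0 < t \<and> t < \<delta> k \<and> ?Q t" ..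
    from choice[OF this] obtain t where "\<forall>k. 0 < t k \<and> t k < \<delta> k \<and> ?Q (t k)" ..
    then have st: "\<And>k. 0 < t k" "\<And>k. t k < \<delta> k" "\<And>k. ?Q (t k)" by blast+
    have rng: "0 \<le> t k" "t k \<le> T" for k using st(1,2)[of k] \<delta>[of k] a by auto
    have "ennreal (c\<^sup>2) \<le> ennreal T * energy g 0 (t k)" for k
    proof -
      have "AE \<omega> in P. c = - G 0 (t k) \<omega>"
        using st(3)[of k]
      proof eventually_elim
        case (elim \<omega>)
        have "min (t k) a = t k" "\<not> a < t k" using st(2)[of k] \<delta>[of k] by auto
        then show ?case using elim by (simp add: G_def \<beta>)
      qed
      then have "(\<integral>\<^sup>+\<omega>. ennreal (c\<^sup>2) \<partial>P) = (\<integral>\<^sup>+\<omega>. ennreal ((G 0 (t k) \<omega>)\<^sup>2) \<partial>P)"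
        by (intro nn_integral_cong_AE) (auto elim!: eventually_mono)
      also have "\<dots> \<le> ennreal T * energy g 0 (t k)"
        by (rule order_trans[OF Ge[OF order_refl rng]], rule mult_right_mono) (use rng[of k] in \<open>auto intro: ennreal_leI\<close>)
      finally show ?thesis by (simp add: emeasure_space_1)
    qed
    moreover have "(\<lambda>k. ennreal T * energy g 0 (t k)) \<longlonglongrightarrow> ennreal T * 0"
    proof (intro ennreal_tendsto_cmult energy_tendsto_zero[OF g])
      have "\<bar>t k - 0\<bar> \<le> \<delta> k" for k using st(1,2)[of k] by linarith
      then show "t \<longlonglongrightarrow> 0" by (rule conv)
    qed (use rng in auto)
    ultimately show ?thesis by (intro real_zero_of_ennreal_bound) auto
  qed
  show d: "d = 0"
  proof -
    \<comment> \<open>Both times now lie after \<open>a\<close>, where the increment of the Brownian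
      term has second moment exactly \<open>d\<^sup>2 * (t - s)\<close>.\<close>
    have "\<exists>s t. a < s \<and> s < t \<and> t < a + \<delta> k \<and> ?Q s \<and> ?Q t" for k
    proof -
      obtain s where s: "a < s" "s < a + \<delta> k" "?Q s" using AE_interval_obtain[OF eq, of a "a + \<delta> k"] \<delta>[of k] a by auto
      moreover obtain t where "s < t" "t < a + \<delta> k" "?Q t" using AE_interval_obtain[OF eq, of s "a + \<delta> k"] \<delta>[of k] a s by auto
      ultimately show ?thesis by blast
    qed
    then have "\<forall>k. \<exists>s t. a < s \<and> s < t \<and> t < a + \<delta> k \<and> ?Q s \<and> ?Q t" ..
    from choice[OF this] obtain s where "\<forall>k. \<exists>t. a < s k \<and> s k < t \<and> t < a + \<delta> k \<and> ?Q (s k) \<and> ?Q t" ..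
    from choice[OF this] obtain t where "\<forall>k. a < s k \<and> s k < t k \<and> t k < a + \<delta> k \<and> ?Q (s k) \<and> ?Q (t k)" ..
    then have st: "\<And>k. a < s k" "\<And>k. s k < t k" "\<And>k. t k < a + \<delta> k" "\<And>k. ?Q (s k)" "\<And>k. ?Q (t k)" by blast+
    have rng: "0 \<le> s k" "s k \<le> t k" "t k \<le> T" for k using st(1-3)[of k] \<delta>[of k] a by auto
    have "ennreal (d\<^sup>2) \<le> energy g (s k) (t k)" for k
    proof -
      have "AE \<omega> in P. d * (W (t k) \<omega> - W (s k) \<omega>) = - G (s k) (t k) \<omega>"
        using st(4)[of k] st(5)[of k] Gd[OF rng, of k]
      proof eventually_elim
        case (elim \<omega>)
        have "min (s k) a = a" "min (t k) a = a" using st(1,2)[of k] by auto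
        then have "d * (W (t k) \<omega> - W a \<omega>) = - G 0 (t k) \<omega>" "d * (W (s k) \<omega> - W a \<omega>) = - G 0 (s k) \<omega>"
          using elim(1,2) by (auto simp: G_def \<beta> c)
        then show ?case using elim(3) by (simp add: algebra_simps)
      qed
      then have "(\<integral>\<^sup>+\<omega>. ennreal ((d * (W (t k) \<omega> - W (s k) \<omega>))\<^sup>2) \<partial>P) = (\<integral>\<^sup>+\<omega>. ennreal ((G (s k) (t k) \<omega>)\<^sup>2) \<partial>P)"
        by (intro nn_integral_cong_AE) (auto elim!: eventually_mono)
      then have "ennreal (d\<^sup>2 * (t k - s k)) \<le> ennreal (t k - s k) * energy g (s k) (t k)"
        using nn_integral_W_incr_sq[OF rng(1,2), of d k] Ge[OF rng, of k] by simp
      moreover have "ennreal (d\<^sup>2 * (t k - s k)) = ennreal (t k - s k) * ennreal (d\<^sup>2)"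
        using rng(2)[of k] by (simp add: ennreal_mult[symmetric] mult.commute)
      \<comment> \<open>The positive length \<open>t k - s k\<close> is a factor on both sides and
        cancels; what remains on the right is the energy, which still tends to 0.\<close>
      ultimately show ?thesis using st(2)[of k] by (simp add: ennreal_mult_le_mult_iff)
    qed
    moreover have "(\<lambda>k. energy g (s k) (t k)) \<longlonglongrightarrow> 0"
    proof (intro energy_tendsto_zero[OF g])
      have "\<bar>s k - a\<bar> \<le> \<delta> k" "\<bar>t k - a\<bar> \<le> \<delta> k" for k
        using st(1-3)[of k] by linarith+
      then show "s \<longlonglongrightarrow> a" "t \<longlonglongrightarrow> a" by (auto intro: conv)
    qed (use rng in auto)
    ultimately show ?thesis by (rule real_zero_of_ennreal_bound)
  qed
  have T: "0 < T" using a by simp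
  have L: "L2_process T (\<lambda>t \<omega>. LINT s:{0..t}|lborel. 1 * g s \<omega>)"
    by (rule L2_process_convolution[OF g _ T, of "\<lambda>_. 1"]) auto
  have "AE t in lborel. t \<in> {0..T} \<longrightarrow> (AE \<omega> in P. (LINT s:{0..t}|lborel. 1 * g s \<omega>) = 0)"
    using eq by eventually_elim (auto simp: \<beta> c d elim!: eventually_mono)
  then have "AE \<omega> in P. AE t in lborel. t \<in> {0..T} \<longrightarrow> (LINT s:{0..t}|lborel. 1 * g s \<omega>) = 0"
    by (subst (asm) AE_swap_process) (use L in \<open>auto simp: L2_process_def\<close>)
  then show "AE \<omega> in P. AE s in lborel. s \<in> {0..T} \<longrightarrow> g s \<omega> = 0"
    using L2_process_paths[OF g]
    by eventually_elim (rule AE_zero_of_zero_integrals[OF T], auto)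
qed

end

section \<open>The Weierstrass form of a regular matrix pencil\<close>

lemma det_nonzero_inverse:
  assumes A: "(A :: real mat) \<in> carrier_mat n n" and d: "det A \<noteq> 0"
  obtains B where "B \<in> carrier_mat n n" "A * B = 1\<^sub>m n" "B * A = 1\<^sub>m n" "det B \<noteq> 0"
proof -
  from det_non_zero_imp_unit[OF A d, of n] have "A \<in> Units (ring_mat TYPE(real) n n)" .
  then obtain B where B: "B \<in> carrier_mat n n" "A * B = 1\<^sub>m n" "B * A = 1\<^sub>m n"
    unfolding Units_def ring_mat_def by auto
  have "det A * det B = 1" using det_mult[OF A B(1)] B(2) by simp
  then have "det B \<noteq> 0" by auto
  with that[OF B] show thesis by blast
qed

lemma det_nonzero_invertible:
  assumes A: "(A :: real mat) \<in> carrier_mat n n" and d: "det A \<noteq> 0"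
  shows "invertible_mat A"
proof -
  from det_nonzero_inverse[OF A d] obtain B where B: "B \<in> carrier_mat n n" "A * B = 1\<^sub>m n" "B * A = 1\<^sub>m n" .
  then show ?thesis
    unfolding invertible_mat_def inverts_mat_def by (intro conjI exI[of _ B]) (use A in auto)
qed

lemma invertible_inverse:
  assumes A: "(A :: real mat) \<in> carrier_mat n n" and i: "invertible_mat A"
  obtains B where "B \<in> carrier_mat n n" "A * B = 1\<^sub>m n" "B * A = 1\<^sub>m n"
proof -
  from i obtain B where B: "A * B = 1\<^sub>m (dim_row A)" "B * A = 1\<^sub>m (dim_row B)"
    unfolding invertible_mat_def inverts_mat_def by auto
  have "dim_col (A * B) = dim_row A" "dim_col (B * A) = dim_row B" unfolding B by simp_all
  then have "B \<in> carrier_mat n n" using A by auto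
  with that B A show thesis by auto
qed

text \<open>Replacing column \<open>i\<close> of the identity by \<open>v\<close> gives determinant
  \<open>v $ i\<close> by Cramer's rule. For a nonzero entry the matrix is nonsingular, and a column
  swap moves \<open>v\<close> to the end.\<close>

lemma exists_nonsingular_last_col:
  fixes v :: "real vec"
  assumes v: "v \<in> carrier_vec (Suc n)" "v \<noteq> 0\<^sub>v (Suc n)"
  obtains N where "N \<in> carrier_mat (Suc n) (Suc n)" "det N \<noteq> 0" "col N n = v"
proof -
  have "\<exists>i<Suc n. v $ i \<noteq> 0"
  proof (rule ccontr)
    assume *: "\<not> ?thesis"
    have "v = 0\<^sub>v (Suc n)" by (rule eq_vecI) (use * v(1) in auto)
    with v(2) show False by simp
  qed
  then obtain i where i: "i < Suc n" "v $ i \<noteq> 0" by blast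
  define R where "R = replace_col (1\<^sub>m (Suc n)) (1\<^sub>m (Suc n) *\<^sub>v v) i"
  have R: "R \<in> carrier_mat (Suc n) (Suc n)" by (simp add: R_def replace_col_def)
  have dR: "det R = v $ i" unfolding R_def using cramer_lemma_mat[of "1\<^sub>m (Suc n)" "Suc n" v i] v i by simp
  have cR: "col R i = v" using v i by (auto simp: R_def replace_col_def)
  show thesis
  proof (cases "i = n")
    case True
    then show ?thesis using that[OF R] dR i cR by simp
  next
    case False
    have "det (swapcols i n R) = - det R" by (rule det_swapcols[OF i(1) lessI False R])
    moreover have "col (swapcols i n R) n = v"
      using R i v cR False by (intro eq_vecI) (auto simp: col_def)
    moreover have "swapcols i n R \<in> carrier_mat (Suc n) (Suc n)" using R by auto
    ultimately show ?thesis using that[of "swapcols i n R"] dR i(2) by (simp del: index_mat_swapcols)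
  qed
qed

lemma mult_mat_unit_vec_col:
  assumes "(A :: real mat) \<in> carrier_mat n m" "j < m"
  shows "A *\<^sub>v unit_vec m j = col A j"
  using assms by (intro eq_vecI) auto

lemma col_mult3:
  assumes "M \<in> carrier_mat n n" "E \<in> carrier_mat n n" "(N :: real mat) \<in> carrier_mat n n" "j < n"
  shows "col (M * E * N) j = M *\<^sub>v (E *\<^sub>v col N j)"
proof -
  have "col (M * E * N) j = (M * E * N) *\<^sub>v unit_vec n j" using mult_mat_unit_vec_col[of "M * E * N" n n j] assms by auto
  also have "\<dots> = M *\<^sub>v (E *\<^sub>v (N *\<^sub>v unit_vec n j))"
    using assms by (simp add: assoc_mult_mat_vec[of _ n n _ n])
  finally show ?thesis using mult_mat_unit_vec_col[of N n n j] assms by simp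
qed

lemma block_last_col:
  fixes X :: "real mat"
  assumes X: "X \<in> carrier_mat (Suc n) (Suc n)" and c: "col X n = d \<cdot>\<^sub>v unit_vec (Suc n) n"
  obtains X2 x where "X2 \<in> carrier_mat n n" "x \<in> carrier_mat 1 n" "X = four_block_mat X2 (0\<^sub>m n 1) x (d \<cdot>\<^sub>m 1\<^sub>m 1)"
proof -
  define X2 where "X2 = mat n n (\<lambda>ij. X $$ ij)"
  define x where "x = mat 1 n (\<lambda>(i, j). X $$ (n, j))"
  have last: "X $$ (i, n) = (if i = n then d else 0)" if "i < Suc n" for i
    using arg_cong[OF c, of "\<lambda>v. v $ i"] X that by (auto simp: unit_vec_def)
  have "X = four_block_mat X2 (0\<^sub>m n 1) x (d \<cdot>\<^sub>m 1\<^sub>m 1)"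
  proof (rule eq_matI)
    fix i j assume ij: "i < dim_row (four_block_mat X2 (0\<^sub>m n 1) x (d \<cdot>\<^sub>m 1\<^sub>m 1))" "j < dim_col (four_block_mat X2 (0\<^sub>m n 1) x (d \<cdot>\<^sub>m 1\<^sub>m 1))"
    then have "i < Suc n" "j < Suc n" by (auto simp: X2_def x_def)
    then show "X $$ (i, j) = four_block_mat X2 (0\<^sub>m n 1) x (d \<cdot>\<^sub>m 1\<^sub>m 1) $$ (i, j)"
      using last[of i] by (cases "i = n"; cases "j = n") (auto simp: X2_def x_def)
  qed (use X in \<open>auto simp: X2_def x_def\<close>)
  then show thesis by (intro that[of X2 x]) (auto simp: X2_def x_def)
qed

text \<open>Induction on \<open>n\<close> by deflation. If \<open>E\<close> is invertible, its
  inverse serves as \<open>M\<close> with \<open>k = 0\<close>. Otherwise a kernel vector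
  \<open>v\<close> of \<open>E\<close> and its image under \<open>A\<close> become the last basis
  vectors of domain and codomain. This splits off a column that is 0 in \<open>E\<close> and a unit
  vector in \<open>A\<close>, and the pencil that remains, smaller by one, is again regular. Each
  such round appends one row to \<open>U\<close>, which therefore comes out strictly lower
  triangular.\<close>

lemma weierstrass_form:
  fixes E A :: "real mat"
  assumes "E \<in> carrier_mat n n" "A \<in> carrier_mat n n" "det (c \<cdot>\<^sub>m E - A) \<noteq> 0"
  shows "\<exists>M N h k A1 U. M \<in> carrier_mat n n \<and> det M \<noteq> 0 \<and> N \<in> carrier_mat n n \<and> det N \<noteq> 0 \<and> n = h + k \<and>
    A1 \<in> carrier_mat h h \<and> U \<in> carrier_mat k k \<and> (\<forall>i j. i \<le> j \<longrightarrow> j < k \<longrightarrow> U $$ (i, j) = 0) \<and>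
    M * E * N = four_block_mat (1\<^sub>m h) (0\<^sub>m h k) (0\<^sub>m k h) U \<and>
    M * A * N = four_block_mat A1 (0\<^sub>m h k) (0\<^sub>m k h) (1\<^sub>m k)"
  using assms
proof (induction n arbitrary: E A)
  case 0
  have "X = Y" if "X \<in> carrier_mat 0 0" "Y \<in> carrier_mat 0 0" for X Y :: "real mat" using that by (intro eq_matI) auto
  then show ?case using 0
    by (intro exI[of _ "1\<^sub>m 0"] exI[of _ 0]) (auto intro!: exI[of _ "1\<^sub>m 0"])
next
  case (Suc n)
  note E = Suc.prems(1) and A = Suc.prems(2) and reg = Suc.prems(3)
  show ?case
  proof (cases "det E = 0")
    case False
    from det_nonzero_inverse[OF E False] obtain M where M: "M \<in> carrier_mat (Suc n) (Suc n)" "M * E = 1\<^sub>m (Suc n)" "det M \<noteq> 0"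
      by blast
    have fb: "X = four_block_mat X (0\<^sub>m (Suc n) 0) (0\<^sub>m 0 (Suc n)) Y"
      if "X \<in> carrier_mat (Suc n) (Suc n)" "Y \<in> carrier_mat 0 0" for X Y :: "real mat"
      using that by (intro eq_matI) auto
    have "M * A * 1\<^sub>m (Suc n) = four_block_mat (M * A) (0\<^sub>m (Suc n) 0) (0\<^sub>m 0 (Suc n)) (1\<^sub>m 0)"
      using fb[of "M * A" "1\<^sub>m 0"] M A by auto
    moreover have "M * E * 1\<^sub>m (Suc n) = four_block_mat (1\<^sub>m (Suc n)) (0\<^sub>m (Suc n) 0) (0\<^sub>m 0 (Suc n)) (0\<^sub>m 0 0)"
      using fb[of "1\<^sub>m (Suc n)" "0\<^sub>m 0 0"] M by auto
    moreover have "M \<in> carrier_mat (Suc n) (Suc n) \<and> det M \<noteq> 0 \<and> 1\<^sub>m (Suc n) \<in> carrier_mat (Suc n) (Suc n) \<and>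
      det (1\<^sub>m (Suc n) :: real mat) \<noteq> 0 \<and> Suc n = Suc n + 0 \<and> M * A \<in> carrier_mat (Suc n) (Suc n) \<and>
      0\<^sub>m 0 0 \<in> carrier_mat 0 0 \<and> (\<forall>i j. i \<le> j \<longrightarrow> j < 0 \<longrightarrow> 0\<^sub>m 0 0 $$ (i, j) = (0 :: real))"
      using M A by auto
    ultimately show ?thesis by blast
  next
    case True
    then obtain v where v: "v \<in> carrier_vec (Suc n)" "v \<noteq> 0\<^sub>v (Suc n)" "E *\<^sub>v v = 0\<^sub>v (Suc n)"
      using det_0_iff_vec_prod_zero_field[OF E] by blast
    define w where "w = A *\<^sub>v v"
    have w: "w \<in> carrier_vec (Suc n)" using A v by (simp add: w_def)
    \<comment> \<open>If \<open>A\<close> annihilated \<open>v\<close> as well, then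
      \<open>v\<close> would lie in the kernel of \<open>c \<cdot>\<^sub>m E - A\<close>, against
      regularity.\<close>
    have "w \<noteq> 0\<^sub>v (Suc n)"
    proof
      assume "w = 0\<^sub>v (Suc n)"
      moreover have "(c \<cdot>\<^sub>m E - A) *\<^sub>v v = c \<cdot>\<^sub>v (E *\<^sub>v v) - A *\<^sub>v v"
      proof -
        have "(c \<cdot>\<^sub>m E) *\<^sub>v v = c \<cdot>\<^sub>v (E *\<^sub>v v)" using E v(1) by (intro eq_vecI) auto
        then show ?thesis using E A v(1) by (simp add: minus_mult_distrib_mat_vec[of _ "Suc n" "Suc n"])
      qed
      moreover have "c \<cdot>\<^sub>v 0\<^sub>v (Suc n) - 0\<^sub>v (Suc n) = 0\<^sub>v (Suc n)" by (intro eq_vecI) auto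
      ultimately have "(c \<cdot>\<^sub>m E - A) *\<^sub>v v = 0\<^sub>v (Suc n)" using v(3) by (simp add: w_def)
      moreover have "c \<cdot>\<^sub>m E - A \<in> carrier_mat (Suc n) (Suc n)" using E A by auto
      ultimately show False using det_0_iff_vec_prod_zero_field[of "c \<cdot>\<^sub>m E - A" "Suc n"] reg v by blast
    qed
    from exists_nonsingular_last_col[OF w this] obtain Nw where Nw: "Nw \<in> carrier_mat (Suc n) (Suc n)" "det Nw \<noteq> 0" "col Nw n = w" .
    from det_nonzero_inverse[OF Nw(1,2)] obtain M1 where M1: "M1 \<in> carrier_mat (Suc n) (Suc n)" "M1 * Nw = 1\<^sub>m (Suc n)" "det M1 \<noteq> 0" by blast
    from exists_nonsingular_last_col[OF v(1,2)] obtain N1 where N1: "N1 \<in> carrier_mat (Suc n) (Suc n)" "det N1 \<noteq> 0" "col N1 n = v" .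
    have M1w: "M1 *\<^sub>v w = unit_vec (Suc n) n"
    proof -
      have "M1 *\<^sub>v w = M1 *\<^sub>v (Nw *\<^sub>v unit_vec (Suc n) n)" using mult_mat_unit_vec_col[OF Nw(1), of n] Nw(3) by simp
      also have "\<dots> = (M1 * Nw) *\<^sub>v unit_vec (Suc n) n" by (rule assoc_mult_mat_vec[symmetric]) (use M1(1) Nw(1) in auto)
      finally show ?thesis unfolding M1(2) by simp
    qed
    have cE: "col (M1 * E * N1) n = 0 \<cdot>\<^sub>v unit_vec (Suc n) n"
      unfolding col_mult3[OF M1(1) E N1(1) lessI] N1(3) v(3) using M1(1) by (intro eq_vecI) auto
    have cA: "col (M1 * A * N1) n = 1 \<cdot>\<^sub>v unit_vec (Suc n) n"
      unfolding col_mult3[OF M1(1) A N1(1) lessI] N1(3) w_def[symmetric] M1w by simp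
    have car: "M1 * E * N1 \<in> carrier_mat (Suc n) (Suc n)" "M1 * A * N1 \<in> carrier_mat (Suc n) (Suc n)" using M1 N1 E A by auto
    obtain E2 e where E2: "E2 \<in> carrier_mat n n" "e \<in> carrier_mat 1 n" "M1 * E * N1 = four_block_mat E2 (0\<^sub>m n 1) e (0 \<cdot>\<^sub>m 1\<^sub>m 1)"
      by (rule block_last_col[OF car(1) cE])
    obtain A2 a where A2: "A2 \<in> carrier_mat n n" "a \<in> carrier_mat 1 n" "M1 * A * N1 = four_block_mat A2 (0\<^sub>m n 1) a (1 \<cdot>\<^sub>m 1\<^sub>m 1)"
      by (rule block_last_col[OF car(2) cA])
    \<comment> \<open>In the new bases the pencil at \<open>c\<close> is block triangular with lower
      right entry -1, so regularity passes to the smaller pencil with the same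
      \<open>c\<close>.\<close>
    have "det (c \<cdot>\<^sub>m E2 - A2) \<noteq> 0"
    proof
      assume d0: "det (c \<cdot>\<^sub>m E2 - A2) = 0"
      have "M1 * (c \<cdot>\<^sub>m E - A) * N1 = c \<cdot>\<^sub>m (M1 * E * N1) - M1 * A * N1"
        using M1 N1 E A
        by (simp add: mult_minus_distrib_mat[of _ "Suc n" "Suc n" _ "Suc n"] minus_mult_distrib_mat[of _ "Suc n" "Suc n" _ _ "Suc n"]
            mult_smult_distrib[of _ "Suc n" "Suc n" _ "Suc n"] mult_smult_assoc_mat[of _ "Suc n" "Suc n" _ "Suc n"])
      also have "\<dots> = four_block_mat (c \<cdot>\<^sub>m E2 - A2) (0\<^sub>m n 1) (c \<cdot>\<^sub>m e - a) (- 1\<^sub>m 1)"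
        (is "_ = ?B")
      proof (rule eq_matI)
        fix i j assume "i < dim_row ?B" "j < dim_col ?B"
        then have ij: "i < Suc n" "j < Suc n" using E2(1) A2(1) by simp_all
        show "(c \<cdot>\<^sub>m (M1 * E * N1) - M1 * A * N1) $$ (i, j) = ?B $$ (i, j)"
          unfolding E2(3) A2(3) using carrier_matD[OF E2(1)] carrier_matD[OF E2(2)] carrier_matD[OF A2(1)] carrier_matD[OF A2(2)] ij
          by (cases "i < n"; cases "j < n") simp_all
      qed (use E2(1) A2(1) M1(1) N1(1) in simp_all)
      finally have "det (M1 * (c \<cdot>\<^sub>m E - A) * N1) = det (four_block_mat (c \<cdot>\<^sub>m E2 - A2) (0\<^sub>m n 1) (c \<cdot>\<^sub>m e - a) (- 1\<^sub>m 1))" by simp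
      also have "\<dots> = det (c \<cdot>\<^sub>m E2 - A2) * det (- 1\<^sub>m 1 :: real mat)"
        by (rule det_four_block_mat_upper_right_zero) (use E2 A2 in auto)
      finally have "det (M1 * (c \<cdot>\<^sub>m E - A) * N1) = 0" using d0 by simp
      moreover have "det (M1 * (c \<cdot>\<^sub>m E - A) * N1) = det M1 * det (c \<cdot>\<^sub>m E - A) * det N1"
      proof -
        have 1: "c \<cdot>\<^sub>m E - A \<in> carrier_mat (Suc n) (Suc n)" using A by (rule minus_carrier_mat)
        have 2: "M1 * (c \<cdot>\<^sub>m E - A) \<in> carrier_mat (Suc n) (Suc n)" using M1(1) 1 by (rule mult_carrier_mat)
        show ?thesis unfolding det_mult[OF 2 N1(1)] det_mult[OF M1(1) 1] ..
      qed
      ultimately show False using M1(3) N1(2) reg by simp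
    qed
    from Suc.IH[OF E2(1) A2(1) this] obtain M2 N2 h k A1 U where IH: "M2 \<in> carrier_mat n n" "det M2 \<noteq> 0" "N2 \<in> carrier_mat n n" "det N2 \<noteq> 0"
      "n = h + k" "A1 \<in> carrier_mat h h" "U \<in> carrier_mat k k" "\<And>i j. i \<le> j \<Longrightarrow> j < k \<Longrightarrow> U $$ (i, j) = 0"
      "M2 * E2 * N2 = four_block_mat (1\<^sub>m h) (0\<^sub>m h k) (0\<^sub>m k h) U"
      "M2 * A2 * N2 = four_block_mat A1 (0\<^sub>m h k) (0\<^sub>m k h) (1\<^sub>m k)" by blast
    define E4 where "E4 = M2 * E2 * N2"
    define A4 where "A4 = M2 * A2 * N2"
    define f where "f = e * N2"
    define g where "g = a * N2"
    \<comment> \<open>The row operation \<open>L\<close> clears those entries in the last row of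
      \<open>E\<close> that stand below the block \<open>1\<^sub>m h\<close>; the entries below
      \<open>U\<close> remain.\<close>
    define l where "l = mat 1 n (\<lambda>(i, j). if j < h then - f $$ (0, j) else 0)"
    define P where "P = four_block_mat M2 (0\<^sub>m n 1) (0\<^sub>m 1 n) (1\<^sub>m 1)"
    define Q where "Q = four_block_mat N2 (0\<^sub>m n 1) (0\<^sub>m 1 n) (1\<^sub>m 1)"
    define L where "L = four_block_mat (1\<^sub>m n) (0\<^sub>m n 1) l (1\<^sub>m 1)"
    \<comment> \<open>The column operation \<open>R\<close> uses the entry 1 in the last column of
      \<open>A\<close> as a pivot to clear the rest of its last row. It does not change
      \<open>E\<close>, whose last column is 0.\<close>
    define R where "R = four_block_mat (1\<^sub>m n) (0\<^sub>m n 1) (- (l * A4 + g)) (1\<^sub>m 1)"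
    have c: "E4 \<in> carrier_mat n n" "A4 \<in> carrier_mat n n" "f \<in> carrier_mat 1 n" "g \<in> carrier_mat 1 n" "l \<in> carrier_mat 1 n"
      using IH(1,3) E2 A2 by (auto simp: E4_def A4_def f_def g_def l_def)
    have C: "P \<in> carrier_mat (Suc n) (Suc n)" "Q \<in> carrier_mat (Suc n) (Suc n)" "L \<in> carrier_mat (Suc n) (Suc n)" "R \<in> carrier_mat (Suc n) (Suc n)"
      unfolding P_def Q_def L_def R_def
      using four_block_carrier_mat[OF IH(1) one_carrier_mat[of 1]] four_block_carrier_mat[OF IH(3) one_carrier_mat[of 1]]
        four_block_carrier_mat[OF one_carrier_mat[of n] one_carrier_mat[of 1]] by simp_all
    have D: "det P \<noteq> 0" "det Q \<noteq> 0" "det L \<noteq> 0" "det R \<noteq> 0"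
    proof -
      have u: "- (l * A4 + g) \<in> carrier_mat 1 n" using c by simp
      have "det P = det M2 * det (1\<^sub>m 1 :: real mat)" "det Q = det N2 * det (1\<^sub>m 1 :: real mat)"
        "det L = det (1\<^sub>m n) * det (1\<^sub>m 1 :: real mat)" "det R = det (1\<^sub>m n) * det (1\<^sub>m 1 :: real mat)"
        unfolding P_def Q_def L_def R_def
        by (rule det_four_block_mat_upper_right_zero[OF _ refl]; rule IH(1) IH(3) one_carrier_mat zero_carrier_mat c(5) u)+
      then show "det P \<noteq> 0" "det Q \<noteq> 0" "det L \<noteq> 0" "det R \<noteq> 0" using IH(2,4) by simp_all
    qed
    have PEQ: "P * (M1 * E * N1) * Q = four_block_mat E4 (0\<^sub>m n 1) f (0\<^sub>m 1 1)"
    proof -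
      have 1: "P * (M1 * E * N1) = four_block_mat (M2 * E2) (0\<^sub>m n 1) e (0\<^sub>m 1 1)"
        unfolding P_def E2(3) using IH(1) E2(1,2) by (subst mult_four_block_mat[of _ n n _ 1 _ 1 _ _ n _ 1]) auto
      have 2: "four_block_mat (M2 * E2) (0\<^sub>m n 1) e (0\<^sub>m 1 1) * Q = four_block_mat E4 (0\<^sub>m n 1) f (0\<^sub>m 1 1)"
        unfolding Q_def E4_def f_def using IH(1,3) E2(1,2) by (subst mult_four_block_mat[of _ n n _ 1 _ 1 _ _ n _ 1]) auto
      show ?thesis unfolding 1 2 ..
    qed
    have PAQ: "P * (M1 * A * N1) * Q = four_block_mat A4 (0\<^sub>m n 1) g (1\<^sub>m 1)"
    proof -
      have 1: "P * (M1 * A * N1) = four_block_mat (M2 * A2) (0\<^sub>m n 1) a (1\<^sub>m 1)"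
        unfolding P_def A2(3) using IH(1) A2(1,2) by (subst mult_four_block_mat[of _ n n _ 1 _ 1 _ _ n _ 1]) auto
      have 2: "four_block_mat (M2 * A2) (0\<^sub>m n 1) a (1\<^sub>m 1) * Q = four_block_mat A4 (0\<^sub>m n 1) g (1\<^sub>m 1)"
        unfolding Q_def A4_def g_def using IH(1,3) A2(1,2) by (subst mult_four_block_mat[of _ n n _ 1 _ 1 _ _ n _ 1]) auto
      show ?thesis unfolding 1 2 ..
    qed
    have LER: "L * four_block_mat E4 (0\<^sub>m n 1) f (0\<^sub>m 1 1) * R = four_block_mat E4 (0\<^sub>m n 1) (l * E4 + f) (0\<^sub>m 1 1)"
    proof -
      have 1: "L * four_block_mat E4 (0\<^sub>m n 1) f (0\<^sub>m 1 1) = four_block_mat E4 (0\<^sub>m n 1) (l * E4 + f) (0\<^sub>m 1 1)"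
        unfolding L_def using c by (subst mult_four_block_mat[of _ n n _ 1 _ 1 _ _ n _ 1]) auto
      have 2: "four_block_mat E4 (0\<^sub>m n 1) (l * E4 + f) (0\<^sub>m 1 1) * R = four_block_mat E4 (0\<^sub>m n 1) (l * E4 + f) (0\<^sub>m 1 1)"
        unfolding R_def using c by (subst mult_four_block_mat[of _ n n _ 1 _ 1 _ _ n _ 1]) auto
      show ?thesis unfolding 1 2 ..
    qed
    have LAR: "L * four_block_mat A4 (0\<^sub>m n 1) g (1\<^sub>m 1) * R = four_block_mat A4 (0\<^sub>m n 1) (0\<^sub>m 1 n) (1\<^sub>m 1)"
    proof -
      have "L * four_block_mat A4 (0\<^sub>m n 1) g (1\<^sub>m 1) = four_block_mat A4 (0\<^sub>m n 1) (l * A4 + g) (1\<^sub>m 1)"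
        unfolding L_def using c by (subst mult_four_block_mat[of _ n n _ 1 _ 1 _ _ n _ 1]) auto
      moreover have "four_block_mat A4 (0\<^sub>m n 1) (l * A4 + g) (1\<^sub>m 1) * R = four_block_mat A4 (0\<^sub>m n 1) (l * A4 + g + - (l * A4 + g)) (1\<^sub>m 1)"
        unfolding R_def using c by (subst mult_four_block_mat[of _ n n _ 1 _ 1 _ _ n _ 1]) auto
      moreover have "l * A4 + g + - (l * A4 + g) = 0\<^sub>m 1 n" using c by (intro eq_matI) auto
      ultimately show ?thesis by simp
    qed
    \<comment> \<open>What is left of the last row of \<open>E\<close> is appended to
      \<open>U\<close> as a new last row with diagonal entry 0, so the enlarged block is again
      strictly lower triangular.\<close>
    define f2 where "f2 = mat 1 k (\<lambda>(i, j). f $$ (0, h + j))"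
    define U' where "U' = four_block_mat U (0\<^sub>m k 1) f2 (0\<^sub>m 1 1)"
    have lE: "(l * E4 + f) $$ (0, j) = (if j < h then 0 else f $$ (0, j))" if "j < n" for j
    proof -
      have "(l * E4) $$ (0, j) = (\<Sum>i<n. l $$ (0, i) * E4 $$ (i, j))"
        using c that by (simp add: scalar_prod_def lessThan_atLeast0)
      also have "\<dots> = (\<Sum>i<n. if i = j then (if j < h then - f $$ (0, j) else 0) else 0)"
        using that IH(5-7) by (intro sum.cong) (auto simp: E4_def IH(9) l_def)
      also have "\<dots> = (if j < h then - f $$ (0, j) else 0)" using that by simp
      finally show ?thesis using c that by auto
    qed
    have dU: "dim_row U = k" "dim_col U = k" "dim_row A1 = h" "dim_col A1 = h" using IH(6,7) by simp_all
    have dE: "dim_row E4 = n" "dim_col E4 = n" "dim_row A4 = n" "dim_col A4 = n" using c(1,2) by simp_all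
    have dU': "dim_row U' = Suc k" "dim_col U' = Suc k" using dU by (simp_all add: U'_def f2_def)
    have E4i: "E4 $$ (i, j) = (if i < h then if j < h then if i = j then 1 else 0 else 0 else if j < h then 0 else U $$ (i - h, j - h))"
      if "i < n" "j < n" for i j
      using that IH(5) dU unfolding E4_def IH(9) by simp
    have A4i: "A4 $$ (i, j) = (if i < h then if j < h then A1 $$ (i, j) else 0 else if i = j then 1 else 0)"
      if "i < n" "j < n" for i j
      using that IH(5) dU unfolding A4_def IH(10) by auto
    have U'i: "U' $$ (i, j) = (if i < k then if j < k then U $$ (i, j) else 0 else if j < k then f $$ (0, h + j) else 0)"
      if "i < Suc k" "j < Suc k" for i j
      using that dU by (simp add: U'_def f2_def)
    have reE: "four_block_mat E4 (0\<^sub>m n 1) (l * E4 + f) (0\<^sub>m 1 1) = four_block_mat (1\<^sub>m h) (0\<^sub>m h (Suc k)) (0\<^sub>m (Suc k) h) U'" (is "?l = ?r")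
    proof (rule eq_matI)
      fix i j assume "i < dim_row ?r" "j < dim_col ?r"
      then have ij: "i < Suc n" "j < Suc n" using IH(5) by (simp_all add: dU')
      have l: "?l $$ (i, j) = (if i < n then if j < n then E4 $$ (i, j) else 0 else if j < n then (l * E4 + f) $$ (0, j) else 0)"
        using ij(1)[unfolded less_Suc_eq] ij(2)[unfolded less_Suc_eq] by (elim disjE) (simp_all add: dE)
      have r: "?r $$ (i, j) = (if i < h then if j < h then if i = j then 1 else 0 else 0 else if j < h then 0 else U' $$ (i - h, j - h))"
        using ij IH(5) by (simp add: dU')
      have ar: "i - h < Suc k" if "\<not> i < h" "j - h < Suc k" using that ij IH(5) by arith
      have ar2: "j - h < Suc k" using ij IH(5) by arith
      show "?l $$ (i, j) = ?r $$ (i, j)"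
      proof (cases "i < n")
        case True
        show ?thesis
        proof (cases "j < n")
          case jn: True
          have "i - h < k" if "\<not> i < h" using that True IH(5) by arith
          moreover have "j - h < k" if "\<not> j < h" using that jn IH(5) by arith
          ultimately show ?thesis
            using True jn E4i[OF True jn] U'i[of "i - h" "j - h"] unfolding l r by (cases "i < h"; cases "j < h") simp_all
        next
          case False
          then have "j = h + k" using ij IH(5) by simp
          moreover have "i - h < k" if "\<not> i < h" using that True IH(5) by arith
          ultimately show ?thesis using True U'i[of "i - h" "j - h"] IH(5) unfolding l r by (cases "i < h") simp_all
        qed
      next
        case False
        then have i: "i = h + k" using ij IH(5) by simp
        show ?thesis
        proof (cases "j < n")
          case jn: True
          then have "h + (j - h) = j" "j - h < k" if "\<not> j < h" using that IH(5) by arith+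
          then show ?thesis using jn lE[OF jn] U'i[of "i - h" "j - h"] i IH(5) unfolding l r by (cases "j < h") simp_all
        next
          case False
          then have "j = h + k" using ij IH(5) by simp
          then show ?thesis using U'i[of "i - h" "j - h"] i IH(5) unfolding l r by simp
        qed
      qed
    qed (use IH(5) in \<open>simp_all add: dE dU'\<close>)
    have reA: "four_block_mat A4 (0\<^sub>m n 1) (0\<^sub>m 1 n) (1\<^sub>m 1) = four_block_mat A1 (0\<^sub>m h (Suc k)) (0\<^sub>m (Suc k) h) (1\<^sub>m (Suc k))" (is "?l = ?r")
    proof (rule eq_matI)
      fix i j assume "i < dim_row ?r" "j < dim_col ?r"
      then have ij: "i < Suc n" "j < Suc n" using IH(5) by (simp_all add: dU)
      have l: "?l $$ (i, j) = (if i < n then if j < n then A4 $$ (i, j) else 0 else if j < n then 0 else 1)"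
        using ij(1)[unfolded less_Suc_eq] ij(2)[unfolded less_Suc_eq] by (elim disjE) (simp_all add: dE)
      have r: "?r $$ (i, j) = (if i < h then if j < h then A1 $$ (i, j) else 0 else if j < h then 0 else if i - h = j - h then 1 else 0)"
        using ij IH(5) by (simp add: dU)
      show "?l $$ (i, j) = ?r $$ (i, j)"
      proof (cases "i < n \<and> j < n")
        case True
        then have "i - h = j - h \<longleftrightarrow> i = j" if "\<not> i < h" "\<not> j < h" using that by arith
        with True show ?thesis unfolding l r using A4i[of i j] by (cases "i < h"; cases "j < h") simp_all
      next
        case False
        then consider "i = h + k" "j < n" | "i < n" "j = h + k" | "i = h + k" "j = h + k" using ij IH(5) by linarith
        then show ?thesis unfolding l r using IH(5) by cases (simp_all, arith+)
      qed
    qed (use IH(5) in \<open>simp_all add: dE dU\<close>)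
    define M where "M = L * (P * M1)"
    define N where "N = N1 * (Q * R)"
    have MN: "M \<in> carrier_mat (Suc n) (Suc n)" "N \<in> carrier_mat (Suc n) (Suc n)" "det M \<noteq> 0" "det N \<noteq> 0"
      using C D M1 N1 by (auto simp: M_def N_def det_mult[of _ "Suc n"])
    have assoc: "M * X * N = L * (P * (M1 * X * N1) * Q) * R" if "X \<in> carrier_mat (Suc n) (Suc n)" for X
      unfolding M_def N_def using C M1(1) N1(1) that
      by (simp add: assoc_mult_mat[of _ "Suc n" "Suc n" _ "Suc n" _ "Suc n"])
    have "M * E * N = four_block_mat (1\<^sub>m h) (0\<^sub>m h (Suc k)) (0\<^sub>m (Suc k) h) U'"
      unfolding assoc[OF E] PEQ LER reE ..
    moreover have "M * A * N = four_block_mat A1 (0\<^sub>m h (Suc k)) (0\<^sub>m (Suc k) h) (1\<^sub>m (Suc k))"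
      unfolding assoc[OF A] PAQ LAR reA ..
    moreover have "U' $$ (i, j) = 0" if "i \<le> j" "j < Suc k" for i j
      using that IH(7) IH(8)[of i j] by (auto simp: U'_def f2_def)
    moreover have "U' \<in> carrier_mat (Suc k) (Suc k)" using IH(7) by (auto simp: U'_def f2_def)
    moreover have "Suc n = h + Suc k" using IH(5) by simp
    ultimately show ?thesis using MN IH(6) by blast
  qed
qed

text \<open>As a polynomial, the determinant of the pencil vanishes at all reals and is therefore 0,
  so the pencil has a nonzero polynomial vector \<open>v\<close> in its kernel. Comparing
  coefficients of equal powers gives the chain, \<open>p j\<close> being the coefficient vector of
  degree \<open>j\<close>.\<close>

lemma singular_pencil_chain:
  fixes E A :: "real mat"
  assumes E: "E \<in> carrier_mat n n" and A: "A \<in> carrier_mat n n" and sing: "\<And>c. det (c \<cdot>\<^sub>m E - A) = 0"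
  obtains p d where "\<And>j. p j \<in> carrier_vec n" "A *\<^sub>v p 0 = 0\<^sub>v n" "\<And>j. A *\<^sub>v p (Suc j) = E *\<^sub>v p j"
    "\<And>j. d \<le> j \<Longrightarrow> p j = 0\<^sub>v n" "\<exists>j. p j \<noteq> 0\<^sub>v n"
proof -
  define Q where "Q = mat n n (\<lambda>(i, j). [:- A $$ (i, j), E $$ (i, j):])"
  have Q: "Q \<in> carrier_mat n n" by (simp add: Q_def)
  have "poly (det Q) c = 0" for c
  proof -
    have h: "comm_ring_hom (\<lambda>p. poly p c)" by unfold_locales auto
    have "map_mat (\<lambda>p. poly p c) Q = c \<cdot>\<^sub>m E - A"
      using E A by (intro eq_matI) (auto simp: Q_def)
    then show ?thesis using comm_ring_hom.hom_det[OF h, of Q] sing[of c] by simp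
  qed
  then have "det Q = 0" using poly_all_0_iff_0 by blast
  then obtain v where v: "v \<in> carrier_vec n" "v \<noteq> 0\<^sub>v n" "Q *\<^sub>v v = 0\<^sub>v n"
    using det_0_iff_vec_prod_zero[OF Q] by blast
  define p where "p j = vec n (\<lambda>i. coeff (v $ i) j)" for j
  have p: "p j \<in> carrier_vec n" for j by (simp add: p_def)
  have row: "(\<Sum>l<n. [:- A $$ (i, l), E $$ (i, l):] * v $ l) = 0" if "i < n" for i
  proof -
    have "(Q *\<^sub>v v) $ i = (\<Sum>l<n. [:- A $$ (i, l), E $$ (i, l):] * v $ l)"
      using that v(1) by (simp add: Q_def scalar_prod_def lessThan_atLeast0)
    then show ?thesis using v(3) that by simp
  qed
  have prod: "(X *\<^sub>v p j) $ i = (\<Sum>l<n. X $$ (i, l) * coeff (v $ l) j)" if "X \<in> carrier_mat n n" "i < n" for X i j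
    using that by (simp add: p_def scalar_prod_def lessThan_atLeast0)
  have c0: "A *\<^sub>v p 0 = 0\<^sub>v n"
  proof (rule eq_vecI)
    fix i assume "i < dim_vec (0\<^sub>v n :: real vec)"
    then have i: "i < n" by simp
    have "coeff (\<Sum>l<n. [:- A $$ (i, l), E $$ (i, l):] * v $ l) 0 = 0" using row[OF i] by simp
    then have "(\<Sum>l<n. A $$ (i, l) * coeff (v $ l) 0) = 0" by (simp add: coeff_sum sum_negf)
    then show "(A *\<^sub>v p 0) $ i = 0\<^sub>v n $ i" using prod[OF A i] i by simp
  qed (use A in simp)
  have cS: "A *\<^sub>v p (Suc j) = E *\<^sub>v p j" for j
  proof (rule eq_vecI)
    fix i assume "i < dim_vec (E *\<^sub>v p j)"
    then have i: "i < n" using E by simp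
    have "coeff (\<Sum>l<n. [:- A $$ (i, l), E $$ (i, l):] * v $ l) (Suc j) = 0" using row[OF i] by simp
    then have "(\<Sum>l<n. A $$ (i, l) * coeff (v $ l) (Suc j)) = (\<Sum>l<n. E $$ (i, l) * coeff (v $ l) j)"
      by (simp add: coeff_sum sum_negf sum.distrib sum_subtractf)
    then show "(A *\<^sub>v p (Suc j)) $ i = (E *\<^sub>v p j) $ i" using prod[OF A i] prod[OF E i] by simp
  qed (use A E in simp)
  define d where "d = Suc (\<Sum>i<n. degree (v $ i))"
  have "p j = 0\<^sub>v n" if "d \<le> j" for j
  proof (rule eq_vecI)
    fix i assume "i < dim_vec (0\<^sub>v n :: real vec)"
    then have i: "i < n" by simp
    then have "degree (v $ i) \<le> (\<Sum>i<n. degree (v $ i))" by (intro member_le_sum) auto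
    then have "degree (v $ i) < j" using that by (simp add: d_def)
    then show "p j $ i = 0\<^sub>v n $ i" using i by (simp add: p_def coeff_eq_0)
  qed (simp add: p_def)
  moreover have "\<exists>j. p j \<noteq> 0\<^sub>v n"
  proof (rule ccontr)
    assume *: "\<not> ?thesis"
    have "v = 0\<^sub>v n"
    proof (rule eq_vecI)
      fix i assume "i < dim_vec (0\<^sub>v n :: real poly vec)"
      then have i: "i < n" by simp
      have "coeff (v $ i) j = 0" for j
      proof -
        have "p j = 0\<^sub>v n" using * by blast
        from arg_cong[OF this, of "\<lambda>x. x $ i"] show ?thesis using i by (simp add: p_def)
      qed
      then show "v $ i = 0\<^sub>v n $ i" using i by (simp add: poly_eq_iff)
    qed (use v in simp)
    with v(2) show False by simp
  qed
  ultimately show thesis using that p c0 cS by blast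
qed

lemma diag_block_mat_pair:
  fixes X Y :: "real mat"
  assumes "X \<in> carrier_mat h h" "Y \<in> carrier_mat k k"
  shows "diag_block_mat [X, Y] = four_block_mat X (0\<^sub>m h k) (0\<^sub>m k h) Y"
proof -
  have "four_block_mat Y (0\<^sub>m k 0) (0\<^sub>m 0 k) (0\<^sub>m 0 0) = Y" using assms by (intro eq_matI) auto
  then show ?thesis using assms by (simp add: Let_def)
qed

text \<open>The characteristic polynomial, read off from the upper triangular transpose, is a power
  of the variable. It splits over the reals, so a real Jordan form exists, and 0 is the only
  eigenvalue. The Jordan blocks carry their ones above the diagonal although \<open>U\<close> is
  lower triangular.\<close>

lemma strictly_lower_triangular_jordan:
  fixes U :: "real mat"
  assumes U: "U \<in> carrier_mat k k" and z: "\<And>i j. i \<le> j \<Longrightarrow> j < k \<Longrightarrow> U $$ (i, j) = 0"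
  obtains ms P Q where "P \<in> carrier_mat k k" "Q \<in> carrier_mat k k" "P * Q = 1\<^sub>m k" "Q * P = 1\<^sub>m k"
    "Q * U * P = diag_block_mat (map shift_block ms)" "\<forall>m\<in>set ms. 1 \<le> m" "sum_list ms = k"
proof -
  have tU: "transpose_mat U \<in> carrier_mat k k" using U by simp
  have ut: "upper_triangular (transpose_mat U)" using U z unfolding upper_triangular_def by auto
  have dg: "diag_mat (transpose_mat U) = replicate k 0"
    using U z by (intro nth_equalityI) (auto simp: diag_mat_def)
  have cp: "char_poly U = (\<Prod>a\<leftarrow>replicate k 0. [:- a, 1:])"
    using char_poly_upper_triangular[OF tU ut] char_poly_transpose_mat[OF U] unfolding dg by simp
  from jordan_nf_exists[OF U cp] obtain n_as where jnf: "jordan_nf U n_as" ..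
  have cp2: "char_poly U = (\<Prod>(na, a)\<leftarrow>n_as. [:- a, 1:] ^ na)" by (rule jordan_nf_char_poly[OF jnf])
  have a0: "a = 0" if "(m, a) \<in> set n_as" for m a
  proof -
    have m: "m \<noteq> 0" using jnf that unfolding jordan_nf_def by force
    have "[:- a, 1:] ^ m \<in> set (map (\<lambda>(na, a). [:- a, 1:] ^ na) n_as)" using that by force
    from prod_list_dvd[OF this] have "[:- a, 1:] ^ m dvd char_poly U" unfolding cp2 .
    moreover have "[:- a, 1:] dvd [:- a, 1:] ^ m" using m by (simp add: dvd_power)
    ultimately have "[:- a, 1:] dvd char_poly U" by (rule dvd_trans[rotated])
    then have "poly (char_poly U) a = 0" by (simp add: poly_eq_0_iff_dvd)
    then show ?thesis unfolding cp by (simp add: poly_power prod_list_replicate)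
  qed
  define ms where "ms = map fst n_as"
  have "(\<lambda>(m, a). jordan_block m a) x = shift_block (fst x)" if "x \<in> set n_as" for x
    using a0[of "fst x" "snd x"] that by (cases x) (auto simp: jordan_block_def shift_block_def intro!: eq_matI)
  then have jm: "jordan_matrix n_as = diag_block_mat (map shift_block ms)"
    unfolding jordan_matrix_def ms_def map_map by (intro arg_cong[of _ _ diag_block_mat] map_cong) auto
  from jnf obtain P Q where w: "similar_mat_wit U (jordan_matrix n_as) P Q"
    unfolding jordan_nf_def similar_mat_def by blast
  then have PQ: "P \<in> carrier_mat k k" "Q \<in> carrier_mat k k" "P * Q = 1\<^sub>m k" "Q * P = 1\<^sub>m k"
    "U = P * jordan_matrix n_as * Q" "jordan_matrix n_as \<in> carrier_mat k k"
    using U unfolding similar_mat_wit_def Let_def by auto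
  define J where "J = jordan_matrix n_as"
  have J: "J \<in> carrier_mat k k" using PQ(6) by (simp add: J_def)
  have "Q * U * P = (Q * P) * J * (Q * P)"
    unfolding PQ(5) J_def[symmetric] using PQ(1,2) J by (simp add: assoc_mult_mat[of _ k k _ k _ k])
  then have "Q * U * P = J" using J by (simp add: PQ(4))
  moreover have "\<forall>m\<in>set ms. 1 \<le> m" using jnf unfolding jordan_nf_def ms_def by (auto simp: Suc_le_eq intro!: gr0I) (metis fst_conv image_eqI)
  moreover have "sum_list ms = k" using PQ(6) unfolding ms_def by auto
  ultimately show thesis using that[OF PQ(1-4)] unfolding J_def jm by blast
qed

text \<open>A similarity of the nilpotent block is a change of both bases that preserves the
  identity block in the form of \<open>A\<close>, since \<open>Q * P = 1\<^sub>m k\<close>. The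
  block \<open>A1\<close> is not touched.\<close>

lemma weierstrass_jordan_form:
  fixes E A :: "real mat"
  assumes E: "E \<in> carrier_mat n n" and A: "A \<in> carrier_mat n n" and reg: "det (c \<cdot>\<^sub>m E - A) \<noteq> 0"
  obtains M N h A1 ms where "M \<in> carrier_mat n n" "det M \<noteq> 0" "N \<in> carrier_mat n n" "det N \<noteq> 0" "h \<le> n"
    "A1 \<in> carrier_mat h h" "\<forall>m\<in>set ms. 1 \<le> m" "sum_list ms = n - h"
    "M * E * N = diag_block_mat [1\<^sub>m h, diag_block_mat (map shift_block ms)]"
    "M * A * N = diag_block_mat [A1, 1\<^sub>m (n - h)]"
proof -
  from weierstrass_form[OF E A reg] obtain M N h k A1 U where 1: "M \<in> carrier_mat n n" "det M \<noteq> 0" "N \<in> carrier_mat n n" "det N \<noteq> 0"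
    "n = h + k" "A1 \<in> carrier_mat h h" "U \<in> carrier_mat k k" "\<And>i j. i \<le> j \<Longrightarrow> j < k \<Longrightarrow> U $$ (i, j) = 0"
    "M * E * N = four_block_mat (1\<^sub>m h) (0\<^sub>m h k) (0\<^sub>m k h) U"
    "M * A * N = four_block_mat A1 (0\<^sub>m h k) (0\<^sub>m k h) (1\<^sub>m k)" by blast
  from strictly_lower_triangular_jordan[OF 1(7,8)] obtain ms P Q where 2: "P \<in> carrier_mat k k" "Q \<in> carrier_mat k k" "P * Q = 1\<^sub>m k" "Q * P = 1\<^sub>m k"
    "Q * U * P = diag_block_mat (map shift_block ms)" "\<forall>m\<in>set ms. 1 \<le> m" "sum_list ms = k" .
  define L where "L = four_block_mat (1\<^sub>m h) (0\<^sub>m h k) (0\<^sub>m k h) Q"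
  define R where "R = four_block_mat (1\<^sub>m h) (0\<^sub>m h k) (0\<^sub>m k h) P"
  have LR: "L \<in> carrier_mat n n" "R \<in> carrier_mat n n" using 1(5) 2(1,2) by (auto simp: L_def R_def)
  have "det P * det Q = 1" "det Q * det P = 1" using det_mult[OF 2(1,2)] det_mult[OF 2(2,1)] 2(3,4) by simp_all
  then have "det P \<noteq> 0" "det Q \<noteq> 0" by auto
  moreover have "det L = det (1\<^sub>m h :: real mat) * det Q" "det R = det (1\<^sub>m h :: real mat) * det P"
    unfolding L_def R_def by (rule det_four_block_mat_upper_right_zero; use 2(1,2) in auto)+
  ultimately have dLR: "det L \<noteq> 0" "det R \<noteq> 0" by simp_all
  have sand: "L * four_block_mat X (0\<^sub>m h k) (0\<^sub>m k h) Y * R = four_block_mat X (0\<^sub>m h k) (0\<^sub>m k h) (Q * Y * P)"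
    if "X \<in> carrier_mat h h" "Y \<in> carrier_mat k k" for X Y
  proof -
    have 3: "L * four_block_mat X (0\<^sub>m h k) (0\<^sub>m k h) Y = four_block_mat X (0\<^sub>m h k) (0\<^sub>m k h) (Q * Y)"
      unfolding L_def using that 2(1,2) by (subst mult_four_block_mat[of _ h h _ k _ k _ _ h _ k]) auto
    have 4: "four_block_mat X (0\<^sub>m h k) (0\<^sub>m k h) (Q * Y) * R = four_block_mat X (0\<^sub>m h k) (0\<^sub>m k h) (Q * Y * P)"
      unfolding R_def using that 2(1,2) by (subst mult_four_block_mat[of _ h h _ k _ k _ _ h _ k]) auto
    show ?thesis unfolding 3 4 ..
  qed
  have assoc: "(L * M) * X * (N * R) = L * (M * X * N) * R" if "X \<in> carrier_mat n n" for X
    using LR 1(1,3) that by (simp add: assoc_mult_mat[of _ n n _ n _ n])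
  show thesis
  proof (rule that)
    show "L * M \<in> carrier_mat n n" "N * R \<in> carrier_mat n n" using LR 1(1,3) by auto
    show "det (L * M) \<noteq> 0" "det (N * R) \<noteq> 0" using dLR 1(2,4) det_mult[OF LR(1) 1(1)] det_mult[OF 1(3) LR(2)] by simp_all
    show "h \<le> n" "A1 \<in> carrier_mat h h" "\<forall>m\<in>set ms. 1 \<le> m" "sum_list ms = n - h" using 1(5,6) 2(6,7) by auto
    have G: "diag_block_mat (map shift_block ms) \<in> carrier_mat k k" using 1(7) 2(1,2) unfolding 2(5)[symmetric] by auto
    show "(L * M) * E * (N * R) = diag_block_mat [1\<^sub>m h, diag_block_mat (map shift_block ms)]"
      unfolding assoc[OF E] 1(9) sand[OF one_carrier_mat 1(7)] 2(5) by (rule diag_block_mat_pair[OF one_carrier_mat G, symmetric])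
    have "Q * 1\<^sub>m k * P = 1\<^sub>m k" using 2(1,2,4) by simp
    then show "(L * M) * A * (N * R) = diag_block_mat [A1, 1\<^sub>m (n - h)]"
      unfolding assoc[OF A] 1(10) sand[OF 1(6) one_carrier_mat] using diag_block_mat_pair[OF 1(6) one_carrier_mat[of k]] 1(5) by simp
  qed
qed

section \<open>Matrices annihilated by a direct sum of shift blocks\<close>

lemma shift_block_carrier: "shift_block m \<in> carrier_mat m m"
  by (simp add: shift_block_def)

lemma shift_block_index: "i < m \<Longrightarrow> j < m \<Longrightarrow> shift_block m $$ (i, j) = (if j = Suc i then 1 else 0)"
  by (simp add: shift_block_def)

lemma shift_diag_carrier: "diag_block_mat (map shift_block ms) \<in> carrier_mat (sum_list ms) (sum_list ms)"
  by (rule carrier_matI) (simp_all add: dim_diag_block_mat comp_def shift_block_def)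

lemma shift_diag_Cons:
  "diag_block_mat (map shift_block (m # ms)) = four_block_mat (shift_block m) (0\<^sub>m m (sum_list ms)) (0\<^sub>m (sum_list ms) m) (diag_block_mat (map shift_block ms))"
  using shift_diag_carrier[of ms] by (simp add: Let_def shift_block_def)

lemma shift_diag_strictly_upper: "j \<le> i \<Longrightarrow> i < sum_list ms \<Longrightarrow> diag_block_mat (map shift_block ms) $$ (i, j) = 0"
proof (induction ms arbitrary: i j)
  case (Cons m ms)
  then show ?case
    unfolding shift_diag_Cons using carrier_matD[OF shift_diag_carrier[of ms]] shift_block_carrier[of m]
    by (cases "i < m"; cases "j < m") (auto simp: shift_block_index)
qed simp

text \<open>The matrix \<open>B2\<close> of the theorem, named so that it can be unfolded along the
  list of block sizes; \<open>head_rows_Cons\<close> shifts the index of \<open>b\<close>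
  accordingly.\<close>

definition head_rows :: "nat \<Rightarrow> nat list \<Rightarrow> (nat \<Rightarrow> real mat) \<Rightarrow> real mat" where
  "head_rows r ms b = stack_rows r (map (\<lambda>k. b k @\<^sub>r 0\<^sub>m (ms ! k - 1) r) [0..<length ms])"

lemma head_rows_Nil: "head_rows r [] b = 0\<^sub>m 0 r"
  by (simp add: head_rows_def stack_rows_def)

lemma head_rows_Cons: "head_rows r (m # ms) b = (b 0 @\<^sub>r 0\<^sub>m (m - 1) r) @\<^sub>r head_rows r ms (\<lambda>k. b (Suc k))"
proof -
  have "[0..<length (m # ms)] = 0 # map Suc [0..<length ms]" by (simp add: upt_conv_Cons map_Suc_upt del: upt_Suc)
  then show ?thesis by (simp add: head_rows_def stack_rows_def comp_def del: upt_Suc)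
qed

lemma index_append_rows:
  assumes "X \<in> carrier_mat p r" "Y \<in> carrier_mat q r" "i < p + q" "j < r"
  shows "(X @\<^sub>r Y) $$ (i, j) = (if i < p then X $$ (i, j) else Y $$ (i - p, j))"
  using assms unfolding append_rows_def by auto

lemma shift_mult_index:
  assumes "X \<in> carrier_mat m r" "i < m" "j < r"
  shows "(shift_block m * X) $$ (i, j) = (if Suc i < m then X $$ (Suc i, j) else 0)"
proof -
  have "(shift_block m * X) $$ (i, j) = (\<Sum>l<m. (if l = Suc i then 1 else 0) * X $$ (l, j))"
    using assms by (simp add: shift_block_def scalar_prod_def lessThan_atLeast0)
  also have "\<dots> = (\<Sum>l<m. if l = Suc i then X $$ (l, j) else 0)" by (intro sum.cong) auto
  finally show ?thesis by simp
qed

lemma shift_diag_mult_append: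
  assumes X: "X \<in> carrier_mat m r" and Y: "Y \<in> carrier_mat (sum_list ms) r"
  shows "diag_block_mat (map shift_block (m # ms)) * (X @\<^sub>r Y) = (shift_block m * X) @\<^sub>r (diag_block_mat (map shift_block ms) * Y)"
proof -
  have s: "shift_block m \<in> carrier_mat m m" by (simp add: shift_block_def)
  have "diag_block_mat (map shift_block (m # ms)) * (X @\<^sub>r Y) =
    four_block_mat (shift_block m * X) (0\<^sub>m m 0) (diag_block_mat (map shift_block ms) * Y) (0\<^sub>m (sum_list ms) 0)"
    unfolding shift_diag_Cons append_rows_def using X Y s shift_diag_carrier[of ms]
    by (subst mult_four_block_mat[of _ m m _ "sum_list ms" _ "sum_list ms" _ _ r _ 0]) auto
  then show ?thesis using X Y s shift_diag_carrier[of ms] by (simp add: append_rows_def)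
qed

lemma head_rows_carrier:
  "(\<And>k. k < length ms \<Longrightarrow> 1 \<le> ms ! k \<and> b k \<in> carrier_mat 1 r) \<Longrightarrow> head_rows r ms b \<in> carrier_mat (sum_list ms) r"
proof (induction ms arbitrary: b)
  case (Cons m ms)
  have "head_rows r ms (\<lambda>k. b (Suc k)) \<in> carrier_mat (sum_list ms) r" using Cons.prems[of "Suc k" for k] by (intro Cons.IH) auto
  moreover have "b 0 @\<^sub>r 0\<^sub>m (m - 1) r \<in> carrier_mat (1 + (m - 1)) r" using Cons.prems[of 0] by (intro carrier_append_rows) auto
  ultimately show ?case unfolding head_rows_Cons using Cons.prems[of 0] carrier_append_rows[of "b 0 @\<^sub>r 0\<^sub>m (m - 1) r" m r _ "sum_list ms"] by auto
qed (simp add: head_rows_Nil)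

lemma shift_kernel_head_rows:
  "(\<And>k. k < length ms \<Longrightarrow> 1 \<le> ms ! k \<and> b k \<in> carrier_mat 1 r) \<Longrightarrow>
    diag_block_mat (map shift_block ms) * head_rows r ms b = 0\<^sub>m (sum_list ms) r"
proof (induction ms arbitrary: b)
  case Nil
  then show ?case by (intro eq_matI) (auto simp: head_rows_Nil)
next
  case (Cons m ms)
  have IH: "diag_block_mat (map shift_block ms) * head_rows r ms (\<lambda>k. b (Suc k)) = 0\<^sub>m (sum_list ms) r"
    using Cons.prems[of "Suc k" for k] by (intro Cons.IH) auto
  have Y: "head_rows r ms (\<lambda>k. b (Suc k)) \<in> carrier_mat (sum_list ms) r"
    using Cons.prems[of "Suc k" for k] by (intro head_rows_carrier) auto
  define X where "X = b 0 @\<^sub>r 0\<^sub>m (m - 1) r"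
  have m: "1 + (m - 1) = m" and b0: "b 0 \<in> carrier_mat 1 r" using Cons.prems[of 0] by auto
  have X: "X \<in> carrier_mat m r" using carrier_append_rows[OF b0, of "0\<^sub>m (m - 1) r" "m - 1"] m by (simp add: X_def)
  have "shift_block m * X = 0\<^sub>m m r"
  proof (rule eq_matI)
    fix i j assume "i < dim_row (0\<^sub>m m r :: real mat)" "j < dim_col (0\<^sub>m m r :: real mat)"
    then have ij: "i < m" "j < r" by auto
    then show "(shift_block m * X) $$ (i, j) = 0\<^sub>m m r $$ (i, j)"
      using shift_mult_index[OF X ij] index_append_rows[OF b0 zero_carrier_mat, of "Suc i" "m - 1" j] by (auto simp: X_def)
  qed (use X in \<open>auto simp: shift_block_def\<close>)
  then show ?case
    unfolding head_rows_Cons X_def[symmetric] shift_diag_mult_append[OF X Y] IH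
    by (intro eq_matI) (auto simp: append_rows_def)
qed

text \<open>A shift block moves each row up by one and discards the first. Being annihilated
  therefore constrains every row of a block except the first, which is free and becomes
  \<open>b k\<close>.\<close>

lemma shift_kernel_is_head_rows:
  "X \<in> carrier_mat (sum_list ms) r \<Longrightarrow> \<forall>m\<in>set ms. 1 \<le> m \<Longrightarrow> diag_block_mat (map shift_block ms) * X = 0\<^sub>m (sum_list ms) r \<Longrightarrow>
    \<exists>b. (\<forall>k<length ms. b k \<in> carrier_mat 1 r) \<and> X = head_rows r ms b"
proof (induction ms arbitrary: X)
  case Nil
  then show ?case by (intro exI[of _ "\<lambda>_. 0\<^sub>m 1 r"]) (auto simp: head_rows_Nil intro!: eq_matI)
next
  case (Cons m ms)
  let ?s = "sum_list ms"
  have X: "X \<in> carrier_mat (m + ?s) r" and m: "1 \<le> m" using Cons.prems by auto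
  define X1 where "X1 = mat m r (\<lambda>ij. X $$ ij)"
  define Y where "Y = mat ?s r (\<lambda>(i, j). X $$ (m + i, j))"
  have c: "X1 \<in> carrier_mat m r" "Y \<in> carrier_mat ?s r" by (auto simp: X1_def Y_def)
  have XX: "X = X1 @\<^sub>r Y"
  proof (rule eq_matI)
    fix i j assume "i < dim_row (X1 @\<^sub>r Y)" "j < dim_col (X1 @\<^sub>r Y)"
    then have "i < m + ?s" "j < r" using carrier_append_rows[OF c] by auto
    then show "X $$ (i, j) = (X1 @\<^sub>r Y) $$ (i, j)"
      using index_append_rows[OF c, of i j] by (auto simp: X1_def Y_def)
  qed (use carrier_append_rows[OF c] X in auto)
  have s: "shift_block m * X1 \<in> carrier_mat m r" "diag_block_mat (map shift_block ms) * Y \<in> carrier_mat ?s r"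
    using c shift_diag_carrier[of ms] by (auto simp: shift_block_def)
  have z: "((shift_block m * X1) @\<^sub>r (diag_block_mat (map shift_block ms) * Y)) $$ (i, j) = 0" if "i < m + ?s" "j < r" for i j
    using Cons.prems(3) that unfolding XX shift_diag_mult_append[OF c] by simp
  have "diag_block_mat (map shift_block ms) * Y = 0\<^sub>m ?s r"
  proof (rule eq_matI)
    fix i j assume "i < dim_row (0\<^sub>m ?s r :: real mat)" "j < dim_col (0\<^sub>m ?s r :: real mat)"
    then show "(diag_block_mat (map shift_block ms) * Y) $$ (i, j) = 0\<^sub>m ?s r $$ (i, j)"
      using z[of "m + i" j] index_append_rows[OF s, of "m + i" j] by auto
  qed (use s in auto)
  then obtain b where b: "\<forall>k<length ms. b k \<in> carrier_mat 1 r" "Y = head_rows r ms b"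
    using Cons.IH[OF c(2)] Cons.prems(2) by auto
  define b0 where "b0 = mat 1 r (\<lambda>(i, j). X $$ (0, j))"
  have b0: "b0 \<in> carrier_mat 1 r" by (simp add: b0_def)
  have "X1 = b0 @\<^sub>r 0\<^sub>m (m - 1) r"
  proof (rule eq_matI)
    fix i j assume "i < dim_row (b0 @\<^sub>r 0\<^sub>m (m - 1) r)" "j < dim_col (b0 @\<^sub>r 0\<^sub>m (m - 1) r)"
    then have ij: "i < 1 + (m - 1)" "j < r" using carrier_append_rows[OF b0 zero_carrier_mat[of "m - 1" r]] by auto
    show "X1 $$ (i, j) = (b0 @\<^sub>r 0\<^sub>m (m - 1) r) $$ (i, j)"
    proof (cases i)
      case 0
      then show ?thesis using index_append_rows[OF b0 zero_carrier_mat ij] ij m by (simp add: b0_def X1_def)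
    next
      case (Suc l)
      then have l: "l < m" "Suc l < m" using ij m by auto
      \<comment> \<open>Row \<open>l\<close> of the product is row \<open>Suc l\<close> of
        \<open>X1\<close>, so all rows after the first vanish.\<close>
      have "(shift_block m * X1) $$ (l, j) = 0" using z[of l j] index_append_rows[OF s, of l j] l ij by auto
      then have "X1 $$ (i, j) = 0" using shift_mult_index[OF c(1) l(1) ij(2)] l Suc by simp
      then show ?thesis using index_append_rows[OF b0 zero_carrier_mat ij] Suc ij by simp
    qed
  qed (use carrier_append_rows[OF b0 zero_carrier_mat[of "m - 1" r]] c m in auto)
  then have "X = head_rows r (m # ms) (case_nat b0 b)" unfolding head_rows_Cons XX b(2) by simp
  moreover have "\<forall>k<length (m # ms). case_nat b0 b k \<in> carrier_mat 1 r" using b(1) b0 by (auto split: nat.split)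
  ultimately show ?case by blast
qed

section \<open>Linear Volterra equations\<close>

text \<open>The kernel \<open>K(t) = A exp(tA)\<close>, entry by entry.\<close>

lemma volterra_kernel_exists:
  fixes a :: "nat \<Rightarrow> nat \<Rightarrow> real"
  shows "\<exists>K :: nat \<Rightarrow> nat \<Rightarrow> real \<Rightarrow> real. (\<forall>i<h. \<forall>j<h. continuous_on UNIV (K i j)) \<and>
    (\<forall>i<h. \<forall>j<h. \<forall>t\<ge>0. K i j t = a i j + (\<Sum>l<h. a i l * (LINT s:{0..t}|lborel. K l j s)))"
proof -
  \<comment> \<open>\<open>p m\<close> consists of the entries of the matrix power with exponent
    \<open>m + 1\<close>, so the series \<open>K\<close> below is that of the exponential with one
    more factor of the matrix.\<close>
  define p where "p = rec_nat a (\<lambda>m q i j. \<Sum>l<h. a i l * q l j)"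
  have p0: "p 0 = a" and pS: "p (Suc m) i j = (\<Sum>l<h. a i l * p m l j)" for m i j
    by (simp_all add: p_def)
  \<comment> \<open>A crude bound for every entry of the matrix. By induction the entries of
    \<open>p m\<close> are at most \<open>\<alpha> * (real h * \<alpha>) ^ m\<close>, so that an
    exponential series dominates \<open>K\<close>.\<close>
  define \<alpha> where "\<alpha> = (\<Sum>i<h. \<Sum>j<h. \<bar>a i j\<bar>)"
  have \<alpha>: "\<bar>a i j\<bar> \<le> \<alpha>" if "i < h" "j < h" for i j
  proof -
    have "\<bar>a i j\<bar> \<le> (\<Sum>j<h. \<bar>a i j\<bar>)" using that by (intro member_le_sum) auto
    also have "\<dots> \<le> \<alpha>" unfolding \<alpha>_def using that by (intro member_le_sum) (auto intro: sum_nonneg)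
    finally show ?thesis .
  qed
  have \<alpha>0: "0 \<le> \<alpha>" unfolding \<alpha>_def by (intro sum_nonneg) auto
  have bound: "\<bar>p m i j\<bar> \<le> \<alpha> * (real h * \<alpha>) ^ m" if "i < h" "j < h" for m i j
    using that(1)
  proof (induction m arbitrary: i)
    case 0
    then show ?case using \<alpha> that(2) by (simp add: p0)
  next
    case (Suc m)
    have "\<bar>p (Suc m) i j\<bar> \<le> (\<Sum>l<h. \<bar>a i l * p m l j\<bar>)" unfolding pS by (rule sum_abs)
    also have "\<dots> \<le> (\<Sum>l<h. \<alpha> * (\<alpha> * (real h * \<alpha>) ^ m))"
      unfolding abs_mult using Suc \<alpha> \<alpha>0 by (intro sum_mono mult_mono) auto
    also have "\<dots> = \<alpha> * (real h * \<alpha>) ^ Suc m" by simp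
    finally show ?case .
  qed
  define c where "c i j m = p m i j / fact m" for i j m
  define K where "K i j t = (\<Sum>m. c i j m * t ^ m)" for i j t
  have sm: "summable (\<lambda>m. c i j m * t ^ m)" if "i < h" "j < h" for i j t
  proof (rule summable_comparison_test)
    have "norm (c i j m * t ^ m) \<le> \<alpha> * (inverse (fact m) * (real h * \<alpha> * \<bar>t\<bar>) ^ m)" for m
    proof -
      have "norm (c i j m * t ^ m) = \<bar>p m i j\<bar> * (\<bar>t\<bar> ^ m * inverse (fact m))"
        by (simp add: c_def abs_mult power_abs divide_inverse)
      also have "\<dots> \<le> (\<alpha> * (real h * \<alpha>) ^ m) * (\<bar>t\<bar> ^ m * inverse (fact m))"
        by (rule mult_right_mono[OF bound[OF that]]) simp
      finally show ?thesis by (simp add: power_mult_distrib mult_ac)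
    qed
    then show "\<exists>N. \<forall>m\<ge>N. norm (c i j m * t ^ m) \<le> \<alpha> * (inverse (fact m) * (real h * \<alpha> * \<bar>t\<bar>) ^ m)" by blast
    show "summable (\<lambda>m. \<alpha> * (inverse (fact m) * (real h * \<alpha> * \<bar>t\<bar>) ^ m))"
      by (intro summable_mult summable_exp)
  qed
  \<comment> \<open>Differentiating termwise multiplies by the matrix once more: this is the linear
    differential equation of the kernel, coefficient by coefficient.\<close>
  have diffs: "diffs (c i j) m = (\<Sum>l<h. a i l * c l j m)" for i j m
  proof -
    have "diffs (c i j) m = real (Suc m) * (p (Suc m) i j / fact (Suc m))" by (simp add: diffs_def c_def)
    also have "\<dots> = p (Suc m) i j / fact m" by (simp add: fact_Suc del: of_nat_Suc)
    also have "\<dots> = (\<Sum>l<h. a i l * c l j m)" by (simp add: pS c_def sum_divide_distrib)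
    finally show ?thesis .
  qed
  have deriv: "(K i j has_real_derivative (\<Sum>l<h. a i l * K l j t)) (at t)" if "i < h" "j < h" for i j t
  proof -
    have "(K i j has_real_derivative (\<Sum>m. diffs (c i j) m * t ^ m)) (at t)"
      unfolding K_def by (rule termdiffs_strong_converges_everywhere) (rule sm[OF that])
    also have "(\<Sum>m. diffs (c i j) m * t ^ m) = (\<Sum>m. \<Sum>l<h. a i l * (c l j m * t ^ m))"
      by (simp add: diffs sum_distrib_right mult.assoc)
    also have "\<dots> = (\<Sum>l<h. \<Sum>m. a i l * (c l j m * t ^ m))"
      by (rule suminf_sum) (use sm that(2) in \<open>auto intro!: summable_mult\<close>)
    also have "\<dots> = (\<Sum>l<h. a i l * K l j t)"
      unfolding K_def using sm that(2) by (intro sum.cong suminf_mult) auto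
    finally show ?thesis .
  qed
  have cont: "continuous_on S (K i j)" if "i < h" "j < h" for i j S
    using DERIV_isCont[OF deriv[OF that]] by (simp add: continuous_at_imp_continuous_on)
  show ?thesis
  proof (intro exI[of _ K] conjI allI impI)
    show "continuous_on UNIV (K i j)" if "i < h" "j < h" for i j by (rule cont[OF that])
    fix i j and t :: real assume ij: "i < h" "j < h" and t: "0 \<le> t"
    have "((\<lambda>s. \<Sum>l<h. a i l * K l j s) has_integral (K i j t - K i j 0)) {0..t}"
      by (rule fundamental_theorem_of_calculus[OF t])
        (use deriv[OF ij] in \<open>auto simp: has_real_derivative_iff_has_vector_derivative[symmetric] intro: DERIV_subset\<close>)
    moreover have si: "set_integrable lborel {0..t} (K l j)" if "l < h" for l
      by (rule borel_integrable_atLeastAtMost'[OF cont[OF that ij(2)]])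
    moreover have "((\<lambda>s. \<Sum>l<h. a i l * K l j s) has_integral (\<Sum>l<h. a i l * (LINT s:{0..t}|lborel. K l j s))) {0..t}"
    proof (intro has_integral_sum has_integral_mult_right)
      fix l assume "l \<in> {..<h}"
      then show "(K l j has_integral (LINT s:{0..t}|lborel. K l j s)) {0..t}"
        using set_borel_integral_eq_integral[OF si[of l]] by (simp add: has_integral_integral)
    qed simp
    ultimately have "K i j t - K i j 0 = (\<Sum>l<h. a i l * (LINT s:{0..t}|lborel. K l j s))"
      using has_integral_unique by blast
    moreover have "K i j 0 = a i j"
      unfolding K_def by (subst powser_zero) (simp add: c_def p0)
    ultimately show "K i j t = a i j + (\<Sum>l<h. a i l * (LINT s:{0..t}|lborel. K l j s))" by simp
  qed
qed

text \<open>The iterated integral runs over the triangle \<open>0 \<le> r \<le> s \<le> t\<close>.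
  Exchanging the order and translating \<open>s\<close> by \<open>r\<close> integrates the kernel in
  place of the convolution.\<close>

lemma set_integral_convolution_fubini:
  fixes k z :: "real \<Rightarrow> real"
  assumes k: "continuous_on UNIV k" and z: "set_integrable lborel {0..t} z" and t: "0 \<le> t"
  shows "(LINT s:{0..t}|lborel. (LINT r:{0..s}|lborel. k (s - r) * z r)) =
      (LINT r:{0..t}|lborel. (LINT s:{0..t - r}|lborel. k s) * z r)"
    "set_integrable lborel {0..t} (\<lambda>s. LINT r:{0..s}|lborel. k (s - r) * z r)"
    "set_integrable lborel {0..t} (\<lambda>r. (LINT s:{0..t - r}|lborel. k s) * z r)"
    "set_integrable lborel {0..t} (\<lambda>r. k (t - r) * z r)"
proof -
  have km[measurable]: "k \<in> borel_measurable borel" by (rule borel_measurable_continuous_onI[OF k])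
  define z0 where "z0 r = indicator {0..t} r * z r" for r
  have z0: "integrable lborel z0" using z by (simp add: z0_def[abs_def] set_integrable_def)
  then have [measurable]: "z0 \<in> borel_measurable borel" by auto
  have "compact (k ` {0..t})" by (intro compact_continuous_image continuous_on_subset[OF k]) auto
  from compact_imp_bounded[OF this] obtain C where "\<forall>x\<in>k ` {0..t}. norm x \<le> C"
    unfolding bounded_iff ..
  then have C: "\<And>s. s \<in> {0..t} \<Longrightarrow> \<bar>k s\<bar> \<le> C" by simp
  \<comment> \<open>The integrand cut to the triangle and extended by zero, so that Fubini's theorem
    on the whole plane applies.\<close>
  define H where "H s r = indicator {0..t} s * (indicator {0..s} r * (k (s - r) * z0 r))" for s r
  have He: "H s r = (if 0 \<le> r \<and> r \<le> s \<and> s \<le> t then k (s - r) * z0 r else 0)" for s r by (auto simp: H_def indicator_def)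
  have Hm[measurable]: "(\<lambda>(s, r). H s r) \<in> borel_measurable (lborel \<Otimes>\<^sub>M lborel)"
    unfolding He by measurable
  \<comment> \<open>The kernel is bounded on the triangle, so \<open>H\<close> is dominated by a
    product of a function of \<open>s\<close> and a function of \<open>r\<close>.\<close>
  have dom: "integrable (lborel \<Otimes>\<^sub>M lborel) (\<lambda>(s, r). (C * indicator {0..t} s) * z0 r :: real)"
  proof (rule lborel_pair.Fubini_integrable)
    show "(\<lambda>(s, r). (C * indicator {0..t} s) * z0 r) \<in> borel_measurable (lborel \<Otimes>\<^sub>M lborel)" by measurable
    have "(\<integral>r. norm ((C * indicator {0..t} s) * z0 r) \<partial>lborel) = (\<bar>C\<bar> * (\<integral>r. \<bar>z0 r\<bar> \<partial>lborel)) * indicator {0..t} s" for s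
      by (simp add: abs_mult)
    then show "integrable lborel (\<lambda>s. \<integral>r. norm (case (s, r) of (s, r) \<Rightarrow> (C * indicator {0..t} s) * z0 r) \<partial>lborel)"
      using t by (simp add: emeasure_lborel_Icc_eq)
    show "AE s in lborel. integrable lborel (\<lambda>r. case (s, r) of (s, r) \<Rightarrow> (C * indicator {0..t} s) * z0 r)"
      using z0 by simp
  qed
  have Hi: "integrable (lborel \<Otimes>\<^sub>M lborel) (\<lambda>(s, r). H s r)"
  proof (rule Bochner_Integration.integrable_bound[OF dom Hm], rule AE_I2)
    fix x :: "real \<times> real"
    obtain s r where x: "x = (s, r)" by (cases x)
    show "norm (case x of (s, r) \<Rightarrow> H s r) \<le> norm (case x of (s, r) \<Rightarrow> (C * indicator {0..t} s) * z0 r)"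
    proof (cases "0 \<le> r \<and> r \<le> s \<and> s \<le> t")
      case True
      then have "\<bar>k (s - r)\<bar> \<le> \<bar>C\<bar>" using C[of "s - r"] by auto
      then show ?thesis using True by (auto simp: x He abs_mult intro!: mult_right_mono)
    qed (auto simp: x He)
  qed
  have H1: "(\<integral>r. H s r \<partial>lborel) = indicator {0..t} s *\<^sub>R (LINT r:{0..s}|lborel. k (s - r) * z r)" for s
  proof (cases "s \<in> {0..t}")
    case True
    then show ?thesis unfolding H_def set_lebesgue_integral_def
      by (auto simp: z0_def indicator_def intro!: Bochner_Integration.integral_cong)
  qed (simp add: H_def)
  have H2: "(\<integral>s. H s r \<partial>lborel) = indicator {0..t} r *\<^sub>R ((LINT s:{0..t - r}|lborel. k s) * z r)" for r
  proof (cases "r \<in> {0..t}")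
    case True
    have "(\<integral>s. H s r \<partial>lborel) = (\<integral>s. z r * (indicator {r..t} s * k (s - r)) \<partial>lborel)"
      using True by (intro Bochner_Integration.integral_cong) (auto simp: H_def z0_def indicator_def)
    also have "\<dots> = z r * (\<integral>s. indicator {r..t} s * k (s - r) \<partial>lborel)" by simp
    also have "(\<integral>s. indicator {r..t} s * k (s - r) \<partial>lborel) = (\<integral>s. indicator {r..t} (r + 1 * s) * k (r + 1 * s - r) \<partial>lborel)"
      by (subst lborel_integral_real_affine[where c = 1 and t = r]) simp_all
    also have "\<dots> = (LINT s:{0..t - r}|lborel. k s)"
      unfolding set_lebesgue_integral_def by (intro Bochner_Integration.integral_cong) (auto simp: indicator_def)
    finally show ?thesis using True by simp
  qed (simp add: H_def z0_def)
  show "(LINT s:{0..t}|lborel. (LINT r:{0..s}|lborel. k (s - r) * z r)) = (LINT r:{0..t}|lborel. (LINT s:{0..t - r}|lborel. k s) * z r)"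
    using lborel_pair.Fubini_integral[OF Hi] unfolding H1 H2 set_lebesgue_integral_def by simp
  show "set_integrable lborel {0..t} (\<lambda>s. LINT r:{0..s}|lborel. k (s - r) * z r)"
    using lborel_pair.integrable_fst[OF Hi] unfolding H1 set_integrable_def .
  show "set_integrable lborel {0..t} (\<lambda>r. (LINT s:{0..t - r}|lborel. k s) * z r)"
    using lborel_pair.integrable_snd[OF Hi] unfolding H2 set_integrable_def .
  show "set_integrable lborel {0..t} (\<lambda>r. k (t - r) * z r)"
    unfolding set_integrable_def
  proof (rule Bochner_Integration.integrable_bound)
    show "integrable lborel (\<lambda>r. C * z0 r)" using z0 by simp
    have eq: "indicator {0..t} r *\<^sub>R (k (t - r) * z r) = k (t - r) * z0 r" for r by (simp add: z0_def)
    show "(\<lambda>r. indicator {0..t} r *\<^sub>R (k (t - r) * z r)) \<in> borel_measurable lborel" unfolding eq by measurable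
    show "AE r in lborel. norm (indicator {0..t} r *\<^sub>R (k (t - r) * z r)) \<le> norm (C * z0 r)"
    proof (rule AE_I2)
      fix r
      show "norm (indicator {0..t} r *\<^sub>R (k (t - r) * z r)) \<le> norm (C * z0 r)"
      proof (cases "r \<in> {0..t}")
        case True
        then have "\<bar>k (t - r)\<bar> \<le> \<bar>C\<bar>" using C[of "t - r"] by auto
        then show ?thesis unfolding eq by (simp add: abs_mult mult_right_mono)
      qed simp
    qed
  qed
qed

text \<open>Variation of constants: the forcing \<open>z\<close> plus its convolution with
  \<open>K\<close> solves the integral equation with matrix \<open>a\<close> and forcing
  \<open>z\<close>. By Fubini's theorem the integrated convolution is a convolution with the
  integrated kernel, and the equation of \<open>K\<close> matches the two sides.\<close>

lemma volterra_solution: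
  fixes a :: "nat \<Rightarrow> nat \<Rightarrow> real" and K :: "nat \<Rightarrow> nat \<Rightarrow> real \<Rightarrow> real"
  assumes K: "\<And>i j. i < h \<Longrightarrow> j < h \<Longrightarrow> continuous_on UNIV (K i j)"
    "\<And>i j t. i < h \<Longrightarrow> j < h \<Longrightarrow> 0 \<le> t \<Longrightarrow> K i j t = a i j + (\<Sum>l<h. a i l * (LINT s:{0..t}|lborel. K l j s))"
    and z: "\<And>j. j < h \<Longrightarrow> set_integrable lborel {0..t} (z j)" and t: "0 \<le> t" and i: "i < h"
  shows "(\<Sum>j<h. a i j * (LINT s:{0..t}|lborel. z j s + (\<Sum>l<h. LINT r:{0..s}|lborel. K j l (s - r) * z l r))) =
    (\<Sum>l<h. LINT r:{0..t}|lborel. K i l (t - r) * z l r)"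
proof -
  define kk where "kk j l r = (LINT s:{0..t - r}|lborel. K j l s)" for j l r
  note F = set_integral_convolution_fubini[OF K(1) z t]
  have 1: "(LINT s:{0..t}|lborel. z j s + (\<Sum>l<h. LINT r:{0..s}|lborel. K j l (s - r) * z l r)) =
    (LINT s:{0..t}|lborel. z j s) + (\<Sum>l<h. LINT r:{0..t}|lborel. kk j l r * z l r)" if "j < h" for j
  proof -
    have i: "set_integrable lborel {0..t} (\<lambda>s. \<Sum>l<h. LINT r:{0..s}|lborel. K j l (s - r) * z l r)"
      using F(2)[OF that] unfolding set_integrable_def scaleR_sum_right by (intro Bochner_Integration.integrable_sum) auto
    have "(LINT s:{0..t}|lborel. (\<Sum>l<h. LINT r:{0..s}|lborel. K j l (s - r) * z l r)) =
        (\<Sum>l<h. LINT s:{0..t}|lborel. LINT r:{0..s}|lborel. K j l (s - r) * z l r)"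
      using F(2)[OF that] unfolding set_lebesgue_integral_def set_integrable_def scaleR_sum_right
      by (intro Bochner_Integration.integral_sum) auto
    then show ?thesis
      using set_integral_add(2)[OF z[OF that] i] F(1)[OF that] by (simp add: kk_def)
  qed
  have 2: "(LINT r:{0..t}|lborel. K i l (t - r) * z l r) =
    a i l * (LINT r:{0..t}|lborel. z l r) + (\<Sum>j<h. a i j * (LINT r:{0..t}|lborel. kk j l r * z l r))" if l: "l < h" for l
  proof -
    have "(LINT r:{0..t}|lborel. K i l (t - r) * z l r) = (LINT r:{0..t}|lborel. a i l * z l r + (\<Sum>j<h. a i j * (kk j l r * z l r)))"
    proof (rule set_lebesgue_integral_cong)
      show "\<forall>r. r \<in> {0..t} \<longrightarrow> K i l (t - r) * z l r = a i l * z l r + (\<Sum>j<h. a i j * (kk j l r * z l r))"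
        using K(2)[OF i l] by (simp add: kk_def distrib_right sum_distrib_right mult.assoc)
    qed simp
    also have "\<dots> = (LINT r:{0..t}|lborel. a i l * z l r) + (LINT r:{0..t}|lborel. (\<Sum>j<h. a i j * (kk j l r * z l r)))"
    proof (rule set_integral_add(2))
      show "set_integrable lborel {0..t} (\<lambda>r. a i l * z l r)" using z[OF l] by simp
      show "set_integrable lborel {0..t} (\<lambda>r. \<Sum>j<h. a i j * (kk j l r * z l r))"
        unfolding set_integrable_def scaleR_sum_right
      proof (rule Bochner_Integration.integrable_sum)
        fix j assume "j \<in> {..<h}"
        then have "set_integrable lborel {0..t} (\<lambda>r. a i j * (kk j l r * z l r))" using F(3)[OF _ l l, of j] by (simp add: kk_def)
        then show "integrable lborel (\<lambda>r. indicator {0..t} r *\<^sub>R (a i j * (kk j l r * z l r)))" by (simp add: set_integrable_def)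
      qed
    qed
    also have "(LINT r:{0..t}|lborel. (\<Sum>j<h. a i j * (kk j l r * z l r))) = (\<Sum>j<h. LINT r:{0..t}|lborel. a i j * (kk j l r * z l r))"
      unfolding set_lebesgue_integral_def scaleR_sum_right
    proof (rule Bochner_Integration.integral_sum)
      fix j assume "j \<in> {..<h}"
      then have "set_integrable lborel {0..t} (\<lambda>r. a i j * (kk j l r * z l r))" using F(3)[OF _ l l, of j] by (simp add: kk_def)
      then show "integrable lborel (\<lambda>r. indicator {0..t} r *\<^sub>R (a i j * (kk j l r * z l r)))" by (simp add: set_integrable_def)
    qed
    finally show ?thesis by simp
  qed
  have "(\<Sum>j<h. a i j * (LINT s:{0..t}|lborel. z j s + (\<Sum>l<h. LINT r:{0..s}|lborel. K j l (s - r) * z l r))) =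
    (\<Sum>j<h. a i j * (LINT s:{0..t}|lborel. z j s)) + (\<Sum>j<h. \<Sum>l<h. a i j * (LINT r:{0..t}|lborel. kk j l r * z l r))"
    by (simp add: 1 distrib_left sum.distrib sum_distrib_left)
  also have "(\<Sum>j<h. \<Sum>l<h. a i j * (LINT r:{0..t}|lborel. kk j l r * z l r)) = (\<Sum>l<h. \<Sum>j<h. a i j * (LINT r:{0..t}|lborel. kk j l r * z l r))"
    by (rule sum.swap)
  finally show ?thesis by (simp add: 2 sum.distrib)
qed

section \<open>The singular equation in block coordinates\<close>

lemma mult_mat_vec_index:
  fixes A :: "real mat"
  assumes "A \<in> carrier_mat m n" "x \<in> carrier_vec n" "i < m"
  shows "(A *\<^sub>v x) $ i = (\<Sum>j<n. A $$ (i, j) * x $ j)"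
  using assms by (simp add: scalar_prod_def lessThan_atLeast0)

lemma diag_block_mult_index:
  fixes X Y :: "real mat"
  assumes "X \<in> carrier_mat h h" "Y \<in> carrier_mat k k" "y \<in> carrier_vec (h + k)" "i < h + k"
  shows "(diag_block_mat [X, Y] *\<^sub>v y) $ i =
    (if i < h then \<Sum>j<h. X $$ (i, j) * y $ j else \<Sum>q<k. Y $$ (i - h, q) * y $ (h + q))"
proof -
  have d: "dim_row X = h" "dim_col X = h" "dim_row Y = k" "dim_col Y = k" using assms by simp_all
  have c: "diag_block_mat [X, Y] \<in> carrier_mat (h + k) (h + k)"
    unfolding diag_block_mat_pair[OF assms(1,2)] by (rule four_block_carrier_mat[OF assms(1,2)])
  have split: "(\<Sum>j<h + k. f j) = (\<Sum>j<h. f j) + (\<Sum>q<k. f (h + q))" for f :: "nat \<Rightarrow> real" by (induction k) simp_all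
  have "(diag_block_mat [X, Y] *\<^sub>v y) $ i = (\<Sum>j<h + k. diag_block_mat [X, Y] $$ (i, j) * y $ j)"
    by (rule mult_mat_vec_index[OF c assms(3,4)])
  also have "\<dots> = (\<Sum>j<h. diag_block_mat [X, Y] $$ (i, j) * y $ j) + (\<Sum>q<k. diag_block_mat [X, Y] $$ (i, h + q) * y $ (h + q))"
    by (rule split)
  also have "(\<Sum>j<h. diag_block_mat [X, Y] $$ (i, j) * y $ j) = (if i < h then \<Sum>j<h. X $$ (i, j) * y $ j else 0)"
    unfolding diag_block_mat_pair[OF assms(1,2)] using assms(4) d by (auto intro!: sum.cong sum.neutral)
  also have "(\<Sum>q<k. diag_block_mat [X, Y] $$ (i, h + q) * y $ (h + q)) = (if i < h then 0 else \<Sum>q<k. Y $$ (i - h, q) * y $ (h + q))"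
    unfolding diag_block_mat_pair[OF assms(1,2)] using assms(4) d by (auto intro!: sum.cong sum.neutral)
  finally show ?thesis by simp
qed

lemma set_integral_lincomb:
  fixes f :: "'i \<Rightarrow> real \<Rightarrow> real"
  assumes "\<And>j. j \<in> K \<Longrightarrow> set_integrable M A (f j)"
  shows "set_integrable M A (\<lambda>s. \<Sum>j\<in>K. c j * f j s)" "(LINT s:A|M. (\<Sum>j\<in>K. c j * f j s)) = (\<Sum>j\<in>K. c j * (LINT s:A|M. f j s))"
proof -
  have i: "integrable M (\<lambda>s. indicator A s *\<^sub>R (c j * f j s))" if "j \<in> K" for j
    using set_integrable_mult_right[of "c j" M A "f j"] assms[OF that] by (simp add: set_integrable_def)
  show "set_integrable M A (\<lambda>s. \<Sum>j\<in>K. c j * f j s)"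
    unfolding set_integrable_def scaleR_sum_right by (rule Bochner_Integration.integrable_sum[OF i])
  have "(LINT s:A|M. (\<Sum>j\<in>K. c j * f j s)) = (\<Sum>j\<in>K. LINT s:A|M. c j * f j s)"
    unfolding set_lebesgue_integral_def scaleR_sum_right by (rule Bochner_Integration.integral_sum[OF i])
  then show "(LINT s:A|M. (\<Sum>j\<in>K. c j * f j s)) = (\<Sum>j\<in>K. c j * (LINT s:A|M. f j s))" by simp
qed

section \<open>Vector processes and the equation in matrix form\<close>

context wiener begin

lemma L2_adapted_iff:
  "x \<in> L2_adapted P W T k \<longleftrightarrow> (\<forall>t\<in>{0..T}. \<forall>\<omega>\<in>space P. x t \<omega> \<in> carrier_vec k) \<and> (\<forall>i<k. L2_process T (\<lambda>t \<omega>. x t \<omega> $ i))"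
proof -
  have fin: "(\<integral>\<^sup>+\<omega>. (\<integral>\<^sup>+t\<in>{0..T}. ennreal (\<Sum>i<k. (x t \<omega> $ i)\<^sup>2) \<partial>lborel) \<partial>P) =
     (\<Sum>i<k. \<integral>\<^sup>+\<omega>. (\<integral>\<^sup>+t\<in>{0..T}. ennreal ((x t \<omega> $ i)\<^sup>2) \<partial>lborel) \<partial>P)" if ad: "\<forall>i<k. adapted_process P W T (\<lambda>t \<omega>. x t \<omega> $ i)"
  proof -
    note m = measurable_ext[OF ad[rule_format]]
    have "(\<integral>\<^sup>+\<omega>. (\<integral>\<^sup>+t\<in>{0..T}. ennreal (\<Sum>i<k. (x t \<omega> $ i)\<^sup>2) \<partial>lborel) \<partial>P) =
      (\<integral>\<^sup>+\<omega>. (\<integral>\<^sup>+t. (\<Sum>i<k. ennreal ((indicator {0..T} t * x t \<omega> $ i)\<^sup>2)) \<partial>lborel) \<partial>P)"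
      by (intro nn_integral_cong) (auto simp: indicator_def sum_nonneg)
    also have "\<dots> = (\<integral>\<^sup>+\<omega>. (\<Sum>i<k. \<integral>\<^sup>+t. ennreal ((indicator {0..T} t * x t \<omega> $ i)\<^sup>2) \<partial>lborel) \<partial>P)"
    proof (intro nn_integral_cong nn_integral_sum)
      fix \<omega> i assume "\<omega> \<in> space P" "i \<in> {..<k}"
      then have [measurable]: "(\<lambda>t. indicator {0..T} t * x t \<omega> $ i) \<in> borel_measurable borel" using sectionI[OF m] by simp
      show "(\<lambda>t. ennreal ((indicator {0..T} t * x t \<omega> $ i)\<^sup>2)) \<in> borel_measurable lborel" by measurable
    qed
    also have "\<dots> = (\<Sum>i<k. \<integral>\<^sup>+\<omega>. (\<integral>\<^sup>+t. ennreal ((indicator {0..T} t * x t \<omega> $ i)\<^sup>2) \<partial>lborel) \<partial>P)"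
      by (rule nn_integral_sum) (use measurable_nn2[OF m] in auto)
    finally show ?thesis unfolding set_nn_integral_sq_eq .
  qed
  show ?thesis
  proof
    assume x: "x \<in> L2_adapted P W T k"
    then have ad: "\<forall>i<k. adapted_process P W T (\<lambda>t \<omega>. x t \<omega> $ i)" by (simp add: L2_adapted_def)
    have "(\<Sum>i<k. \<integral>\<^sup>+\<omega>. (\<integral>\<^sup>+t\<in>{0..T}. ennreal ((x t \<omega> $ i)\<^sup>2) \<partial>lborel) \<partial>P) < \<infinity>"
      using x unfolding fin[OF ad, symmetric] by (simp add: L2_adapted_def)
    then have "\<forall>i<k. (\<integral>\<^sup>+\<omega>. (\<integral>\<^sup>+t\<in>{0..T}. ennreal ((x t \<omega> $ i)\<^sup>2) \<partial>lborel) \<partial>P) < \<infinity>" by auto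
    with x ad show "(\<forall>t\<in>{0..T}. \<forall>\<omega>\<in>space P. x t \<omega> \<in> carrier_vec k) \<and> (\<forall>i<k. L2_process T (\<lambda>t \<omega>. x t \<omega> $ i))"
      by (simp add: L2_adapted_def L2_process_def)
  next
    assume x: "(\<forall>t\<in>{0..T}. \<forall>\<omega>\<in>space P. x t \<omega> \<in> carrier_vec k) \<and> (\<forall>i<k. L2_process T (\<lambda>t \<omega>. x t \<omega> $ i))"
    then have ad: "\<forall>i<k. adapted_process P W T (\<lambda>t \<omega>. x t \<omega> $ i)" by (simp add: L2_process_def)
    have "(\<Sum>i<k. \<integral>\<^sup>+\<omega>. (\<integral>\<^sup>+t\<in>{0..T}. ennreal ((x t \<omega> $ i)\<^sup>2) \<partial>lborel) \<partial>P) < \<infinity>"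
      using x by (auto simp: L2_process_def)
    with x ad show "x \<in> L2_adapted P W T k" unfolding fin[OF ad, symmetric] by (simp add: L2_adapted_def)
  qed
qed

lemma L2_adapted_carrier: "x \<in> L2_adapted P W T k \<Longrightarrow> t \<in> {0..T} \<Longrightarrow> \<omega> \<in> space P \<Longrightarrow> x t \<omega> \<in> carrier_vec k"
  by (simp add: L2_adapted_iff)

lemma L2_adapted_component: "x \<in> L2_adapted P W T k \<Longrightarrow> i < k \<Longrightarrow> L2_process T (\<lambda>t \<omega>. x t \<omega> $ i)"
  by (simp add: L2_adapted_iff)

lemma L2_process_lincomb:
  "finite K \<Longrightarrow> (\<And>j. j \<in> K \<Longrightarrow> L2_process T (f j)) \<Longrightarrow> L2_process T (\<lambda>s \<omega>. \<Sum>j\<in>K. c j * f j s \<omega>)"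
  by (rule L2_process_sum) (auto intro: L2_process_cmult)

lemma L2_adapted_mult:
  assumes x: "x \<in> L2_adapted P W T n" and N: "N \<in> carrier_mat m n"
  shows "(\<lambda>t \<omega>. N *\<^sub>v x t \<omega>) \<in> L2_adapted P W T m"
  unfolding L2_adapted_iff
proof (intro conjI ballI allI impI)
  fix t \<omega> assume "t \<in> {0..T}" "\<omega> \<in> space P"
  then show "N *\<^sub>v x t \<omega> \<in> carrier_vec m" by (rule mult_mat_vec_carrier[OF N L2_adapted_carrier[OF x]])
next
  fix i assume i: "i < m"
  have "L2_process T (\<lambda>t \<omega>. \<Sum>j<n. N $$ (i, j) * x t \<omega> $ j)"
    by (rule L2_process_lincomb) (auto intro: L2_adapted_component[OF x])
  then show "L2_process T (\<lambda>t \<omega>. (N *\<^sub>v x t \<omega>) $ i)"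
    by (rule L2_process_cong) (use mult_mat_vec_index[OF N L2_adapted_carrier[OF x] i] in simp)
qed

definition ivec :: "nat \<Rightarrow> (real \<Rightarrow> 'w \<Rightarrow> real vec) \<Rightarrow> real \<Rightarrow> 'w \<Rightarrow> real vec" where
  "ivec n x t \<omega> = Matrix.vec n (\<lambda>j. LINT s:{0..t}|lborel. x s \<omega> $ j)"

lemma ivec_carrier [simp]: "ivec n x t \<omega> \<in> carrier_vec n" by (simp add: ivec_def)

lemma ivec_index [simp]: "j < n \<Longrightarrow> ivec n x t \<omega> $ j = (LINT s:{0..t}|lborel. x s \<omega> $ j)" by (simp add: ivec_def)

text \<open>Integration commutes with matrices only along integrable paths, as other integrals take
  default values. Almost every path of a process in \<open>L2_adapted\<close> is of this
  kind.\<close>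

definition ipaths :: "real \<Rightarrow> nat \<Rightarrow> (real \<Rightarrow> 'w \<Rightarrow> real vec) \<Rightarrow> 'w \<Rightarrow> bool" where
  "ipaths T n x \<omega> \<longleftrightarrow> (\<forall>s\<in>{0..T}. x s \<omega> \<in> carrier_vec n) \<and> (\<forall>j<n. \<forall>t\<in>{0..T}. set_integrable lborel {0..t} (\<lambda>s. x s \<omega> $ j))"

lemma AE_ipaths:
  assumes x: "x \<in> L2_adapted P W T n"
  shows "AE \<omega> in P. ipaths T n x \<omega>"
proof -
  have "AE \<omega> in P. \<forall>j\<in>{..<n}. set_integrable lborel {0..T} (\<lambda>s. x s \<omega> $ j)"
    by (intro AE_finite_allI L2_process_paths L2_adapted_component[OF x]) auto
  then show ?thesis using AE_space
  proof eventually_elim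
    case (elim \<omega>)
    have "set_integrable lborel {0..t} (\<lambda>s. x s \<omega> $ j)" if "j < n" "t \<in> {0..T}" for j t
      by (rule set_integrable_subset[of lborel "{0..T}"]) (use elim that in auto)
    then show ?case using L2_adapted_carrier[OF x _ elim(2)] by (simp add: ipaths_def)
  qed
qed

lemma ivec_mult:
  assumes "ipaths T n x \<omega>" and N: "N \<in> carrier_mat m n" and t: "t \<in> {0..T}"
  shows "ivec m (\<lambda>t \<omega>. N *\<^sub>v x t \<omega>) t \<omega> = N *\<^sub>v ivec n x t \<omega>"
    "i < m \<Longrightarrow> set_integrable lborel {0..t} (\<lambda>s. (N *\<^sub>v x s \<omega>) $ i)"
proof -
  have x: "\<And>s. s \<in> {0..T} \<Longrightarrow> x s \<omega> \<in> carrier_vec n" and i: "\<And>j. j < n \<Longrightarrow> set_integrable lborel {0..t} (\<lambda>s. x s \<omega> $ j)"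
    using assms(1) t by (auto simp: ipaths_def)
  have e: "(N *\<^sub>v x s \<omega>) $ i = (\<Sum>j<n. N $$ (i, j) * x s \<omega> $ j)" if "i < m" "s \<in> {0..t}" for i s
    by (rule mult_mat_vec_index[OF N x that(1)]) (use that t in auto)
  have si: "set_integrable lborel {0..t} (\<lambda>s. \<Sum>j<n. N $$ (i, j) * x s \<omega> $ j)" for i
    by (rule set_integral_lincomb(1)) (use i in auto)
  show "set_integrable lborel {0..t} (\<lambda>s. (N *\<^sub>v x s \<omega>) $ i)" if "i < m"
    using si[of i] by (rule set_integrable_cong[THEN iffD1, rotated -1]) (use e that in auto)
  show "ivec m (\<lambda>t \<omega>. N *\<^sub>v x t \<omega>) t \<omega> = N *\<^sub>v ivec n x t \<omega>"
  proof (rule eq_vecI)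
    fix i assume "i < dim_vec (N *\<^sub>v ivec n x t \<omega>)"
    then have im: "i < m" using N by simp
    have "ivec m (\<lambda>t \<omega>. N *\<^sub>v x t \<omega>) t \<omega> $ i = (LINT s:{0..t}|lborel. \<Sum>j<n. N $$ (i, j) * x s \<omega> $ j)"
      using im by (simp, intro set_lebesgue_integral_cong) (use e im in auto)
    also have "\<dots> = (\<Sum>j<n. N $$ (i, j) * (LINT s:{0..t}|lborel. x s \<omega> $ j))"
      by (rule set_integral_lincomb(2)) (use i in auto)
    also have "\<dots> = (N *\<^sub>v ivec n x t \<omega>) $ i"
      using mult_mat_vec_index[OF N ivec_carrier im, of x t \<omega>] by simp
    finally show "ivec m (\<lambda>t \<omega>. N *\<^sub>v x t \<omega>) t \<omega> $ i = (N *\<^sub>v ivec n x t \<omega>) $ i" .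
  qed (use N in \<open>simp add: ivec_def\<close>)
qed

lemma drift_ivec:
  assumes "ipaths T n x \<omega>" "ipaths T r u \<omega>" and A: "A \<in> carrier_mat n n" and B: "B \<in> carrier_mat n r" and t: "t \<in> {0..T}"
  shows "Matrix.vec n (\<lambda>i. LINT s:{0..t}|lborel. (A *\<^sub>v x s \<omega> + B *\<^sub>v u s \<omega>) $ i) = A *\<^sub>v ivec n x t \<omega> + B *\<^sub>v ivec r u t \<omega>"
proof (rule eq_vecI)
  fix i assume "i < dim_vec (A *\<^sub>v ivec n x t \<omega> + B *\<^sub>v ivec r u t \<omega>)"
  then have i: "i < n" using B by simp
  have "(LINT s:{0..t}|lborel. (A *\<^sub>v x s \<omega> + B *\<^sub>v u s \<omega>) $ i) = (LINT s:{0..t}|lborel. (A *\<^sub>v x s \<omega>) $ i + (B *\<^sub>v u s \<omega>) $ i)"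
    using A B i by simp
  also have "\<dots> = (LINT s:{0..t}|lborel. (A *\<^sub>v x s \<omega>) $ i) + (LINT s:{0..t}|lborel. (B *\<^sub>v u s \<omega>) $ i)"
    by (rule set_integral_add(2)[OF ivec_mult(2)[OF assms(1) A t i] ivec_mult(2)[OF assms(2) B t i]])
  also have "\<dots> = (A *\<^sub>v ivec n x t \<omega>) $ i + (B *\<^sub>v ivec r u t \<omega>) $ i"
    using arg_cong[OF ivec_mult(1)[OF assms(1) A t], of "\<lambda>v. v $ i"] arg_cong[OF ivec_mult(1)[OF assms(2) B t], of "\<lambda>v. v $ i"] i by simp
  finally show "Matrix.vec n (\<lambda>i. LINT s:{0..t}|lborel. (A *\<^sub>v x s \<omega> + B *\<^sub>v u s \<omega>) $ i) $ i = (A *\<^sub>v ivec n x t \<omega> + B *\<^sub>v ivec r u t \<omega>) $ i"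
    using i A B by simp
qed (use B in simp)

text \<open>Ito integrals are unique up to null sets, so the versions that
  \<open>is_solution\<close> chooses separately for each time can be replaced by one family
  \<open>J\<close> fixed in advance.\<close>

lemma is_solution_iff:
  assumes u: "u \<in> L2_adapted P W T r" and A: "A \<in> carrier_mat n n" and B: "B \<in> carrier_mat n r"
    and J: "\<And>i t. i < n \<Longrightarrow> t \<in> {0..T} \<Longrightarrow> has_ito_integral P W t (\<lambda>s \<omega>. (D *\<^sub>v u s \<omega>) $ i) (J i t)"
  shows "is_solution P W T n E A B D x0 u x \<longleftrightarrow> x \<in> L2_adapted P W T n \<and>
    (\<forall>t\<in>{0..T}. AE \<omega> in P. E *\<^sub>v x t \<omega> = x0 + (A *\<^sub>v ivec n x t \<omega> + B *\<^sub>v ivec r u t \<omega>) + Matrix.vec n (\<lambda>i. J i t \<omega>))"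
proof -
  have dr: "AE \<omega> in P. Matrix.vec n (\<lambda>i. LINT s:{0..t}|lborel. (A *\<^sub>v x s \<omega> + B *\<^sub>v u s \<omega>) $ i) = A *\<^sub>v ivec n x t \<omega> + B *\<^sub>v ivec r u t \<omega>"
    if "x \<in> L2_adapted P W T n" "t \<in> {0..T}" for t
    using AE_ipaths[OF that(1)] AE_ipaths[OF u] by eventually_elim (rule drift_ivec[OF _ _ A B that(2)])
  show ?thesis
  proof
    assume s: "is_solution P W T n E A B D x0 u x"
    then have x: "x \<in> L2_adapted P W T n" by (simp add: is_solution_def)
    have "AE \<omega> in P. E *\<^sub>v x t \<omega> = x0 + (A *\<^sub>v ivec n x t \<omega> + B *\<^sub>v ivec r u t \<omega>) + Matrix.vec n (\<lambda>i. J i t \<omega>)" if t: "t \<in> {0..T}" for t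
    proof -
      from s t obtain J' where J': "\<And>i. i < n \<Longrightarrow> has_ito_integral P W t (\<lambda>s \<omega>. (D *\<^sub>v u s \<omega>) $ i) (J' i)"
        "AE \<omega> in P. E *\<^sub>v x t \<omega> = x0 + Matrix.vec n (\<lambda>i. LINT s:{0..t}|lborel. (A *\<^sub>v x s \<omega> + B *\<^sub>v u s \<omega>) $ i) + Matrix.vec n (\<lambda>i. J' i \<omega>)"
        unfolding is_solution_def by blast
      have "AE \<omega> in P. \<forall>i\<in>{..<n}. J' i \<omega> = J i t \<omega>"
        by (intro AE_finite_allI ito_integral_unique[OF J'(1) J]) (use t in auto)
      then show ?thesis using J'(2) dr[OF x t]
      proof eventually_elim
        case (elim \<omega>)
        have "Matrix.vec n (\<lambda>i. J' i \<omega>) = Matrix.vec n (\<lambda>i. J i t \<omega>)" using elim(1) by (intro eq_vecI) auto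
        then show ?case using elim(2,3) by simp
      qed
    qed
    with x show "x \<in> L2_adapted P W T n \<and>
      (\<forall>t\<in>{0..T}. AE \<omega> in P. E *\<^sub>v x t \<omega> = x0 + (A *\<^sub>v ivec n x t \<omega> + B *\<^sub>v ivec r u t \<omega>) + Matrix.vec n (\<lambda>i. J i t \<omega>))" by blast
  next
    assume s: "x \<in> L2_adapted P W T n \<and>
      (\<forall>t\<in>{0..T}. AE \<omega> in P. E *\<^sub>v x t \<omega> = x0 + (A *\<^sub>v ivec n x t \<omega> + B *\<^sub>v ivec r u t \<omega>) + Matrix.vec n (\<lambda>i. J i t \<omega>))"
    show "is_solution P W T n E A B D x0 u x"
      unfolding is_solution_def
    proof (intro conjI ballI)
      fix t assume t: "t \<in> {0..T}"
      have "AE \<omega> in P. E *\<^sub>v x t \<omega> = x0 + Matrix.vec n (\<lambda>i. LINT s:{0..t}|lborel. (A *\<^sub>v x s \<omega> + B *\<^sub>v u s \<omega>) $ i) + Matrix.vec n (\<lambda>i. J i t \<omega>)"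
        using dr[OF s[THEN conjunct1] t] s[THEN conjunct2, rule_format, OF t] by eventually_elim simp
      then show "\<exists>J. (\<forall>i<n. has_ito_integral P W t (\<lambda>s \<omega>. (D *\<^sub>v u s \<omega>) $ i) (J i)) \<and>
        (AE \<omega> in P. E *\<^sub>v x t \<omega> = x0 + Matrix.vec n (\<lambda>i. LINT s:{0..t}|lborel. (A *\<^sub>v x s \<omega> + B *\<^sub>v u s \<omega>) $ i) + Matrix.vec n (\<lambda>i. J i \<omega>))"
        using J[OF _ t] by (intro exI[of _ "\<lambda>i. J i t"]) auto
    qed (use s in blast)
  qed
qed

end

text \<open>Multiplication by \<open>M\<close> is injective because of the left inverse
  \<open>M'\<close>, so nothing is lost in passing to the transformed equation.\<close>

lemma equation_transform:
  fixes E A M N M' :: "real mat"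
  assumes c: "E \<in> carrier_mat n n" "A \<in> carrier_mat n n" "B \<in> carrier_mat n r" "M \<in> carrier_mat n n" "N \<in> carrier_mat n n" "M' \<in> carrier_mat n n"
    and inv: "M' * M = 1\<^sub>m n"
    and v: "x0 \<in> carrier_vec n" "y \<in> carrier_vec n" "yi \<in> carrier_vec n" "ui \<in> carrier_vec r" "J \<in> carrier_vec n"
  shows "E *\<^sub>v (N *\<^sub>v y) = x0 + (A *\<^sub>v (N *\<^sub>v yi) + B *\<^sub>v ui) + J \<longleftrightarrow>
    (M * E * N) *\<^sub>v y = M *\<^sub>v x0 + ((M * A * N) *\<^sub>v yi + (M * B) *\<^sub>v ui) + M *\<^sub>v J"
proof -
  have assoc: "(M * X * N) *\<^sub>v z = M *\<^sub>v (X *\<^sub>v (N *\<^sub>v z))" if "X \<in> carrier_mat n n" "z \<in> carrier_vec n" for X z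
    using that c by (simp add: assoc_mult_mat_vec[of _ n n _ n])
  have B: "(M * B) *\<^sub>v ui = M *\<^sub>v (B *\<^sub>v ui)" by (rule assoc_mult_mat_vec[OF c(4,3) v(4)])
  define a where "a = E *\<^sub>v (N *\<^sub>v y)"
  define b where "b = x0 + (A *\<^sub>v (N *\<^sub>v yi) + B *\<^sub>v ui) + J"
  have cb: "A *\<^sub>v (N *\<^sub>v yi) \<in> carrier_vec n" "B *\<^sub>v ui \<in> carrier_vec n" using c v by auto
  have ab: "a \<in> carrier_vec n" "b \<in> carrier_vec n" using c v by (auto simp: a_def b_def)
  have Mb: "M *\<^sub>v b = M *\<^sub>v x0 + (M *\<^sub>v (A *\<^sub>v (N *\<^sub>v yi)) + M *\<^sub>v (B *\<^sub>v ui)) + M *\<^sub>v J"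
    unfolding b_def using cb v c by (simp add: mult_add_distrib_mat_vec[of _ n n] assoc_add_vec[of _ n])
  have "a = b" if "M *\<^sub>v a = M *\<^sub>v b"
  proof -
    have "M' *\<^sub>v (M *\<^sub>v a) = M' *\<^sub>v (M *\<^sub>v b)" using that by simp
    then have "(M' * M) *\<^sub>v a = (M' * M) *\<^sub>v b" using assoc_mult_mat_vec[OF c(6,4) ab(1)] assoc_mult_mat_vec[OF c(6,4) ab(2)] by simp
    then show ?thesis using ab by (simp add: inv)
  qed
  then have "a = b \<longleftrightarrow> M *\<^sub>v a = M *\<^sub>v b" by blast
  then show ?thesis unfolding assoc[OF c(1) v(2)] assoc[OF c(2) v(3)] B unfolding a_def[symmetric] Mb b_def[symmetric] by simp
qed

context wiener begin

lemma L2_process_indicator: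
  assumes "S \<in> sets borel"
  shows "L2_process T (\<lambda>s \<omega>. b * indicator S s)"
proof -
  have "L2_process T (\<lambda>s \<omega>. indicator S s * b)"
    by (rule L2_process_bounded_mult[where c = "indicator S" and C = 1], rule L2_process_const) (use assms in \<open>auto simp: indicator_def\<close>)
  then show ?thesis by (rule L2_process_cong) simp
qed

lemma jump_L2_adapted:
  assumes v: "v \<in> carrier_vec r"
  shows "(\<lambda>t \<omega>. if a < t then v else 0\<^sub>v r) \<in> L2_adapted P W T r"
  unfolding L2_adapted_iff
proof (intro conjI ballI allI impI)
  fix i assume i: "i < r"
  have "L2_process T (\<lambda>s \<omega>. v $ i * indicator {a<..} s)" by (rule L2_process_indicator) simp
  then show "L2_process T (\<lambda>t \<omega>. (if a < t then v else 0\<^sub>v r) $ i)" by (rule L2_process_cong) (use i in auto)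
qed (use v in simp)

lemma L2_process_diff: "L2_process T f \<Longrightarrow> L2_process T g \<Longrightarrow> L2_process T (\<lambda>s \<omega>. f s \<omega> - g s \<omega>)"
  by (rule L2_process_cong[OF L2_process_add[OF _ L2_process_cmult[of T g "-1"]], of f]) simp_all

lemma L2_process_time_integral: "L2_process T f \<Longrightarrow> 0 < T \<Longrightarrow> L2_process T (\<lambda>t \<omega>. LINT s:{0..t}|lborel. f s \<omega>)"
  using L2_process_convolution[of T f "\<lambda>_. 1"] by simp

lemma L2_process_adapted: "L2_process T f \<Longrightarrow> adapted_process P W T f"
  by (simp add: L2_process_def)

text \<open>Downward induction on the rows: once the rows below have been solved, the strictly upper triangular left-hand side
  is an explicit multiple of the jump.\<close>

lemma nilpotent_jump_descent:
  fixes G :: "nat \<Rightarrow> nat \<Rightarrow> real"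
  assumes G: "\<And>i q. q \<le> i \<Longrightarrow> i < k \<Longrightarrow> G i q = 0" and y: "\<And>i. i < k \<Longrightarrow> L2_process T (y i)" and a: "0 < a" "a < T"
    and eq: "\<And>i t. i < k \<Longrightarrow> t \<in> {0..T} \<Longrightarrow> AE \<omega> in P. (\<Sum>q<k. G i q * y q t \<omega>) =
      c i + (LINT s:{0..t}|lborel. y i s \<omega> + b i * indicator {a<..} s) + d i * (W t \<omega> - W (min t a) \<omega>)"
    and "i < k"
  shows "(\<Sum>q<k. G i q * b q) = 0 \<and> c i = 0 \<and> d i = 0 \<and>
    (AE t in lborel. t \<in> {0..T} \<longrightarrow> (AE \<omega> in P. y i t \<omega> + b i * indicator {a<..} t = 0))"
  using \<open>i < k\<close>
proof (induction "k - i" arbitrary: i rule: less_induct)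
  case less
  define g where "g j s \<omega> = y j s \<omega> + b j * indicator {a<..} s" for j s \<omega>
  have g: "L2_process T (g j)" if "j < k" for j
    unfolding g_def by (rule L2_process_add[OF y[OF that] L2_process_indicator]) simp
  have ih: "AE t in lborel. t \<in> {0..T} \<longrightarrow> (AE \<omega> in P. g q t \<omega> = 0)" if "i < q" "q < k" for q
    using less.hyps[of q] that unfolding g_def by simp
  have "AE t in lborel. \<forall>q\<in>{i<..<k}. t \<in> {0..T} \<longrightarrow> (AE \<omega> in P. g q t \<omega> = 0)"
    by (rule AE_finite_allI) (use ih in auto)
  then have "AE t in lborel. t \<in> {0..T} \<longrightarrow> (AE \<omega> in P. - (\<Sum>q<k. G i q * b q) * indicator {a<..} t =
      c i + (LINT s:{0..t}|lborel. g i s \<omega>) + d i * (W t \<omega> - W (min t a) \<omega>))"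
  proof eventually_elim
    case (elim t)
    show ?case
    proof
      assume t: "t \<in> {0..T}"
      have "AE \<omega> in P. \<forall>q\<in>{i<..<k}. g q t \<omega> = 0"
        by (rule AE_finite_allI) (use elim t in auto)
      then show "AE \<omega> in P. - (\<Sum>q<k. G i q * b q) * indicator {a<..} t =
        c i + (LINT s:{0..t}|lborel. g i s \<omega>) + d i * (W t \<omega> - W (min t a) \<omega>)"
        using eq[OF less.prems t]
      proof eventually_elim
        case (elim \<omega>)
        have "G i q * y q t \<omega> = - (G i q * b q * indicator {a<..} t)" if q: "q < k" for q
        proof (cases "q \<le> i")
          case False
          then have "y q t \<omega> = - (b q * indicator {a<..} t)" using elim(1) q by (simp add: g_def eq_neg_iff_add_eq_0)
          then show ?thesis by simp
        qed (simp add: G[OF _ less.prems])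
        then have "(\<Sum>q<k. G i q * y q t \<omega>) = - (\<Sum>q<k. G i q * b q) * indicator {a<..} t"
          by (simp add: sum_negf sum_distrib_right)
        then show ?case using elim(2) unfolding g_def by simp
      qed
    qed
  qed
  note j = jump_brownian_integral_independent[OF g[OF less.prems] a this]
  have "AE t in lborel. t \<in> {0..T} \<longrightarrow> (AE \<omega> in P. g i t \<omega> = 0)"
    using AE_swap_process[OF L2_process_adapted[OF g[OF less.prems]]] j(4) by blast
  then show ?case using j(1-3) unfolding g_def by simp
qed

section \<open>Equality almost everywhere in time and outcome\<close>

lemma pair_sigma_finite_time: "pair_sigma_finite (restrict_space lborel {0..T :: real}) P"
proof -
  have "sigma_finite_measure (restrict_space lborel {0..T :: real})"
    by (rule sigma_finite_measure_restrict_space[OF lborel.sigma_finite_measure_axioms]) simp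
  then show ?thesis unfolding pair_sigma_finite_def using sigma_finite_measure_axioms by blast
qed

lemma AE_time_sections:
  fixes T :: real
  assumes "AE (t, \<omega>) in restrict_space lborel {0..T} \<Otimes>\<^sub>M P. Q t \<omega>"
  shows "AE t in lborel. t \<in> {0..T} \<longrightarrow> (AE \<omega> in P. Q t \<omega>)"
proof -
  have "AE t in restrict_space lborel {0..T}. AE \<omega> in P. Q t \<omega>"
    using pair_sigma_finite.AE_pair[OF pair_sigma_finite_time, of "\<lambda>(t, \<omega>). Q t \<omega>"] assms by simp
  moreover have "{0..T} \<inter> space lborel \<in> sets lborel" by simp
  ultimately show ?thesis by (simp only: AE_restrict_space_iff)
qed

text \<open>This direction of Fubini's theorem needs the set of agreement to be measurable in the
  product, which joint measurability of the components provides. Equal components give equal vectors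
  because both have dimension \<open>n\<close>.\<close>

lemma AE_time_product:
  assumes x: "x \<in> L2_adapted P W T n" and y: "y \<in> L2_adapted P W T n"
    and eq: "AE t in lborel. t \<in> {0..T} \<longrightarrow> (AE \<omega> in P. \<forall>i<n. x t \<omega> $ i = y t \<omega> $ i)"
  shows "AE (t, \<omega>) in restrict_space lborel {0..T} \<Otimes>\<^sub>M P. x t \<omega> = y t \<omega>"
proof -
  let ?M = "restrict_space lborel {0..T} \<Otimes>\<^sub>M P"
  have s: "sets ?M = sets (restrict_space borel {0..T} \<Otimes>\<^sub>M P)"
    by (intro sets_pair_measure_cong sets_restrict_space_cong) simp_all
  have m: "(\<lambda>(t, \<omega>). z t \<omega> $ i) \<in> borel_measurable ?M" if "z \<in> L2_adapted P W T n" "i < n" for z i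
    unfolding measurable_cong_sets[OF s refl]
    using L2_process_adapted[OF L2_adapted_component[OF that]] unfolding adapted_process_def by blast
  have "{p \<in> space ?M. (\<lambda>(t, \<omega>). x t \<omega> $ i) p = (\<lambda>(t, \<omega>). y t \<omega> $ i) p} \<in> sets ?M" if "i < n" for i
    by (intro measurable_equality_set m x y that)
  then have "{p \<in> space ?M. \<forall>i\<in>{..<n}. (\<lambda>(t, \<omega>). x t \<omega> $ i) p = (\<lambda>(t, \<omega>). y t \<omega> $ i) p} \<in> sets ?M"
    by (intro sets.sets_Collect_finite_All) auto
  moreover have "AE t in restrict_space lborel {0..T}. AE \<omega> in P. \<forall>i\<in>{..<n}. x t \<omega> $ i = y t \<omega> $ i"
    using eq AE_restrict_space_iff[of "{0..T}" lborel] by (simp add: Ball_def)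
  ultimately have "AE p in ?M. \<forall>i\<in>{..<n}. (\<lambda>(t, \<omega>). x t \<omega> $ i) p = (\<lambda>(t, \<omega>). y t \<omega> $ i) p"
    by (intro pair_sigma_finite.AE_pair_measure[OF pair_sigma_finite_time]) simp_all
  then show ?thesis using AE_space
  proof eventually_elim
    case (elim p)
    obtain t \<omega> where p: "p = (t, \<omega>)" by (cases p)
    then have "t \<in> {0..T}" "\<omega> \<in> space P" using elim(2) by (auto simp: space_pair_measure)
    then have "x t \<omega> \<in> carrier_vec n" "y t \<omega> \<in> carrier_vec n" using L2_adapted_carrier x y by blast+
    then show ?case using elim(1) unfolding p by (simp, intro eq_vecI) auto
  qed
qed

end

text \<open>Strict upper triangularity is all that is recorded about \<open>G\<close>; its Jordan
  blocks matter when \<open>G * B2 = 0\<close> is translated into the shape of \<open>B2\<close>.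
  The left inverse \<open>M'\<close> cancels \<open>M\<close>, and the right inverse
  \<open>N'\<close> provides coordinates \<open>y\<close> with
  \<open>x = N *\<^sub>v y\<close>.\<close>

locale weierstrass_sde = wiener P W for P :: "'w measure" and W :: "real \<Rightarrow> 'w \<Rightarrow> real" +
  fixes h k r :: nat and T :: real and E A B D M N M' N' A1 G :: "real mat" and x0 :: "real vec"
  assumes T: "0 < T"
    and E: "E \<in> carrier_mat (h + k) (h + k)" and A: "A \<in> carrier_mat (h + k) (h + k)"
    and B: "B \<in> carrier_mat (h + k) r" and D: "D \<in> carrier_mat (h + k) r" and x0: "x0 \<in> carrier_vec (h + k)"
    and M: "M \<in> carrier_mat (h + k) (h + k)" and N: "N \<in> carrier_mat (h + k) (h + k)"
    and M': "M' \<in> carrier_mat (h + k) (h + k)" and N': "N' \<in> carrier_mat (h + k) (h + k)"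
    and M'M: "M' * M = 1\<^sub>m (h + k)" and NN': "N * N' = 1\<^sub>m (h + k)"
    and A1: "A1 \<in> carrier_mat h h" and G: "G \<in> carrier_mat k k"
    and MEN: "M * E * N = diag_block_mat [1\<^sub>m h, G]" and MAN: "M * A * N = diag_block_mat [A1, 1\<^sub>m k]"
    and G_upper: "\<And>i q. q \<le> i \<Longrightarrow> i < k \<Longrightarrow> G $$ (i, q) = 0"
begin

abbreviation "n \<equiv> h + k"

text \<open>The transformed equation at one time and outcome. The upper rows express
  \<open>y\<close> itself at time \<open>t\<close>, the lower rows only the image of its lower part
  under \<open>G\<close>.\<close>

definition rows where
  "rows u J y t \<omega> \<longleftrightarrow>
    (\<forall>i<h. y t \<omega> $ i = (M *\<^sub>v x0) $ i + ((\<Sum>j<h. A1 $$ (i, j) * (LINT s:{0..t}|lborel. y s \<omega> $ j)) +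
      ((M * B) *\<^sub>v ivec r u t \<omega>) $ i) + (M *\<^sub>v Matrix.vec n (\<lambda>i. J i t \<omega>)) $ i) \<and>
    (\<forall>i<k. (\<Sum>q<k. G $$ (i, q) * y t \<omega> $ (h + q)) = (M *\<^sub>v x0) $ (h + i) + ((LINT s:{0..t}|lborel. y s \<omega> $ (h + i)) +
      ((M * B) *\<^sub>v ivec r u t \<omega>) $ (h + i)) + (M *\<^sub>v Matrix.vec n (\<lambda>i. J i t \<omega>)) $ (h + i))"

lemma equation_iff_rows:
  assumes y: "y t \<omega> \<in> carrier_vec n"
  shows "E *\<^sub>v (N *\<^sub>v y t \<omega>) = x0 + (A *\<^sub>v (N *\<^sub>v ivec n y t \<omega>) + B *\<^sub>v ivec r u t \<omega>) + Matrix.vec n (\<lambda>i. J i t \<omega>) \<longleftrightarrow>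
    rows u J y t \<omega>"
proof -
  let ?l = "diag_block_mat [1\<^sub>m h, G] *\<^sub>v y t \<omega>"
  let ?r = "M *\<^sub>v x0 + (diag_block_mat [A1, 1\<^sub>m k] *\<^sub>v ivec n y t \<omega> + (M * B) *\<^sub>v ivec r u t \<omega>) + M *\<^sub>v Matrix.vec n (\<lambda>i. J i t \<omega>)"
  have l: "?l $ i = (if i < h then y t \<omega> $ i else \<Sum>q<k. G $$ (i - h, q) * y t \<omega> $ (h + q))" if "i < n" for i
  proof -
    have "(\<Sum>j<h. 1\<^sub>m h $$ (i, j) * y t \<omega> $ j) = y t \<omega> $ i" if "i < h"
    proof -
      have "(\<Sum>j<h. 1\<^sub>m h $$ (i, j) * y t \<omega> $ j) = (\<Sum>j<h. if j = i then y t \<omega> $ j else 0)" using that by (intro sum.cong) auto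
      then show ?thesis using that by simp
    qed
    then show ?thesis using diag_block_mult_index[OF one_carrier_mat G y that] by simp
  qed
  have r: "?r $ i = (M *\<^sub>v x0) $ i + ((if i < h then \<Sum>j<h. A1 $$ (i, j) * (LINT s:{0..t}|lborel. y s \<omega> $ j) else LINT s:{0..t}|lborel. y s \<omega> $ i) +
      ((M * B) *\<^sub>v ivec r u t \<omega>) $ i) + (M *\<^sub>v Matrix.vec n (\<lambda>i. J i t \<omega>)) $ i" if "i < n" for i
  proof -
    have c: "diag_block_mat [A1, 1\<^sub>m k] \<in> carrier_mat n n"
      unfolding diag_block_mat_pair[OF A1 one_carrier_mat] by (rule four_block_carrier_mat[OF A1 one_carrier_mat])
    have 1: "(\<Sum>q<k. 1\<^sub>m k $$ (i - h, q) * ivec n y t \<omega> $ (h + q)) = (LINT s:{0..t}|lborel. y s \<omega> $ i)" if "\<not> i < h"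
    proof -
      have "(\<Sum>q<k. 1\<^sub>m k $$ (i - h, q) * ivec n y t \<omega> $ (h + q)) = (\<Sum>q<k. if q = i - h then ivec n y t \<omega> $ (h + q) else 0)"
        using that \<open>i < n\<close> by (intro sum.cong) auto
      then show ?thesis using that \<open>i < n\<close> by simp
    qed
    have "(\<Sum>j<h. A1 $$ (i, j) * ivec n y t \<omega> $ j) = (\<Sum>j<h. A1 $$ (i, j) * (LINT s:{0..t}|lborel. y s \<omega> $ j))" by simp
    then have "(diag_block_mat [A1, 1\<^sub>m k] *\<^sub>v ivec n y t \<omega>) $ i =
      (if i < h then \<Sum>j<h. A1 $$ (i, j) * (LINT s:{0..t}|lborel. y s \<omega> $ j) else LINT s:{0..t}|lborel. y s \<omega> $ i)"
      using diag_block_mult_index[OF A1 one_carrier_mat ivec_carrier that] 1 by simp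
    moreover have "?r $ i = (M *\<^sub>v x0) $ i + ((diag_block_mat [A1, 1\<^sub>m k] *\<^sub>v ivec n y t \<omega>) $ i + ((M * B) *\<^sub>v ivec r u t \<omega>) $ i) +
      (M *\<^sub>v Matrix.vec n (\<lambda>i. J i t \<omega>)) $ i"
      using that carrier_matD(1)[OF M] carrier_matD(1)[OF c] carrier_matD(1)[OF mult_carrier_mat[OF M B]]
      by (simp del: diag_block_mat.simps index_mult_mat_vec)
    ultimately show ?thesis by simp
  qed
  have d: "dim_vec ?l = n" "dim_vec ?r = n"
    using M carrier_matD(1)[OF four_block_carrier_mat[OF one_carrier_mat[of h] G, of "0\<^sub>m h k" "0\<^sub>m k h"]] diag_block_mat_pair[OF one_carrier_mat[of h] G]
    by simp_all
  have split: "(\<forall>i<n. Q i) \<longleftrightarrow> (\<forall>i<h. Q i) \<and> (\<forall>i<k. Q (h + i))" for Q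
  proof (intro iffI allI impI)
    fix i assume *: "(\<forall>i<h. Q i) \<and> (\<forall>i<k. Q (h + i))" "i < n"
    then have "i < h \<or> (i - h < k \<and> h + (i - h) = i)" by auto
    then show "Q i" using * by metis
  qed auto
  have "?l = ?r \<longleftrightarrow> (\<forall>i<n. ?l $ i = ?r $ i)"
    unfolding Matrix.vec_eq_iff d by simp
  also have "\<dots> \<longleftrightarrow> (\<forall>i<h. ?l $ i = ?r $ i) \<and> (\<forall>i<k. ?l $ (h + i) = ?r $ (h + i))"
    by (rule split)
  also have "\<dots> \<longleftrightarrow> rows u J y t \<omega>"
    unfolding rows_def using l r by (simp del: diag_block_mat.simps index_mult_mat_vec)
  finally show ?thesis
    using equation_transform[OF E A B M N M' M'M x0 y ivec_carrier ivec_carrier vec_carrier] unfolding MEN MAN by (simp only:)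
qed

lemma solution_iff_rows:
  assumes u: "u \<in> L2_adapted P W T r" and x: "x \<in> L2_adapted P W T n" and y: "y \<in> L2_adapted P W T n"
    and xy: "\<And>t \<omega>. t \<in> {0..T} \<Longrightarrow> \<omega> \<in> space P \<Longrightarrow> x t \<omega> = N *\<^sub>v y t \<omega>"
    and J: "\<forall>i<n. \<forall>t\<in>{0..T}. has_ito_integral P W t (\<lambda>s \<omega>. (D *\<^sub>v u s \<omega>) $ i) (J i t)"
  shows "is_solution P W T n E A B D x0 u x \<longleftrightarrow> (\<forall>t\<in>{0..T}. AE \<omega> in P. rows u J y t \<omega>)"
proof -
  have "(AE \<omega> in P. E *\<^sub>v x t \<omega> = x0 + (A *\<^sub>v ivec n x t \<omega> + B *\<^sub>v ivec r u t \<omega>) + Matrix.vec n (\<lambda>i. J i t \<omega>)) \<longleftrightarrow>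
    (AE \<omega> in P. rows u J y t \<omega>)" if t: "t \<in> {0..T}" for t
  proof (rule eventually_subst)
    show "AE \<omega> in P. (E *\<^sub>v x t \<omega> = x0 + (A *\<^sub>v ivec n x t \<omega> + B *\<^sub>v ivec r u t \<omega>) + Matrix.vec n (\<lambda>i. J i t \<omega>)) = rows u J y t \<omega>"
      using AE_ipaths[OF y] AE_space
    proof eventually_elim
      case (elim \<omega>)
      have "ivec n x t \<omega> = ivec n (\<lambda>t \<omega>. N *\<^sub>v y t \<omega>) t \<omega>"
      proof (rule eq_vecI)
        fix j assume "j < dim_vec (ivec n (\<lambda>t \<omega>. N *\<^sub>v y t \<omega>) t \<omega>)"
        then have j: "j < n" by (simp add: ivec_def)
        have "(LINT s:{0..t}|lborel. x s \<omega> $ j) = (LINT s:{0..t}|lborel. (N *\<^sub>v y s \<omega>) $ j)"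
          by (rule set_lebesgue_integral_cong) (use xy[OF _ elim(2)] t in auto)
        then show "ivec n x t \<omega> $ j = ivec n (\<lambda>t \<omega>. N *\<^sub>v y t \<omega>) t \<omega> $ j" using j by simp
      qed (simp add: ivec_def)
      also have "\<dots> = N *\<^sub>v ivec n y t \<omega>" by (rule ivec_mult(1)[OF elim(1) N t])
      finally have i: "ivec n x t \<omega> = N *\<^sub>v ivec n y t \<omega>" .
      show ?case unfolding i xy[OF t elim(2)] by (rule equation_iff_rows[of y t \<omega>, OF L2_adapted_carrier[OF y t elim(2)]])
    qed
  qed
  moreover have "is_solution P W T n E A B D x0 u x \<longleftrightarrow> x \<in> L2_adapted P W T n \<and>
    (\<forall>t\<in>{0..T}. AE \<omega> in P. E *\<^sub>v x t \<omega> = x0 + (A *\<^sub>v ivec n x t \<omega> + B *\<^sub>v ivec r u t \<omega>) + Matrix.vec n (\<lambda>i. J i t \<omega>))"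
    by (rule is_solution_iff[OF u A B]) (use J in blast)
  ultimately show ?thesis using x by simp
qed

lemma solution_rows:
  assumes u: "u \<in> L2_adapted P W T r" and s: "is_solution P W T n E A B D x0 u x"
    and J: "\<forall>i<n. \<forall>t\<in>{0..T}. has_ito_integral P W t (\<lambda>s \<omega>. (D *\<^sub>v u s \<omega>) $ i) (J i t)"
  shows "(\<lambda>t \<omega>. N' *\<^sub>v x t \<omega>) \<in> L2_adapted P W T n"
    "\<And>t. t \<in> {0..T} \<Longrightarrow> AE \<omega> in P. rows u J (\<lambda>t \<omega>. N' *\<^sub>v x t \<omega>) t \<omega>"
    "\<And>t \<omega>. t \<in> {0..T} \<Longrightarrow> \<omega> \<in> space P \<Longrightarrow> x t \<omega> = N *\<^sub>v (N' *\<^sub>v x t \<omega>)"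
proof -
  have x: "x \<in> L2_adapted P W T n" using s by (simp add: is_solution_def)
  show y: "(\<lambda>t \<omega>. N' *\<^sub>v x t \<omega>) \<in> L2_adapted P W T n" by (rule L2_adapted_mult[OF x N'])
  show xy: "x t \<omega> = N *\<^sub>v (N' *\<^sub>v x t \<omega>)" if "t \<in> {0..T}" "\<omega> \<in> space P" for t \<omega>
    using assoc_mult_mat_vec[OF N N' L2_adapted_carrier[OF x that]] L2_adapted_carrier[OF x that] by (simp add: NN')
  show "AE \<omega> in P. rows u J (\<lambda>t \<omega>. N' *\<^sub>v x t \<omega>) t \<omega>" if "t \<in> {0..T}" for t
    using solution_iff_rows[OF u x y xy J] s that by blast
qed

end

section \<open>Necessity, uniqueness and existence in block coordinates\<close>

context weierstrass_sde begin

lemma MB_carrier: "M * B \<in> carrier_mat n r" and MD_carrier: "M * D \<in> carrier_mat n r"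
  using M B D by simp_all

text \<open>For this deterministic input both the drift and the noise are explicit, so the lower
  rows take exactly the form treated by \<open>nilpotent_jump_descent\<close>.\<close>

lemma jump_input_necessary:
  assumes v: "v \<in> carrier_vec r" and a: "0 < a" "a < T"
    and s: "is_solution P W T n E A B D x0 (\<lambda>t \<omega>. if a < t then v else 0\<^sub>v r) x" and i: "i < k"
  shows "(\<Sum>q<k. G $$ (i, q) * ((M * B) *\<^sub>v v) $ (h + q)) = 0" "(M *\<^sub>v x0) $ (h + i) = 0" "((M * D) *\<^sub>v v) $ (h + i) = 0"
proof -
  define u :: "real \<Rightarrow> 'w \<Rightarrow> real vec" where "u = (\<lambda>t \<omega>. if a < t then v else 0\<^sub>v r)"
  have mult: "(X *\<^sub>v u t \<omega>) $ i = (X *\<^sub>v v) $ i * indicator {a<..} t" if "X \<in> carrier_mat n r" "i < n" for X t i and \<omega> :: 'w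
    using that carrier_vecD[OF v] by (auto simp: u_def)
  have u: "u \<in> L2_adapted P W T r" unfolding u_def by (rule jump_L2_adapted[OF v])
  \<comment> \<open>The Ito integral of a step function is a multiple of the increment of
    \<open>W\<close> since the jump; \<open>min t a\<close> makes it 0 before the jump.\<close>
  define J where "J i t \<omega> = (D *\<^sub>v v) $ i * (W t \<omega> - W (min t a) \<omega>)" for i t \<omega>
  have "has_ito_integral P W t (\<lambda>s \<omega>. (D *\<^sub>v u s \<omega>) $ i) (J i t)" if "i < n" "t \<in> {0..T}" for i t
    unfolding mult[OF D that(1)] J_def by (rule has_ito_integral_step) (use a that in auto)
  then have J: "\<forall>i<n. \<forall>t\<in>{0..T}. has_ito_integral P W t (\<lambda>s \<omega>. (D *\<^sub>v u s \<omega>) $ i) (J i t)" by blast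
  define y where "y = (\<lambda>t \<omega>. N' *\<^sub>v x t \<omega>)"
  note rw = solution_rows[OF u s[folded u_def] J, folded y_def]
  define b where "b i = ((M * B) *\<^sub>v v) $ (h + i)" for i
  have "AE \<omega> in P. (\<Sum>q<k. G $$ (i, q) * y t \<omega> $ (h + q)) = (M *\<^sub>v x0) $ (h + i) +
      (LINT s:{0..t}|lborel. y s \<omega> $ (h + i) + b i * indicator {a<..} s) + ((M * D) *\<^sub>v v) $ (h + i) * (W t \<omega> - W (min t a) \<omega>)"
    if i: "i < k" and t: "t \<in> {0..T}" for i t
    using rw(2)[OF t] AE_ipaths[OF u] AE_ipaths[OF rw(1)] AE_space
  proof eventually_elim
    case (elim \<omega>)
    have hi: "h + i < n" using i by simp
    have mbu: "(\<lambda>s. ((M * B) *\<^sub>v u s \<omega>) $ (h + i)) = (\<lambda>s. b i * indicator {a<..} s)"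
      unfolding mult[OF MB_carrier hi] b_def ..
    have "((M * B) *\<^sub>v ivec r u t \<omega>) $ (h + i) = ivec n (\<lambda>t \<omega>. (M * B) *\<^sub>v u t \<omega>) t \<omega> $ (h + i)"
      unfolding ivec_mult(1)[OF elim(2) MB_carrier t] ..
    also have "\<dots> = (LINT s:{0..t}|lborel. b i * indicator {a<..} s)"
      unfolding ivec_index[OF hi] mbu ..
    finally have 1: "((M * B) *\<^sub>v ivec r u t \<omega>) $ (h + i) = (LINT s:{0..t}|lborel. b i * indicator {a<..} s)" .
    have "set_integrable lborel {0..t} (\<lambda>s. b i * indicator {a<..} s)"
      using ivec_mult(2)[OF elim(2) MB_carrier t hi] unfolding mbu .
    moreover have "set_integrable lborel {0..t} (\<lambda>s. y s \<omega> $ (h + i))" using elim(3) hi t by (simp add: ipaths_def)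
    ultimately have 2: "(LINT s:{0..t}|lborel. y s \<omega> $ (h + i) + b i * indicator {a<..} s) =
        (LINT s:{0..t}|lborel. y s \<omega> $ (h + i)) + (LINT s:{0..t}|lborel. b i * indicator {a<..} s)"
      by (intro set_integral_add(2))
    have Dv: "D *\<^sub>v v \<in> carrier_vec n" using D v by simp
    have "Matrix.vec n (\<lambda>i. J i t \<omega>) = (W t \<omega> - W (min t a) \<omega>) \<cdot>\<^sub>v (D *\<^sub>v v)"
      using D by (intro eq_vecI) (simp_all add: J_def)
    then have "M *\<^sub>v Matrix.vec n (\<lambda>i. J i t \<omega>) = (W t \<omega> - W (min t a) \<omega>) \<cdot>\<^sub>v ((M * D) *\<^sub>v v)"
      using mult_mat_vec[OF M Dv] assoc_mult_mat_vec[OF M D v] by simp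
    then have 3: "(M *\<^sub>v Matrix.vec n (\<lambda>i. J i t \<omega>)) $ (h + i) = ((M * D) *\<^sub>v v) $ (h + i) * (W t \<omega> - W (min t a) \<omega>)"
      using hi M by (simp del: index_mult_mat_vec)
    show ?case using elim(1)[unfolded rows_def, THEN conjunct2, rule_format, OF i] unfolding 1 2 3 by linarith
  qed
  note desc = nilpotent_jump_descent[where G = "\<lambda>i q. G $$ (i, q)" and y = "\<lambda>i t \<omega>. y t \<omega> $ (h + i)" and b = b and
    c = "\<lambda>i. (M *\<^sub>v x0) $ (h + i)" and d = "\<lambda>i. ((M * D) *\<^sub>v v) $ (h + i)" and k = k, OF G_upper _ a this i]
  have "(\<Sum>q<k. G $$ (i, q) * b q) = 0 \<and> (M *\<^sub>v x0) $ (h + i) = 0 \<and> ((M * D) *\<^sub>v v) $ (h + i) = 0"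
    using desc L2_adapted_component[OF rw(1)] by simp
  then show "(\<Sum>q<k. G $$ (i, q) * ((M * B) *\<^sub>v v) $ (h + q)) = 0" "(M *\<^sub>v x0) $ (h + i) = 0" "((M * D) *\<^sub>v v) $ (h + i) = 0"
    by (simp_all add: b_def del: index_mult_mat_vec)
qed

text \<open>By Fubini's theorem almost every path satisfies the system at almost every time. The sum
  of the absolute values of its components then obeys a scalar Gronwall bound.\<close>

lemma linear_volterra_zero:
  assumes z: "\<And>i. i < h \<Longrightarrow> L2_process T (z i)"
    and eq: "\<And>i t. i < h \<Longrightarrow> t \<in> {0..T} \<Longrightarrow> AE \<omega> in P. z i t \<omega> = (\<Sum>j<h. A1 $$ (i, j) * (LINT s:{0..t}|lborel. z j s \<omega>))"
    and i: "i < h"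
  shows "AE t in lborel. t \<in> {0..T} \<longrightarrow> (AE \<omega> in P. z i t \<omega> = 0)"
proof -
  have "AE \<omega> in P. AE t in lborel. t \<in> {0..T} \<longrightarrow> z i t \<omega> - (\<Sum>j<h. A1 $$ (i, j) * (LINT s:{0..t}|lborel. z j s \<omega>)) = 0"
    if i: "i < h" for i
  proof -
    have "L2_process T (\<lambda>t \<omega>. z i t \<omega> - (\<Sum>j<h. A1 $$ (i, j) * (LINT s:{0..t}|lborel. z j s \<omega>)))"
      by (intro L2_process_diff L2_process_lincomb L2_process_time_integral z i T) auto
    moreover have "AE t in lborel. t \<in> {0..T} \<longrightarrow> (AE \<omega> in P. z i t \<omega> - (\<Sum>j<h. A1 $$ (i, j) * (LINT s:{0..t}|lborel. z j s \<omega>)) = 0)"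
      using eq[OF i] by (intro AE_I2) simp
    ultimately show ?thesis using AE_swap_process[OF L2_process_adapted] by blast
  qed
  then have "AE \<omega> in P. \<forall>i\<in>{..<h}. AE t in lborel. t \<in> {0..T} \<longrightarrow> z i t \<omega> - (\<Sum>j<h. A1 $$ (i, j) * (LINT s:{0..t}|lborel. z j s \<omega>)) = 0"
    by (intro AE_finite_allI) auto
  moreover have "AE \<omega> in P. \<forall>i\<in>{..<h}. set_integrable lborel {0..T} (\<lambda>s. z i s \<omega>)"
    by (intro AE_finite_allI L2_process_paths z) auto
  ultimately have "AE \<omega> in P. AE t in lborel. t \<in> {0..T} \<longrightarrow> z i t \<omega> = 0"
  proof eventually_elim
    case (elim \<omega>)
    define \<phi> where "\<phi> t = (\<Sum>j<h. 1 * \<bar>z j t \<omega>\<bar>)" for t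
    \<comment> \<open>Each component is bounded by its absolute row sum of \<open>A1\<close> times
      the integral of \<open>\<phi>\<close>; adding up the components adds up the row sums.\<close>
    define C where "C = (\<Sum>i<h. \<Sum>j<h. \<bar>A1 $$ (i, j)\<bar>)"
    have ai: "set_integrable lborel {0..T} (\<lambda>t. \<bar>z j t \<omega>\<bar>)" if "j < h" for j
      using elim(2) that by (intro set_integrable_abs) auto
    have sub: "set_integrable lborel {0..t} f" if "set_integrable lborel {0..T} f" "t \<in> {0..T}" for t and f :: "real \<Rightarrow> real"
      by (rule set_integrable_subset[OF that(1)]) (use that(2) in auto)
    have "AE t in lborel. \<forall>i\<in>{..<h}. t \<in> {0..T} \<longrightarrow> z i t \<omega> - (\<Sum>j<h. A1 $$ (i, j) * (LINT s:{0..t}|lborel. z j s \<omega>)) = 0"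
      by (intro AE_finite_allI) (use elim(1) in auto)
    then have "AE t in lborel. t \<in> {0..T} \<longrightarrow> \<phi> t \<le> C * (LINT s:{0..t}|lborel. \<phi> s)"
    proof eventually_elim
      case (elim t)
      show ?case
      proof
        assume t: "t \<in> {0..T}"
        have I: "(LINT s:{0..t}|lborel. \<phi> s) = (\<Sum>j<h. 1 * (LINT s:{0..t}|lborel. \<bar>z j s \<omega>\<bar>))"
          unfolding \<phi>_def by (rule set_integral_lincomb(2)) (use ai sub t in auto)
        have nn: "0 \<le> (LINT s:{0..t}|lborel. \<bar>z j s \<omega>\<bar>)" for j
          unfolding set_lebesgue_integral_def by (intro Bochner_Integration.integral_nonneg) simp
        have le: "\<bar>LINT s:{0..t}|lborel. z j s \<omega>\<bar> \<le> (LINT s:{0..t}|lborel. \<phi> s)" if "j < h" for j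
        proof -
          have "\<bar>LINT s:{0..t}|lborel. z j s \<omega>\<bar> \<le> (LINT s:{0..t}|lborel. \<bar>z j s \<omega>\<bar>)"
            using set_integral_norm_bound[of lborel "{0..t}" "\<lambda>s. z j s \<omega>"] sub[OF _ t] \<open>\<forall>i\<in>{..<h}. set_integrable lborel {0..T} (\<lambda>s. z i s \<omega>)\<close> that by simp
          also have "\<dots> \<le> (LINT s:{0..t}|lborel. \<phi> s)"
            unfolding I using that nn by (simp, intro member_le_sum) auto
          finally show ?thesis .
        qed
        have "\<bar>z i t \<omega>\<bar> \<le> (\<Sum>j<h. \<bar>A1 $$ (i, j)\<bar>) * (LINT s:{0..t}|lborel. \<phi> s)" if "i < h" for i
        proof -
          have "\<bar>z i t \<omega>\<bar> = \<bar>\<Sum>j<h. A1 $$ (i, j) * (LINT s:{0..t}|lborel. z j s \<omega>)\<bar>" using elim that t by simp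
          also have "\<dots> \<le> (\<Sum>j<h. \<bar>A1 $$ (i, j) * (LINT s:{0..t}|lborel. z j s \<omega>)\<bar>)" by (rule sum_abs)
          also have "\<dots> \<le> (\<Sum>j<h. \<bar>A1 $$ (i, j)\<bar> * (LINT s:{0..t}|lborel. \<phi> s))"
            unfolding abs_mult by (intro sum_mono mult_left_mono le) auto
          finally show ?thesis by (simp add: sum_distrib_right)
        qed
        then have "\<phi> t \<le> (\<Sum>i<h. (\<Sum>j<h. \<bar>A1 $$ (i, j)\<bar>) * (LINT s:{0..t}|lborel. \<phi> s))"
          unfolding \<phi>_def[of t] by (intro sum_mono) simp
        then show "\<phi> t \<le> C * (LINT s:{0..t}|lborel. \<phi> s)" by (simp add: C_def sum_distrib_right)
      qed
    qed
    moreover have "set_integrable lborel {0..T} \<phi>" unfolding \<phi>_def[abs_def] by (rule set_integral_lincomb(1)) (use ai in auto)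
    moreover have "0 \<le> \<phi> s" for s by (simp add: \<phi>_def sum_nonneg)
    moreover have "0 \<le> C" by (simp add: C_def sum_nonneg)
    ultimately have "AE t in lborel. t \<in> {0..T} \<longrightarrow> \<phi> t = 0" by (intro AE_zero_of_integral_bound[OF T])
    then show ?case
    proof eventually_elim
      case (elim t)
      have "\<bar>z i t \<omega>\<bar> \<le> \<phi> t" unfolding \<phi>_def using i by (simp, intro member_le_sum) auto
      then show ?case using elim by auto
    qed
  qed
  then show ?thesis using AE_swap_process[OF L2_process_adapted[OF z[OF i]]] by blast
qed

text \<open>Input, noise and initial value cancel in the difference \<open>z\<close> of two
  solutions. Its upper rows satisfy a homogeneous Volterra equation, its lower rows the nilpotent
  system with neither jump nor constant nor noise.\<close>

lemma solution_unique:
  assumes u: "u \<in> L2_adapted P W T r" and s: "is_solution P W T n E A B D x0 u x" "is_solution P W T n E A B D x0 u x'"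
    and J: "\<forall>i<n. \<forall>t\<in>{0..T}. has_ito_integral P W t (\<lambda>s \<omega>. (D *\<^sub>v u s \<omega>) $ i) (J i t)"
  shows "AE (t, \<omega>) in restrict_space lborel {0..T} \<Otimes>\<^sub>M P. x t \<omega> = x' t \<omega>"
proof -
  define y where "y = (\<lambda>t \<omega>. N' *\<^sub>v x t \<omega>)"
  define y' where "y' = (\<lambda>t \<omega>. N' *\<^sub>v x' t \<omega>)"
  note rw = solution_rows[OF u s(1) J, folded y_def] and rw' = solution_rows[OF u s(2) J, folded y'_def]
  have yN: "y t \<omega> = N' *\<^sub>v x t \<omega>" "y' t \<omega> = N' *\<^sub>v x' t \<omega>" for t \<omega> by (simp_all add: y_def y'_def)
  define z where "z i t \<omega> = y t \<omega> $ i - y' t \<omega> $ i" for i t \<omega>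
  have z: "L2_process T (z i)" if "i < n" for i
    unfolding z_def by (intro L2_process_diff L2_adapted_component[OF rw(1)] L2_adapted_component[OF rw'(1)] that)
  have zint: "AE \<omega> in P. \<forall>j<n. (LINT s:{0..t}|lborel. z j s \<omega>) = (LINT s:{0..t}|lborel. y s \<omega> $ j) - (LINT s:{0..t}|lborel. y' s \<omega> $ j)"
    if "t \<in> {0..T}" for t
    using AE_ipaths[OF rw(1)] AE_ipaths[OF rw'(1)]
    by eventually_elim (use that in \<open>simp add: z_def ipaths_def set_integral_diff\<close>)
  have fast: "AE t in lborel. t \<in> {0..T} \<longrightarrow> (AE \<omega> in P. z i t \<omega> = 0)" if "i < h" for i
  proof (rule linear_volterra_zero[of z, OF _ _ that])
    fix i t assume i: "i < h" and t: "t \<in> {0..T}"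
    show "AE \<omega> in P. z i t \<omega> = (\<Sum>j<h. A1 $$ (i, j) * (LINT s:{0..t}|lborel. z j s \<omega>))"
      using rw(2)[OF t] rw'(2)[OF t] zint[OF t]
    proof eventually_elim
      case (elim \<omega>)
      have "z i t \<omega> = (\<Sum>j<h. A1 $$ (i, j) * (LINT s:{0..t}|lborel. y s \<omega> $ j)) - (\<Sum>j<h. A1 $$ (i, j) * (LINT s:{0..t}|lborel. y' s \<omega> $ j))"
        using elim(1)[unfolded rows_def, THEN conjunct1, rule_format, OF i] elim(2)[unfolded rows_def, THEN conjunct1, rule_format, OF i]
        unfolding z_def by linarith
      also have "\<dots> = (\<Sum>j<h. A1 $$ (i, j) * (LINT s:{0..t}|lborel. z j s \<omega>))"
        using elim(3) by (simp add: right_diff_distrib sum_subtractf)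
      finally show ?case .
    qed
  qed (use z in auto)
  have slow: "AE t in lborel. t \<in> {0..T} \<longrightarrow> (AE \<omega> in P. z (h + i) t \<omega> = 0)" if "i < k" for i
  proof -
    \<comment> \<open>Zero terms are inserted to match the shape of
      \<open>nilpotent_jump_descent\<close>; \<open>T / 2\<close> is just some interior
      time.\<close>
    have "AE \<omega> in P. (\<Sum>q<k. G $$ (i, q) * z (h + q) t \<omega>) =
      0 + (LINT s:{0..t}|lborel. z (h + i) s \<omega> + 0 * indicator {T / 2<..} s) + 0 * (W t \<omega> - W (min t (T / 2)) \<omega>)"
      if i: "i < k" and t: "t \<in> {0..T}" for i t
      using rw(2)[OF t] rw'(2)[OF t] zint[OF t]
    proof eventually_elim
      case (elim \<omega>)
      have "(\<Sum>q<k. G $$ (i, q) * z (h + q) t \<omega>) = (\<Sum>q<k. G $$ (i, q) * y t \<omega> $ (h + q)) - (\<Sum>q<k. G $$ (i, q) * y' t \<omega> $ (h + q))"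
        by (simp add: z_def right_diff_distrib sum_subtractf)
      also have "\<dots> = (LINT s:{0..t}|lborel. y s \<omega> $ (h + i)) - (LINT s:{0..t}|lborel. y' s \<omega> $ (h + i))"
        using elim(1)[unfolded rows_def, THEN conjunct2, rule_format, OF i] elim(2)[unfolded rows_def, THEN conjunct2, rule_format, OF i] by linarith
      finally show ?case using elim(3) i by simp
    qed
    from nilpotent_jump_descent[where G = "\<lambda>i q. G $$ (i, q)" and y = "\<lambda>i. z (h + i)" and b = "\<lambda>_. 0" and c = "\<lambda>_. 0" and d = "\<lambda>_. 0" and k = k,
        OF G_upper _ _ _ this \<open>i < k\<close>]
    show ?thesis using z T by simp
  qed
  have "AE t in lborel. t \<in> {0..T} \<longrightarrow> (AE \<omega> in P. z i t \<omega> = 0)" if "i < n" for i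
  proof (cases "i < h")
    case False
    then show ?thesis using slow[of "i - h"] that by simp
  qed (rule fast)
  then have "AE t in lborel. \<forall>i\<in>{..<n}. t \<in> {0..T} \<longrightarrow> (AE \<omega> in P. z i t \<omega> = 0)"
    by (intro AE_finite_allI) auto
  then have "AE t in lborel. t \<in> {0..T} \<longrightarrow> (AE \<omega> in P. \<forall>i<n. x t \<omega> $ i = x' t \<omega> $ i)"
  proof eventually_elim
    case (elim t)
    show ?case
    proof
      assume t: "t \<in> {0..T}"
      have "AE \<omega> in P. \<forall>i\<in>{..<n}. z i t \<omega> = 0" by (rule AE_finite_allI) (use elim t in auto)
      then show "AE \<omega> in P. \<forall>i<n. x t \<omega> $ i = x' t \<omega> $ i"
        using AE_space
      proof eventually_elim
        case (elim \<omega>)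
        have "y t \<omega> = y' t \<omega>"
          using elim(1) L2_adapted_carrier[OF rw(1) t elim(2)] L2_adapted_carrier[OF rw'(1) t elim(2)]
          by (intro eq_vecI) (auto simp: z_def)
        then have "N *\<^sub>v (N' *\<^sub>v x t \<omega>) = N *\<^sub>v (N' *\<^sub>v x' t \<omega>)" unfolding yN by (rule arg_cong)
        then have "x t \<omega> = x' t \<omega>"
          unfolding rw(3)[OF t elim(2), symmetric] rw'(3)[OF t elim(2), symmetric] .
        then show ?case by simp
      qed
    qed
  qed
  then show ?thesis using s by (intro AE_time_product[where n = n]) (simp_all add: is_solution_def)
qed

text \<open>In the lower rows the choice of \<open>y\<close> cancels the input under the time
  integral, and the left-hand side is 0 by the assumption \<open>GB\<close>. The upper rows are a
  linear Volterra equation, solved by the kernel \<open>K\<close> with forcing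
  \<open>Z\<close>.\<close>

lemma solution_exists:
  assumes u: "u \<in> L2_adapted P W T r"
    and GB: "\<And>i v. i < k \<Longrightarrow> v \<in> carrier_vec r \<Longrightarrow> (\<Sum>q<k. G $$ (i, q) * ((M * B) *\<^sub>v v) $ (h + q)) = 0"
    and Mx0: "\<And>i. i < k \<Longrightarrow> (M *\<^sub>v x0) $ (h + i) = 0"
    and MD: "\<And>i v. i < k \<Longrightarrow> v \<in> carrier_vec r \<Longrightarrow> ((M * D) *\<^sub>v v) $ (h + i) = 0"
    and J: "\<forall>i<n. \<forall>t\<in>{0..T}. has_ito_integral P W t (\<lambda>s \<omega>. (D *\<^sub>v u s \<omega>) $ i) (J i t)"
    and J2: "\<And>i. i < n \<Longrightarrow> L2_process T (J i)"
  shows "\<exists>x. is_solution P W T n E A B D x0 u x"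
proof -
  from volterra_kernel_exists[of h "\<lambda>i j. A1 $$ (i, j)"] obtain K :: "nat \<Rightarrow> nat \<Rightarrow> real \<Rightarrow> real" where
    KK: "\<forall>i<h. \<forall>j<h. continuous_on UNIV (K i j)"
      "\<forall>i<h. \<forall>j<h. \<forall>t\<ge>0. K i j t = A1 $$ (i, j) + (\<Sum>l<h. A1 $$ (i, l) * (LINT s:{0..t}|lborel. K l j s))"
    by (elim exE conjE)
  have K: "\<And>i j. i < h \<Longrightarrow> j < h \<Longrightarrow> continuous_on UNIV (K i j)"
      "\<And>i j t. i < h \<Longrightarrow> j < h \<Longrightarrow> 0 \<le> t \<Longrightarrow> K i j t = A1 $$ (i, j) + (\<Sum>l<h. A1 $$ (i, l) * (LINT s:{0..t}|lborel. K l j s))"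
    using KK by blast+
  \<comment> \<open>Everything in the equation that does not involve the unknown: initial value,
    integrated input and noise.\<close>
  define Z where "Z i t \<omega> = (M *\<^sub>v x0) $ i + ((M * B) *\<^sub>v ivec r u t \<omega>) $ i + (M *\<^sub>v Matrix.vec n (\<lambda>i. J i t \<omega>)) $ i" for i t \<omega>
  have Z: "L2_process T (Z i)" if i: "i < n" for i
  proof -
    have MJ: "(M *\<^sub>v Matrix.vec n (\<lambda>i. J i t \<omega>)) $ i = (\<Sum>j<n. M $$ (i, j) * J j t \<omega>)" for t \<omega>
      using mult_mat_vec_index[OF M vec_carrier i, of "\<lambda>i. J i t \<omega>"] by simp
    have MBu: "((M * B) *\<^sub>v ivec r u t \<omega>) $ i = (\<Sum>j<r. (M * B) $$ (i, j) * (LINT s:{0..t}|lborel. u s \<omega> $ j))" for t \<omega>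
      using mult_mat_vec_index[OF MB_carrier ivec_carrier i, of u t \<omega>] by simp
    show ?thesis
      unfolding Z_def MJ MBu
      by (intro L2_process_add L2_process_const L2_process_lincomb L2_process_time_integral J2 L2_adapted_component[OF u] T) auto
  qed
  define y where "y t \<omega> = Matrix.vec n (\<lambda>i. if i < h then Z i t \<omega> + (\<Sum>l<h. LINT s:{0..t}|lborel. K i l (t - s) * Z l s \<omega>)
    else - ((M * B) *\<^sub>v u t \<omega>) $ i)" for t \<omega>
  have yh: "y t \<omega> $ i = Z i t \<omega> + (\<Sum>l<h. LINT s:{0..t}|lborel. K i l (t - s) * Z l s \<omega>)" if "i < h" for i t \<omega>
    using that by (simp add: y_def)
  have yk: "y t \<omega> $ (h + i) = - ((M * B) *\<^sub>v u t \<omega>) $ (h + i)" if "i < k" for i t \<omega>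
    using that by (simp add: y_def)
  have y: "y \<in> L2_adapted P W T n"
    unfolding L2_adapted_iff
  proof (intro conjI ballI allI impI)
    fix i assume i: "i < n"
    show "L2_process T (\<lambda>t \<omega>. y t \<omega> $ i)"
    proof (cases "i < h")
      case True
      show ?thesis unfolding yh[OF True]
        by (intro L2_process_add L2_process_sum L2_process_convolution Z K(1) T True) (use i in auto)
    next
      case False
      have "L2_process T (\<lambda>t \<omega>. (-1) * ((M * B) *\<^sub>v u t \<omega>) $ i)"
        by (intro L2_process_cmult L2_adapted_component[OF L2_adapted_mult[OF u MB_carrier] i])
      then show ?thesis by (rule L2_process_cong) (use False i in \<open>simp add: y_def\<close>)
    qed
  qed (simp add: y_def)
  \<comment> \<open>The lower rows of \<open>M * D\<close> are 0, so this combination of the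
    integrands vanishes pointwise, and with it almost surely the same combination of the Ito
    integrals.\<close>
  have noise: "AE \<omega> in P. (M *\<^sub>v Matrix.vec n (\<lambda>i. J i t \<omega>)) $ (h + i) = 0" if i: "i < k" and t: "t \<in> {0..T}" for i t
  proof -
    have hi: "h + i < n" using i by simp
    have "AE \<omega> in P. (\<Sum>j<n. M $$ (h + i, j) * J j t \<omega>) = 0"
    proof (rule ito_integral_comb_zero)
      show "has_ito_integral P W t (\<lambda>s \<omega>. (D *\<^sub>v u s \<omega>) $ j) (J j t)" if "j \<in> {..<n}" for j using J t that by simp
      fix s \<omega> assume "s \<in> {0..t}" and w: "\<omega> \<in> space P"
      then have s: "s \<in> {0..T}" using t by auto
      note us = L2_adapted_carrier[OF u s w]
      have "D *\<^sub>v u s \<omega> \<in> carrier_vec n" using D us by simp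
      from mult_mat_vec_index[OF M this hi]
      have "(\<Sum>j<n. M $$ (h + i, j) * (D *\<^sub>v u s \<omega>) $ j) = (M *\<^sub>v (D *\<^sub>v u s \<omega>)) $ (h + i)" by simp
      also have "\<dots> = 0" using MD[OF i us] assoc_mult_mat_vec[OF M D us] by simp
      finally show "(\<Sum>j<n. M $$ (h + i, j) * (D *\<^sub>v u s \<omega>) $ j) = 0" .
    qed simp
    then show ?thesis using mult_mat_vec_index[OF M vec_carrier hi] by simp
  qed
  have "AE \<omega> in P. rows u J y t \<omega>" if t: "t \<in> {0..T}" for t
  proof -
    have "AE \<omega> in P. \<forall>i\<in>{..<k}. (M *\<^sub>v Matrix.vec n (\<lambda>i. J i t \<omega>)) $ (h + i) = 0"
      by (rule AE_finite_allI) (use noise t in auto)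
    moreover have "AE \<omega> in P. \<forall>i\<in>{..<h}. set_integrable lborel {0..T} (\<lambda>s. Z i s \<omega>)"
      by (intro AE_finite_allI L2_process_paths Z) auto
    ultimately show ?thesis using AE_ipaths[OF u] AE_space
    proof eventually_elim
      case (elim \<omega>)
      have Zi: "set_integrable lborel {0..t} (\<lambda>s. Z j s \<omega>)" if "j < h" for j
        by (rule set_integrable_subset[of lborel "{0..T}"]) (use elim(2) that t in auto)
      have t0: "0 \<le> t" using t by simp
      have 1: "y t \<omega> $ i = (M *\<^sub>v x0) $ i + ((\<Sum>j<h. A1 $$ (i, j) * (LINT s:{0..t}|lborel. y s \<omega> $ j)) +
        ((M * B) *\<^sub>v ivec r u t \<omega>) $ i) + (M *\<^sub>v Matrix.vec n (\<lambda>i. J i t \<omega>)) $ i" if i: "i < h" for i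
      proof -
        have "(\<Sum>j<h. A1 $$ (i, j) * (LINT s:{0..t}|lborel. y s \<omega> $ j)) =
          (\<Sum>j<h. A1 $$ (i, j) * (LINT s:{0..t}|lborel. Z j s \<omega> + (\<Sum>l<h. LINT r:{0..s}|lborel. K j l (s - r) * Z l r \<omega>)))"
          by (rule sum.cong) (simp_all add: yh)
        also have "\<dots> = (\<Sum>l<h. LINT s:{0..t}|lborel. K i l (t - s) * Z l s \<omega>)"
          by (rule volterra_solution[where z = "\<lambda>j s. Z j s \<omega>" and K = K and a = "\<lambda>i j. A1 $$ (i, j)", OF K Zi t0 i])
        finally show ?thesis unfolding yh[OF i] Z_def[of i] by linarith
      qed
      have 2: "(\<Sum>q<k. G $$ (i, q) * y t \<omega> $ (h + q)) = (M *\<^sub>v x0) $ (h + i) + ((LINT s:{0..t}|lborel. y s \<omega> $ (h + i)) +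
        ((M * B) *\<^sub>v ivec r u t \<omega>) $ (h + i)) + (M *\<^sub>v Matrix.vec n (\<lambda>i. J i t \<omega>)) $ (h + i)" if i: "i < k" for i
      proof -
        have hi: "h + i < n" using i by simp
        have "(\<Sum>q<k. G $$ (i, q) * y t \<omega> $ (h + q)) = - (\<Sum>q<k. G $$ (i, q) * ((M * B) *\<^sub>v u t \<omega>) $ (h + q))"
          by (simp add: yk sum_negf del: index_mult_mat_vec)
        also have "\<dots> = 0" using GB[OF i L2_adapted_carrier[OF u t elim(4)]] by (simp del: index_mult_mat_vec)
        finally have l: "(\<Sum>q<k. G $$ (i, q) * y t \<omega> $ (h + q)) = 0" .
        have "((M * B) *\<^sub>v ivec r u t \<omega>) $ (h + i) = ivec n (\<lambda>t \<omega>. (M * B) *\<^sub>v u t \<omega>) t \<omega> $ (h + i)"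
          unfolding ivec_mult(1)[OF elim(3) MB_carrier t] ..
        also have "\<dots> = (LINT s:{0..t}|lborel. ((M * B) *\<^sub>v u s \<omega>) $ (h + i))" by (rule ivec_index[OF hi])
        finally have "(LINT s:{0..t}|lborel. y s \<omega> $ (h + i)) + ((M * B) *\<^sub>v ivec r u t \<omega>) $ (h + i) = 0"
          unfolding yk[OF i] by (simp add: set_integral_uminus set_lebesgue_integral_def del: index_mult_mat_vec)
        then show ?thesis using l Mx0[OF i] elim(1) i by (simp del: index_mult_mat_vec)
      qed
      show ?case unfolding rows_def using 1 2 by blast
    qed
  qed
  then have "is_solution P W T n E A B D x0 u (\<lambda>t \<omega>. N *\<^sub>v y t \<omega>)"
    using solution_iff_rows[OF u L2_adapted_mult[OF y N] y refl J] by blast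
  then show ?thesis by blast
qed

lemma uniquely_solvable_of_form:
  assumes u: "u \<in> L2_adapted P W T r"
    and GB: "\<And>i v. i < k \<Longrightarrow> v \<in> carrier_vec r \<Longrightarrow> (\<Sum>q<k. G $$ (i, q) * ((M * B) *\<^sub>v v) $ (h + q)) = 0"
    and Mx0: "\<And>i. i < k \<Longrightarrow> (M *\<^sub>v x0) $ (h + i) = 0"
    and MD: "\<And>i v. i < k \<Longrightarrow> v \<in> carrier_vec r \<Longrightarrow> ((M * D) *\<^sub>v v) $ (h + i) = 0"
  shows "uniquely_solvable P W T n E A B D x0 u"
proof -
  have "\<forall>i\<in>{..<n}. \<exists>I. L2_process T I \<and> (\<forall>t\<in>{0..T}. has_ito_integral P W t (\<lambda>s \<omega>. (D *\<^sub>v u s \<omega>) $ i) (I t))"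
  proof
    fix i assume "i \<in> {..<n}"
    then have "L2_process T (\<lambda>s \<omega>. (D *\<^sub>v u s \<omega>) $ i)" using L2_adapted_component[OF L2_adapted_mult[OF u D]] by simp
    from ito_integral_exists[OF this T] show "\<exists>I. L2_process T I \<and> (\<forall>t\<in>{0..T}. has_ito_integral P W t (\<lambda>s \<omega>. (D *\<^sub>v u s \<omega>) $ i) (I t))"
      by metis
  qed
  from bchoice[OF this] obtain J where J: "\<And>i. i < n \<Longrightarrow> L2_process T (J i)"
    "\<forall>i<n. \<forall>t\<in>{0..T}. has_ito_integral P W t (\<lambda>s \<omega>. (D *\<^sub>v u s \<omega>) $ i) (J i t)" by auto
  have "\<exists>x. is_solution P W T n E A B D x0 u x" by (rule solution_exists[OF u _ _ _ J(2) J(1)]) (use GB Mx0 MD in blast)+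
  moreover have "AE (t, \<omega>) in restrict_space lborel {0..T} \<Otimes>\<^sub>M P. x t \<omega> = y t \<omega>"
    if "is_solution P W T n E A B D x0 u x" "is_solution P W T n E A B D x0 u y" for x y
    by (rule solution_unique[OF u that J(2)])
  ultimately show ?thesis unfolding uniquely_solvable_def by blast
qed

end

section \<open>Unique solvability and the block form\<close>

lemma append_rows_mult_vec:
  fixes X Y :: "real mat"
  assumes "X \<in> carrier_mat h r" "Y \<in> carrier_mat k r" "v \<in> carrier_vec r" "q < k"
  shows "((X @\<^sub>r Y) *\<^sub>v v) $ (h + q) = (Y *\<^sub>v v) $ q"
proof -
  have "((X @\<^sub>r Y) *\<^sub>v v) $ (h + q) = (\<Sum>j<r. (X @\<^sub>r Y) $$ (h + q, j) * v $ j)"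
    by (rule mult_mat_vec_index[OF carrier_append_rows[OF assms(1,2)] assms(3)]) (use assms(4) in simp)
  also have "\<dots> = (\<Sum>j<r. Y $$ (q, j) * v $ j)"
    using index_append_rows[OF assms(1,2)] assms(4) by (intro sum.cong) auto
  also have "\<dots> = (Y *\<^sub>v v) $ q" by (rule mult_mat_vec_index[OF assms(2,3,4), symmetric])
  finally show ?thesis .
qed

lemma split_rows:
  fixes X :: "real mat"
  assumes "X \<in> carrier_mat (h + k) r"
  shows "X = mat h r (\<lambda>ij. X $$ ij) @\<^sub>r mat k r (\<lambda>(i, j). X $$ (h + i, j))" (is "X = ?U @\<^sub>r ?L")
proof (rule eq_matI)
  have c: "?U \<in> carrier_mat h r" "?L \<in> carrier_mat k r" by simp_all
  show d: "dim_row X = dim_row (?U @\<^sub>r ?L)" "dim_col X = dim_col (?U @\<^sub>r ?L)"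
    using carrier_matD[OF carrier_append_rows[OF c]] assms by simp_all
  fix i j assume "i < dim_row (?U @\<^sub>r ?L)" "j < dim_col (?U @\<^sub>r ?L)"
  then have ij: "i < h + k" "j < r" using carrier_matD[OF carrier_append_rows[OF c]] by simp_all
  then show "X $$ (i, j) = (?U @\<^sub>r ?L) $$ (i, j)" using index_append_rows[OF c ij] by auto
qed

lemma append_cols_zero_one_mult_index:
  assumes w: "w \<in> carrier_vec (h + k)" and i: "i < k"
  shows "(append_cols (0\<^sub>m k h) (1\<^sub>m k) *\<^sub>v w) $ i = w $ (h + i)"
proof -
  have c: "append_cols (0\<^sub>m k h) (1\<^sub>m k) \<in> carrier_mat k (h + k)" by (auto simp: append_cols_def)
  have "(append_cols (0\<^sub>m k h) (1\<^sub>m k) *\<^sub>v w) $ i = (\<Sum>j<h + k. append_cols (0\<^sub>m k h) (1\<^sub>m k) $$ (i, j) * w $ j)"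
    by (rule mult_mat_vec_index[OF c w i])
  also have "\<dots> = (\<Sum>j<h + k. if j = h + i then w $ j else 0)"
    using i by (intro sum.cong) (auto simp: append_cols_def)
  also have "\<dots> = w $ (h + i)" using i by simp
  finally show ?thesis .
qed

section \<open>Unique solvability forces the block form, and conversely\<close>

context wiener begin

lemma L2_process_bounded_time:
  assumes "c \<in> borel_measurable borel" "\<And>s. s \<in> {0..T} \<Longrightarrow> \<bar>c s\<bar> \<le> C"
  shows "L2_process T (\<lambda>s \<omega>. c s)"
  by (rule L2_process_cong[OF L2_process_bounded_mult[OF L2_process_const[of T 1] assms]]) simp_all

text \<open>The polynomial \<open>z(t) = \<Sum>\<^sub>l t\<^bsup>d-l\<^esup>/(d-l)! p\<^sub>l\<close> built from a chain of a singular pencil solves the homogeneous equation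
  with zero initial value.\<close>

lemma pencil_regular:
  assumes E: "E \<in> carrier_mat n n" and A: "A \<in> carrier_mat n n" and B: "B \<in> carrier_mat n r" and D: "D \<in> carrier_mat n r"
    and x0: "x0 \<in> carrier_vec n" and T: "0 < T"
    and us: "uniquely_solvable P W T n E A B D x0 (\<lambda>t \<omega>. 0\<^sub>v r)"
  shows "\<exists>c. det (c \<cdot>\<^sub>m E - A) \<noteq> 0"
proof (rule ccontr)
  assume "\<not> ?thesis"
  then have "\<And>c. det (c \<cdot>\<^sub>m E - A) = 0" by blast
  from singular_pencil_chain[OF E A this] obtain p d where
    p: "\<And>j. p j \<in> carrier_vec n" "A *\<^sub>v p 0 = 0\<^sub>v n" "\<And>j. A *\<^sub>v p (Suc j) = E *\<^sub>v p j"
      "\<And>j. d \<le> j \<Longrightarrow> p j = 0\<^sub>v n" "\<exists>j. p j \<noteq> 0\<^sub>v n" by blast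
  \<comment> \<open>For \<open>l < d\<close>, integration from 0 turns \<open>e (Suc l)\<close> into
    \<open>e l\<close>, just as the chain relation turns \<open>A *\<^sub>v p (Suc l)\<close> into
    \<open>E *\<^sub>v p l\<close>.\<close>
  define e where "e l t = t ^ (d - l) / fact (d - l)" for l and t :: real
  define comb where "comb c = Matrix.vec n (\<lambda>i. \<Sum>l\<le>d. p l $ i * c l)" for c :: "nat \<Rightarrow> real"
  have comb: "comb c \<in> carrier_vec n" "i < n \<Longrightarrow> comb c $ i = (\<Sum>l\<le>d. p l $ i * c l)" for c i by (simp_all add: comb_def)
  have mult: "(X *\<^sub>v comb c) $ i = (\<Sum>l\<le>d. (X *\<^sub>v p l) $ i * c l)" if X: "X \<in> carrier_mat n n" and i: "i < n" for X c i
  proof -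
    have "(X *\<^sub>v comb c) $ i = (\<Sum>j<n. \<Sum>l\<le>d. X $$ (i, j) * p l $ j * c l)"
      using mult_mat_vec_index[OF X comb(1) i] by (simp add: comb(2) sum_distrib_left mult.assoc)
    also have "\<dots> = (\<Sum>l\<le>d. \<Sum>j<n. X $$ (i, j) * p l $ j * c l)" by (rule sum.swap)
    finally show ?thesis using mult_mat_vec_index[OF X p(1) i] by (simp add: sum_distrib_right)
  qed
  have ec: "continuous_on S (e l)" for l S unfolding e_def by (intro continuous_intros) simp
  have em: "e l \<in> borel_measurable borel" for l by (rule borel_measurable_continuous_onI[OF ec])
  have ei: "set_integrable lborel {0..t} (e l)" for l t by (rule borel_integrable_atLeastAtMost'[OF ec])
  have eS: "(LINT s:{0..t}|lborel. e (Suc l) s) = e l t" if "l < d" "0 \<le> t" for l t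
  proof -
    have "((e l) has_vector_derivative e (Suc l) s) (at s within {0..t})" for s
    proof -
      define m where "m = d - Suc l"
      have m: "d - l = Suc m" "d - Suc l = m" using that by (simp_all add: m_def)
      have "((\<lambda>s. s ^ Suc m / fact (Suc m)) has_real_derivative (1 + real m) * (1 * s ^ m) / fact (Suc m)) (at s)"
        by (intro DERIV_cdivide DERIV_power_Suc DERIV_ident)
      also have "(1 + real m) * (1 * s ^ m) / fact (Suc m) = s ^ m / fact m"
      proof -
        have "fact (Suc m) = (1 + real m) * fact m" "1 + real m \<noteq> 0" by simp_all
        then show ?thesis by simp
      qed
      also have "(\<lambda>s. s ^ Suc m / fact (Suc m)) = e l" unfolding e_def m ..
      also have "s ^ m / fact m = e (Suc l) s" unfolding e_def m ..
      finally show ?thesis by (simp add: has_real_derivative_iff_has_vector_derivative has_vector_derivative_at_within)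
    qed
    then have "(e (Suc l) has_integral (e l t - e l 0)) {0..t}" by (intro fundamental_theorem_of_calculus that)
    moreover have "(e (Suc l) has_integral (LINT s:{0..t}|lborel. e (Suc l) s)) {0..t}"
      using set_borel_integral_eq_integral[OF ei[of t "Suc l"]] by (simp add: has_integral_integral)
    ultimately have "e l t - e l 0 = (LINT s:{0..t}|lborel. e (Suc l) s)" by (rule has_integral_unique)
    then show ?thesis using that by (simp add: e_def power_0_left)
  qed
  define z where "z t = comb (\<lambda>l. e l t)" for t
  define zi where "zi t = comb (\<lambda>l. LINT s:{0..t}|lborel. e l s)" for t
  have AE: "A *\<^sub>v zi t = E *\<^sub>v z t" if "0 \<le> t" for t
  proof (rule eq_vecI)
    fix i assume "i < dim_vec (E *\<^sub>v z t)"
    then have i: "i < n" using E by simp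
    \<comment> \<open>The index is shifted by one: the bottom term drops out because
      \<open>A\<close> annihilates \<open>p 0\<close>, and the top term missing on the other side is
      0 because \<open>p d\<close> is 0.\<close>
    have "(A *\<^sub>v zi t) $ i = (A *\<^sub>v p 0) $ i * (LINT s:{0..t}|lborel. e 0 s) + (\<Sum>l<d. (A *\<^sub>v p (Suc l)) $ i * (LINT s:{0..t}|lborel. e (Suc l) s))"
      unfolding zi_def mult[OF A i] by (rule sum.atMost_shift)
    also have "\<dots> = (\<Sum>l<d. (E *\<^sub>v p l) $ i * e l t)"
      unfolding p(2,3) using i that by (simp add: eS)
    also have "\<dots> = (\<Sum>l\<le>d. (E *\<^sub>v p l) $ i * e l t)"
      using p(4)[of d] E i by (simp add: lessThan_Suc_atMost[symmetric])
    also have "\<dots> = (E *\<^sub>v z t) $ i" unfolding z_def mult[OF E i] ..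
    finally show "(A *\<^sub>v zi t) $ i = (E *\<^sub>v z t) $ i" .
  qed (use A E in simp)
  let ?u = "\<lambda>t \<omega>. 0\<^sub>v r" let ?J = "\<lambda>i t \<omega>. 0 * (W t \<omega> - W (min t 0) \<omega>)"
  have u: "?u \<in> L2_adapted P W T r"
    unfolding L2_adapted_iff by (auto intro!: L2_process_cong[OF L2_process_const[of T 0]])
  have J: "has_ito_integral P W t (\<lambda>s \<omega>. (D *\<^sub>v ?u s \<omega>) $ i) (?J i t)" if "i < n" "t \<in> {0..T}" for i t
  proof -
    have eq0: "(\<lambda>s \<omega>. (D *\<^sub>v ?u s \<omega>) $ i) = (\<lambda>s \<omega>. 0 * indicator {0<..} s)" using D that by (auto intro!: ext)
    show ?thesis unfolding eq0 by (rule has_ito_integral_step) (use that in auto)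
  qed
  have shuffle: "(x0 + (a + b) + c) + w = x0 + ((a + w) + b) + c"
    if "a \<in> carrier_vec n" "b \<in> carrier_vec n" "c \<in> carrier_vec n" "w \<in> carrier_vec n" for a b c w :: "real vec"
    by (rule eq_vecI) (use that x0 in simp_all)
  have sol: "is_solution P W T n E A B D x0 ?u x \<longleftrightarrow> x \<in> L2_adapted P W T n \<and>
    (\<forall>t\<in>{0..T}. AE \<omega> in P. E *\<^sub>v x t \<omega> = x0 + (A *\<^sub>v ivec n x t \<omega> + B *\<^sub>v ivec r ?u t \<omega>) + Matrix.vec n (\<lambda>i. ?J i t \<omega>))" for x
    by (rule is_solution_iff[OF u A B J])
  from us obtain x where x: "is_solution P W T n E A B D x0 ?u x" unfolding uniquely_solvable_def by blast
  then have xL: "x \<in> L2_adapted P W T n" by (simp add: is_solution_def)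
  \<comment> \<open>A given solution plus the homogeneous one is a second solution, so uniqueness
    makes \<open>z\<close> vanish at almost every time.\<close>
  define y where "y t \<omega> = x t \<omega> + z t" for t \<omega>
  have eL: "L2_process T (\<lambda>t \<omega>. e l t)" for l
  proof (rule L2_process_bounded_time[OF em])
    show "\<bar>e l s\<bar> \<le> T ^ (d - l) / fact (d - l)" if "s \<in> {0..T}" for s
      unfolding e_def using that by (auto intro!: divide_right_mono power_mono simp: abs_mult power_abs)
  qed
  have yL: "y \<in> L2_adapted P W T n"
    unfolding L2_adapted_iff
  proof (intro conjI ballI allI impI)
    fix i assume i: "i < n"
    have "L2_process T (\<lambda>t \<omega>. x t \<omega> $ i + (\<Sum>l\<le>d. p l $ i * e l t))"
      by (intro L2_process_add L2_process_lincomb L2_adapted_component[OF xL i] eL) simp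
    then show "L2_process T (\<lambda>t \<omega>. y t \<omega> $ i)"
      by (rule L2_process_cong) (use i in \<open>simp add: y_def z_def comb_def\<close>)
  qed (use L2_adapted_carrier[OF xL] in \<open>simp add: y_def z_def comb_def\<close>)
  have "AE \<omega> in P. E *\<^sub>v y t \<omega> = x0 + (A *\<^sub>v ivec n y t \<omega> + B *\<^sub>v ivec r ?u t \<omega>) + Matrix.vec n (\<lambda>i. ?J i t \<omega>)"
    if t: "t \<in> {0..T}" for t
  proof -
    have "AE \<omega> in P. E *\<^sub>v x t \<omega> = x0 + (A *\<^sub>v ivec n x t \<omega> + B *\<^sub>v ivec r ?u t \<omega>) + Matrix.vec n (\<lambda>i. ?J i t \<omega>)"
      using x t unfolding sol by blast
    then show ?thesis using AE_ipaths[OF xL] AE_space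
    proof eventually_elim
      case (elim \<omega>)
      have i: "ivec n y t \<omega> = ivec n x t \<omega> + zi t"
      proof (rule eq_vecI)
        fix j assume "j < dim_vec (ivec n x t \<omega> + zi t)"
        then have j: "j < n" by (simp add: zi_def comb_def)
        have "(LINT s:{0..t}|lborel. y s \<omega> $ j) = (LINT s:{0..t}|lborel. x s \<omega> $ j + (\<Sum>l\<le>d. p l $ j * e l s))"
          using j by (simp add: y_def z_def comb_def)
        also have "\<dots> = (LINT s:{0..t}|lborel. x s \<omega> $ j) + (LINT s:{0..t}|lborel. \<Sum>l\<le>d. p l $ j * e l s)"
          by (rule set_integral_add(2)[OF _ set_integral_lincomb(1)[OF ei]]) (use elim(2) j t in \<open>simp add: ipaths_def\<close>)
        also have "(LINT s:{0..t}|lborel. \<Sum>l\<le>d. p l $ j * e l s) = zi t $ j"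
          unfolding set_integral_lincomb(2)[OF ei] zi_def comb(2)[OF j] ..
        finally show "ivec n y t \<omega> $ j = (ivec n x t \<omega> + zi t) $ j" using j by (simp add: zi_def comb_def)
      qed (simp add: ivec_def zi_def comb_def)
      have c: "x t \<omega> \<in> carrier_vec n" "z t \<in> carrier_vec n" "zi t \<in> carrier_vec n"
        using L2_adapted_carrier[OF xL t elim(3)] by (simp_all add: z_def zi_def comb_def)
      have "E *\<^sub>v y t \<omega> = E *\<^sub>v x t \<omega> + E *\<^sub>v z t" unfolding y_def by (rule mult_add_distrib_mat_vec[OF E c(1,2)])
      also have "\<dots> = (x0 + (A *\<^sub>v ivec n x t \<omega> + B *\<^sub>v ivec r ?u t \<omega>) + Matrix.vec n (\<lambda>i. ?J i t \<omega>)) + E *\<^sub>v z t"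
        unfolding elim(1) ..
      also have "\<dots> = x0 + ((A *\<^sub>v ivec n x t \<omega> + E *\<^sub>v z t) + B *\<^sub>v ivec r ?u t \<omega>) + Matrix.vec n (\<lambda>i. ?J i t \<omega>)"
        by (rule shuffle) (rule mult_mat_vec_carrier[OF A ivec_carrier] mult_mat_vec_carrier[OF B ivec_carrier] mult_mat_vec_carrier[OF E c(2)] vec_carrier)+
      also have "A *\<^sub>v ivec n x t \<omega> + E *\<^sub>v z t = A *\<^sub>v ivec n y t \<omega>"
        unfolding i mult_add_distrib_mat_vec[OF A ivec_carrier c(3)] using AE[of t] t by simp
      finally show ?case .
    qed
  qed
  then have "is_solution P W T n E A B D x0 ?u y" using yL unfolding sol by blast
  with x us have "AE (t, \<omega>) in restrict_space lborel {0..T} \<Otimes>\<^sub>M P. x t \<omega> = y t \<omega>" unfolding uniquely_solvable_def by blast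
  from AE_time_sections[OF this] have z0: "AE t in lborel. t \<in> {0..T} \<longrightarrow> (\<forall>i<n. z t $ i = 0)"
  proof eventually_elim
    case (elim t)
    show ?case
    proof
      assume t: "t \<in> {0..T}"
      with elim have "AE \<omega> in P. x t \<omega> = y t \<omega>" by blast
      then have "AE \<omega> in P. \<forall>i<n. z t $ i = 0"
        using AE_space
      proof eventually_elim
        case (elim \<omega>)
        show ?case
        proof (intro allI impI)
          fix i assume i: "i < n"
          have "x t \<omega> $ i = (x t \<omega> + z t) $ i" using arg_cong[OF elim(1), of "\<lambda>v. v $ i"] by (simp add: y_def)
          then show "z t $ i = 0" using i by (simp add: z_def comb_def)
        qed
      qed
      then show "\<forall>i<n. z t $ i = 0" by simp
    qed
  qed
  have "p l $ i = 0" if i: "i < n" and l: "l \<le> d" for i l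
  proof -
    \<comment> \<open>Each component of \<open>z\<close> is a polynomial in \<open>t\<close> that
      vanishes almost everywhere on an interval, hence is 0. The powers \<open>d - l\<close> are
      distinct for \<open>l \<le> d\<close>, so its coefficients are the entries of the
      \<open>p l\<close> up to factorials.\<close>
    define q where "q = (\<Sum>l\<le>d. Polynomial.monom (p l $ i / fact (d - l)) (d - l))"
    have pq: "poly q t = z t $ i" for t
      using i by (simp add: q_def z_def comb_def e_def poly_sum poly_monom)
    have "q = 0"
    proof (rule ccontr)
      assume "q \<noteq> 0"
      then have "finite {t. poly q t = 0}" by (rule poly_roots_finite)
      then have "AE t in lborel. t \<notin> {t. poly q t = 0}"
        by (intro AE_not_in countable_imp_null_set_lborel countable_finite)
      with z0 have "AE t in lborel. t \<in> {0..T} \<longrightarrow> False"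
        by eventually_elim (use i pq in auto)
      then show False using AE_interval_obtain[of T "\<lambda>_. False" 0 T] T by auto
    qed
    have "coeff q (d - l) = (\<Sum>m\<le>d. if m = l then p m $ i / fact (d - m) else 0)"
      unfolding q_def coeff_sum coeff_monom using l by (intro sum.cong) auto
    then show ?thesis using \<open>q = 0\<close> l by simp
  qed
  then have "p l = 0\<^sub>v n" for l
    using p(1)[of l] p(4)[of l] by (cases "l \<le> d") (auto intro!: eq_vecI)
  then show False using p(5) by blast
qed

text \<open>The zero input yields regularity of the pencil and with it the coordinates. In these the
  jump inputs yield the three conditions, which unit vectors turn into identities between
  matrices.\<close>

lemma form_of_uniquely_solvable:
  assumes E: "E \<in> carrier_mat n n" and A: "A \<in> carrier_mat n n" and B: "B \<in> carrier_mat n r" and D: "D \<in> carrier_mat n r"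
    and x0: "x0 \<in> carrier_vec n" and T: "0 < T"
    and us: "\<forall>u\<in>L2_adapted P W T r. uniquely_solvable P W T n E A B D x0 u"
  obtains M N h A1 B1 D1 ms b where "M \<in> carrier_mat n n" "invertible_mat M" "N \<in> carrier_mat n n" "invertible_mat N" "h \<le> n"
    "A1 \<in> carrier_mat h h" "B1 \<in> carrier_mat h r" "D1 \<in> carrier_mat h r"
    "\<forall>k<length ms. 1 \<le> ms ! k \<and> b k \<in> carrier_mat 1 r" "sum_list ms = n - h"
    "M * E * N = diag_block_mat [1\<^sub>m h, diag_block_mat (map shift_block ms)]"
    "M * A * N = diag_block_mat [A1, 1\<^sub>m (n - h)]" "M * B = B1 @\<^sub>r head_rows r ms b" "M * D = D1 @\<^sub>r 0\<^sub>m (n - h) r"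
    "append_cols (0\<^sub>m (n - h) h) (1\<^sub>m (n - h)) *\<^sub>v (M *\<^sub>v x0) = 0\<^sub>v (n - h)"
proof -
  have "(\<lambda>t \<omega>. 0\<^sub>v r) \<in> L2_adapted P W T r" using jump_L2_adapted[of "0\<^sub>v r" r 0 T] by simp
  then obtain c where "det (c \<cdot>\<^sub>m E - A) \<noteq> 0" using pencil_regular[OF E A B D x0 T] us by blast
  from weierstrass_jordan_form[OF E A this] obtain M N h A1 ms where
    M: "M \<in> carrier_mat n n" "det M \<noteq> 0" and N: "N \<in> carrier_mat n n" "det N \<noteq> 0" and h: "h \<le> n" and A1: "A1 \<in> carrier_mat h h"
    and ms: "\<forall>m\<in>set ms. 1 \<le> m" "sum_list ms = n - h"
    and eq: "M * E * N = diag_block_mat [1\<^sub>m h, diag_block_mat (map shift_block ms)]" "M * A * N = diag_block_mat [A1, 1\<^sub>m (n - h)]" .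
  define k where "k = n - h"
  have n: "n = h + k" using h by (simp add: k_def)
  define G where "G = diag_block_mat (map shift_block ms)"
  have G: "G \<in> carrier_mat k k" using shift_diag_carrier[of ms] ms(2) by (simp add: G_def k_def)
  from det_nonzero_inverse[OF M] obtain M' where M': "M' \<in> carrier_mat n n" "M' * M = 1\<^sub>m n" by blast
  from det_nonzero_inverse[OF N] obtain N' where N': "N' \<in> carrier_mat n n" "N * N' = 1\<^sub>m n" by blast
  have eq': "M * E * N = diag_block_mat [1\<^sub>m h, G]" "M * A * N = diag_block_mat [A1, 1\<^sub>m k]"
    by (simp_all only: eq G_def k_def)
  interpret sde: weierstrass_sde P W h k r T E A B D M N M' N' A1 G x0
  proof unfold_locales
    show "G $$ (i, q) = 0" if "q \<le> i" "i < k" for i q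
      unfolding G_def by (rule shift_diag_strictly_upper) (use that ms(2) in \<open>simp_all add: k_def\<close>)
  qed (use E A B D x0 T M(1) N(1) M' N' A1 G eq' in \<open>simp_all only: n[symmetric]\<close>)
  have *: "(\<Sum>q<k. G $$ (i, q) * ((M * B) *\<^sub>v v) $ (h + q)) = 0 \<and> (M *\<^sub>v x0) $ (h + i) = 0 \<and> ((M * D) *\<^sub>v v) $ (h + i) = 0"
    if v: "v \<in> carrier_vec r" and i: "i < k" for v i
  proof -
    \<comment> \<open>The jump may sit at any time strictly between 0 and \<open>T\<close>.\<close>
    have "uniquely_solvable P W T (h + k) E A B D x0 (\<lambda>t \<omega>. if T / 2 < t then v else 0\<^sub>v r)"
      using us jump_L2_adapted[OF v] unfolding n by blast
    then obtain x where "is_solution P W T (h + k) E A B D x0 (\<lambda>t \<omega>. if T / 2 < t then v else 0\<^sub>v r) x"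
      unfolding uniquely_solvable_def by blast
    from sde.jump_input_necessary[OF v _ _ this i] show ?thesis using T by simp
  qed
  have unit: "(X *\<^sub>v unit_vec r j) $ i = X $$ (i, j)" if "X \<in> carrier_mat n r" "i < n" "j < r" for X :: "real mat" and i j
  proof -
    have "(X *\<^sub>v unit_vec r j) $ i = (\<Sum>l<r. X $$ (i, l) * unit_vec r j $ l)" by (rule mult_mat_vec_index) (use that in auto)
    also have "\<dots> = (\<Sum>l<r. if l = j then X $$ (i, l) else 0)" using that by (intro sum.cong) auto
    finally show ?thesis using that by simp
  qed
  have MB: "M * B \<in> carrier_mat n r" and MD: "M * D \<in> carrier_mat n r" using M B D by simp_all
  define B2 where "B2 = mat k r (\<lambda>(i, j). (M * B) $$ (h + i, j))"
  have B2: "B2 \<in> carrier_mat k r" by (simp add: B2_def)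
  have "G * B2 = 0\<^sub>m k r"
  proof (rule eq_matI)
    fix i j assume "i < dim_row (0\<^sub>m k r :: real mat)" "j < dim_col (0\<^sub>m k r :: real mat)"
    then have ij: "i < k" "j < r" by auto
    have "(G * B2) $$ (i, j) = (\<Sum>q<k. G $$ (i, q) * B2 $$ (q, j))"
      using G B2 ij by (simp add: scalar_prod_def lessThan_atLeast0)
    also have "\<dots> = (\<Sum>q<k. G $$ (i, q) * (M * B) $$ (h + q, j))"
      unfolding B2_def using ij by (simp del: index_mult_mat)
    also have "\<dots> = (\<Sum>q<k. G $$ (i, q) * ((M * B) *\<^sub>v unit_vec r j) $ (h + q))"
      using unit[OF MB _ ij(2)] n by (intro sum.cong) auto
    also have "\<dots> = 0" using *[of "unit_vec r j" i] ij by simp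
    finally show "(G * B2) $$ (i, j) = 0\<^sub>m k r $$ (i, j)" using ij by simp
  qed (use G B2 in auto)
  then obtain b where b: "\<forall>l<length ms. b l \<in> carrier_mat 1 r" "B2 = head_rows r ms b"
    using shift_kernel_is_head_rows[of B2 ms r] B2 ms unfolding G_def k_def by auto
  have D2: "mat k r (\<lambda>(i, j). (M * D) $$ (h + i, j)) = 0\<^sub>m k r"
  proof (rule eq_matI)
    fix i j assume "i < dim_row (0\<^sub>m k r :: real mat)" "j < dim_col (0\<^sub>m k r :: real mat)"
    then have ij: "i < k" "j < r" by auto
    have "(M * D) $$ (h + i, j) = ((M * D) *\<^sub>v unit_vec r j) $ (h + i)" using unit[OF MD _ ij(2), of "h + i"] ij n by simp
    also have "\<dots> = 0" using *[of "unit_vec r j" i] ij by simp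
    finally show "mat k r (\<lambda>(i, j). (M * D) $$ (h + i, j)) $$ (i, j) = 0\<^sub>m k r $$ (i, j)" using ij by simp
  qed auto
  have c1: "append_cols (0\<^sub>m k h) (1\<^sub>m k) *\<^sub>v (M *\<^sub>v x0) = 0\<^sub>v k"
  proof (rule eq_vecI)
    fix i assume "i < dim_vec (0\<^sub>v k :: real vec)"
    then have i: "i < k" by simp
    have "M *\<^sub>v x0 \<in> carrier_vec (h + k)" using M x0 n by simp
    from append_cols_zero_one_mult_index[OF this i] show "(append_cols (0\<^sub>m k h) (1\<^sub>m k) *\<^sub>v (M *\<^sub>v x0)) $ i = 0\<^sub>v k $ i"
      using *[OF zero_carrier_vec i] i by simp
  qed (simp add: append_cols_def)
  have c2: "M * B = mat h r (\<lambda>ij. (M * B) $$ ij) @\<^sub>r head_rows r ms b"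
    using split_rows[of "M * B" h k r] MB n unfolding b(2)[symmetric] B2_def by simp
  have c3: "M * D = mat h r (\<lambda>ij. (M * D) $$ ij) @\<^sub>r 0\<^sub>m k r"
    using split_rows[of "M * D" h k r] MD n unfolding D2 by simp
  have c4: "\<forall>l<length ms. 1 \<le> ms ! l \<and> b l \<in> carrier_mat 1 r" using b(1) ms(1) by simp
  show thesis
    by (rule that[OF M(1) det_nonzero_invertible[OF M] N(1) det_nonzero_invertible[OF N] h A1 mat_carrier mat_carrier c4 ms(2) eq c2
      c3[unfolded k_def] c1[unfolded k_def]])
qed

text \<open>The shift blocks annihilate \<open>head_rows r ms b\<close>, which supplies the
  condition on \<open>G\<close> and \<open>B\<close>. The other two conditions are the lower rows of
  \<open>M * D\<close> and of \<open>M *\<^sub>v x0\<close>, given by the form.\<close>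

lemma uniquely_solvable_of_block_form:
  assumes E: "E \<in> carrier_mat n n" and A: "A \<in> carrier_mat n n" and B: "B \<in> carrier_mat n r" and D: "D \<in> carrier_mat n r"
    and x0: "x0 \<in> carrier_vec n" and T: "0 < T" and u: "u \<in> L2_adapted P W T r"
    and M: "M \<in> carrier_mat n n" "invertible_mat M" and N: "N \<in> carrier_mat n n" "invertible_mat N" and h: "h \<le> n"
    and A1: "A1 \<in> carrier_mat h h" and B1: "B1 \<in> carrier_mat h r" and D1: "D1 \<in> carrier_mat h r"
    and b: "\<forall>k<length ms. 1 \<le> ms ! k \<and> b k \<in> carrier_mat 1 r" and ms: "sum_list ms = n - h"
    and eq: "M * E * N = diag_block_mat [1\<^sub>m h, diag_block_mat (map shift_block ms)]"
      "M * A * N = diag_block_mat [A1, 1\<^sub>m (n - h)]" "M * B = B1 @\<^sub>r head_rows r ms b" "M * D = D1 @\<^sub>r 0\<^sub>m (n - h) r"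
      "append_cols (0\<^sub>m (n - h) h) (1\<^sub>m (n - h)) *\<^sub>v (M *\<^sub>v x0) = 0\<^sub>v (n - h)"
  shows "uniquely_solvable P W T n E A B D x0 u"
proof -
  define k where "k = n - h"
  have n: "n = h + k" using h by (simp add: k_def)
  define G where "G = diag_block_mat (map shift_block ms)"
  have G: "G \<in> carrier_mat k k" using shift_diag_carrier[of ms] ms by (simp add: G_def k_def)
  from invertible_inverse[OF M] obtain M' where M': "M' \<in> carrier_mat n n" "M' * M = 1\<^sub>m n" by blast
  from invertible_inverse[OF N] obtain N' where N': "N' \<in> carrier_mat n n" "N * N' = 1\<^sub>m n" by blast
  have eq': "M * E * N = diag_block_mat [1\<^sub>m h, G]" "M * A * N = diag_block_mat [A1, 1\<^sub>m k]"
    by (simp_all only: eq G_def k_def)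
  interpret sde: weierstrass_sde P W h k r T E A B D M N M' N' A1 G x0
  proof unfold_locales
    show "G $$ (i, q) = 0" if "q \<le> i" "i < k" for i q
      unfolding G_def by (rule shift_diag_strictly_upper) (use that ms in \<open>simp_all add: k_def\<close>)
  qed (use E A B D x0 T M(1) N(1) M' N' A1 G eq' in \<open>simp_all only: n[symmetric]\<close>)
  have H: "head_rows r ms b \<in> carrier_mat k r" using head_rows_carrier[of ms b r] b ms by (simp add: k_def)
  have GH: "G * head_rows r ms b = 0\<^sub>m k r" using shift_kernel_head_rows[of ms b r] b ms by (simp add: G_def k_def)
  have "uniquely_solvable P W T (h + k) E A B D x0 u"
  proof (rule sde.uniquely_solvable_of_form[OF u])
    fix i and v :: "real vec" assume i: "i < k" and v: "v \<in> carrier_vec r"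
    have Hv: "head_rows r ms b *\<^sub>v v \<in> carrier_vec k" using H v by simp
    have "(\<Sum>q<k. G $$ (i, q) * ((M * B) *\<^sub>v v) $ (h + q)) = (\<Sum>q<k. G $$ (i, q) * (head_rows r ms b *\<^sub>v v) $ q)"
      unfolding eq(3) using append_rows_mult_vec[OF B1 H v] by (intro sum.cong) auto
    also have "\<dots> = (G *\<^sub>v (head_rows r ms b *\<^sub>v v)) $ i" by (rule mult_mat_vec_index[OF G Hv i, symmetric])
    also have "\<dots> = 0" unfolding assoc_mult_mat_vec[OF G H v, symmetric] GH using i v by simp
    finally show "(\<Sum>q<k. G $$ (i, q) * ((M * B) *\<^sub>v v) $ (h + q)) = 0" .
    show "((M * D) *\<^sub>v v) $ (h + i) = 0"
      unfolding eq(4) k_def[symmetric] append_rows_mult_vec[OF D1 zero_carrier_mat v i] using i v by simp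
  next
    fix i assume i: "i < k"
    have "M *\<^sub>v x0 \<in> carrier_vec (h + k)" using M x0 n by simp
    from append_cols_zero_one_mult_index[OF this i] show "(M *\<^sub>v x0) $ (h + i) = 0"
      using eq(5) i unfolding k_def[symmetric] by simp
  qed
  then show ?thesis unfolding n .
qed

end

theorem theorem3p1:
  fixes P :: "'w measure" and W :: "real \<Rightarrow> 'w \<Rightarrow> real"
    and n m r :: nat and T :: real
    and E A B D :: "real Matrix.mat" and x0 :: "real Matrix.vec"
  assumes "prob_space P" and "complete_measure P" and "brownian_motion P W"
    and "E \<in> carrier_mat n n" and "A \<in> carrier_mat n n"
    and "vec_space.rank n E = m" and "m < n"
    and "B \<in> carrier_mat n r" and "D \<in> carrier_mat n r"
    and "x0 \<in> carrier_vec n" and "T > 0"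
  shows
    "(\<forall>u\<in>L2_adapted P W T r. uniquely_solvable P W T n E A B D x0 u) \<longleftrightarrow>
     (\<exists>M N h A1 B1 D1 (ms :: nat list) b.
        M \<in> carrier_mat n n \<and> invertible_mat M \<and>
        N \<in> carrier_mat n n \<and> invertible_mat N \<and> h \<le> n \<and>
        A1 \<in> carrier_mat h h \<and> B1 \<in> carrier_mat h r \<and> D1 \<in> carrier_mat h r \<and>
        (\<forall>k<length ms. 1 \<le> ms ! k \<and> b k \<in> carrier_mat 1 r) \<and> sum_list ms = n - h \<and>
        (let G = diag_block_mat (map shift_block ms);
             B2 = stack_rows r (map (\<lambda>k. b k @\<^sub>r 0\<^sub>m (ms ! k - 1) r) [0..<length ms])
         in M * E * N = diag_block_mat [1\<^sub>m h, G] \<and>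
            M * A * N = diag_block_mat [A1, 1\<^sub>m (n - h)] \<and>
            M * B = B1 @\<^sub>r B2 \<and>
            M * D = D1 @\<^sub>r 0\<^sub>m (n - h) r) \<and>
        append_cols (0\<^sub>m (n - h) h) (1\<^sub>m (n - h)) *\<^sub>v (M *\<^sub>v x0) = 0\<^sub>v (n - h))"
  (is "?unique \<longleftrightarrow> ?form")
proof -
  interpret prob_space P by fact
  interpret complete_measure P by fact
  interpret wiener P W by unfold_locales fact
  show ?thesis
  proof
    assume ?unique
    from form_of_uniquely_solvable[OF assms(4,5,8,9,10,11) this] obtain M N h A1 B1 D1 ms b where f:
      "M \<in> carrier_mat n n" "invertible_mat M" "N \<in> carrier_mat n n" "invertible_mat N" "h \<le> n"
      "A1 \<in> carrier_mat h h" "B1 \<in> carrier_mat h r" "D1 \<in> carrier_mat h r"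
      "\<forall>k<length ms. 1 \<le> ms ! k \<and> b k \<in> carrier_mat 1 r" "sum_list ms = n - h"
      "M * E * N = diag_block_mat [1\<^sub>m h, diag_block_mat (map shift_block ms)]"
      "M * A * N = diag_block_mat [A1, 1\<^sub>m (n - h)]" "M * B = B1 @\<^sub>r head_rows r ms b" "M * D = D1 @\<^sub>r 0\<^sub>m (n - h) r"
      "append_cols (0\<^sub>m (n - h) h) (1\<^sub>m (n - h)) *\<^sub>v (M *\<^sub>v x0) = 0\<^sub>v (n - h)" .
    show ?form
      unfolding Let_def
      by (intro exI[of _ M] exI[of _ N] exI[of _ h] exI[of _ A1] exI[of _ B1] exI[of _ D1] exI[of _ ms] exI[of _ b] conjI)
        (fact f[unfolded head_rows_def])+
  next
    assume ?form
    then obtain M N h A1 B1 D1 ms b where f: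
      "M \<in> carrier_mat n n" "invertible_mat M" "N \<in> carrier_mat n n" "invertible_mat N" "h \<le> n"
      "A1 \<in> carrier_mat h h" "B1 \<in> carrier_mat h r" "D1 \<in> carrier_mat h r"
      "\<forall>k<length ms. 1 \<le> ms ! k \<and> b k \<in> carrier_mat 1 r" "sum_list ms = n - h"
      "M * E * N = diag_block_mat [1\<^sub>m h, diag_block_mat (map shift_block ms)]"
      "M * A * N = diag_block_mat [A1, 1\<^sub>m (n - h)]" "M * B = B1 @\<^sub>r head_rows r ms b" "M * D = D1 @\<^sub>r 0\<^sub>m (n - h) r"
      "append_cols (0\<^sub>m (n - h) h) (1\<^sub>m (n - h)) *\<^sub>v (M *\<^sub>v x0) = 0\<^sub>v (n - h)"
      unfolding head_rows_def Let_def by (elim exE conjE)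
    show ?unique
      using uniquely_solvable_of_block_form[OF assms(4,5,8,9,10,11) _ f] by blast
  qed
qed

end
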